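(* It is consistent relative to $\mathsf{ZF}+\mathsf{AD}_{\mathbb{R}}$ that $\mathsf{ZF}+\mathsf{AD}$ holds and there is a poset $\mathbb{P}$ such that for every $\mathbb{P}$-generic filter $G$ over $V$, we have $\Theta^{V}<\Theta^{V[G]}$ and $\mathsf{AD}$ holds in $V[G]$.
   Context: $\Theta$ denotes the supremum of the ordinals that are surjective images of $\mathbb{R}$ (computed in the model indicated by the superscript). $\mathsf{AD}$ is the Axiom of Determinacy and $\mathsf{AD}_{\mathbb{R}}$ is the axiom of determinacy for games on reals of length $\omega$. *)

theory Defs
  imports Main
begin

section \<open>First-order logic of set theory\<close>

datatype fm =
    Falsum
  | Mem nat nat
  | Eq nat nat
  | Imp fm fm
  | Forall nat fm

primrec fv :: "fm \<Rightarrow> nat set" where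
  "fv Falsum = {}"
| "fv (Mem x y) = {x, y}"
| "fv (Eq x y) = {x, y}"
| "fv (Imp \<phi> \<psi>) = fv \<phi> \<union> fv \<psi>"
| "fv (Forall x \<phi>) = fv \<phi> - {x}"

primrec vars :: "fm \<Rightarrow> nat set" where
  "vars Falsum = {}"
| "vars (Mem x y) = {x, y}"
| "vars (Eq x y) = {x, y}"
| "vars (Imp \<phi> \<psi>) = vars \<phi> \<union> vars \<psi>"
| "vars (Forall x \<phi>) = insert x (vars \<phi>)"

(* Substitution of the variable y for the free occurrences of x; it is only used
   under the proviso free_for y x \<phi>, which excludes capture. *)
primrec subst :: "nat \<Rightarrow> nat \<Rightarrow> fm \<Rightarrow> fm" where
  "subst y x Falsum = Falsum"
| "subst y x (Mem u v) = Mem (if u = x then y else u) (if v = x then y else v)"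
| "subst y x (Eq u v) = Eq (if u = x then y else u) (if v = x then y else v)"
| "subst y x (Imp \<phi> \<psi>) = Imp (subst y x \<phi>) (subst y x \<psi>)"
| "subst y x (Forall z \<phi>) = (if z = x then Forall z \<phi> else Forall z (subst y x \<phi>))"

primrec free_for :: "nat \<Rightarrow> nat \<Rightarrow> fm \<Rightarrow> bool" where
  "free_for y x Falsum \<longleftrightarrow> True"
| "free_for y x (Mem u v) \<longleftrightarrow> True"
| "free_for y x (Eq u v) \<longleftrightarrow> True"
| "free_for y x (Imp \<phi> \<psi>) \<longleftrightarrow> free_for y x \<phi> \<and> free_for y x \<psi>"
| "free_for y x (Forall z \<phi>) \<longleftrightarrow> x \<notin> fv (Forall z \<phi>) \<or> (z \<noteq> y \<and> free_for y x \<phi>)"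

(* Hilbert calculus for classical first-order logic with equality. Unrestricted
   generalization is sound here because theories are sets of sentences. *)
inductive proves :: "fm set \<Rightarrow> fm \<Rightarrow> bool" (infix \<open>\<turnstile>\<close> 50) for T :: "fm set" where
  ax: "\<phi> \<in> T \<Longrightarrow> T \<turnstile> \<phi>"
| imp_K: "T \<turnstile> Imp \<phi> (Imp \<psi> \<phi>)"
| imp_S: "T \<turnstile> Imp (Imp \<phi> (Imp \<psi> \<chi>)) (Imp (Imp \<phi> \<psi>) (Imp \<phi> \<chi>))"
| double_neg: "T \<turnstile> Imp (Imp (Imp \<phi> Falsum) Falsum) \<phi>"
| inst: "free_for y x \<phi> \<Longrightarrow> T \<turnstile> Imp (Forall x \<phi>) (subst y x \<phi>)"
| distrib: "x \<notin> fv \<phi> \<Longrightarrow> T \<turnstile> Imp (Forall x (Imp \<phi> \<psi>)) (Imp \<phi> (Forall x \<psi>))"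
| eq_refl: "T \<turnstile> Eq x x"
| eq_Eq: "T \<turnstile> Imp (Eq x y) (Imp (Eq x z) (Eq y z))"
| eq_Mem_left: "T \<turnstile> Imp (Eq x y) (Imp (Mem x z) (Mem y z))"
| eq_Mem_right: "T \<turnstile> Imp (Eq x y) (Imp (Mem z x) (Mem z y))"
| modus_ponens: "T \<turnstile> \<phi> \<Longrightarrow> T \<turnstile> Imp \<phi> \<psi> \<Longrightarrow> T \<turnstile> \<psi>"
| generalization: "T \<turnstile> \<phi> \<Longrightarrow> T \<turnstile> Forall x \<phi>"

definition consistent :: "fm set \<Rightarrow> bool" where
  "consistent T \<longleftrightarrow> \<not> T \<turnstile> Falsum"


section \<open>Writing formulas with bound variables\<close>

(* To write long formulas legibly, bound variables are HOL-bound: an element of fb is a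
   formula that awaits a number n, and its quantifiers bind the variables n, n+1, ...
   (nested quantifiers bind different ones). Hence n has to exceed every variable that is
   mentioned from outside; for a closed formula n = 0 will do. *)
type_synonym fb = "nat \<Rightarrow> fm"

definition sentence :: "fb \<Rightarrow> fm" where
  "sentence \<phi> = \<phi> 0"

definition fresh :: "fm \<Rightarrow> nat" where
  "fresh \<phi> = Suc (Max (insert 0 (vars \<phi>)))"

definition fixed :: "fm \<Rightarrow> fb" where
  "fixed \<phi> = (\<lambda>n. \<phi>)"

definition bMem :: "nat \<Rightarrow> nat \<Rightarrow> fb" (infix \<open>\<^bold>\<in>\<close> 50) where
  "(x \<^bold>\<in> y) = (\<lambda>n. Mem x y)"

definition bEq :: "nat \<Rightarrow> nat \<Rightarrow> fb" (infix \<open>\<^bold>=\<close> 50) where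
  "(x \<^bold>= y) = (\<lambda>n. Eq x y)"

definition bFalse :: fb (\<open>\<^bold>\<bottom>\<close>) where
  "\<^bold>\<bottom> = (\<lambda>n. Falsum)"

definition bImp :: "fb \<Rightarrow> fb \<Rightarrow> fb" (infixr \<open>\<^bold>\<longrightarrow>\<close> 25) where
  "(\<phi> \<^bold>\<longrightarrow> \<psi>) = (\<lambda>n. Imp (\<phi> n) (\<psi> n))"

definition bAll :: "(nat \<Rightarrow> fb) \<Rightarrow> fb" (binder \<open>\<^bold>\<forall>\<close> 10) where
  "bAll \<phi> = (\<lambda>n. Forall n (\<phi> n (Suc n)))"

definition bNot :: "fb \<Rightarrow> fb" (\<open>\<^bold>\<not> _\<close> [40] 40) where
  "(\<^bold>\<not> \<phi>) = (\<phi> \<^bold>\<longrightarrow> \<^bold>\<bottom>)"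

definition bAnd :: "fb \<Rightarrow> fb \<Rightarrow> fb" (infixr \<open>\<^bold>\<and>\<close> 35) where
  "(\<phi> \<^bold>\<and> \<psi>) = (\<^bold>\<not> (\<phi> \<^bold>\<longrightarrow> \<^bold>\<not> \<psi>))"

definition bOr :: "fb \<Rightarrow> fb \<Rightarrow> fb" (infixr \<open>\<^bold>\<or>\<close> 30) where
  "(\<phi> \<^bold>\<or> \<psi>) = (\<^bold>\<not> \<phi> \<^bold>\<longrightarrow> \<psi>)"

definition bIff :: "fb \<Rightarrow> fb \<Rightarrow> fb" (infixr \<open>\<^bold>\<longleftrightarrow>\<close> 25) where
  "(\<phi> \<^bold>\<longleftrightarrow> \<psi>) = ((\<phi> \<^bold>\<longrightarrow> \<psi>) \<^bold>\<and> (\<psi> \<^bold>\<longrightarrow> \<phi>))"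

definition bEx :: "(nat \<Rightarrow> fb) \<Rightarrow> fb" (binder \<open>\<^bold>\<exists>\<close> 10) where
  "(\<^bold>\<exists>x. \<phi> x) = (\<^bold>\<not> (\<^bold>\<forall>x. \<^bold>\<not> \<phi> x))"

(* Quantification over a given variable, for use with formulas of type fm. *)
definition all_var :: "nat \<Rightarrow> fb \<Rightarrow> fb" where
  "all_var x \<phi> = (\<lambda>n. Forall x (\<phi> n))"

definition ex_var :: "nat \<Rightarrow> fb \<Rightarrow> fb" where
  "ex_var x \<phi> = (\<^bold>\<not> all_var x (\<^bold>\<not> \<phi>))"

definition universal_closure :: "fm \<Rightarrow> fm" where
  "universal_closure \<phi> = fold Forall (sorted_list_of_set (fv \<phi>)) \<phi>"


section \<open>Elementary set-theoretic notions\<close>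

definition is_subset :: "nat \<Rightarrow> nat \<Rightarrow> fb" where
  "is_subset x y = (\<^bold>\<forall>z. z \<^bold>\<in> x \<^bold>\<longrightarrow> z \<^bold>\<in> y)"

definition is_empty :: "nat \<Rightarrow> fb" where
  "is_empty x = (\<^bold>\<forall>z. \<^bold>\<not> z \<^bold>\<in> x)"

definition is_diff :: "nat \<Rightarrow> nat \<Rightarrow> nat \<Rightarrow> fb" where
  "is_diff x y d = (\<^bold>\<forall>z. z \<^bold>\<in> d \<^bold>\<longleftrightarrow> z \<^bold>\<in> x \<^bold>\<and> \<^bold>\<not> z \<^bold>\<in> y)"

definition is_succ :: "nat \<Rightarrow> nat \<Rightarrow> fb" where
  "is_succ x y = (\<^bold>\<forall>z. z \<^bold>\<in> y \<^bold>\<longleftrightarrow> z \<^bold>\<in> x \<^bold>\<or> z \<^bold>= x)"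

definition is_upair :: "nat \<Rightarrow> nat \<Rightarrow> nat \<Rightarrow> fb" where
  "is_upair x y u = (\<^bold>\<forall>z. z \<^bold>\<in> u \<^bold>\<longleftrightarrow> z \<^bold>= x \<^bold>\<or> z \<^bold>= y)"

definition is_pair :: "nat \<Rightarrow> nat \<Rightarrow> nat \<Rightarrow> fb" where
  "is_pair x y p = (\<^bold>\<exists>u v. is_upair x x u \<^bold>\<and> is_upair x y v \<^bold>\<and> is_upair u v p)"

definition related :: "nat \<Rightarrow> nat \<Rightarrow> nat \<Rightarrow> fb" where
  "related f x y = (\<^bold>\<exists>p. is_pair x y p \<^bold>\<and> p \<^bold>\<in> f)"

definition is_function :: "nat \<Rightarrow> nat \<Rightarrow> nat \<Rightarrow> fb" where
  "is_function f X Y =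
    ((\<^bold>\<forall>p. p \<^bold>\<in> f \<^bold>\<longrightarrow> (\<^bold>\<exists>x y. x \<^bold>\<in> X \<^bold>\<and> y \<^bold>\<in> Y \<^bold>\<and> is_pair x y p)) \<^bold>\<and>
     (\<^bold>\<forall>x. x \<^bold>\<in> X \<^bold>\<longrightarrow> (\<^bold>\<exists>y. \<^bold>\<forall>z. related f x z \<^bold>\<longleftrightarrow> z \<^bold>= y)))"

definition is_surjection :: "nat \<Rightarrow> nat \<Rightarrow> nat \<Rightarrow> fb" where
  "is_surjection f X Y =
    (is_function f X Y \<^bold>\<and> (\<^bold>\<forall>y. y \<^bold>\<in> Y \<^bold>\<longrightarrow> (\<^bold>\<exists>x. x \<^bold>\<in> X \<^bold>\<and> related f x y)))"

definition is_restriction :: "nat \<Rightarrow> nat \<Rightarrow> nat \<Rightarrow> fb" where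
  "is_restriction f X g =
    (\<^bold>\<forall>p. p \<^bold>\<in> g \<^bold>\<longleftrightarrow> p \<^bold>\<in> f \<^bold>\<and> (\<^bold>\<exists>x y. x \<^bold>\<in> X \<^bold>\<and> is_pair x y p))"

definition is_transitive :: "nat \<Rightarrow> fb" where
  "is_transitive x = (\<^bold>\<forall>y. y \<^bold>\<in> x \<^bold>\<longrightarrow> is_subset y x)"

(* The well-foundedness of \<in> on x is supplied by the axiom of foundation. *)
definition is_ordinal :: "nat \<Rightarrow> fb" where
  "is_ordinal x = (is_transitive x \<^bold>\<and> (\<^bold>\<forall>y. y \<^bold>\<in> x \<^bold>\<longrightarrow> is_transitive y))"

definition is_inductive :: "nat \<Rightarrow> fb" where
  "is_inductive x =
    ((\<^bold>\<forall>e. is_empty e \<^bold>\<longrightarrow> e \<^bold>\<in> x) \<^bold>\<and>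
     (\<^bold>\<forall>y s. y \<^bold>\<in> x \<^bold>\<and> is_succ y s \<^bold>\<longrightarrow> s \<^bold>\<in> x))"

definition is_omega :: "nat \<Rightarrow> fb" where
  "is_omega w = (is_inductive w \<^bold>\<and> (\<^bold>\<forall>v. is_inductive v \<^bold>\<longrightarrow> is_subset w v))"


section \<open>The axioms of ZF\<close>

definition extensionality :: fm where
  "extensionality = sentence (\<^bold>\<forall>x y. (\<^bold>\<forall>z. z \<^bold>\<in> x \<^bold>\<longleftrightarrow> z \<^bold>\<in> y) \<^bold>\<longrightarrow> x \<^bold>= y)"

definition foundation :: fm where
  "foundation = sentence
    (\<^bold>\<forall>x. (\<^bold>\<exists>y. y \<^bold>\<in> x) \<^bold>\<longrightarrow> (\<^bold>\<exists>y. y \<^bold>\<in> x \<^bold>\<and> \<^bold>\<not> (\<^bold>\<exists>z. z \<^bold>\<in> x \<^bold>\<and> z \<^bold>\<in> y)))"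

definition pairing :: fm where
  "pairing = sentence (\<^bold>\<forall>x y. \<^bold>\<exists>u. is_upair x y u)"

definition union :: fm where
  "union = sentence (\<^bold>\<forall>x. \<^bold>\<exists>u. \<^bold>\<forall>z. z \<^bold>\<in> u \<^bold>\<longleftrightarrow> (\<^bold>\<exists>y. y \<^bold>\<in> x \<^bold>\<and> z \<^bold>\<in> y))"

definition power_set :: fm where
  "power_set = sentence (\<^bold>\<forall>x. \<^bold>\<exists>u. \<^bold>\<forall>z. z \<^bold>\<in> u \<^bold>\<longleftrightarrow> is_subset z x)"

definition infinity :: fm where
  "infinity = sentence (\<^bold>\<exists>x. (\<^bold>\<exists>e. is_empty e \<^bold>\<and> e \<^bold>\<in> x) \<^bold>\<and>
    (\<^bold>\<forall>y. y \<^bold>\<in> x \<^bold>\<longrightarrow> (\<^bold>\<exists>s. is_succ y s \<^bold>\<and> s \<^bold>\<in> x)))"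

(* The distinguished variables of \<phi> are 0 in separation, and 0 (argument) and 1 (value) in
   replacement; all other free variables of \<phi> are parameters. *)
definition separation :: "fm \<Rightarrow> fm" where
  "separation \<phi> = universal_closure
    ((\<^bold>\<forall>a. \<^bold>\<exists>b. all_var 0 (0 \<^bold>\<in> b \<^bold>\<longleftrightarrow> 0 \<^bold>\<in> a \<^bold>\<and> fixed \<phi>)) (fresh \<phi>))"

definition replacement :: "fm \<Rightarrow> fm" where
  "replacement \<phi> = universal_closure
    ((\<^bold>\<forall>a. all_var 0 (0 \<^bold>\<in> a \<^bold>\<longrightarrow> (\<^bold>\<exists>c. all_var 1 (fixed \<phi> \<^bold>\<longleftrightarrow> 1 \<^bold>= c))) \<^bold>\<longrightarrow>
      (\<^bold>\<exists>b. all_var 1 (1 \<^bold>\<in> b \<^bold>\<longleftrightarrow> ex_var 0 (0 \<^bold>\<in> a \<^bold>\<and> fixed \<phi>)))) (Suc (fresh \<phi>)))"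

definition ZF :: "fm set" where
  "ZF = {extensionality, foundation, pairing, union, power_set, infinity}
        \<union> range separation \<union> range replacement"


section \<open>Reals, \<open>\<Theta>\<close>, and determinacy\<close>

(* S is the set of all \<omega>-sequences of elements of X. *)
definition is_sequences :: "nat \<Rightarrow> nat \<Rightarrow> fb" where
  "is_sequences X S = (\<^bold>\<exists>w. is_omega w \<^bold>\<and> (\<^bold>\<forall>f. f \<^bold>\<in> S \<^bold>\<longleftrightarrow> is_function f w X))"

definition is_finite_sequences :: "nat \<Rightarrow> nat \<Rightarrow> fb" where
  "is_finite_sequences X S =
    (\<^bold>\<exists>w. is_omega w \<^bold>\<and> (\<^bold>\<forall>f. f \<^bold>\<in> S \<^bold>\<longleftrightarrow> (\<^bold>\<exists>n. n \<^bold>\<in> w \<^bold>\<and> is_function f n X)))"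

(* As usual in descriptive set theory, the reals are the elements of Baire space. *)
definition is_reals :: "nat \<Rightarrow> fb" where
  "is_reals R = (\<^bold>\<exists>w. is_omega w \<^bold>\<and> is_sequences w R)"

definition is_real_image :: "nat \<Rightarrow> fb" where
  "is_real_image a = (is_ordinal a \<^bold>\<and> (\<^bold>\<exists>R f. is_reals R \<^bold>\<and> is_surjection f R a))"

definition is_upper_bound :: "nat \<Rightarrow> fb" where
  "is_upper_bound b = (is_ordinal b \<^bold>\<and> (\<^bold>\<forall>a. is_real_image a \<^bold>\<longrightarrow> a \<^bold>\<in> b \<^bold>\<or> a \<^bold>= b))"

definition is_Theta :: "nat \<Rightarrow> fb" where
  "is_Theta t = (is_upper_bound t \<^bold>\<and> (\<^bold>\<forall>b. is_upper_bound b \<^bold>\<longrightarrow> t \<^bold>\<in> b \<^bold>\<or> t \<^bold>= b))"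

definition is_evens :: "nat \<Rightarrow> fb" where
  "is_evens E = (\<^bold>\<exists>w. is_omega w \<^bold>\<and> is_subset E w \<^bold>\<and>
    (\<^bold>\<forall>e. is_empty e \<^bold>\<longrightarrow> e \<^bold>\<in> E) \<^bold>\<and>
    (\<^bold>\<forall>m n. m \<^bold>\<in> w \<^bold>\<and> is_succ m n \<^bold>\<longrightarrow> (n \<^bold>\<in> E \<^bold>\<longleftrightarrow> \<^bold>\<not> m \<^bold>\<in> E)))"

(* In the play x, the player who moves at the stages n in N follows the strategy s,
   i.e. x(n) = s(x restricted to n) for these n. *)
definition follows :: "nat \<Rightarrow> nat \<Rightarrow> nat \<Rightarrow> fb" where
  "follows N s x = (\<^bold>\<forall>n. n \<^bold>\<in> N \<^bold>\<longrightarrow>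
    (\<^bold>\<exists>g y. is_restriction x n g \<^bold>\<and> related s g y \<^bold>\<and> related x n y))"

(* Player I moves at even stages, player II at odd ones; a play is a sequence of elements
   of X and player I wins it iff it belongs to A. *)
definition determined :: "nat \<Rightarrow> nat \<Rightarrow> fb" where
  "determined X A =
    (\<^bold>\<exists>w E D S M. is_omega w \<^bold>\<and> is_evens E \<^bold>\<and> is_diff w E D \<^bold>\<and>
        is_finite_sequences X S \<^bold>\<and> is_sequences X M \<^bold>\<and>
      ((\<^bold>\<exists>s. is_function s S X \<^bold>\<and> (\<^bold>\<forall>x. x \<^bold>\<in> M \<^bold>\<and> follows E s x \<^bold>\<longrightarrow> x \<^bold>\<in> A)) \<^bold>\<or>
       (\<^bold>\<exists>s. is_function s S X \<^bold>\<and> (\<^bold>\<forall>x. x \<^bold>\<in> M \<^bold>\<and> follows D s x \<^bold>\<longrightarrow> \<^bold>\<not> x \<^bold>\<in> A))))"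

definition all_games_determined :: "nat \<Rightarrow> fb" where
  "all_games_determined X =
    (\<^bold>\<forall>M A. is_sequences X M \<^bold>\<and> is_subset A M \<^bold>\<longrightarrow> determined X A)"

definition AD :: fb where
  "AD = (\<^bold>\<exists>w. is_omega w \<^bold>\<and> all_games_determined w)"

definition AD_R :: fb where
  "AD_R = (\<^bold>\<exists>R. is_reals R \<^bold>\<and> all_games_determined R)"


section \<open>Forcing\<close>

definition is_poset :: "nat \<Rightarrow> nat \<Rightarrow> fb" where
  "is_poset P L =
    ((\<^bold>\<exists>p. p \<^bold>\<in> P) \<^bold>\<and>
     (\<^bold>\<forall>z. z \<^bold>\<in> L \<^bold>\<longrightarrow> (\<^bold>\<exists>p q. p \<^bold>\<in> P \<^bold>\<and> q \<^bold>\<in> P \<^bold>\<and> is_pair p q z)) \<^bold>\<and>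
     (\<^bold>\<forall>p. p \<^bold>\<in> P \<^bold>\<longrightarrow> related L p p) \<^bold>\<and>
     (\<^bold>\<forall>p q. related L p q \<^bold>\<and> related L q p \<^bold>\<longrightarrow> p \<^bold>= q) \<^bold>\<and>
     (\<^bold>\<forall>p q r. related L p q \<^bold>\<and> related L q r \<^bold>\<longrightarrow> related L p r))"

(* By foundation, a set is a P-name (hereditarily a set of pairs (s, p) with s a P-name and
   p in P) iff it belongs to a set D as in the next definition. *)
definition is_name_domain :: "nat \<Rightarrow> nat \<Rightarrow> fb" where
  "is_name_domain P D = (\<^bold>\<forall>a z. a \<^bold>\<in> D \<^bold>\<and> z \<^bold>\<in> a \<^bold>\<longrightarrow>
    (\<^bold>\<exists>s p. s \<^bold>\<in> D \<^bold>\<and> p \<^bold>\<in> P \<^bold>\<and> is_pair s p z))"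

definition is_name :: "nat \<Rightarrow> nat \<Rightarrow> fb" where
  "is_name P a = (\<^bold>\<exists>D. is_name_domain P D \<^bold>\<and> a \<^bold>\<in> D)"

(* t is the canonical name of x, by recursion  check x = {(check u, p). u \<in> x, p \<in> P};
   f is the restriction of this recursion to a transitive set T containing x. *)
definition is_check :: "nat \<Rightarrow> nat \<Rightarrow> nat \<Rightarrow> fb" where
  "is_check P x t = (\<^bold>\<exists>T C f. is_transitive T \<^bold>\<and> x \<^bold>\<in> T \<^bold>\<and> is_function f T C \<^bold>\<and>
    (\<^bold>\<forall>y c. related f y c \<^bold>\<longrightarrow>
      (\<^bold>\<forall>z. z \<^bold>\<in> c \<^bold>\<longleftrightarrow> (\<^bold>\<exists>u v p. u \<^bold>\<in> y \<^bold>\<and> related f u v \<^bold>\<and> p \<^bold>\<in> P \<^bold>\<and> is_pair v p z))) \<^bold>\<and>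
    related f x t)"

definition related3 :: "nat \<Rightarrow> nat \<Rightarrow> nat \<Rightarrow> nat \<Rightarrow> fb" where
  "related3 R p a b = (\<^bold>\<exists>u. is_pair a b u \<^bold>\<and> related R p u)"

(* On the names in D, the relations E(p,a,b) and M(p,a,b) are "p forces a = b" and
   "p forces a \<in> b", which are determined by the simultaneous recursion
     p forces a = b  iff  q forces s \<in> a  <->  q forces s \<in> b,
                          for all s in dom a \<union> dom b and q \<le> p;
     p forces a \<in> b  iff  the set of r with r \<le> t and r forces a = s, for some (s,t) in b,
                          is dense below p. *)
definition is_atomic_forcing :: "nat \<Rightarrow> nat \<Rightarrow> nat \<Rightarrow> nat \<Rightarrow> nat \<Rightarrow> fb" where
  "is_atomic_forcing P L D E M =
    (is_name_domain P D \<^bold>\<and>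
     (\<^bold>\<forall>p a b. p \<^bold>\<in> P \<^bold>\<and> a \<^bold>\<in> D \<^bold>\<and> b \<^bold>\<in> D \<^bold>\<longrightarrow>
       (related3 E p a b \<^bold>\<longleftrightarrow>
         (\<^bold>\<forall>s q. (\<^bold>\<exists>t. related a s t \<^bold>\<or> related b s t) \<^bold>\<and> related L q p \<^bold>\<longrightarrow>
           (related3 M q s a \<^bold>\<longleftrightarrow> related3 M q s b))) \<^bold>\<and>
       (related3 M p a b \<^bold>\<longleftrightarrow>
         (\<^bold>\<forall>q. related L q p \<^bold>\<longrightarrow> (\<^bold>\<exists>r s t. related L r q \<^bold>\<and>
           related b s t \<^bold>\<and> related L r t \<^bold>\<and> related3 E r a s)))))"

definition forces_Eq :: "nat \<Rightarrow> nat \<Rightarrow> nat \<Rightarrow> nat \<Rightarrow> nat \<Rightarrow> fb" where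
  "forces_Eq P L p a b =
    (\<^bold>\<exists>D E M. is_atomic_forcing P L D E M \<^bold>\<and> a \<^bold>\<in> D \<^bold>\<and> b \<^bold>\<in> D \<^bold>\<and> related3 E p a b)"

definition forces_Mem :: "nat \<Rightarrow> nat \<Rightarrow> nat \<Rightarrow> nat \<Rightarrow> nat \<Rightarrow> fb" where
  "forces_Mem P L p a b =
    (\<^bold>\<exists>D E M. is_atomic_forcing P L D E M \<^bold>\<and> a \<^bold>\<in> D \<^bold>\<and> b \<^bold>\<in> D \<^bold>\<and> related3 M p a b)"

(* forces P L \<phi> p is the formula "p forces \<phi>" for the poset (P, L); the free variables of
   \<phi> now stand for names. The variables P, L, p must not occur in \<phi>. *)
primrec forces :: "nat \<Rightarrow> nat \<Rightarrow> fm \<Rightarrow> nat \<Rightarrow> fb" where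
  "forces P L Falsum p = \<^bold>\<bottom>"
| "forces P L (Mem x y) p = forces_Mem P L p x y"
| "forces P L (Eq x y) p = forces_Eq P L p x y"
| "forces P L (Imp \<phi> \<psi>) p =
    (\<^bold>\<forall>q. related L q p \<^bold>\<longrightarrow> forces P L \<phi> q \<^bold>\<longrightarrow> forces P L \<psi> q)"
| "forces P L (Forall x \<phi>) p = all_var x (is_name P x \<^bold>\<longrightarrow> forces P L \<phi> p)"

(* Truth of \<phi> in V[G] for every generic filter G over V, as a statement about V: the ground
   model has no generic filters of its own in general, so this is by convention the
   statement that every condition forces \<phi>. *)
definition holds_in_every_extension :: "nat \<Rightarrow> nat \<Rightarrow> fm \<Rightarrow> fb" where
  "holds_in_every_extension P L \<phi> = (\<^bold>\<forall>p. p \<^bold>\<in> P \<^bold>\<longrightarrow> forces P L \<phi> p)"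

(* "The ordinal denoted by the variable 0 is smaller than \<Theta>, and AD holds." *)
definition above_and_AD :: fm where
  "above_and_AD = ((\<^bold>\<exists>t. is_Theta t \<^bold>\<and> 0 \<^bold>\<in> t) \<^bold>\<and> AD) 1"

(* The variable 0 is the canonical name of the \<Theta> of V. The initial value fresh above_and_AD
   keeps all variables of the surrounding formula apart from those of above_and_AD. *)
definition forcing_increases_Theta_preserving_AD :: fm where
  "forcing_increases_Theta_preserving_AD =
    (\<^bold>\<exists>P L. is_poset P L \<^bold>\<and>
      (\<^bold>\<exists>\<theta>. is_Theta \<theta> \<^bold>\<and>
        all_var 0 (is_check P \<theta> 0 \<^bold>\<longrightarrow> holds_in_every_extension P L above_and_AD)))
    (fresh above_and_AD)"

end

theory Submission
  imports Defs "HOL-Library.Countable" "HOL-Library.Infinite_Set"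
begin

text \<open>Let \<open>V\<close> be a model of ZF and \<open>AD\<^sub>R\<close>, and let \<open>N\<close> be the class of all sets that are hereditarily
  ordinal definable from a real. It contains all reals, hence all strategies for games on integers, and
  so satisfies AD. On the other hand, uniformization in \<open>V\<close> yields a set of reals \<open>A\<close> outside \<open>N\<close>. By
  Wadge's lemma every set of reals in \<open>N\<close> is a continuous preimage of \<open>A\<close>, so that the prewellorderings
  in \<open>N\<close> are indexed by reals and, in \<open>V\<close>, there is a surjection \<open>B\<close> from the reals onto \<open>\<Theta>\<^sup>N + 1\<close>.

  In \<open>N\<close>, force with (codes of) the nonempty sets of such surjections that are ordinal definable from a
  real. For every surjection \<open>B\<close> the conditions containing \<open>B\<close> interpret the names, giving a class
  \<open>N[B]\<close>. The set of all \<open>B\<close> in a condition \<open>p\<close> for which \<open>N[B]\<close> satisfies a formula is ordinal definable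
  from a real, hence a condition if nonempty; therefore \<open>p\<close> forces \<open>\<phi>\<close> iff \<open>N[B]\<close> satisfies \<open>\<phi>\<close> for all
  \<open>B\<close> in \<open>p\<close>, and generic filters are not needed. As \<open>N[B]\<close> contains \<open>B\<close> and all reals and strategies of
  \<open>V\<close>, it has a larger \<open>\<Theta>\<close> and satisfies AD.

  The natural numbers of \<open>V\<close> may be nonstandard. Instead of the satisfaction relation of \<open>V\<close>, the
  definition of \<open>N\<close> uses a relation \<open>R\<close> that indexes, by ordinals and parameters, all sets definable
  from \<open>\<in>\<close> and \<open>R\<close> itself. For finitely many formulas such an \<open>R\<close> is definable by the reflection
  principle, and an ultraproduct provides one for all formulas.\<close>

section \<open>Semantics, soundness and completeness\<close>

text \<open>Consistency speaks of derivations, so completeness first provides a countable model. It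
  may be ill-founded, its formulas may be nonstandard, and it has no truth predicate; hence
  definability is measured by formulas given from outside, and the sets indexed by \<open>R\<close>
  have to be closed under definitions that mention \<open>R\<close> again. This is the obstacle
  behind the enumeration: its levels refer to the enumeration below them, and reflection, applied to
  formulas with \<open>R\<close>, shows that nothing definable is missed. The poset is a variant of
  Vopenka's algebra: in place of density arguments, a definable subset is cut out of a condition.
  The surjections go onto \<Theta> + 1 rather than \<Theta> because \<Theta> is a supremum and the
  inequality has to be strict. Beyond AD for integers, determinacy with real moves enters through
  uniformization of the relation "y is not definable from x and ordinals". It is total because
  determinacy forbids a well-ordering of the reals, and no function uniformizing it is definable
  from a real and ordinals: its value at that real would be definable from it.\<close>

primrec sat :: "'a set \<Rightarrow> ('a \<Rightarrow> 'a \<Rightarrow> bool) \<Rightarrow> (nat \<Rightarrow> 'a) \<Rightarrow> fm \<Rightarrow> bool" where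
  "sat A E s Falsum \<longleftrightarrow> False"
| "sat A E s (Mem x y) \<longleftrightarrow> E (s x) (s y)"
| "sat A E s (Eq x y) \<longleftrightarrow> s x = s y"
| "sat A E s (Imp \<phi> \<psi>) \<longleftrightarrow> (sat A E s \<phi> \<longrightarrow> sat A E s \<psi>)"
| "sat A E s (Forall x \<phi>) \<longleftrightarrow> (\<forall>a\<in>A. sat A E (s(x := a)) \<phi>)"

text \<open>Free variables are read universally; this is what makes unrestricted generalization
  sound.\<close>

definition valid :: "'a set \<Rightarrow> ('a \<Rightarrow> 'a \<Rightarrow> bool) \<Rightarrow> fm \<Rightarrow> bool" where
  "valid A E \<phi> \<longleftrightarrow> (\<forall>s. range s \<subseteq> A \<longrightarrow> sat A E s \<phi>)"

lemma sat_cong: "(\<And>v. v \<in> fv \<phi> \<Longrightarrow> s v = t v) \<Longrightarrow> sat A E s \<phi> = sat A E t \<phi>"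
proof (induction \<phi> arbitrary: s t)
  case (Forall x \<phi>)
  have "sat A E (s(x := a)) \<phi> = sat A E (t(x := a)) \<phi>" for a
    by (rule Forall.IH) (use Forall.prems in auto)
  then show ?case by simp
next
  case (Imp \<phi> \<psi>)
  have "sat A E s \<phi> = sat A E t \<phi>" by (rule Imp.IH(1)) (simp add: Imp.prems)
  moreover have "sat A E s \<psi> = sat A E t \<psi>" by (rule Imp.IH(2)) (simp add: Imp.prems)
  ultimately show ?case by simp
qed simp_all

lemma sat_subst:
  "free_for y x \<phi> \<Longrightarrow> sat A E s (subst y x \<phi>) = sat A E (s(x := s y)) \<phi>"
proof (induction \<phi> arbitrary: s)
  case (Forall z \<phi>)
  show ?case
  proof (cases "z = x")
    case True
    show ?thesis unfolding True by (simp only: subst.simps sat.simps fun_upd_upd if_True simp_thms)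
  next
    case z: False
    show ?thesis
    proof (cases "x \<in> fv \<phi>")
      case False
      have *: "subst y x \<psi> = \<psi>" if "x \<notin> fv \<psi>" for \<psi>
        using that by (induction \<psi>) auto
      have "sat A E ((s(x := s y))(z := a)) \<phi> = sat A E (s(z := a)) \<phi>" for a
        by (rule sat_cong) (use False in auto)
      with z False * show ?thesis by (simp del: fun_upd_apply)
    next
      case True
      with Forall.prems z have "z \<noteq> y" "free_for y x \<phi>" by auto
      with Forall.IH z show ?thesis by (simp add: fun_upd_twist fun_upd_other del: fun_upd_apply)
    qed
  qed
qed auto

theorem soundness:
  assumes "T \<turnstile> \<phi>" "\<And>\<psi>. \<psi> \<in> T \<Longrightarrow> valid A E \<psi>" "A \<noteq> {}"
  shows "valid A E \<phi>"
  using assms(1)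
proof induction
  case (inst y x \<phi>)
  then show ?case by (auto simp: valid_def sat_subst)
next
  case (distrib x \<phi> \<psi>)
  have "sat A E (s(x := a)) \<phi> = sat A E s \<phi>" for s a
    by (rule sat_cong) (use distrib in auto)
  then show ?case by (simp add: valid_def)
next
  case (generalization \<phi> x)
  have "range (s(x := a)) \<subseteq> A" if "range s \<subseteq> A" "a \<in> A" for s a
    using that by auto
  with generalization show ?case by (simp add: valid_def)
qed (use assms(2) in \<open>auto simp: valid_def\<close>)

corollary consistent_if_model:
  assumes "\<And>\<psi>. \<psi> \<in> T \<Longrightarrow> valid A E \<psi>" "A \<noteq> {}"
  shows "consistent T"
proof -
  from assms(2) obtain a where "a \<in> A" by auto
  then have "\<not> valid A E Falsum"
    by (auto simp: valid_def intro: exI[of _ "\<lambda>_. a"])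
  with soundness[of T Falsum A E] assms show ?thesis
    by (auto simp: consistent_def)
qed

text \<open>Variables free in \<Gamma> act as constants: generalization enters only through theorems
  of \<open>T\<close>, never after a hypothesis has been used. The deduction theorem therefore holds
  without a proviso on variables.\<close>

inductive derives :: "fm set \<Rightarrow> fm set \<Rightarrow> fm \<Rightarrow> bool" for T \<Gamma> where
  prv: "T \<turnstile> \<phi> \<Longrightarrow> derives T \<Gamma> \<phi>"
| hyp: "\<phi> \<in> \<Gamma> \<Longrightarrow> derives T \<Gamma> \<phi>"
| mp: "derives T \<Gamma> \<phi> \<Longrightarrow> derives T \<Gamma> (Imp \<phi> \<psi>) \<Longrightarrow> derives T \<Gamma> \<psi>"

lemma derives_mono: "derives T \<Gamma> \<phi> \<Longrightarrow> \<Gamma> \<subseteq> \<Delta> \<Longrightarrow> derives T \<Delta> \<phi>"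
  by (induction rule: derives.induct) (auto intro: derives.intros)

lemma derives_imp_refl: "derives T \<Gamma> (Imp \<phi> \<phi>)"
  using modus_ponens[OF imp_K modus_ponens[OF imp_K imp_S]] by (rule derives.prv)

lemma derives_weaken: "derives T \<Gamma> \<phi> \<Longrightarrow> derives T \<Gamma> (Imp \<psi> \<phi>)"
  by (rule derives.mp[OF _ derives.prv[OF imp_K]])

lemma deduction: "derives T (insert \<psi> \<Gamma>) \<phi> \<Longrightarrow> derives T \<Gamma> (Imp \<psi> \<phi>)"
proof (induction rule: derives.induct)
  case (hyp \<phi>)
  then show ?case by (auto intro: derives_imp_refl derives_weaken derives.hyp)
next
  case (mp \<phi> \<chi>)
  then show ?case using derives.mp[OF _ derives.mp[OF _ derives.prv[OF imp_S]]] by blast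
qed (auto intro: derives_weaken derives.prv)

lemma derives_finite: "derives T \<Gamma> \<phi> \<Longrightarrow> \<exists>\<Delta>. finite \<Delta> \<and> \<Delta> \<subseteq> \<Gamma> \<and> derives T \<Delta> \<phi>"
proof (induction rule: derives.induct)
  case (prv \<phi>)
  then show ?case by (auto intro: derives.prv exI[of _ "{}"])
next
  case (hyp \<phi>)
  then show ?case by (auto intro: derives.hyp exI[of _ "{\<phi>}"])
next
  case (mp \<phi> \<psi>)
  then obtain \<Delta> \<Delta>' where "finite \<Delta>" "\<Delta> \<subseteq> \<Gamma>" "derives T \<Delta> \<phi>"
    "finite \<Delta>'" "\<Delta>' \<subseteq> \<Gamma>" "derives T \<Delta>' (Imp \<phi> \<psi>)" by blast
  then show ?case
    by (intro exI[of _ "\<Delta> \<union> \<Delta>'"]) (auto intro: derives.mp[of _ _ \<phi>] derives_mono)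
qed

lemma derives_cut: "derives T (insert \<psi> \<Gamma>) \<phi> \<Longrightarrow> derives T \<Gamma> \<psi> \<Longrightarrow> derives T \<Gamma> \<phi>"
  using deduction derives.mp by blast

lemma derives_contradiction:
  "derives T (insert (Imp \<phi> Falsum) \<Gamma>) Falsum \<Longrightarrow> derives T \<Gamma> \<phi>"
  by (rule derives.mp[OF deduction derives.prv[OF double_neg]])

lemma derives_empty: "derives T {} \<phi> \<Longrightarrow> T \<turnstile> \<phi>"
  by (induction rule: derives.induct) (auto intro: modus_ponens)

section \<open>Instantiation, generalization and bound renaming under hypotheses\<close>

lemma subst_self [simp]: "subst x x \<phi> = \<phi>"
  by (induction \<phi>) auto

lemma free_for_self [simp]: "free_for x x \<phi>"
  by (induction \<phi>) auto

lemma derives_inst: "derives T \<Gamma> (Forall x \<phi>) \<Longrightarrow> free_for y x \<phi> \<Longrightarrow> derives T \<Gamma> (subst y x \<phi>)"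
  by (rule derives.mp[OF _ derives.prv[OF inst]])

text \<open>Neither hypothesis has \<open>x\<close> free, so after instantiating both at
  \<open>x\<close> itself the variable can be generalized and moved inwards by two uses of
  \<open>distrib\<close>. Generalization under hypotheses relies on this to pass through modus
  ponens.\<close>

lemma proves_all_mp: "T \<turnstile> Imp (Forall x (Imp \<phi> \<psi>)) (Imp (Forall x \<phi>) (Forall x \<psi>))"
proof -
  let ?A = "Forall x (Imp \<phi> \<psi>)" and ?B = "Forall x \<phi>"
  have "derives T {?A, ?B} (subst x x (Imp \<phi> \<psi>))" "derives T {?A, ?B} (subst x x \<phi>)"
    by (rule derives_inst[OF derives.hyp], simp, simp)+
  then have "derives T {?A, ?B} \<psi>" by (auto intro: derives.mp)
  then have "derives T {} (Imp ?A (Imp ?B \<psi>))"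
    by (auto intro!: deduction simp: insert_commute)
  then have "T \<turnstile> Forall x (Imp ?A (Imp ?B \<psi>))"
    by (intro generalization derives_empty)
  moreover have "T \<turnstile> Imp (Forall x (Imp ?A (Imp ?B \<psi>))) (Imp ?A (Forall x (Imp ?B \<psi>)))"
    by (rule distrib) auto
  moreover have "T \<turnstile> Imp (Forall x (Imp ?B \<psi>)) (Imp ?B (Forall x \<psi>))"
    by (rule distrib) auto
  ultimately have "T \<turnstile> Imp ?A (Forall x (Imp ?B \<psi>))"
    by (blast intro: modus_ponens)
  then have "derives T {?A} (Imp ?B (Forall x \<psi>))"
    using \<open>T \<turnstile> Imp (Forall x (Imp ?B \<psi>)) _\<close>
    using derives.mp[OF derives.mp[OF derives.hyp derives.prv] derives.prv] by blast
  then show ?thesis by (rule derives_empty[OF deduction])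
qed

text \<open>As \<open>derives\<close> has no generalization rule, the quantifier is pushed to the
  leaves of the derivation: theorems of \<open>T\<close> can be generalized, hypotheses do not
  contain \<open>y\<close>, and modus ponens is handled by \<open>proves_all_mp\<close>.\<close>

lemma derives_generalize:
  "derives T \<Gamma> \<phi> \<Longrightarrow> (\<And>\<gamma>. \<gamma> \<in> \<Gamma> \<Longrightarrow> y \<notin> fv \<gamma>) \<Longrightarrow> derives T \<Gamma> (Forall y \<phi>)"
proof (induction rule: derives.induct)
  case (prv \<phi>)
  then show ?case by (auto intro: derives.prv generalization)
next
  case (hyp \<phi>)
  have "T \<turnstile> Forall y (Imp \<phi> \<phi>)"
    by (intro generalization derives_empty derives_imp_refl)
  moreover have "T \<turnstile> Imp (Forall y (Imp \<phi> \<phi>)) (Imp \<phi> (Forall y \<phi>))"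
    by (rule distrib) (use hyp in auto)
  ultimately show ?case using derives.mp[OF derives.hyp[OF hyp(1)] derives.prv] modus_ponens by blast
next
  case (mp \<phi> \<psi>)
  then show ?case using derives.mp[OF _ derives.mp[OF _ derives.prv[OF proves_all_mp]]] by blast
qed

lemma fv_subset_vars: "fv \<phi> \<subseteq> vars \<phi>"
  by (induction \<phi>) auto

lemma finite_vars [simp]: "finite (vars \<phi>)"
  by (induction \<phi>) auto

lemma subst_id: "x \<notin> vars \<phi> \<Longrightarrow> subst y x \<phi> = \<phi>"
  by (induction \<phi>) auto

lemma subst_back: "y \<notin> vars \<phi> \<Longrightarrow> subst x y (subst y x \<phi>) = \<phi>"
  by (induction \<phi>) (auto simp: subst_id)

lemma fv_subst: "fv (subst y x \<phi>) \<subseteq> (fv \<phi> - {x}) \<union> {y}"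
  by (induction \<phi>) (auto split: if_splits)

lemma free_for_back: "y \<notin> vars \<phi> \<Longrightarrow> free_for x y (subst y x \<phi>)"
proof (induction \<phi>)
  case (Forall z \<phi>)
  then show ?case using fv_subset_vars[of \<phi>] by auto
qed auto

text \<open>Substituting back is free of capture when \<open>y\<close> is new to \<phi>, so the
  renamed universal formula yields \<phi> itself; \<open>x\<close> is no longer free in that formula
  and can be generalized.\<close>

lemma derives_rename_bound:
  assumes "y \<notin> vars \<phi>" "derives T \<Gamma> (Forall y (subst y x \<phi>))"
  shows "derives T \<Gamma> (Forall x \<phi>)"
proof (cases "x = y")
  case False
  let ?A = "Forall y (subst y x \<phi>)"
  have "derives T {?A} (subst x y (subst y x \<phi>))"
    by (intro derives_inst derives.hyp free_for_back assms) auto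
  then have "derives T {?A} (Forall x \<phi>)"
    unfolding subst_back[OF assms(1)]
    by (rule derives_generalize) (use fv_subst[of y x \<phi>] False in auto)
  then have "derives T {} (Imp ?A (Forall x \<phi>))" by (rule deduction)
  with assms(2) show ?thesis using derives.mp[OF _ derives_mono[of _ "{}"]] by blast
qed (use assms in simp)

text \<open>A new variable behaves like an arbitrary element: refuting the negated instance at
  \<open>y\<close> would prove the instance, hence after generalization the universal formula, whose
  negation is among the hypotheses.\<close>

lemma witness_consistent:
  assumes "\<not> derives T (insert (Imp (Forall x \<psi>) Falsum) \<Gamma>) Falsum"
    and y: "y \<notin> vars \<psi>" "y \<noteq> x" "\<And>\<gamma>. \<gamma> \<in> \<Gamma> \<Longrightarrow> y \<notin> fv \<gamma>"
  shows "\<not> derives T (insert (Imp (subst y x \<psi>) Falsum) (insert (Imp (Forall x \<psi>) Falsum) \<Gamma>)) Falsum"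
proof
  let ?G = "insert (Imp (Forall x \<psi>) Falsum) \<Gamma>"
  assume "derives T (insert (Imp (subst y x \<psi>) Falsum) ?G) Falsum"
  then have "derives T ?G (subst y x \<psi>)" by (rule derives_contradiction)
  then have "derives T ?G (Forall y (subst y x \<psi>))"
    by (rule derives_generalize) (use y fv_subset_vars[of \<psi>] in auto)
  then have "derives T ?G (Forall x \<psi>)" by (rule derives_rename_bound[OF y(1)])
  then have "derives T ?G Falsum" using derives.mp[OF _ derives.hyp] by blast
  with assms(1) show False by simp
qed

section \<open>The Henkin extension of a consistent theory\<close>

instance fm :: countable by countable_datatype

definition witness :: "fm set \<Rightarrow> nat" where
  "witness G = (SOME y. odd y \<and> y \<notin> (\<Union>\<gamma>\<in>G. vars \<gamma>))"

lemma witness: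
  assumes "finite G"
  shows "odd (witness G)" "\<gamma> \<in> G \<Longrightarrow> witness G \<notin> vars \<gamma>"
proof -
  let ?X = "\<Union>\<gamma>\<in>G. vars \<gamma>"
  have "finite ?X" using assms by simp
  then obtain k where "\<forall>v\<in>?X. v < k" using finite_nat_set_iff_bounded by auto
  then have "2 * k + 1 \<notin> ?X" by fastforce
  then have "odd (2 * k + 1) \<and> 2 * k + 1 \<notin> ?X" by auto
  then have *: "odd (witness G) \<and> witness G \<notin> ?X"
    unfolding witness_def by (rule someI)
  then show "odd (witness G)" "\<gamma> \<in> G \<Longrightarrow> witness G \<notin> vars \<gamma>" by auto
qed

text \<open>Only a rejected universal formula needs a witness. It is supplied in the very step that
  rejects the formula, as the negated instance at a variable new to everything decided so
  far.\<close>

primrec henkin_neg :: "fm set \<Rightarrow> fm \<Rightarrow> fm set" where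
  "henkin_neg G Falsum = {}"
| "henkin_neg G (Mem x y) = {}"
| "henkin_neg G (Eq x y) = {}"
| "henkin_neg G (Imp \<phi> \<psi>) = {}"
| "henkin_neg G (Forall x \<phi>) = {Imp (subst (witness (insert (Forall x \<phi>) G)) x \<phi>) Falsum}"

primrec henkin :: "fm set \<Rightarrow> nat \<Rightarrow> fm set" where
  "henkin T 0 = {}"
| "henkin T (Suc n) = (let G = henkin T n; \<phi> = from_nat n in
    if derives T (insert \<phi> G) Falsum
    then henkin_neg G \<phi> \<union> insert (Imp \<phi> Falsum) G else insert \<phi> G)"

lemma finite_henkin [simp]: "finite (henkin T n)"
proof (induction n)
  case (Suc n)
  have "finite (henkin_neg G \<phi>)" for G \<phi> by (cases \<phi>) auto
  with Suc show ?case by (simp add: Let_def)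
qed simp

lemma henkin_consistent:
  assumes "consistent T"
  shows "\<not> derives T (henkin T n) Falsum"
proof (induction n)
  case 0
  then show ?case using assms derives_empty by (auto simp: consistent_def)
next
  case (Suc n)
  let ?G = "henkin T n" and ?\<phi> = "from_nat n :: fm"
  show ?case
  proof (cases "derives T (insert ?\<phi> ?G) Falsum")
    case True
    then have neg: "\<not> derives T (insert (Imp ?\<phi> Falsum) ?G) Falsum"
      using Suc deduction derives_cut by blast
    show ?thesis
    proof (cases ?\<phi>)
      case (Forall x \<psi>)
      let ?y = "witness (insert (Forall x \<psi>) ?G)"
      have y: "?y \<notin> vars (Forall x \<psi>)" "\<And>\<gamma>. \<gamma> \<in> ?G \<Longrightarrow> ?y \<notin> vars \<gamma>"
        by (simp_all add: witness(2) del: vars.simps)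
      have "\<not> derives T (insert (Imp (subst ?y x \<psi>) Falsum) (insert (Imp (Forall x \<psi>) Falsum) ?G)) Falsum"
        by (rule witness_consistent) (use neg y fv_subset_vars in \<open>auto simp: Forall\<close>)
      with True Forall show ?thesis by (simp add: Let_def insert_commute)
    qed (use True neg in \<open>simp_all add: Let_def\<close>)
  qed (simp add: Let_def)
qed

lemma henkin_mono: "m \<le> n \<Longrightarrow> henkin T m \<subseteq> henkin T n"
proof (rule lift_Suc_mono_le[of "henkin T"])
  show "henkin T n \<subseteq> henkin T (Suc n)" for n
    by (cases "derives T (insert (from_nat n) (henkin T n)) Falsum") (simp_all add: Let_def subset_insertI le_supI2 subset_insertI2)
qed

text \<open>The last clause is the Henkin property in contrapositive form; witnesses have to be odd
  because the term model consists of odd variables only.\<close>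

definition complete_extension :: "fm set \<Rightarrow> fm set \<Rightarrow> bool" where
  "complete_extension T \<Gamma> \<longleftrightarrow>
    (\<forall>\<phi>. derives T \<Gamma> \<phi> \<longrightarrow> \<phi> \<in> \<Gamma>) \<and> Falsum \<notin> \<Gamma> \<and> (\<forall>\<phi>. \<phi> \<in> \<Gamma> \<or> Imp \<phi> Falsum \<in> \<Gamma>) \<and>
    (\<forall>x \<psi>. Forall x \<psi> \<notin> \<Gamma> \<longrightarrow> (\<exists>y. odd y \<and> subst y x \<psi> \<notin> \<Gamma>))"

lemma complete_extension_exists:
  assumes "consistent T"
  shows "\<exists>\<Gamma>. complete_extension T \<Gamma>"
proof -
  define \<Gamma> where "\<Gamma> = (\<Union>n. henkin T n)"
  have con: "\<not> derives T \<Gamma> Falsum"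
  proof
    assume "derives T \<Gamma> Falsum"
    from derives_finite[OF this]
    obtain \<Delta> where \<Delta>: "finite \<Delta>" "\<Delta> \<subseteq> \<Gamma>" "derives T \<Delta> Falsum"
      by (elim exE conjE)
    have "\<exists>n. \<Delta> \<subseteq> henkin T n" using \<Delta>(1,2)
    proof (induction \<Delta>)
      case (insert \<phi> \<Delta>)
      from insert.prems have "\<phi> \<in> \<Gamma>" "\<Delta> \<subseteq> \<Gamma>" by simp_all
      from insert.IH[OF this(2)] obtain n where "\<Delta> \<subseteq> henkin T n" ..
      moreover from \<open>\<phi> \<in> \<Gamma>\<close> obtain m where "\<phi> \<in> henkin T m" unfolding \<Gamma>_def by (rule UN_E)
      ultimately have "insert \<phi> \<Delta> \<subseteq> henkin T (max m n)"
        using henkin_mono[of m "max m n" T] henkin_mono[of n "max m n" T]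
        by (meson insert_subset max.cobounded1 max.cobounded2 order_trans subsetD)
      then show ?case by (rule exI)
    qed simp
    then obtain n where "\<Delta> \<subseteq> henkin T n" ..
    with henkin_consistent[OF assms] derives_mono[OF \<Delta>(3)] show False by blast
  qed
  have dec: "\<phi> \<in> henkin T (Suc (to_nat \<phi>)) \<or>
      (henkin_neg (henkin T (to_nat \<phi>)) \<phi> \<union> {Imp \<phi> Falsum} \<subseteq> henkin T (Suc (to_nat \<phi>)))" for \<phi> :: fm
  proof (cases "derives T (insert \<phi> (henkin T (to_nat \<phi>))) Falsum")
    case True
    then have "henkin T (Suc (to_nat \<phi>)) =
        henkin_neg (henkin T (to_nat \<phi>)) \<phi> \<union> insert (Imp \<phi> Falsum) (henkin T (to_nat \<phi>))"
      by (simp only: henkin.simps Let_def from_nat_to_nat if_True)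
    then show ?thesis by blast
  next
    case False
    then have "henkin T (Suc (to_nat \<phi>)) = insert \<phi> (henkin T (to_nat \<phi>))"
      by (simp only: henkin.simps Let_def from_nat_to_nat if_False)
    then show ?thesis by blast
  qed
  have sub: "henkin T n \<subseteq> \<Gamma>" for n unfolding \<Gamma>_def by (rule UN_upper) simp
  have not_both: "Imp \<phi> Falsum \<notin> \<Gamma>" if "derives T \<Gamma> \<phi>" for \<phi>
    using con derives.mp[OF that derives.hyp] by blast
  show ?thesis unfolding complete_extension_def
  proof (intro exI[of _ \<Gamma>] conjI allI impI)
    fix \<phi> assume "derives T \<Gamma> \<phi>"
    then have "Imp \<phi> Falsum \<notin> \<Gamma>" by (rule not_both)
    with dec[of \<phi>] sub show "\<phi> \<in> \<Gamma>" by blast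
  next
    show "Falsum \<notin> \<Gamma>" using con derives.hyp[of Falsum \<Gamma> T] by blast
  next
    show "\<phi> \<in> \<Gamma> \<or> Imp \<phi> Falsum \<in> \<Gamma>" for \<phi> using dec[of \<phi>] sub by blast
  next
    fix x \<psi> assume "Forall x \<psi> \<notin> \<Gamma>"
    let ?G = "insert (Forall x \<psi>) (henkin T (to_nat (Forall x \<psi>)))"
    from \<open>Forall x \<psi> \<notin> \<Gamma>\<close> dec[of "Forall x \<psi>"] sub
    have "henkin_neg (henkin T (to_nat (Forall x \<psi>))) (Forall x \<psi>) \<subseteq> \<Gamma>" by blast
    then have "Imp (subst (witness ?G) x \<psi>) Falsum \<in> \<Gamma>" by simp
    moreover have "odd (witness ?G)" by (rule witness) simp
    ultimately show "\<exists>y. odd y \<and> subst y x \<psi> \<notin> \<Gamma>"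
      using not_both[OF derives.hyp] by blast
  qed
qed

text \<open>Odd variables serve as Henkin constants and even variables are the ones of the formulas to be
  interpreted, so that substituting the former for the latter never captures.\<close>

primrec inst_vars :: "(nat \<Rightarrow> nat) \<Rightarrow> fm \<Rightarrow> fm" where
  "inst_vars \<sigma> Falsum = Falsum"
| "inst_vars \<sigma> (Mem x y) = Mem (\<sigma> x) (\<sigma> y)"
| "inst_vars \<sigma> (Eq x y) = Eq (\<sigma> x) (\<sigma> y)"
| "inst_vars \<sigma> (Imp \<phi> \<psi>) = Imp (inst_vars \<sigma> \<phi>) (inst_vars \<sigma> \<psi>)"
| "inst_vars \<sigma> (Forall x \<phi>) = Forall x (inst_vars (\<sigma>(x := x)) \<phi>)"

lemma subst_inst_vars:
  assumes "even x" "odd y"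
  shows "(\<And>v. v \<in> vars \<phi> \<Longrightarrow> even v) \<Longrightarrow> (\<And>z. \<sigma> z = z \<or> odd (\<sigma> z)) \<Longrightarrow>
    subst y x (inst_vars (\<sigma>(x := x)) \<phi>) = inst_vars (\<sigma>(x := y)) \<phi>"
proof (induction \<phi> arbitrary: \<sigma>)
  case (Forall z \<phi>)
  show ?case
  proof (cases "z = x")
    case False
    have "subst y x (inst_vars ((\<sigma>(z := z))(x := x)) \<phi>) = inst_vars ((\<sigma>(z := z))(x := y)) \<phi>"
      by (rule Forall.IH) (use Forall.prems in auto)
    with False show ?thesis by (simp add: fun_upd_twist del: fun_upd_apply)
  qed (simp del: fun_upd_apply)
next
  case (Mem u v)
  then show ?case using assms by (auto, metis+)
next
  case (Eq u v)
  then show ?case using assms by (auto, metis+)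
qed simp_all

lemma free_for_inst_vars:
  "odd y \<Longrightarrow> (\<And>v. v \<in> vars \<phi> \<Longrightarrow> even v) \<Longrightarrow> free_for y x (inst_vars \<sigma> \<phi>)"
  by (induction \<phi> arbitrary: \<sigma>) auto

lemma inst_vars_id: "(\<And>v. v \<in> fv \<phi> \<Longrightarrow> \<sigma> v = v) \<Longrightarrow> inst_vars \<sigma> \<phi> = \<phi>"
  by (induction \<phi> arbitrary: \<sigma>) auto

section \<open>Universal closures and the term model\<close>

lemma fv_fold_Forall: "fv (fold Forall xs \<phi>) = fv \<phi> - set xs"
  by (induction xs arbitrary: \<phi>) auto

lemma vars_fold_Forall: "vars (fold Forall xs \<phi>) = vars \<phi> \<union> set xs"
  by (induction xs arbitrary: \<phi>) auto

lemma proves_fold_Forall: "T \<turnstile> \<phi> \<Longrightarrow> T \<turnstile> fold Forall xs \<phi>"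
  by (induction xs arbitrary: \<phi>) (auto intro: generalization)

lemma valid_Forall: "valid A E (Forall x \<phi>) = valid A E \<phi>"
proof
  assume "valid A E (Forall x \<phi>)"
  then have *: "sat A E (s(x := s x)) \<phi>" if "range s \<subseteq> A" for s
    using that by (fastforce simp: valid_def simp del: fun_upd_triv)
  then show "valid A E \<phi>" by (simp add: valid_def)
next
  assume "valid A E \<phi>"
  moreover have "range (s(x := a)) \<subseteq> A" if "range s \<subseteq> A" "a \<in> A" for s a
    using that by auto
  ultimately show "valid A E (Forall x \<phi>)" by (simp add: valid_def)
qed

lemma valid_fold_Forall: "valid A E (fold Forall xs \<phi>) = valid A E \<phi>"
  by (induction xs arbitrary: \<phi>) (auto simp: valid_Forall)

lemma finite_fv [simp]: "finite (fv \<phi>)"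
  by (induction \<phi>) auto

text \<open>The domain consists of representatives, the least odd variable of each class modulo
  equality in \<Gamma>, so the model lives on a set of numbers rather than on a quotient. Truth is
  then membership in \<Gamma>, by induction on the formula.\<close>

lemma even_model:
  assumes "consistent T" and even: "\<And>\<phi> v. \<phi> \<in> T \<Longrightarrow> v \<in> vars \<phi> \<Longrightarrow> even v"
  shows "\<exists>(A :: nat set) E. A \<noteq> {} \<and> (\<forall>\<phi>\<in>T. valid A E \<phi>)"
proof -
  from complete_extension_exists[OF assms(1)] obtain \<Gamma> where ce: "complete_extension T \<Gamma>" ..
  then have closed: "\<And>\<phi>. derives T \<Gamma> \<phi> \<Longrightarrow> \<phi> \<in> \<Gamma>"
    and nF: "Falsum \<notin> \<Gamma>"
    and total: "\<And>\<phi>. \<phi> \<in> \<Gamma> \<or> Imp \<phi> Falsum \<in> \<Gamma>"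
    by (auto simp: complete_extension_def)
  from ce have wit: "Forall x \<psi> \<notin> \<Gamma> \<Longrightarrow> \<exists>y. odd y \<and> subst y x \<psi> \<notin> \<Gamma>" for x \<psi>
    by (auto simp: complete_extension_def)
  have prv: "T \<turnstile> \<phi> \<Longrightarrow> \<phi> \<in> \<Gamma>" for \<phi> by (rule closed[OF derives.prv])
  have mp: "\<phi> \<in> \<Gamma> \<Longrightarrow> Imp \<phi> \<psi> \<in> \<Gamma> \<Longrightarrow> \<psi> \<in> \<Gamma>" for \<phi> \<psi>
    using closed[OF derives.mp[OF derives.hyp derives.hyp]] .
  have imp: "Imp \<phi> \<psi> \<in> \<Gamma> \<longleftrightarrow> (\<phi> \<in> \<Gamma> \<longrightarrow> \<psi> \<in> \<Gamma>)" for \<phi> \<psi>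
  proof
    assume *: "\<phi> \<in> \<Gamma> \<longrightarrow> \<psi> \<in> \<Gamma>"
    show "Imp \<phi> \<psi> \<in> \<Gamma>"
    proof (cases "\<psi> \<in> \<Gamma>")
      case True
      then show ?thesis by (rule closed[OF derives_weaken[OF derives.hyp]])
    next
      case False
      with * total have "Imp \<phi> Falsum \<in> \<Gamma>" by blast
      then have "derives T (insert \<phi> \<Gamma>) Falsum"

        using derives.mp[of T "insert \<phi> \<Gamma>" \<phi> Falsum] derives.hyp[of \<phi> "insert \<phi> \<Gamma>" T]
          derives.hyp[of "Imp \<phi> Falsum" "insert \<phi> \<Gamma>" T] by simp
      then have "derives T (insert \<phi> \<Gamma>) \<psi>"
        by (rule derives_contradiction[OF derives_mono[OF _ subset_insertI]])
      then show ?thesis by (rule closed[OF deduction])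
    qed
  qed (use mp in blast)
  have sym: "Eq x y \<in> \<Gamma> \<Longrightarrow> Eq y x \<in> \<Gamma>" for x y
    by (rule mp[OF prv[OF eq_refl] mp[OF _ prv[OF eq_Eq]]])
  have trans: "Eq x y \<in> \<Gamma> \<Longrightarrow> Eq y z \<in> \<Gamma> \<Longrightarrow> Eq x z \<in> \<Gamma>" for x y z
    by (rule mp[OF _ mp[OF sym prv[OF eq_Eq]]])
  have memc: "Eq x x' \<in> \<Gamma> \<Longrightarrow> Eq y y' \<in> \<Gamma> \<Longrightarrow> Mem x y \<in> \<Gamma> \<Longrightarrow> Mem x' y' \<in> \<Gamma>" for x x' y y'
    using mp[OF mp[OF _ mp[OF _ prv[OF eq_Mem_left]]] mp[OF _ prv[OF eq_Mem_right]]] by this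
  define rep where "rep x = (LEAST z. odd z \<and> Eq x z \<in> \<Gamma>)" for x
  have rep: "odd (rep x) \<and> Eq x (rep x) \<in> \<Gamma>" if "odd x" for x
    unfolding rep_def by (rule LeastI[of _ x]) (use that prv eq_refl in auto)
  have rep_eq: "rep x = rep y \<longleftrightarrow> Eq x y \<in> \<Gamma>" if "odd x" "odd y" for x y
  proof
    assume "Eq x y \<in> \<Gamma>"
    then have "Eq x z \<in> \<Gamma> \<longleftrightarrow> Eq y z \<in> \<Gamma>" for z using sym trans by blast
    then show "rep x = rep y" by (simp add: rep_def)
  next
    assume "rep x = rep y"
    then have "Eq x (rep y) \<in> \<Gamma>" using rep[OF that(1)] by simp
    then show "Eq x y \<in> \<Gamma>" using rep[OF that(2)] by (blast intro: trans sym)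
  qed
  define A where "A = rep ` {x. odd x}"
  define M where "M a b \<longleftrightarrow> Mem a b \<in> \<Gamma>" for a b
  have truth: "sat A M (rep \<circ> s) \<phi> \<longleftrightarrow> inst_vars s \<phi> \<in> \<Gamma>"
    if "\<And>v. odd (s v)" "\<And>v. v \<in> vars \<phi> \<Longrightarrow> even v" for s \<phi>
    using that
  proof (induction \<phi> arbitrary: s)
    case Falsum
    then show ?case using nF by simp
  next
    case (Mem x y)
    then have "Eq (s x) (rep (s x)) \<in> \<Gamma>" "Eq (s y) (rep (s y)) \<in> \<Gamma>" using rep by auto
    then have "Mem (rep (s x)) (rep (s y)) \<in> \<Gamma> \<longleftrightarrow> Mem (s x) (s y) \<in> \<Gamma>"
      using memc[of "s x" "rep (s x)" "s y" "rep (s y)"]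
        memc[of "rep (s x)" "s x" "rep (s y)" "s y"] sym[of "s x"] sym[of "s y"] by blast
    then show ?case by (simp add: M_def)
  next
    case (Eq x y)
    then show ?case by (simp add: rep_eq)
  next
    case (Imp \<phi> \<psi>)
    then show ?case by (simp add: imp)
  next
    case (Forall x \<phi>)
    have "even x" "\<And>v. v \<in> vars \<phi> \<Longrightarrow> even v" using Forall.prems by auto
    note sub = subst_inst_vars[OF this(1) _ this(2), where \<sigma> = s and \<phi> = \<phi>]
    have ff: "free_for y x (inst_vars (s(x := x)) \<phi>)" if "odd y" for y
      by (rule free_for_inst_vars) (use that Forall.prems in auto)
    have upd: "(rep \<circ> s)(x := rep y) = rep \<circ> (s(x := y))" for y by auto
    have "sat A M (rep \<circ> s) (Forall x \<phi>) \<longleftrightarrow> (\<forall>y. odd y \<longrightarrow> sat A M (rep \<circ> (s(x := y))) \<phi>)"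
      by (auto simp: A_def upd simp del: comp_apply)
    also have "\<dots> \<longleftrightarrow> (\<forall>y. odd y \<longrightarrow> inst_vars (s(x := y)) \<phi> \<in> \<Gamma>)"
    proof -
      have "sat A M (rep \<circ> (s(x := y))) \<phi> \<longleftrightarrow> inst_vars (s(x := y)) \<phi> \<in> \<Gamma>" if "odd y" for y
        by (rule Forall.IH) (use that Forall.prems in auto)
      then show ?thesis by blast
    qed
    also have "\<dots> \<longleftrightarrow> (\<forall>y. odd y \<longrightarrow> subst y x (inst_vars (s(x := x)) \<phi>) \<in> \<Gamma>)"
      using sub Forall.prems(1) by simp
    also have "\<dots> \<longleftrightarrow> Forall x (inst_vars (s(x := x)) \<phi>) \<in> \<Gamma>"
      (is "?l \<longleftrightarrow> ?r")
    proof
      assume ?r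
      then show ?l using mp[OF \<open>?r\<close> prv[OF inst[OF ff]]] by simp
    next
      assume ?l
      then show ?r using wit[of x "inst_vars (s(x := x)) \<phi>"] by blast
    qed
    finally show ?case by (simp only: inst_vars.simps)
  qed
  have "valid A M \<phi>" if "\<phi> \<in> T" for \<phi>
  proof -
    \<comment> \<open>Passing to the closure removes the mismatch between the even variables of an
      axiom and the odd ones put in their place: \<open>inst_vars\<close> leaves a sentence
      unchanged.\<close>
    let ?\<psi> = "fold Forall (sorted_list_of_set (fv \<phi>)) \<phi>"
    have "T \<turnstile> ?\<psi>" by (intro proves_fold_Forall ax that)
    moreover have "inst_vars s ?\<psi> = ?\<psi>" for s
      by (rule inst_vars_id) (simp add: fv_fold_Forall)
    ultimately have "inst_vars s ?\<psi> \<in> \<Gamma>" for s using prv by simp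
    moreover have "even v" if "v \<in> vars ?\<psi>" for v
      using that even \<open>\<phi> \<in> T\<close> fv_subset_vars by (auto simp: vars_fold_Forall)
    ultimately have *: "sat A M (rep \<circ> s) ?\<psi>" if "\<And>v. odd (s v)" for s
      using truth that by blast
    have "sat A M s ?\<psi>" if s: "range s \<subseteq> A" for s
    proof -
      from s have "\<forall>v. \<exists>x. odd x \<and> s v = rep x" by (auto simp: A_def)
      then obtain t where "\<And>v. odd (t v) \<and> s v = rep (t v)" by metis
      then have "s = rep \<circ> t" "\<And>v. odd (t v)" by auto
      with * show ?thesis by simp
    qed
    then have "valid A M ?\<psi>" by (simp add: valid_def)
    then show ?thesis by (simp add: valid_fold_Forall)
  qed
  moreover have "A \<noteq> {}" by (auto simp: A_def intro: exI[of _ 1])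
  ultimately show ?thesis by blast
qed

section \<open>Renaming all variables injectively\<close>

primrec rename :: "(nat \<Rightarrow> nat) \<Rightarrow> fm \<Rightarrow> fm" where
  "rename f Falsum = Falsum"
| "rename f (Mem x y) = Mem (f x) (f y)"
| "rename f (Eq x y) = Eq (f x) (f y)"
| "rename f (Imp \<phi> \<psi>) = Imp (rename f \<phi>) (rename f \<psi>)"
| "rename f (Forall x \<phi>) = Forall (f x) (rename f \<phi>)"

lemma vars_rename: "vars (rename f \<phi>) = f ` vars \<phi>"
  by (induction \<phi>) auto

lemma fv_rename: "inj f \<Longrightarrow> fv (rename f \<phi>) = f ` fv \<phi>"
  by (induction \<phi>) (auto simp: inj_eq)

lemma subst_rename: "inj f \<Longrightarrow> rename f (subst y x \<phi>) = subst (f y) (f x) (rename f \<phi>)"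
  by (induction \<phi>) (auto simp: inj_eq)

lemma free_for_rename: "inj f \<Longrightarrow> free_for (f y) (f x) (rename f \<phi>) = free_for y x \<phi>"
  by (induction \<phi>) (auto simp: inj_eq fv_rename)

lemma rename_rename: "rename f (rename g \<phi>) = rename (f \<circ> g) \<phi>"
  by (induction \<phi>) auto

lemma rename_id: "(\<And>v. v \<in> vars \<phi> \<Longrightarrow> f v = v) \<Longrightarrow> rename f \<phi> = \<phi>"
  by (induction \<phi>) auto

lemma proves_rename:
  assumes "inj f"
  shows "T \<turnstile> \<phi> \<Longrightarrow> rename f ` T \<turnstile> rename f \<phi>"
proof (induction rule: proves.induct)
  case (inst y x \<phi>)
  then show ?case by (simp add: subst_rename assms free_for_rename proves.inst)
next
  case (distrib x \<phi> \<psi>)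
  then have "f x \<notin> fv (rename f \<phi>)" by (simp add: fv_rename assms inj_image_mem_iff)
  then show ?case by (simp add: proves.distrib)
qed (auto intro: proves.intros)

lemma sat_rename: "inj f \<Longrightarrow> sat A E s (rename f \<phi>) = sat A E (s \<circ> f) \<phi>"
proof (induction \<phi> arbitrary: s)
  case (Forall x \<phi>)
  then have "s(f x := a) \<circ> f = (s \<circ> f)(x := a)" for a
    by (auto simp: inj_eq)
  with Forall show ?case by (simp del: fun_upd_apply comp_apply)
qed simp_all

lemma proves_mono: "T \<turnstile> \<phi> \<Longrightarrow> T \<subseteq> T' \<Longrightarrow> T' \<turnstile> \<phi>"
  by (induction rule: proves.induct) (auto intro: proves.intros)

lemma proves_finite: "T \<turnstile> \<phi> \<Longrightarrow> \<exists>T'. finite T' \<and> T' \<subseteq> T \<and> T' \<turnstile> \<phi>"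
proof (induction rule: proves.induct)
  case (ax \<phi>)
  then show ?case by (auto intro: proves.ax exI[of _ "{\<phi>}"])
next
  case (modus_ponens \<phi> \<psi>)
  then obtain U W where "finite U" "U \<subseteq> T" "U \<turnstile> \<phi>" "finite W" "W \<subseteq> T" "W \<turnstile> Imp \<phi> \<psi>" by blast
  then show ?case
    by (intro exI[of _ "U \<union> W"]) (auto intro: proves.modus_ponens[of _ \<phi>] proves_mono)
qed (blast intro: proves.intros)+

text \<open>Doubling every variable makes room for the odd ones. No injection of the numbers undoes
  doubling everywhere, but a contradiction uses finitely many axioms, and on their variables it can
  be undone.\<close>

theorem completeness:
  assumes "consistent T"
  shows "\<exists>(A :: nat set) E. A \<noteq> {} \<and> (\<forall>\<phi>\<in>T. valid A E \<phi>)"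
proof -
  let ?d = "\<lambda>n :: nat. 2 * n"
  have inj: "inj ?d" by (auto simp: inj_def)
  have "consistent (rename ?d ` T)"
  proof (rule ccontr)
    assume "\<not> consistent (rename ?d ` T)"
    then have "rename ?d ` T \<turnstile> Falsum" by (simp add: consistent_def)
    from proves_finite[OF this]
    obtain U where U: "finite U" "U \<subseteq> rename ?d ` T" "U \<turnstile> Falsum"
      by (elim exE conjE)
    then obtain W where W: "finite W" "W \<subseteq> T" "U = rename ?d ` W"
      by (meson finite_subset_image)
    obtain k where k: "\<forall>v \<in> (\<Union>\<phi>\<in>W. vars \<phi>). v < k"
      using W(1) finite_nat_set_iff_bounded[of "\<Union>\<phi>\<in>W. vars \<phi>"] by auto
    \<comment> \<open>The doubled variables of the finitely many axioms go back to their halves,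
      below \<open>k\<close>; all other numbers are moved to \<open>k\<close> or above, which keeps
      \<open>f\<close> injective.\<close>
    define f where "f n = (if even n \<and> n < 2 * k then n div 2 else n + k)" for n
    have "inj f"
      unfolding inj_def f_def by (auto elim!: evenE split: if_splits)
    then have "rename f ` U \<turnstile> rename f Falsum" using U(3) by (rule proves_rename)
    moreover have "rename f (rename ?d \<phi>) = \<phi>" if "\<phi> \<in> W" for \<phi>
      unfolding rename_rename by (rule rename_id) (use k that in \<open>auto simp: f_def\<close>)
    then have "rename f ` U = W" by (auto simp: W(3) image_image)
    ultimately have "T \<turnstile> Falsum" using proves_mono[OF _ W(2)] by simp
    with assms show False by (simp add: consistent_def)
  qed
  then have "\<exists>(A :: nat set) E. A \<noteq> {} \<and> (\<forall>\<phi>\<in>rename ?d ` T. valid A E \<phi>)"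
    by (rule even_model) (auto simp: vars_rename)
  then obtain A :: "nat set" and E where AE: "A \<noteq> {}" "\<forall>\<phi>\<in>rename ?d ` T. valid A E \<phi>"
    by (elim exE conjE)
  have "valid A E \<phi>" if "\<phi> \<in> T" for \<phi>
    unfolding valid_def
  proof (intro allI impI)
    fix s :: "nat \<Rightarrow> nat" assume s: "range s \<subseteq> A"
    have "sat A E (\<lambda>n. s (n div 2)) (rename ?d \<phi>)"
    proof -
      have "valid A E (rename ?d \<phi>)" using AE(2) that by simp
      moreover have "range (\<lambda>n. s (n div 2)) \<subseteq> A" using s by auto
      ultimately show ?thesis unfolding valid_def by simp
    qed
    then show "sat A E s \<phi>" by (simp add: sat_rename inj comp_def)
  qed
  with AE(1) show ?thesis by blast
qed

section \<open>Definable classes\<close>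

definition scons :: "'a \<Rightarrow> (nat \<Rightarrow> 'a) \<Rightarrow> nat \<Rightarrow> 'a" where
  "scons x s = case_nat x s"

lemma scons_simps [simp]: "scons x s 0 = x" "scons x s (Suc n) = s n"
  by (simp_all add: scons_def)

text \<open>Formulas in de Bruijn notation, with an extra ternary relation symbol.\<close>

datatype dfm = DFalse | DMem nat nat | DEq nat nat | DRel nat nat nat | DImp dfm dfm | DAll dfm

instance dfm :: countable by countable_datatype

primrec dsat :: "'a set \<Rightarrow> ('a \<Rightarrow> 'a \<Rightarrow> bool) \<Rightarrow> ('a \<Rightarrow> 'a \<Rightarrow> 'a \<Rightarrow> bool) \<Rightarrow> (nat \<Rightarrow> 'a) \<Rightarrow> dfm \<Rightarrow> bool" where
  "dsat A E R s DFalse \<longleftrightarrow> False"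
| "dsat A E R s (DMem i j) \<longleftrightarrow> E (s i) (s j)"
| "dsat A E R s (DEq i j) \<longleftrightarrow> s i = s j"
| "dsat A E R s (DRel i j k) \<longleftrightarrow> R (s i) (s j) (s k)"
| "dsat A E R s (DImp \<phi> \<psi>) \<longleftrightarrow> (dsat A E R s \<phi> \<longrightarrow> dsat A E R s \<psi>)"
| "dsat A E R s (DAll \<phi>) \<longleftrightarrow> (\<forall>a\<in>A. dsat A E R (scons a s) \<phi>)"

definition dlift :: "(nat \<Rightarrow> nat) \<Rightarrow> nat \<Rightarrow> nat" where
  "dlift r = case_nat 0 (\<lambda>n. Suc (r n))"

lemma scons_dlift: "(\<lambda>n. scons a s (dlift r n)) = scons a (\<lambda>n. s (r n))"
  by (auto simp: dlift_def scons_def fun_eq_iff split: nat.split)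

primrec drename :: "(nat \<Rightarrow> nat) \<Rightarrow> dfm \<Rightarrow> dfm" where
  "drename r DFalse = DFalse"
| "drename r (DMem i j) = DMem (r i) (r j)"
| "drename r (DEq i j) = DEq (r i) (r j)"
| "drename r (DRel i j k) = DRel (r i) (r j) (r k)"
| "drename r (DImp \<phi> \<psi>) = DImp (drename r \<phi>) (drename r \<psi>)"
| "drename r (DAll \<phi>) = DAll (drename (dlift r) \<phi>)"

lemma dsat_drename: "dsat A E R s (drename r \<phi>) = dsat A E R (\<lambda>n. s (r n)) \<phi>"
  by (induction \<phi> arbitrary: r s) (simp_all add: scons_dlift)

lemma dsat_finite_support:
  "\<exists>m. \<forall>A E R (s :: nat \<Rightarrow> 'a) t. (\<forall>i<m. s i = t i) \<longrightarrow> dsat A E R s \<phi> = dsat A E R t \<phi>"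
proof (induction \<phi>)
  case (DImp \<phi> \<psi>)
  then obtain m n where mn:
    "\<And>A E R (s :: nat \<Rightarrow> 'a) t. (\<forall>i<m. s i = t i) \<Longrightarrow> dsat A E R s \<phi> = dsat A E R t \<phi>"
    "\<And>A E R (s :: nat \<Rightarrow> 'a) t. (\<forall>i<n. s i = t i) \<Longrightarrow> dsat A E R s \<psi> = dsat A E R t \<psi>"
    by metis
  then have "(\<forall>i<max m n. s i = t i) \<longrightarrow> dsat A E R s (DImp \<phi> \<psi>) = dsat A E R t (DImp \<phi> \<psi>)"
    for A E R and s t :: "nat \<Rightarrow> 'a"
  proof (intro impI)
    assume *: "\<forall>i<max m n. s i = t i"
    have "dsat A E R s \<phi> = dsat A E R t \<phi>" by (rule mn(1)) (use * in simp)
    moreover have "dsat A E R s \<psi> = dsat A E R t \<psi>" by (rule mn(2)) (use * in simp)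
    ultimately show "dsat A E R s (DImp \<phi> \<psi>) = dsat A E R t (DImp \<phi> \<psi>)" by simp
  qed
  then show ?case by blast
next
  case (DAll \<phi>)
  then obtain m where
    m: "\<And>A E R (s :: nat \<Rightarrow> 'a) t. (\<forall>i<m. s i = t i) \<Longrightarrow> dsat A E R s \<phi> = dsat A E R t \<phi>"
    by metis
  have "dsat A E R (scons a s) \<phi> = dsat A E R (scons a t) \<phi>" if "\<forall>i<m. s i = t i"
    for A E R a and s t :: "nat \<Rightarrow> 'a"
    by (rule m) (use that in \<open>auto simp: scons_def split: nat.split\<close>)
  then show ?case unfolding dsat.simps by blast
next
  case DFalse
  show ?case by simp
next
  case (DMem i j)
  show ?case by (rule exI[of _ "Suc (max i j)"]) (simp add: less_Suc_eq_le)
next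
  case (DEq i j)
  show ?case by (rule exI[of _ "Suc (max i j)"]) (simp add: less_Suc_eq_le)
next
  case (DRel i j k)
  show ?case by (rule exI[of _ "Suc (max i (max j k))"]) (simp add: less_Suc_eq_le)
qed

text \<open>Definability is given semantically, as a closure of the atomic relations on assignments,
  so that it can be proved by following the shape of a HOL term; syntax is recovered only where a
  formula has to be named. \<open>Def_Par\<close> plugs a parameter into slot 0.\<close>

inductive Def :: "('a \<Rightarrow> 'a \<Rightarrow> bool) \<Rightarrow> ('a \<Rightarrow> 'a \<Rightarrow> 'a \<Rightarrow> bool) \<Rightarrow> 'a set \<Rightarrow> ((nat \<Rightarrow> 'a) \<Rightarrow> bool) \<Rightarrow> bool"
  for E R C where
  Def_False: "Def E R C (\<lambda>s. False)"
| Def_Mem: "Def E R C (\<lambda>s. E (s i) (s j))"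
| Def_Eq: "Def E R C (\<lambda>s. s i = s j)"
| Def_Rel: "Def E R C (\<lambda>s. R (s i) (s j) (s k))"
| Def_Imp: "Def E R C P \<Longrightarrow> Def E R C Q \<Longrightarrow> Def E R C (\<lambda>s. P s \<longrightarrow> Q s)"
| Def_All: "Def E R C P \<Longrightarrow> Def E R C (\<lambda>s. \<forall>x. P (scons x s))"
| Def_Par: "Def E R C P \<Longrightarrow> c \<in> C \<Longrightarrow> Def E R C (\<lambda>s. P (scons c s))"

lemma Def_rename: "Def E R C P \<Longrightarrow> Def E R C (\<lambda>s. P (\<lambda>n. s (r n)))"
proof (induction arbitrary: r rule: Def.induct)
  case (Def_All P)
  from Def.Def_All[OF Def_All.IH[of "dlift r"]] show ?case by (simp add: scons_dlift)
next
  case (Def_Par P c)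
  from Def.Def_Par[OF Def_Par.IH[of "dlift r"] Def_Par.hyps(2)] show ?case by (simp add: scons_dlift)
qed (auto intro: Def.intros)

lemma Def_imp_dsat: "Def E R {} P \<Longrightarrow> \<exists>\<phi>. \<forall>s. P s = dsat UNIV E R s \<phi>"
proof (induction rule: Def.induct)
  case Def_False
  show ?case by (rule exI[of _ DFalse]) simp
next
  case (Def_Mem i j)
  show ?case by (rule exI[of _ "DMem i j"]) simp
next
  case (Def_Eq i j)
  show ?case by (rule exI[of _ "DEq i j"]) simp
next
  case (Def_Rel i j k)
  show ?case by (rule exI[of _ "DRel i j k"]) simp
next
  case (Def_Imp P Q)
  then obtain \<phi> \<psi> where "\<forall>s. P s = dsat UNIV E R s \<phi>" "\<forall>s. Q s = dsat UNIV E R s \<psi>" by auto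
  then show ?case by (intro exI[of _ "DImp \<phi> \<psi>"]) simp
next
  case (Def_All P)
  then obtain \<phi> where "\<forall>s. P s = dsat UNIV E R s \<phi>" by auto
  then show ?case by (intro exI[of _ "DAll \<phi>"]) simp
qed simp

text \<open>Even slots carry the variables and odd slots the parameters, so that one formula without
  parameters is evaluated at both together.\<close>

definition mix :: "(nat \<Rightarrow> 'a) \<Rightarrow> (nat \<Rightarrow> 'a) \<Rightarrow> nat \<Rightarrow> 'a" where
  "mix s e n = (if even n then s (n div 2) else e (n div 2))"

lemma mix_simps [simp]: "mix s e (2 * n) = s n" "mix s e (Suc (2 * n)) = e n"
  by (simp_all add: mix_def)

text \<open>A definition uses finitely many parameters while an assignment is infinite; the element
  \<open>c0\<close> fills the slots left over.\<close>

lemma Def_imp_dsat_params: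
  assumes "Def E R C P" "c0 \<in> C"
  shows "\<exists>\<phi> e. range e \<subseteq> C \<and> (\<forall>s. P s = dsat UNIV E R (mix s e) \<phi>)"
  using assms(1)
proof (induction rule: Def.induct)
  case Def_False
  show ?case by (rule exI[of _ DFalse], rule exI[of _ "\<lambda>_. c0"]) (simp add: assms)
next
  case (Def_Mem i j)
  show ?case by (rule exI[of _ "DMem (2*i) (2*j)"], rule exI[of _ "\<lambda>_. c0"]) (simp add: assms)
next
  case (Def_Eq i j)
  show ?case by (rule exI[of _ "DEq (2*i) (2*j)"], rule exI[of _ "\<lambda>_. c0"]) (simp add: assms)
next
  case (Def_Rel i j k)
  show ?case by (rule exI[of _ "DRel (2*i) (2*j) (2*k)"], rule exI[of _ "\<lambda>_. c0"]) (simp add: assms)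
next
  case (Def_Imp P Q)
  then obtain \<phi> e \<psi> f where *: "range e \<subseteq> C" "\<And>s. P s = dsat UNIV E R (mix s e) \<phi>"
    "range f \<subseteq> C" "\<And>s. Q s = dsat UNIV E R (mix s f) \<psi>" by auto
  \<comment> \<open>The two parameter sequences are interleaved in \<open>mix e f\<close>;
    \<open>r\<close> and \<open>q\<close> redirect each formula to its own half.\<close>
  define r where "r n = (if even n then n else Suc (2 * (2 * (n div 2))))" for n :: nat
  define q where "q n = (if even n then n else Suc (2 * Suc (2 * (n div 2))))" for n :: nat
  have r: "(\<lambda>n. mix s (mix e f) (r n)) = mix s e" and q: "(\<lambda>n. mix s (mix e f) (q n)) = mix s f" for s
  proof -
    show "(\<lambda>n. mix s (mix e f) (r n)) = mix s e"
      unfolding fun_eq_iff r_def by (auto simp: mix_def elim!: oddE)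
    show "(\<lambda>n. mix s (mix e f) (q n)) = mix s f"
      unfolding fun_eq_iff q_def by (auto simp: mix_def elim!: oddE)
  qed
  have "range (mix e f) \<subseteq> C" using *(1,3) by (auto simp: mix_def)
  then show ?case
    by (intro exI[of _ "DImp (drename r \<phi>) (drename q \<psi>)"] exI[of _ "mix e f"])
      (simp add: dsat_drename r q *)
next
  case (Def_All P)
  then obtain \<phi> e where *: "range e \<subseteq> C" "\<And>s. P s = dsat UNIV E R (mix s e) \<phi>" by auto
  \<comment> \<open>Translates slots of \<open>mix (scons x s) e\<close> into slots of
    \<open>scons x (mix s e)\<close>: old variables drop by two slots and parameters keep theirs,
    and then both move up by one because \<open>x\<close> sits in front.\<close>
  define r where "r n = (if n = 0 then 0 else if even n then n - 1 else n + 1)" for n :: nat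
  have "(\<lambda>n. scons x (mix s e) (r n)) = mix (scons x s) e" for x s
  proof
    fix n
    show "scons x (mix s e) (r n) = mix (scons x s) e n"
    proof (cases "even n")
      case True
      then obtain k where "n = 2 * k" by (rule evenE)
      then show ?thesis by (cases k) (simp_all add: r_def mix_def)
    next
      case False
      then obtain k where "n = 2 * k + 1" by (rule oddE)
      then show ?thesis by (simp add: r_def)
    qed
  qed
  then show ?case using *
    by (intro exI[of _ "DAll (drename r \<phi>)"] exI[of _ e]) (simp add: dsat_drename)
next
  case (Def_Par P c)
  then obtain \<phi> e where *: "range e \<subseteq> C" "\<And>s. P s = dsat UNIV E R (mix s e) \<phi>" by auto
  \<comment> \<open>Slot 0 becomes the new first parameter at slot 1; the other variables move down
    and the old parameters up by one index, that is by two slots.\<close>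
  define r where "r n = (if n = 0 then 1 else if even n then n - 2 else n + 2)" for n :: nat
  have "(\<lambda>n. mix s (scons c e) (r n)) = mix (scons c s) e" for s
  proof
    fix n
    show "mix s (scons c e) (r n) = mix (scons c s) e n"
    proof (cases "even n")
      case True
      then obtain k where "n = 2 * k" by (rule evenE)
      then show ?thesis by (cases k) (simp_all add: r_def mix_def)
    next
      case False
      then obtain k where "n = 2 * k + 1" by (rule oddE)
      then show ?thesis by (simp add: r_def mix_def)
    qed
  qed
  moreover have "range (scons c e) \<subseteq> C"
    using * Def_Par.hyps(2) by (auto simp: scons_def image_subset_iff split: nat.split)
  ultimately show ?case using *
    by (intro exI[of _ "drename r \<phi>"] exI[of _ "scons c e"]) (simp add: dsat_drename)
qed

lemma Def_interpret:
  assumes "Def E R C P" and R: "Def E R' C (\<lambda>s. R (s 0) (s (Suc 0)) (s (Suc (Suc 0))))"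
  shows "Def E R' C P"
  using assms(1)
proof induction
  case (Def_Rel i j k)
  from Def_rename[OF R, of "case_nat i (case_nat j (\<lambda>_. k))"] show ?case by simp
qed (auto intro: Def.intros)

text \<open>Rules that build definability along the structure of a term. Every induction, separation
  and recursion inside the model carries such a side condition, since only definable classes are
  available there.\<close>

named_theorems dfi

locale rel_struct =
  fixes E :: "'u \<Rightarrow> 'u \<Rightarrow> bool" (infix \<open>\<epsilon>\<close> 50) and R :: "'u \<Rightarrow> 'u \<Rightarrow> 'u \<Rightarrow> bool"
begin

abbreviation df :: "'u set \<Rightarrow> ((nat \<Rightarrow> 'u) \<Rightarrow> bool) \<Rightarrow> bool" where
  "df \<equiv> Def (\<epsilon>) R"

text \<open>A term counts as definable if its graph is: slot 0 is the value, and the arguments are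
  shifted up by one.\<close>

definition dft :: "'u set \<Rightarrow> ((nat \<Rightarrow> 'u) \<Rightarrow> 'u) \<Rightarrow> bool" where
  "dft C t \<longleftrightarrow> df C (\<lambda>s. s 0 = t (\<lambda>n. s (Suc n)))"

lemma dft_shift: "dft C t \<Longrightarrow> dft C (\<lambda>s. t (\<lambda>n. s (Suc n)))"
  unfolding dft_def by (drule Def_rename[of _ _ _ _ "\<lambda>n. if n = 0 then 0 else Suc n"]) simp

lemma df_imp [dfi]: "df C P \<Longrightarrow> df C Q \<Longrightarrow> df C (\<lambda>s. P s \<longrightarrow> Q s)"
  by (rule Def_Imp)

lemma df_False [dfi]: "df C (\<lambda>s. False)"
  by (rule Def_False)

lemma df_not [dfi]: "df C P \<Longrightarrow> df C (\<lambda>s. \<not> P s)"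
  using df_imp[OF _ df_False] by simp

lemma df_True [dfi]: "df C (\<lambda>s. True)"
  using df_not[OF df_False] by simp

lemma df_or [dfi]: "df C P \<Longrightarrow> df C Q \<Longrightarrow> df C (\<lambda>s. P s \<or> Q s)"
  using df_imp[OF df_not[of C P], of Q] by (simp add: disj_imp)

lemma df_and [dfi]: "df C P \<Longrightarrow> df C Q \<Longrightarrow> df C (\<lambda>s. P s \<and> Q s)"
  using df_not[OF df_imp[OF _ df_not], of C P Q] by simp

lemma df_iff [dfi]: "df C P \<Longrightarrow> df C Q \<Longrightarrow> df C (\<lambda>s. P s = Q s)"
  using df_and[OF df_imp[of C P Q] df_imp[of C Q P]] by (simp add: iff_conv_conj_imp)

lemma df_all [dfi]: "df C (\<lambda>s. Q (\<lambda>n. s (Suc n)) (s 0)) \<Longrightarrow> df C (\<lambda>s. \<forall>x. Q s x)"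
  by (drule Def_All) simp

lemma df_ex [dfi]: "df C (\<lambda>s. Q (\<lambda>n. s (Suc n)) (s 0)) \<Longrightarrow> df C (\<lambda>s. \<exists>x. Q s x)"
  using df_not[OF df_all[of C "\<lambda>s x. \<not> Q s x"]] df_not by simp

lemma df_subst: "df C (\<lambda>s. Q (\<lambda>n. s (Suc n)) (s 0)) \<Longrightarrow> dft C t \<Longrightarrow> df C (\<lambda>s. Q s (t s))"
  using df_ex[OF df_and, of C "\<lambda>s x. x = t s" Q] by (simp add: dft_def)

lemma dft_var [dfi]: "dft C (\<lambda>s. s i)"
  unfolding dft_def by (rule Def_Eq)

lemma dft_par: "c \<in> C \<Longrightarrow> dft C (\<lambda>s. c)"
  unfolding dft_def using Def_Par[OF Def_Eq[of _ _ _ 1 0]] by simp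

lemmas dfp = dft_par[OF UNIV_I]

lemma df1: "df C (\<lambda>s. P (s 0)) \<Longrightarrow> dft C a \<Longrightarrow> df C (\<lambda>s. P (a s))"
  using df_subst[of C "\<lambda>s x. P x"] by simp

lemma df2: "df C (\<lambda>s. P (s 0) (s (Suc 0))) \<Longrightarrow> dft C a \<Longrightarrow> dft C b \<Longrightarrow> df C (\<lambda>s. P (a s) (b s))"
proof -
  assume *: "df C (\<lambda>s. P (s 0) (s (Suc 0)))" and a: "dft C a" and b: "dft C b"
  have "df C (\<lambda>s. P (a (\<lambda>n. s (Suc n))) (s 0))"
    by (rule df_subst[of C "\<lambda>s x. P x (s 0)"]) (use * a in \<open>auto intro: dft_shift\<close>)
  from df_subst[of C "\<lambda>s x. P (a s) x", OF this b] show ?thesis .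
qed

lemma df3: "df C (\<lambda>s. P (s 0) (s (Suc 0)) (s (Suc (Suc 0)))) \<Longrightarrow> dft C a \<Longrightarrow> dft C b \<Longrightarrow> dft C c \<Longrightarrow>
    df C (\<lambda>s. P (a s) (b s) (c s))"
proof -
  assume *: "df C (\<lambda>s. P (s 0) (s (Suc 0)) (s (Suc (Suc 0))))" and a: "dft C a" and b: "dft C b" and c: "dft C c"
  have 1: "df C (\<lambda>s. P (a (\<lambda>n. s (Suc (Suc n)))) (s 0) (s (Suc 0)))"
    by (rule df_subst[of C "\<lambda>s x. P x (s 0) (s (Suc 0))", OF *])
      (rule dft_shift[OF dft_shift[OF a]])
  have "df C (\<lambda>s. P (a (\<lambda>n. s (Suc n))) (b (\<lambda>n. s (Suc n))) (s 0))"
    by (rule df_subst[of C "\<lambda>s x. P (a (\<lambda>n. s (Suc n))) x (s 0)", OF 1]) (rule dft_shift[OF b])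
  from df_subst[of C "\<lambda>s x. P (a s) (b s) x", OF this c] show ?thesis .
qed

lemma df_mem [dfi]: "dft C a \<Longrightarrow> dft C b \<Longrightarrow> df C (\<lambda>s. a s \<epsilon> b s)"
  by (rule df2[where P = "(\<epsilon>)", OF Def_Mem])

lemma df_eq [dfi]: "dft C a \<Longrightarrow> dft C b \<Longrightarrow> df C (\<lambda>s. a s = b s)"
  by (rule df2[where P = "(=)", OF Def_Eq])

lemma df_rel [dfi]: "dft C a \<Longrightarrow> dft C b \<Longrightarrow> dft C c \<Longrightarrow> df C (\<lambda>s. R (a s) (b s) (c s))"
  by (rule df3[where P = R, OF Def_Rel])

lemma dft_subst: "dft C (\<lambda>s. f (\<lambda>n. s (Suc n)) (s 0)) \<Longrightarrow> dft C t \<Longrightarrow> dft C (\<lambda>s. f s (t s))"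
proof -
  assume f: "dft C (\<lambda>s. f (\<lambda>n. s (Suc n)) (s 0))" and t: "dft C t"
  have "df C (\<lambda>s. s (Suc 0) = f (\<lambda>n. s (Suc (Suc n))) (s 0))"
    using Def_rename[OF f[unfolded dft_def], of "\<lambda>n. if n = 0 then Suc 0 else if n = Suc 0 then 0 else n"]
    by simp
  from df_subst[of C "\<lambda>s x. s 0 = f (\<lambda>n. s (Suc n)) x", OF this dft_shift[OF t]]
  show ?thesis by (simp add: dft_def)
qed

lemma dft1: "dft C (\<lambda>s. f (s 0)) \<Longrightarrow> dft C a \<Longrightarrow> dft C (\<lambda>s. f (a s))"
  using dft_subst[of C "\<lambda>s x. f x"] by simp

lemma dft2: "dft C (\<lambda>s. f (s 0) (s (Suc 0))) \<Longrightarrow> dft C a \<Longrightarrow> dft C b \<Longrightarrow> dft C (\<lambda>s. f (a s) (b s))"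
proof -
  assume *: "dft C (\<lambda>s. f (s 0) (s (Suc 0)))" and a: "dft C a" and b: "dft C b"
  have "dft C (\<lambda>s. f (a (\<lambda>n. s (Suc n))) (s 0))"
    by (rule dft_subst[of C "\<lambda>s x. f x (s 0)", OF *]) (rule dft_shift[OF a])
  from dft_subst[of C "\<lambda>s x. f (a s) x", OF this b] show ?thesis .
qed

lemma dft3: "dft C (\<lambda>s. f (s 0) (s (Suc 0)) (s (Suc (Suc 0)))) \<Longrightarrow> dft C a \<Longrightarrow> dft C b \<Longrightarrow> dft C c \<Longrightarrow>
    dft C (\<lambda>s. f (a s) (b s) (c s))"
proof -
  assume *: "dft C (\<lambda>s. f (s 0) (s (Suc 0)) (s (Suc (Suc 0))))" and a: "dft C a" and b: "dft C b" and c: "dft C c"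
  have 1: "dft C (\<lambda>s. f (a (\<lambda>n. s (Suc (Suc n)))) (s 0) (s (Suc 0)))"
    by (rule dft_subst[of C "\<lambda>s x. f x (s 0) (s (Suc 0))", OF *])
      (rule dft_shift[OF dft_shift[OF a]])
  have "dft C (\<lambda>s. f (a (\<lambda>n. s (Suc n))) (b (\<lambda>n. s (Suc n))) (s 0))"
    by (rule dft_subst[of C "\<lambda>s x. f (a (\<lambda>n. s (Suc n))) x (s 0)", OF 1]) (rule dft_shift[OF b])
  from dft_subst[of C "\<lambda>s x. f (a s) (b s) x", OF this c] show ?thesis .
qed

lemma df_finite_all: "finite I \<Longrightarrow> (\<And>i. i \<in> I \<Longrightarrow> df C (P i)) \<Longrightarrow> df C (\<lambda>s. \<forall>i\<in>I. P i s)"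
  by (induction I rule: finite_induct) (auto intro: dfi)

lemma df_finite_ex: "finite I \<Longrightarrow> (\<And>i. i \<in> I \<Longrightarrow> df C (P i)) \<Longrightarrow> df C (\<lambda>s. \<exists>i\<in>I. P i s)"
  by (induction I rule: finite_induct) (auto intro: dfi)

text \<open>The formula is fixed outside of the model, so its satisfaction over a definable class
  unwinds into one definable property, by recursion on the formula; no truth definition inside the
  model is involved. The class \<open>W\<close>, the relation \<open>Q\<close> and the assignment
  \<open>t\<close> may depend on the variables.\<close>

lemma df_dsat:
  assumes "df C (\<lambda>s. W (\<lambda>n. s (Suc n)) (s 0))"
    and "df C (\<lambda>s. Q (\<lambda>n. s (Suc (Suc (Suc n)))) (s 0) (s (Suc 0)) (s (Suc (Suc 0))))"
    and "\<And>n. dft C (\<lambda>s. t s n)"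
  shows "df C (\<lambda>s. dsat {x. W s x} (\<epsilon>) (Q s) (t s) \<phi>)"
  using assms
proof (induction \<phi> arbitrary: W Q t)
  case (DRel i j k)
  have "df C (\<lambda>s. Q (\<lambda>n. s (Suc (Suc n))) (t (\<lambda>n. s (Suc (Suc n))) i) (s 0) (s (Suc 0)))"
    by (rule df_subst[of C "\<lambda>s x. Q (\<lambda>n. s (Suc (Suc n))) x (s 0) (s (Suc 0))", OF DRel(2)])
      (rule dft_shift[OF dft_shift[OF DRel(3)]])
  then have "df C (\<lambda>s. Q (\<lambda>n. s (Suc n)) (t (\<lambda>n. s (Suc n)) i) (t (\<lambda>n. s (Suc n)) j) (s 0))"
    by (rule df_subst[of C "\<lambda>s x. Q (\<lambda>n. s (Suc n)) (t (\<lambda>n. s (Suc n)) i) x (s 0)"])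
      (rule dft_shift[OF DRel(3)])
  from df_subst[of C "\<lambda>s x. Q s (t s i) (t s j) x", OF this DRel(3)] show ?case by simp
next
  case (DAll \<phi>)
  have "df C (\<lambda>s. dsat {x. W (\<lambda>n. s (Suc n)) x} (\<epsilon>) (Q (\<lambda>n. s (Suc n))) (scons (s 0) (t (\<lambda>n. s (Suc n)))) \<phi>)"
  proof (rule DAll.IH)
    show "df C (\<lambda>s. W (\<lambda>n. s (Suc (Suc n))) (s 0))"
      using Def_rename[OF DAll.prems(1), of "case_nat 0 (\<lambda>n. Suc (Suc n))"] by simp
    show "df C (\<lambda>s. Q (\<lambda>n. s (Suc (Suc (Suc (Suc n))))) (s 0) (s (Suc 0)) (s (Suc (Suc 0))))"
      using Def_rename[OF DAll.prems(2), of "\<lambda>n. if n < 3 then n else Suc n"] by simp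
    show "dft C (\<lambda>s. scons (s 0) (t (\<lambda>n. s (Suc n))) n)" for n
      by (cases n) (auto intro: dfi dft_shift DAll.prems(3))
  qed
  with DAll.prems(1) have "df C (\<lambda>s. W (\<lambda>n. s (Suc n)) (s 0) \<longrightarrow>
      dsat {x. W (\<lambda>n. s (Suc n)) x} (\<epsilon>) (Q (\<lambda>n. s (Suc n))) (scons (s 0) (t (\<lambda>n. s (Suc n)))) \<phi>)"
    by (rule df_imp)
  then show ?case by (simp, intro df_all)
qed (auto intro: dfi)

lemma df_sat:
  assumes "df C (\<lambda>s. W (\<lambda>n. s (Suc n)) (s 0))" and "\<And>n. dft C (\<lambda>s. t s n)"
  shows "df C (\<lambda>s. sat {x. W s x} (\<epsilon>) (t s) \<phi>)"
  using assms
proof (induction \<phi> arbitrary: W t)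
  case (Forall v \<phi>)
  have "df C (\<lambda>s. sat {x. W (\<lambda>n. s (Suc n)) x} (\<epsilon>) ((t (\<lambda>n. s (Suc n)))(v := s 0)) \<phi>)"
  proof (rule Forall.IH)
    show "df C (\<lambda>s. W (\<lambda>n. s (Suc (Suc n))) (s 0))"
      using Def_rename[OF Forall.prems(1), of "case_nat 0 (\<lambda>n. Suc (Suc n))"] by simp
    show "dft C (\<lambda>s. ((t (\<lambda>n. s (Suc n)))(v := s 0)) n)" for n
      by (cases "n = v") (auto intro: dfi dft_shift Forall.prems(2))
  qed
  with Forall.prems(1) have "df C (\<lambda>s. W (\<lambda>n. s (Suc n)) (s 0) \<longrightarrow>
      sat {x. W (\<lambda>n. s (Suc n)) x} (\<epsilon>) ((t (\<lambda>n. s (Suc n)))(v := s 0)) \<phi>)"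
    by (rule df_imp)
  then show ?case by (simp del: fun_upd_apply, intro df_all)
qed (auto intro: dfi)

end

section \<open>Set theory inside a model\<close>

context rel_struct
begin

lemma dft_ren: "dft C t \<Longrightarrow> dft C (\<lambda>s. t (\<lambda>n. s (r n)))"
  unfolding dft_def
  using Def_rename[of "(\<epsilon>)" R C "\<lambda>s. s 0 = t (\<lambda>n. s (Suc n))" "case_nat 0 (\<lambda>n. Suc (r n))"] by simp

lemma df_ren: "df C P \<Longrightarrow> df C (\<lambda>s. P (\<lambda>n. s (r n)))"
  by (rule Def_rename)

lemma df_ren1: "df C (\<lambda>s. P (\<lambda>n. s (Suc n)) (s 0)) \<Longrightarrow> df C (\<lambda>s. P (\<lambda>n. s (r n)) (s i))"
  using Def_rename[of "(\<epsilon>)" R C "\<lambda>s. P (\<lambda>n. s (Suc n)) (s 0)" "case_nat i r"] by simp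

lemma dft_ren1: "dft C (\<lambda>s. g (\<lambda>n. s (Suc n)) (s 0)) \<Longrightarrow> dft C (\<lambda>s. g (\<lambda>n. s (r n)) (s i))"
  using dft_ren[of C "\<lambda>s. g (\<lambda>n. s (Suc n)) (s 0)" "case_nat i r"] by simp

lemma dft_ren2: "dft C (\<lambda>s. g (\<lambda>n. s (Suc (Suc n))) (s (Suc 0)) (s 0)) \<Longrightarrow>
    dft C (\<lambda>s. g (\<lambda>n. s (r n)) (s i) (s j))"
  using dft_ren[of C "\<lambda>s. g (\<lambda>n. s (Suc (Suc n))) (s (Suc 0)) (s 0)" "case_nat j (case_nat i r)"] by simp

definition sub :: "'u \<Rightarrow> 'u \<Rightarrow> bool" where
  "sub x y \<longleftrightarrow> (\<forall>z. z \<epsilon> x \<longrightarrow> z \<epsilon> y)"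

lemma df_sub [dfi]: "dft C a \<Longrightarrow> dft C b \<Longrightarrow> df C (\<lambda>s. sub (a s) (b s))"
  by (rule df2[of C sub]) (unfold sub_def, intro dfi)

lemma subI: "(\<And>z. z \<epsilon> x \<Longrightarrow> z \<epsilon> y) \<Longrightarrow> sub x y" and subD: "sub x y \<Longrightarrow> z \<epsilon> x \<Longrightarrow> z \<epsilon> y"
  by (auto simp: sub_def)

lemma sub_refl [simp]: "sub x x" by (simp add: sub_def)

end

text \<open>The schemas range over everything definable from \<epsilon> and the extra relation
  \<open>R\<close>, with arbitrary parameters. Having them for \<open>R\<close> as well is what
  later permits recursion and reflection about definability itself.\<close>

locale zf = rel_struct E R for E :: "'u \<Rightarrow> 'u \<Rightarrow> bool" (infix \<open>\<epsilon>\<close> 50) and R :: "'u \<Rightarrow> 'u \<Rightarrow> 'u \<Rightarrow> bool" +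
  assumes extensional: "(\<And>z. z \<epsilon> x \<longleftrightarrow> z \<epsilon> y) \<Longrightarrow> x = y"
    and founded: "y \<epsilon> x \<Longrightarrow> \<exists>y. y \<epsilon> x \<and> (\<forall>z. z \<epsilon> x \<longrightarrow> \<not> z \<epsilon> y)"
    and pairs: "\<exists>u. \<forall>z. z \<epsilon> u \<longleftrightarrow> z = x \<or> z = y"
    and unions: "\<exists>u. \<forall>z. z \<epsilon> u \<longleftrightarrow> (\<exists>y. y \<epsilon> x \<and> z \<epsilon> y)"
    and powers: "\<exists>u. \<forall>z. z \<epsilon> u \<longleftrightarrow> (\<forall>w. w \<epsilon> z \<longrightarrow> w \<epsilon> x)"
    and infinite: "\<exists>x. (\<exists>e. (\<forall>z. \<not> z \<epsilon> e) \<and> e \<epsilon> x) \<and>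
      (\<forall>y. y \<epsilon> x \<longrightarrow> (\<exists>s. (\<forall>z. z \<epsilon> s \<longleftrightarrow> z \<epsilon> y \<or> z = y) \<and> s \<epsilon> x))"
    and separate: "df UNIV (\<lambda>s. P (s 0)) \<Longrightarrow> \<exists>b. \<forall>x. x \<epsilon> b \<longleftrightarrow> x \<epsilon> a \<and> P x"
    and replace: "df UNIV (\<lambda>s. Q (s 0) (s (Suc 0))) \<Longrightarrow> (\<And>x. x \<epsilon> a \<Longrightarrow> \<exists>!y. Q x y) \<Longrightarrow>
      \<exists>b. \<forall>y. y \<epsilon> b \<longleftrightarrow> (\<exists>x. x \<epsilon> a \<and> Q x y)"
begin

section \<open>Definite descriptions and the basic set operations\<close>

definition emp :: 'u where "emp = (THE e. \<forall>z. \<not> z \<epsilon> e)"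

lemma emp_unique: "(\<forall>z. \<not> z \<epsilon> x) \<longleftrightarrow> x = emp"
proof -
  obtain e where e: "\<forall>z. \<not> z \<epsilon> e" using infinite by blast
  have "emp = e" unfolding emp_def
  proof (rule the_equality)
    show "\<forall>z. \<not> z \<epsilon> e" by (rule e)
    fix e' assume "\<forall>z. \<not> z \<epsilon> e'"
    with e show "e' = e" by (intro extensional) simp
  qed
  show ?thesis
  proof
    assume "\<forall>z. \<not> z \<epsilon> x"
    then show "x = emp" using e \<open>emp = e\<close> by (intro extensional) simp
  qed (use e \<open>emp = e\<close> in simp)
qed

lemma not_mem_emp [simp]: "\<not> z \<epsilon> emp"
  using emp_unique[of emp] by simp

lemma mem_nonemp: "z \<epsilon> x \<Longrightarrow> x \<noteq> emp" by auto

lemma nonemp_iff: "x \<noteq> emp \<longleftrightarrow> (\<exists>z. z \<epsilon> x)"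
  using emp_unique[of x] by blast

lemma dft_emp [dfi]: "dft C (\<lambda>s. emp)"
  unfolding dft_def emp_unique[symmetric] by (intro dfi)

text \<open>The default \<open>emp\<close> makes every description a total definable term;
  application outside of a domain and comprehensions that form no set thus denote the empty
  set.\<close>

definition iota :: "('u \<Rightarrow> bool) \<Rightarrow> 'u" where
  "iota P = (if \<exists>!x. P x then THE x. P x else emp)"

lemma iota_eq: "P x \<Longrightarrow> (\<And>y. P y \<Longrightarrow> y = x) \<Longrightarrow> iota P = x"
proof -
  assume *: "P x" "\<And>y. P y \<Longrightarrow> y = x"
  then have "\<exists>!x. P x" by (rule ex1I)
  moreover have "(THE x. P x) = x" using * by (rule the_equality)
  ultimately show ?thesis by (simp only: iota_def if_True)
qed

lemma iota_prop: "P x \<Longrightarrow> (\<And>y. P y \<Longrightarrow> y = x) \<Longrightarrow> P (iota P)"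
  by (subst iota_eq[of P x]) assumption+

lemma dft_iota [dfi]:
  assumes "df C (\<lambda>s. Q (\<lambda>n. s (Suc n)) (s 0))"
  shows "dft C (\<lambda>s. iota (Q s))"
proof -
  have *: "y = iota P \<longleftrightarrow> (P y \<and> (\<forall>z. P z \<longrightarrow> z = y)) \<or> (\<not> (\<exists>x. P x \<and> (\<forall>z. P z \<longrightarrow> z = x)) \<and> y = emp)"
    for P y
  proof (cases "\<exists>x. P x \<and> (\<forall>z. P z \<longrightarrow> z = x)")
    case True
    then obtain x where x: "P x" "\<And>z. P z \<Longrightarrow> z = x" by blast
    have "iota P = x" by (rule iota_eq[of P, OF x])
    with x show ?thesis by blast
  next
    case False
    then have "\<not> (\<exists>!x. P x)" by blast
    then show ?thesis using False by (auto simp: iota_def)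
  qed
  show ?thesis unfolding dft_def * by (intro dfi df_ren1[OF assms])
qed

definition setof :: "('u \<Rightarrow> bool) \<Rightarrow> 'u" where
  "setof P = iota (\<lambda>b. \<forall>x. x \<epsilon> b \<longleftrightarrow> P x)"

lemma dft_setof [dfi]: "df C (\<lambda>s. Q (\<lambda>n. s (Suc n)) (s 0)) \<Longrightarrow> dft C (\<lambda>s. setof (Q s))"
proof -
  assume Q: "df C (\<lambda>s. Q (\<lambda>n. s (Suc n)) (s 0))"
  show ?thesis unfolding setof_def by (intro dfi df_ren1[OF Q])
qed

definition isset :: "('u \<Rightarrow> bool) \<Rightarrow> bool" where
  "isset P \<longleftrightarrow> (\<exists>b. \<forall>x. x \<epsilon> b \<longleftrightarrow> P x)"

lemma mem_setof: "isset P \<Longrightarrow> x \<epsilon> setof P \<longleftrightarrow> P x"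
proof -
  assume "isset P"
  then obtain b where b: "\<forall>x. x \<epsilon> b \<longleftrightarrow> P x" by (auto simp: isset_def)
  have "\<forall>x. x \<epsilon> setof P \<longleftrightarrow> P x" unfolding setof_def
    by (rule iota_prop[of "\<lambda>b. \<forall>x. x \<epsilon> b \<longleftrightarrow> P x", OF b]) (use b in \<open>auto intro: extensional\<close>)
  then show ?thesis by simp
qed

lemma setof_eq: "(\<And>x. x \<epsilon> b \<longleftrightarrow> P x) \<Longrightarrow> setof P = b"
  by (rule extensional, subst mem_setof) (auto simp: isset_def)

lemma isset_sub: "df UNIV (\<lambda>s. P (s 0)) \<Longrightarrow> (\<And>x. P x \<Longrightarrow> x \<epsilon> a) \<Longrightarrow> isset P"
  using separate[of P a] unfolding isset_def by metis

definition upr :: "'u \<Rightarrow> 'u \<Rightarrow> 'u" where "upr x y = setof (\<lambda>z. z = x \<or> z = y)"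
definition un :: "'u \<Rightarrow> 'u" where "un x = setof (\<lambda>z. \<exists>y. y \<epsilon> x \<and> z \<epsilon> y)"
definition pw :: "'u \<Rightarrow> 'u" where "pw x = setof (\<lambda>z. sub z x)"
definition sep :: "'u \<Rightarrow> ('u \<Rightarrow> bool) \<Rightarrow> 'u" where "sep a P = setof (\<lambda>x. x \<epsilon> a \<and> P x)"
definition repl :: "'u \<Rightarrow> ('u \<Rightarrow> 'u) \<Rightarrow> 'u" where "repl a f = setof (\<lambda>y. \<exists>x. x \<epsilon> a \<and> y = f x)"

lemma mem_upr [simp]: "z \<epsilon> upr x y \<longleftrightarrow> z = x \<or> z = y"
  unfolding upr_def by (rule mem_setof) (simp add: isset_def pairs)

lemma mem_un [simp]: "z \<epsilon> un x \<longleftrightarrow> (\<exists>y. y \<epsilon> x \<and> z \<epsilon> y)"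
  unfolding un_def by (rule mem_setof) (simp add: isset_def unions)

lemma mem_pw [simp]: "z \<epsilon> pw x \<longleftrightarrow> sub z x"
  unfolding pw_def by (rule mem_setof) (simp add: isset_def powers sub_def)

lemma mem_sep: "df UNIV (\<lambda>s. P (s 0)) \<Longrightarrow> x \<epsilon> sep a P \<longleftrightarrow> x \<epsilon> a \<and> P x"
  unfolding sep_def by (rule mem_setof) (simp add: isset_def separate)

lemma mem_repl: "dft UNIV (\<lambda>s. f (s 0)) \<Longrightarrow> y \<epsilon> repl a f \<longleftrightarrow> (\<exists>x. x \<epsilon> a \<and> y = f x)"
  unfolding repl_def
proof (rule mem_setof)
  assume f: "dft UNIV (\<lambda>s. f (s 0))"
  have "\<exists>b. \<forall>y. y \<epsilon> b \<longleftrightarrow> (\<exists>x. x \<epsilon> a \<and> y = f x)"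
    by (rule replace) (intro dfi dft1[OF f], auto)
  then show "isset (\<lambda>y. \<exists>x. x \<epsilon> a \<and> y = f x)" by (simp add: isset_def)
qed

lemma dft_upr [dfi]: "dft C a \<Longrightarrow> dft C b \<Longrightarrow> dft C (\<lambda>s. upr (a s) (b s))"
  by (rule dft2[of C upr]) (unfold upr_def, intro dfi)

lemma dft_un [dfi]: "dft C a \<Longrightarrow> dft C (\<lambda>s. un (a s))"
  by (rule dft1[of C un]) (unfold un_def, intro dfi)

lemma dft_pw [dfi]: "dft C a \<Longrightarrow> dft C (\<lambda>s. pw (a s))"
  by (rule dft1[of C pw]) (unfold pw_def, intro dfi)

lemma dft_sep [dfi]: "dft C a \<Longrightarrow> df C (\<lambda>s. P (\<lambda>n. s (Suc n)) (s 0)) \<Longrightarrow> dft C (\<lambda>s. sep (a s) (P s))"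
proof -
  assume a: "dft C a" and P: "df C (\<lambda>s. P (\<lambda>n. s (Suc n)) (s 0))"
  show ?thesis unfolding sep_def by (intro dfi dft_ren[OF a] P)
qed

lemma dft_repl [dfi]: "dft C a \<Longrightarrow> dft C (\<lambda>s. f (\<lambda>n. s (Suc n)) (s 0)) \<Longrightarrow> dft C (\<lambda>s. repl (a s) (f s))"
proof -
  assume a: "dft C a" and f: "dft C (\<lambda>s. f (\<lambda>n. s (Suc n)) (s 0))"
  show ?thesis unfolding repl_def by (intro dfi dft_ren[OF a] dft_ren1[OF f])
qed

definition cup :: "'u \<Rightarrow> 'u \<Rightarrow> 'u" where "cup x y = un (upr x y)"
definition suc :: "'u \<Rightarrow> 'u" where "suc x = cup x (upr x x)"
definition prd :: "'u \<Rightarrow> 'u \<Rightarrow> 'u" where "prd x y = upr (upr x x) (upr x y)"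
definition app :: "'u \<Rightarrow> 'u \<Rightarrow> 'u" where "app f x = iota (\<lambda>y. prd x y \<epsilon> f)"
definition pfst :: "'u \<Rightarrow> 'u" where "pfst p = iota (\<lambda>x. \<exists>y. p = prd x y)"
definition psnd :: "'u \<Rightarrow> 'u" where "psnd p = iota (\<lambda>y. \<exists>x. p = prd x y)"
definition lam :: "'u \<Rightarrow> ('u \<Rightarrow> 'u) \<Rightarrow> 'u" where "lam a f = repl a (\<lambda>x. prd x (f x))"
definition cart :: "'u \<Rightarrow> 'u \<Rightarrow> 'u" where "cart a b = setof (\<lambda>p. \<exists>x y. x \<epsilon> a \<and> y \<epsilon> b \<and> p = prd x y)"

lemma dft_cup [dfi]: "dft C a \<Longrightarrow> dft C b \<Longrightarrow> dft C (\<lambda>s. cup (a s) (b s))"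
  unfolding cup_def by (intro dfi)

lemma dft_suc [dfi]: "dft C a \<Longrightarrow> dft C (\<lambda>s. suc (a s))"
  unfolding suc_def by (intro dfi)

lemma dft_prd [dfi]: "dft C a \<Longrightarrow> dft C b \<Longrightarrow> dft C (\<lambda>s. prd (a s) (b s))"
  unfolding prd_def by (intro dfi)

lemma dft_app [dfi]: "dft C a \<Longrightarrow> dft C b \<Longrightarrow> dft C (\<lambda>s. app (a s) (b s))"
  by (rule dft2[of C app]) (unfold app_def, intro dfi)

lemma dft_pfst [dfi]: "dft C a \<Longrightarrow> dft C (\<lambda>s. pfst (a s))"
  by (rule dft1[of C pfst]) (unfold pfst_def, intro dfi)

lemma dft_psnd [dfi]: "dft C a \<Longrightarrow> dft C (\<lambda>s. psnd (a s))"
  by (rule dft1[of C psnd]) (unfold psnd_def, intro dfi)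

lemma dft_lam [dfi]: "dft C a \<Longrightarrow> dft C (\<lambda>s. f (\<lambda>n. s (Suc n)) (s 0)) \<Longrightarrow> dft C (\<lambda>s. lam (a s) (f s))"
  unfolding lam_def by (intro dfi)

lemma dft_cart [dfi]: "dft C a \<Longrightarrow> dft C b \<Longrightarrow> dft C (\<lambda>s. cart (a s) (b s))"
  by (rule dft2[of C cart]) (unfold cart_def, intro dfi)

lemma dft_if [dfi]: "df C P \<Longrightarrow> dft C a \<Longrightarrow> dft C b \<Longrightarrow> dft C (\<lambda>s. if P s then a s else b s)"
proof -
  assume P: "df C P" and a: "dft C a" and b: "dft C b"
  have *: "y = (if p then u else v) \<longleftrightarrow> (p \<and> y = u) \<or> (\<not> p \<and> y = v)" for p and y u v :: 'u by auto
  show ?thesis unfolding dft_def * by (intro dfi df_ren[OF P] dft_ren[OF a] dft_ren[OF b])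
qed

lemma mem_cup [simp]: "z \<epsilon> cup x y \<longleftrightarrow> z \<epsilon> x \<or> z \<epsilon> y"
  by (auto simp: cup_def)

lemma mem_suc [simp]: "z \<epsilon> suc x \<longleftrightarrow> z \<epsilon> x \<or> z = x"
  by (simp add: suc_def)

lemma suc_nonemp [simp]: "suc x \<noteq> emp" "emp \<noteq> suc x"
  using mem_nonemp[of x "suc x"] by auto

lemma upr_eq: "upr a b = upr c d \<longleftrightarrow> (a = c \<and> b = d) \<or> (a = d \<and> b = c)"
proof
  assume "upr a b = upr c d"
  then have "\<And>z. z = a \<or> z = b \<longleftrightarrow> z = c \<or> z = d" using mem_upr by metis
  then show "(a = c \<and> b = d) \<or> (a = d \<and> b = c)" by metis
qed (auto intro: extensional)

lemma prd_inject [simp]: "prd a b = prd c d \<longleftrightarrow> a = c \<and> b = d"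
  by (auto simp: prd_def upr_eq)

lemma pfst_prd [simp]: "pfst (prd x y) = x"
  unfolding pfst_def by (rule iota_eq) auto

lemma psnd_prd [simp]: "psnd (prd x y) = y"
  unfolding psnd_def by (rule iota_eq) auto

lemma mem_cart [simp]: "p \<epsilon> cart a b \<longleftrightarrow> (\<exists>x y. x \<epsilon> a \<and> y \<epsilon> b \<and> p = prd x y)"
  unfolding cart_def
proof (rule mem_setof, rule isset_sub)
  show "df UNIV (\<lambda>s. \<exists>x y. x \<epsilon> a \<and> y \<epsilon> b \<and> s 0 = prd x y)" by (intro dfi dfp)
  show "p \<epsilon> pw (pw (cup a b))" if "\<exists>x y. x \<epsilon> a \<and> y \<epsilon> b \<and> p = prd x y" for p
    using that by (auto simp: prd_def sub_def)
qed

lemma app_eq: "prd x y \<epsilon> f \<Longrightarrow> (\<And>z. prd x z \<epsilon> f \<Longrightarrow> z = y) \<Longrightarrow> app f x = y"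
  unfolding app_def by (rule iota_eq)

lemma mem_lam: "dft UNIV (\<lambda>s. f (s 0)) \<Longrightarrow> p \<epsilon> lam a f \<longleftrightarrow> (\<exists>x. x \<epsilon> a \<and> p = prd x (f x))"
  unfolding lam_def by (rule mem_repl) (intro dfi)

lemma prd_mem_lam: "dft UNIV (\<lambda>s. f (s 0)) \<Longrightarrow> prd x y \<epsilon> lam a f \<longleftrightarrow> x \<epsilon> a \<and> y = f x"
  by (auto simp: mem_lam)

lemma app_lam: "dft UNIV (\<lambda>s. f (s 0)) \<Longrightarrow> x \<epsilon> a \<Longrightarrow> app (lam a f) x = f x"
  by (rule app_eq) (simp_all add: prd_mem_lam)

lemma not_mem_self [simp]: "\<not> x \<epsilon> x"
  using founded[of x "upr x x"] by auto

lemma mem_asym: "x \<epsilon> y \<Longrightarrow> \<not> y \<epsilon> x"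
  using founded[of x "upr x y"] by auto

lemma suc_inject [simp]: "suc x = suc y \<longleftrightarrow> x = y"
proof
  assume "suc x = suc y"
  then have "x \<epsilon> suc y" "y \<epsilon> suc x" using mem_suc[of x x] mem_suc[of y y] by simp_all
  then show "x = y" using mem_asym by auto
qed simp

subsection \<open>Natural numbers\<close>

definition succ_closed :: "'u \<Rightarrow> bool" where
  "succ_closed I \<longleftrightarrow> emp \<epsilon> I \<and> (\<forall>y. y \<epsilon> I \<longrightarrow> suc y \<epsilon> I)"

definition om :: 'u where "om = setof (\<lambda>n. \<forall>I. succ_closed I \<longrightarrow> n \<epsilon> I)"

lemma df_succ_closed [dfi]: "dft C a \<Longrightarrow> df C (\<lambda>s. succ_closed (a s))"
  by (rule df1[of C succ_closed]) (unfold succ_closed_def, intro dfi)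

lemma dft_om [dfi]: "dft C (\<lambda>s. om)"
  unfolding om_def by (intro dfi)

lemma mem_om: "n \<epsilon> om \<longleftrightarrow> (\<forall>I. succ_closed I \<longrightarrow> n \<epsilon> I)"
proof -
  obtain x where x: "\<exists>e. (\<forall>z. \<not> z \<epsilon> e) \<and> e \<epsilon> x"
    "\<And>y. y \<epsilon> x \<Longrightarrow> \<exists>s. (\<forall>z. z \<epsilon> s \<longleftrightarrow> z \<epsilon> y \<or> z = y) \<and> s \<epsilon> x"
    using infinite by blast
  have "succ_closed x" unfolding succ_closed_def
  proof (intro conjI allI impI)
    show "emp \<epsilon> x" using x(1) by (simp add: emp_unique)
    fix y assume "y \<epsilon> x"
    from x(2)[OF this] obtain t where t: "\<forall>z. z \<epsilon> t \<longleftrightarrow> z \<epsilon> y \<or> z = y" "t \<epsilon> x" by blast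
    have "t = suc y" by (rule extensional) (simp add: t)
    with t show "suc y \<epsilon> x" by simp
  qed
  then have "isset (\<lambda>n. \<forall>I. succ_closed I \<longrightarrow> n \<epsilon> I)"
    by (intro isset_sub[where a = x]) (intro dfi, blast)
  then show ?thesis unfolding om_def by (rule mem_setof)
qed

lemma emp_om [simp]: "emp \<epsilon> om" and suc_om [simp]: "n \<epsilon> om \<Longrightarrow> suc n \<epsilon> om"
  by (auto simp: mem_om succ_closed_def)

lemma om_induct:
  assumes "df UNIV (\<lambda>s. P (s 0))" and n: "n \<epsilon> om" and "P emp"
    and "\<And>n. n \<epsilon> om \<Longrightarrow> P n \<Longrightarrow> P (suc n)"
  shows "P n"
proof -
  have "succ_closed (sep om P)"
    using assms(3,4) by (simp add: succ_closed_def mem_sep[OF assms(1)])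
  with n have "n \<epsilon> sep om P" by (simp add: mem_om)
  then show ?thesis by (simp add: mem_sep[OF assms(1)])
qed

lemma om_cases: "n \<epsilon> om \<Longrightarrow> n = emp \<or> (\<exists>m. m \<epsilon> om \<and> n = suc m)"
  by (rule om_induct[where P = "\<lambda>n. n = emp \<or> (\<exists>m. m \<epsilon> om \<and> n = suc m)"]) (intro dfi, auto)

text \<open>An approximation to the recursion, closed under predecessors: each pair is the initial
  one or comes from an earlier pair. Functionality is not built in; it follows by induction on the
  argument.\<close>

definition wgood :: "('u \<Rightarrow> 'u \<Rightarrow> 'u) \<Rightarrow> 'u \<Rightarrow> 'u \<Rightarrow> bool" where
  "wgood g a r \<longleftrightarrow> (\<forall>p. p \<epsilon> r \<longrightarrow> p = prd emp a \<or>
     (\<exists>i z. i \<epsilon> om \<and> p = prd (suc i) (g i z) \<and> prd i z \<epsilon> r))"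

definition wrel :: "('u \<Rightarrow> 'u \<Rightarrow> 'u) \<Rightarrow> 'u \<Rightarrow> 'u \<Rightarrow> 'u \<Rightarrow> bool" where
  "wrel g a n y \<longleftrightarrow> (\<exists>r. wgood g a r \<and> prd n y \<epsilon> r)"

definition wrec :: "('u \<Rightarrow> 'u \<Rightarrow> 'u) \<Rightarrow> 'u \<Rightarrow> 'u \<Rightarrow> 'u" where
  "wrec g a n = iota (wrel g a n)"

lemma df_wrel:
  assumes g: "dft C (\<lambda>s. g (\<lambda>n. s (Suc (Suc n))) (s (Suc 0)) (s 0))" and a: "dft C a" and n: "dft C n" and y: "dft C y"
  shows "df C (\<lambda>s. wrel (g s) (a s) (n s) (y s))"
  unfolding wrel_def wgood_def
  by (intro dfi dft_ren2[OF g] dft_ren[OF a] dft_ren[OF n] dft_ren[OF y])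

lemma dft_wrec [dfi]:
  assumes g: "dft C (\<lambda>s. g (\<lambda>n. s (Suc (Suc n))) (s (Suc 0)) (s 0))" and a: "dft C a" and n: "dft C n"
  shows "dft C (\<lambda>s. wrec (g s) (a s) (n s))"
  unfolding wrec_def by (intro dfi df_wrel dft_ren2[OF g] dft_ren[OF a] dft_ren[OF n])

context
  fixes g :: "'u \<Rightarrow> 'u \<Rightarrow> 'u" and a :: 'u
  assumes g: "dft UNIV (\<lambda>s. g (s (Suc 0)) (s 0))"
begin

lemma wrel_emp: "wrel g a emp y \<longleftrightarrow> y = a"
proof
  assume "wrel g a emp y"
  then show "y = a" by (auto simp: wrel_def wgood_def)
next
  assume "y = a"
  then show "wrel g a emp y"
    unfolding wrel_def wgood_def by (intro exI[of _ "upr (prd emp a) (prd emp a)"]) simp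
qed

lemma wrel_suc: "n \<epsilon> om \<Longrightarrow> wrel g a (suc n) y \<longleftrightarrow> (\<exists>z. wrel g a n z \<and> y = g n z)"
proof
  assume "wrel g a (suc n) y"
  then obtain r where r: "wgood g a r" "prd (suc n) y \<epsilon> r" by (auto simp: wrel_def)
  from r(1)[unfolded wgood_def, rule_format, OF r(2)]
  obtain z where "y = g n z" "prd n z \<epsilon> r" by auto
  with r(1) show "\<exists>z. wrel g a n z \<and> y = g n z" by (auto simp: wrel_def)
next
  assume n: "n \<epsilon> om" and "\<exists>z. wrel g a n z \<and> y = g n z"
  then obtain z r where y: "y = g n z" and r: "wgood g a r" "prd n z \<epsilon> r" by (auto simp: wrel_def)
  let ?p = "prd (suc n) y"
  have "wgood g a (cup r (upr ?p ?p))" unfolding wgood_def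
  proof (intro allI impI)
    fix p assume "p \<epsilon> cup r (upr ?p ?p)"
    then consider "p \<epsilon> r" | "p = ?p" by auto
    then show "p = prd emp a \<or> (\<exists>i z. i \<epsilon> om \<and> p = prd (suc i) (g i z) \<and> prd i z \<epsilon> cup r (upr ?p ?p))"
    proof cases
      case 1
      from r(1)[unfolded wgood_def, rule_format, OF 1] show ?thesis by auto
    next
      case 2
      then show ?thesis using y r(2) n by auto
    qed
  qed
  then show "wrel g a (suc n) y" unfolding wrel_def by (intro exI[of _ "cup r (upr ?p ?p)"]) simp
qed

lemma wrec_emp: "wrec g a emp = a"
  unfolding wrec_def by (rule iota_eq) (simp_all add: wrel_emp)

lemma wrel_unique: "n \<epsilon> om \<Longrightarrow> \<exists>y. wrel g a n y \<and> (\<forall>z. wrel g a n z \<longrightarrow> z = y)"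
proof (rule om_induct[where P = "\<lambda>n. \<exists>y. wrel g a n y \<and> (\<forall>z. wrel g a n z \<longrightarrow> z = y)"])
  show "df UNIV (\<lambda>s. \<exists>y. wrel g a (s 0) y \<and> (\<forall>z. wrel g a (s 0) z \<longrightarrow> z = y))"
    by (intro dfi dfp df_wrel g)
  show "\<exists>y. wrel g a emp y \<and> (\<forall>z. wrel g a emp z \<longrightarrow> z = y)" by (simp add: wrel_emp)
  fix n assume "n \<epsilon> om" "\<exists>y. wrel g a n y \<and> (\<forall>z. wrel g a n z \<longrightarrow> z = y)"
  then show "\<exists>y. wrel g a (suc n) y \<and> (\<forall>z. wrel g a (suc n) z \<longrightarrow> z = y)"
    by (auto simp: wrel_suc)
qed

lemma wrel_wrec: "n \<epsilon> om \<Longrightarrow> wrel g a n (wrec g a n)"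
proof -
  assume "n \<epsilon> om"
  from wrel_unique[OF this] obtain y where y: "wrel g a n y" "\<And>z. wrel g a n z \<Longrightarrow> z = y" by blast
  then show ?thesis unfolding wrec_def by (rule iota_prop)
qed

lemma wrec_suc: "n \<epsilon> om \<Longrightarrow> wrec g a (suc n) = g n (wrec g a n)"
  using wrel_unique[of "suc n"] wrel_wrec[of n] wrel_wrec[of "suc n"] wrel_suc[of n] by (metis suc_om)

end

subsection \<open>Transitive closure, induction and recursion\<close>

definition trans_set :: "'u \<Rightarrow> bool" where
  "trans_set x \<longleftrightarrow> (\<forall>y. y \<epsilon> x \<longrightarrow> sub y x)"

text \<open>The iterates of union start from \<open>x\<close> itself, so that \<open>tc x\<close>
  collects the proper descendants of \<open>x\<close>, and a recursion along it never refers to its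
  own argument.\<close>

definition tc :: "'u \<Rightarrow> 'u" where
  "tc x = un (repl om (\<lambda>n. wrec (\<lambda>i z. un z) x n))"

lemma df_trans_set [dfi]: "dft C a \<Longrightarrow> df C (\<lambda>s. trans_set (a s))"
  by (rule df1[of C trans_set]) (unfold trans_set_def, intro dfi)

lemma dft_tc [dfi]: "dft C a \<Longrightarrow> dft C (\<lambda>s. tc (a s))"
  by (rule dft1[of C tc]) (unfold tc_def, intro dfi)

lemma trans_setD: "trans_set x \<Longrightarrow> y \<epsilon> x \<Longrightarrow> z \<epsilon> y \<Longrightarrow> z \<epsilon> x"
  by (auto simp: trans_set_def sub_def)

lemma mem_tc_wrec: "z \<epsilon> tc x \<longleftrightarrow> (\<exists>n. n \<epsilon> om \<and> z \<epsilon> wrec (\<lambda>i z. un z) x n)"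
proof -
  have "dft UNIV (\<lambda>s. wrec (\<lambda>i z. un z) x (s 0))" by (intro dfi dfp)
  from mem_repl[OF this] show ?thesis by (auto simp: tc_def)
qed

lemma wrec_un:
  shows "wrec (\<lambda>i z. un z) x emp = x"
    and "n \<epsilon> om \<Longrightarrow> wrec (\<lambda>i z. un z) x (suc n) = un (wrec (\<lambda>i z. un z) x n)"
proof -
  have g: "dft UNIV (\<lambda>s. un (s 0))" by (intro dfi)
  show "wrec (\<lambda>i z. un z) x emp = x" by (rule wrec_emp) (rule g)
  show "n \<epsilon> om \<Longrightarrow> wrec (\<lambda>i z. un z) x (suc n) = un (wrec (\<lambda>i z. un z) x n)"
    by (rule wrec_suc) (rule g)
qed

lemma sub_tc: "sub x (tc x)"
  unfolding sub_def mem_tc_wrec by (metis emp_om wrec_un(1))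

lemma trans_tc: "trans_set (tc x)"
  unfolding trans_set_def
proof (intro allI impI subI)
  fix y z assume "y \<epsilon> tc x" "z \<epsilon> y"
  then obtain n where n: "n \<epsilon> om" "y \<epsilon> wrec (\<lambda>i z. un z) x n" by (auto simp: mem_tc_wrec)
  with \<open>z \<epsilon> y\<close> have "z \<epsilon> wrec (\<lambda>i z. un z) x (suc n)" by (auto simp: wrec_un(2))
  with n(1) show "z \<epsilon> tc x" unfolding mem_tc_wrec using suc_om by blast
qed

lemma tc_least: "trans_set t \<Longrightarrow> sub x t \<Longrightarrow> sub (tc x) t"
proof -
  assume t: "trans_set t" and x: "sub x t"
  have "sub (wrec (\<lambda>i z. un z) x n) t" if "n \<epsilon> om" for n
  proof (rule om_induct[where P = "\<lambda>n. sub (wrec (\<lambda>i z. un z) x n) t", OF _ that])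
    show "df UNIV (\<lambda>s. sub (wrec (\<lambda>i z. un z) x (s 0)) t)" by (intro dfi dfp)
    show "sub (wrec (\<lambda>i z. un z) x emp) t" by (simp add: wrec_un x)
    show "sub (wrec (\<lambda>i z. un z) x (suc n)) t" if "n \<epsilon> om" "sub (wrec (\<lambda>i z. un z) x n) t" for n
      using that t by (auto simp: wrec_un sub_def trans_set_def)
  qed
  then show ?thesis by (auto simp: sub_def mem_tc_wrec)
qed

lemma tc_iff: "z \<epsilon> tc x \<longleftrightarrow> z \<epsilon> x \<or> (\<exists>y. y \<epsilon> x \<and> z \<epsilon> tc y)"
proof
  let ?t = "sep (tc x) (\<lambda>z. z \<epsilon> x \<or> (\<exists>y. y \<epsilon> x \<and> z \<epsilon> tc y))"
  have t: "z \<epsilon> ?t \<longleftrightarrow> z \<epsilon> tc x \<and> (z \<epsilon> x \<or> (\<exists>y. y \<epsilon> x \<and> z \<epsilon> tc y))" for z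
    by (rule mem_sep) (intro dfi dfp)
  have "trans_set ?t" unfolding trans_set_def sub_def t
    using trans_setD[OF trans_tc] subD[OF sub_tc] by blast
  moreover have "sub x ?t" unfolding sub_def t using subD[OF sub_tc] by blast
  ultimately have "sub (tc x) ?t" by (rule tc_least)
  then show "z \<epsilon> tc x \<Longrightarrow> z \<epsilon> x \<or> (\<exists>y. y \<epsilon> x \<and> z \<epsilon> tc y)" using t by (auto simp: sub_def)
next
  assume "z \<epsilon> x \<or> (\<exists>y. y \<epsilon> x \<and> z \<epsilon> tc y)"
  moreover have "sub (tc y) (tc x)" if "y \<epsilon> x" for y
    by (rule tc_least[OF trans_tc]) (use that trans_tc[of x] subD[OF sub_tc] in \<open>auto simp: trans_set_def\<close>)
  ultimately show "z \<epsilon> tc x" using subD[OF sub_tc[of x]] by (auto dest: subD)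
qed

lemma mem_tc: "y \<epsilon> x \<Longrightarrow> y \<epsilon> tc x"
  by (rule subD[OF sub_tc])

lemma tc_trans: "y \<epsilon> tc x \<Longrightarrow> z \<epsilon> tc y \<Longrightarrow> z \<epsilon> tc x"
proof -
  assume y: "y \<epsilon> tc x" and z: "z \<epsilon> tc y"
  have "sub y (tc x)" using trans_tc[of x] y unfolding trans_set_def by blast
  then have "sub (tc y) (tc x)" by (rule tc_least[OF trans_tc])
  then show ?thesis using z by (rule subD)
qed

text \<open>A minimal counterexample is sought in the transitive closure of \<open>x\<close>,
  because foundation is available for sets only.\<close>

lemma eps_induct:
  assumes "df UNIV (\<lambda>s. P (s 0))" and step: "\<And>x. (\<And>y. y \<epsilon> x \<Longrightarrow> P y) \<Longrightarrow> P x"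
  shows "P x"
proof (rule ccontr)
  assume "\<not> P x"
  have t: "z \<epsilon> sep (suc (tc x)) (\<lambda>z. \<not> P z) \<longleftrightarrow> z \<epsilon> suc (tc x) \<and> \<not> P z" for z
    by (rule mem_sep) (intro dfi assms(1))
  have "\<exists>z. z \<epsilon> tc x \<and> \<not> P z" using step[of x] \<open>\<not> P x\<close> mem_tc by blast
  then obtain z where "z \<epsilon> tc x \<and> \<not> P z" ..
  then have z: "z \<epsilon> sep (tc x) (\<lambda>z. \<not> P z)" by (subst mem_sep) (intro dfi assms(1))
  have s: "z \<epsilon> sep (tc x) (\<lambda>z. \<not> P z) \<longleftrightarrow> z \<epsilon> tc x \<and> \<not> P z" for z
    by (rule mem_sep) (intro dfi assms(1))
  from founded[OF z] obtain y where y: "y \<epsilon> tc x" "\<not> P y" "\<And>w. w \<epsilon> tc x \<Longrightarrow> \<not> P w \<Longrightarrow> \<not> w \<epsilon> y"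
    unfolding s by blast
  have "P w" if "w \<epsilon> y" for w using y(3)[of w] that trans_setD[OF trans_tc y(1) that] by blast
  with step y(2) show False by blast
qed

lemma tc_induct:
  assumes P: "df UNIV (\<lambda>s. P (s 0))" and step: "\<And>x. (\<And>y. y \<epsilon> tc x \<Longrightarrow> P y) \<Longrightarrow> P x"
  shows "P x"
proof -
  have "\<forall>y. y \<epsilon> tc x \<longrightarrow> P y"
  proof (rule eps_induct[where P = "\<lambda>x. \<forall>y. y \<epsilon> tc x \<longrightarrow> P y"])
    show "df UNIV (\<lambda>s. \<forall>y. y \<epsilon> tc (s 0) \<longrightarrow> P y)" by (intro dfi df1[OF P])
    fix x assume "\<And>y. y \<epsilon> x \<Longrightarrow> \<forall>z. z \<epsilon> tc y \<longrightarrow> P z"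
    then show "\<forall>y. y \<epsilon> tc x \<longrightarrow> P y" using step tc_iff[of _ x] by blast
  qed
  with step show ?thesis by blast
qed

text \<open>Each value is justified by a part \<open>h\<close> of the approximation that lives on
  exactly \<open>tc u\<close>. The part is mentioned as a set because \<open>G\<close> takes the
  restricted function as its second argument.\<close>

definition rgood :: "('u \<Rightarrow> 'u \<Rightarrow> 'u) \<Rightarrow> 'u \<Rightarrow> bool" where
  "rgood G r \<longleftrightarrow> (\<forall>u v. prd u v \<epsilon> r \<longrightarrow> (\<exists>h. v = G u h \<and> sub h r \<and>
     (\<forall>q. q \<epsilon> h \<longrightarrow> (\<exists>t w. t \<epsilon> tc u \<and> q = prd t w)) \<and> (\<forall>t. t \<epsilon> tc u \<longrightarrow> (\<exists>w. prd t w \<epsilon> h))))"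

definition rrel :: "('u \<Rightarrow> 'u \<Rightarrow> 'u) \<Rightarrow> 'u \<Rightarrow> 'u \<Rightarrow> bool" where
  "rrel G x y \<longleftrightarrow> (\<exists>r. rgood G r \<and> prd x y \<epsilon> r)"

text \<open>Recursion along the transitive closure; \<open>G\<close> receives the argument and the restriction of the
  function to the transitive closure of the argument.\<close>

definition trec :: "('u \<Rightarrow> 'u \<Rightarrow> 'u) \<Rightarrow> 'u \<Rightarrow> 'u" where
  "trec G x = iota (rrel G x)"

lemma df_rrel:
  assumes G: "dft C (\<lambda>s. G (\<lambda>n. s (Suc (Suc n))) (s (Suc 0)) (s 0))" and x: "dft C x" and y: "dft C y"
  shows "df C (\<lambda>s. rrel (G s) (x s) (y s))"
  unfolding rrel_def rgood_def
  by (intro dfi dft_ren2[OF G] dft_ren[OF x] dft_ren[OF y])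

lemma dft_trec [dfi]:
  assumes G: "dft C (\<lambda>s. G (\<lambda>n. s (Suc (Suc n))) (s (Suc 0)) (s 0))" and x: "dft C x"
  shows "dft C (\<lambda>s. trec (G s) (x s))"
  unfolding trec_def by (intro dfi df_rrel dft_ren2[OF G] dft_ren[OF x])

theorem trec:
  assumes G: "dft UNIV (\<lambda>s. G (s (Suc 0)) (s 0))"
  shows "trec G x = G x (lam (tc x) (trec G))"
proof -
  have [dfi]: "dft UNIV t \<Longrightarrow> dft UNIV (\<lambda>s. trec G (t s))" for t by (rule dft_trec[OF G])
  \<comment> \<open>Existence and uniqueness of the value are carried through the induction together
    with its identification as \<open>trec G x\<close>, which is a mere description and would be
    \<open>emp\<close> without them.\<close>
  define P where "P x \<longleftrightarrow> rrel G x (trec G x) \<and> (\<forall>y. rrel G x y \<longrightarrow> y = trec G x)" for x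
  have Pdf: "df UNIV (\<lambda>s. P (s 0))" unfolding P_def by (intro dfi df_rrel G)
  have lamG: "p \<epsilon> lam a (trec G) \<longleftrightarrow> (\<exists>x. x \<epsilon> a \<and> p = prd x (trec G x))" for p a
    by (rule mem_lam) (intro dfi)
  have unique: "y = G x (lam (tc x) (trec G))" if IH: "\<And>t. t \<epsilon> tc x \<Longrightarrow> P t" and "rrel G x y" for x y
  proof -
    from that(2) obtain r where r: "rgood G r" "prd x y \<epsilon> r" by (auto simp: rrel_def)
    from r(1)[unfolded rgood_def, rule_format, OF r(2)] obtain h where
      h: "y = G x h" "sub h r" "\<forall>q. q \<epsilon> h \<longrightarrow> (\<exists>t w. t \<epsilon> tc x \<and> q = prd t w)"
        "\<forall>t. t \<epsilon> tc x \<longrightarrow> (\<exists>w. prd t w \<epsilon> h)" by blast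
    have val: "w = trec G t" if "prd t w \<epsilon> h" "t \<epsilon> tc x" for t w
      using IH[OF that(2)] r(1) subD[OF h(2) that(1)] by (auto simp: P_def rrel_def)
    have "h = lam (tc x) (trec G)"
    proof (rule extensional)
      fix q show "q \<epsilon> h \<longleftrightarrow> q \<epsilon> lam (tc x) (trec G)" unfolding lamG using h(3,4) val by metis
    qed
    with h(1) show ?thesis by simp
  qed
  have rel: "rrel G x (G x (lam (tc x) (trec G)))" if IH: "\<And>t. t \<epsilon> tc x \<Longrightarrow> P t" for x
  proof -
    let ?h = "lam (tc x) (trec G)"
    let ?p = "prd x (G x ?h)"
    let ?r = "cup ?h (upr ?p ?p)"
    have "rgood G ?r" unfolding rgood_def
    proof (intro allI impI)
      fix u v assume "prd u v \<epsilon> ?r"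
      then consider "u \<epsilon> tc x" "v = trec G u" | "u = x" "v = G x ?h" by (auto simp: lamG)
      then show "\<exists>h. v = G u h \<and> sub h ?r \<and> (\<forall>q. q \<epsilon> h \<longrightarrow> (\<exists>t w. t \<epsilon> tc u \<and> q = prd t w)) \<and>
          (\<forall>t. t \<epsilon> tc u \<longrightarrow> (\<exists>w. prd t w \<epsilon> h))"
      proof cases
        case 1
        have "P t" if "t \<epsilon> tc u" for t using IH tc_trans[OF 1(1) that] by blast
        then have "trec G u = G u (lam (tc u) (trec G))"
          using unique[of u "trec G u"] IH[OF 1(1)] by (simp add: P_def)
        moreover have "sub (lam (tc u) (trec G)) ?r"
          using tc_trans[OF 1(1)] by (auto simp: sub_def lamG)
        ultimately show ?thesis using 1(2) by (intro exI[of _ "lam (tc u) (trec G)"]) (auto simp: lamG)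
      next
        case 2
        then show ?thesis by (intro exI[of _ ?h]) (auto simp: lamG sub_def)
      qed
    qed
    then show ?thesis unfolding rrel_def by (intro exI[of _ ?r]) simp
  qed
  have eq: "trec G x = G x (lam (tc x) (trec G))" if IH: "\<And>t. t \<epsilon> tc x \<Longrightarrow> P t" for x
    unfolding trec_def[of G x] using rel[of x, OF IH] unique[of x, OF IH] by (rule iota_eq)
  have "P x" for x
  proof (rule tc_induct[where P = P, OF Pdf])
    fix x assume "\<And>y. y \<epsilon> tc x \<Longrightarrow> P y"
    then have e: "trec G x = G x (lam (tc x) (trec G))"
      and "rrel G x (G x (lam (tc x) (trec G)))"
      and "\<And>y. rrel G x y \<Longrightarrow> y = G x (lam (tc x) (trec G))"
      using rel[of x] unique[of x] eq[of x] by blast+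
    then show "P x" unfolding P_def e by blast
  qed
  then show ?thesis by (rule eq)
qed

lemma app_lam_trec:
  "dft UNIV (\<lambda>s. G (s (Suc 0)) (s 0)) \<Longrightarrow> y \<epsilon> tc x \<Longrightarrow> app (lam (tc x) (trec G)) y = trec G y"
  by (rule app_lam) (intro dfi)

end

subsection \<open>Ordinals and the cumulative hierarchy\<close>

context zf
begin

definition ord :: "'u \<Rightarrow> bool" where
  "ord x \<longleftrightarrow> trans_set x \<and> (\<forall>y. y \<epsilon> x \<longrightarrow> trans_set y)"

lemma df_ord [dfi]: "dft C a \<Longrightarrow> df C (\<lambda>s. ord (a s))"
  by (rule df1[of C ord]) (unfold ord_def, intro dfi)

lemma ord_mem: "ord x \<Longrightarrow> y \<epsilon> x \<Longrightarrow> ord y"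
  unfolding ord_def using trans_setD by blast

lemma ord_trans: "ord z \<Longrightarrow> x \<epsilon> y \<Longrightarrow> y \<epsilon> z \<Longrightarrow> x \<epsilon> z"
  unfolding ord_def using trans_setD by blast

lemma ord_emp [simp]: "ord emp"
  by (simp add: ord_def trans_set_def)

lemma ord_suc: "ord x \<Longrightarrow> ord (suc x)"
  unfolding ord_def trans_set_def sub_def mem_suc by blast

lemma ord_suc_iff [simp]: "ord (suc x) \<longleftrightarrow> ord x"
  using ord_suc[of x] ord_mem[of "suc x" x] by auto

lemma ord_un: "(\<And>x. x \<epsilon> a \<Longrightarrow> ord x) \<Longrightarrow> ord (un a)"
  unfolding ord_def trans_set_def sub_def mem_un by blast

text \<open>Nested induction on both arguments: if all pairs with an earlier component are
  comparable, two incomparable ordinals would have the same elements.\<close>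

lemma ord_linear: "ord x \<Longrightarrow> ord y \<Longrightarrow> x \<epsilon> y \<or> x = y \<or> y \<epsilon> x"
proof -
  have "\<forall>y. ord x \<and> ord y \<longrightarrow> x \<epsilon> y \<or> x = y \<or> y \<epsilon> x"
  proof (rule eps_induct[where P = "\<lambda>x. \<forall>y. ord x \<and> ord y \<longrightarrow> x \<epsilon> y \<or> x = y \<or> y \<epsilon> x"])
    show "df UNIV (\<lambda>s. \<forall>y. ord (s 0) \<and> ord y \<longrightarrow> s 0 \<epsilon> y \<or> s 0 = y \<or> y \<epsilon> s 0)" by (intro dfi)
    fix x assume IHx: "\<And>z. z \<epsilon> x \<Longrightarrow> \<forall>y. ord z \<and> ord y \<longrightarrow> z \<epsilon> y \<or> z = y \<or> y \<epsilon> z"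
    show "\<forall>y. ord x \<and> ord y \<longrightarrow> x \<epsilon> y \<or> x = y \<or> y \<epsilon> x"
    proof
      fix y
      show "ord x \<and> ord y \<longrightarrow> x \<epsilon> y \<or> x = y \<or> y \<epsilon> x"
      proof (rule eps_induct[where P = "\<lambda>y. ord x \<and> ord y \<longrightarrow> x \<epsilon> y \<or> x = y \<or> y \<epsilon> x"])
        show "df UNIV (\<lambda>s. ord x \<and> ord (s 0) \<longrightarrow> x \<epsilon> s 0 \<or> x = s 0 \<or> s 0 \<epsilon> x)" by (intro dfi dfp)
        fix y assume IHy: "\<And>z. z \<epsilon> y \<Longrightarrow> ord x \<and> ord z \<longrightarrow> x \<epsilon> z \<or> x = z \<or> z \<epsilon> x"
        show "ord x \<and> ord y \<longrightarrow> x \<epsilon> y \<or> x = y \<or> y \<epsilon> x"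
        proof (intro impI, elim conjE)
          assume o: "ord x" "ord y"
          show "x \<epsilon> y \<or> x = y \<or> y \<epsilon> x"
          proof (rule ccontr)
            assume n: "\<not> (x \<epsilon> y \<or> x = y \<or> y \<epsilon> x)"
            have "z \<epsilon> y" if "z \<epsilon> x" for z
              using IHx[OF that] ord_mem[OF o(1) that] o(2) n that ord_trans[OF o(1) _ that] by blast
            moreover have "z \<epsilon> x" if "z \<epsilon> y" for z
              using IHy[OF that] ord_mem[OF o(2) that] o(1) n that ord_trans[OF o(2) _ that] by blast
            ultimately have "x = y" by (intro extensional) blast
            with n show False by blast
          qed
        qed
      qed
    qed
  qed
  then show "ord x \<Longrightarrow> ord y \<Longrightarrow> ?thesis" by blast
qed

lemma ord_sub: "ord x \<Longrightarrow> ord y \<Longrightarrow> sub x y \<longleftrightarrow> x \<epsilon> y \<or> x = y"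
  using ord_linear[of x y] ord_trans[of y _ x] unfolding sub_def by (metis not_mem_self)

lemma ord_mem_suc: "ord x \<Longrightarrow> ord y \<Longrightarrow> suc x \<epsilon> suc y \<longleftrightarrow> x \<epsilon> y"
proof
  assume o: "ord x" "ord y" and "suc x \<epsilon> suc y"
  then show "x \<epsilon> y" using ord_trans[of y x "suc x"] by auto
next
  assume o: "ord x" "ord y" and "x \<epsilon> y"
  then have "sub (suc x) y" using ord_trans[OF o(2) _ \<open>x \<epsilon> y\<close>] unfolding sub_def mem_suc by blast
  with o show "suc x \<epsilon> suc y" by (simp add: ord_sub)
qed

section \<open>Least ordinals and boundedness\<close>

definition lst :: "('u \<Rightarrow> bool) \<Rightarrow> 'u" where
  "lst P = iota (\<lambda>b. ord b \<and> P b \<and> (\<forall>c. c \<epsilon> b \<longrightarrow> \<not> P c))"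

lemma dft_lst [dfi]: "df C (\<lambda>s. Q (\<lambda>n. s (Suc n)) (s 0)) \<Longrightarrow> dft C (\<lambda>s. lst (Q s))"
proof -
  assume Q: "df C (\<lambda>s. Q (\<lambda>n. s (Suc n)) (s 0))"
  show ?thesis unfolding lst_def by (intro dfi df_ren1[OF Q])
qed

lemma lst:
  assumes P: "df UNIV (\<lambda>s. P (s 0))" and a: "ord a" "P a"
  shows "ord (lst P)" "P (lst P)" "c \<epsilon> lst P \<Longrightarrow> \<not> P c"
proof -
  let ?Q = "\<lambda>b. ord b \<and> P b \<and> (\<forall>c. c \<epsilon> b \<longrightarrow> \<not> P c)"
  have "\<exists>b. ?Q b"
  proof (rule ccontr)
    assume n: "\<not> (\<exists>b. ?Q b)"
    have "ord a \<longrightarrow> \<not> P a"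
    proof (rule eps_induct[where P = "\<lambda>a. ord a \<longrightarrow> \<not> P a"])
      show "df UNIV (\<lambda>s. ord (s 0) \<longrightarrow> \<not> P (s 0))" by (intro dfi P)
      fix x assume "\<And>y. y \<epsilon> x \<Longrightarrow> ord y \<longrightarrow> \<not> P y"
      with n ord_mem show "ord x \<longrightarrow> \<not> P x" by blast
    qed
    with a show False by blast
  qed
  then obtain b where b: "?Q b" ..
  have "?Q (lst P)" unfolding lst_def
    by (rule iota_prop[of ?Q b, OF b]) (use b ord_linear in blast)
  then show "ord (lst P)" "P (lst P)" "c \<epsilon> lst P \<Longrightarrow> \<not> P c" by blast+
qed

text \<open>Taking the least witness for each element turns the relation into a function, so that
  replacement and union give a bound; the successor makes it strict.\<close>

lemma bounding:
  assumes Q: "df UNIV (\<lambda>s. Q (s 0) (s (Suc 0)))" and "\<And>x. x \<epsilon> a \<Longrightarrow> \<exists>g. ord g \<and> Q x g"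
  shows "\<exists>g. ord g \<and> (\<forall>x. x \<epsilon> a \<longrightarrow> (\<exists>d. d \<epsilon> g \<and> ord d \<and> Q x d))"
proof -
  have Q1: "df UNIV (\<lambda>s. Q x (s 0))" for x by (rule df2[OF Q]) (intro dfi dfp)+
  have f: "dft UNIV (\<lambda>s. lst (Q (s 0)))" by (intro dfi df2[OF Q])
  let ?b = "repl a (\<lambda>x. lst (Q x))"
  have b: "y \<epsilon> ?b \<longleftrightarrow> (\<exists>x. x \<epsilon> a \<and> y = lst (Q x))" for y by (rule mem_repl[OF f])
  have l: "ord (lst (Q x)) \<and> Q x (lst (Q x))" if "x \<epsilon> a" for x
  proof -
    from assms(2)[OF that] obtain g where g: "ord g" "Q x g" by blast
    from lst(1)[of "Q x" g] lst(2)[of "Q x" g] g Q1 show ?thesis by blast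
  qed
  have "ord (un ?b)"
  proof (rule ord_un)
    fix z assume "z \<epsilon> ?b"
    then obtain x where "x \<epsilon> a" "z = lst (Q x)" unfolding b by (elim exE conjE)
    then show "ord z" using l by simp
  qed
  moreover have "lst (Q x) \<epsilon> suc (un ?b)" if "x \<epsilon> a" for x
  proof -
    have "sub (lst (Q x)) (un ?b)" using that b by (auto simp: sub_def)
    then show ?thesis using ord_sub[of "lst (Q x)" "un ?b"] l[OF that] \<open>ord (un ?b)\<close> by simp
  qed
  ultimately show ?thesis using l by (intro exI[of _ "suc (un ?b)"]) (simp del: mem_suc mem_un, blast)
qed

lemma om_elt: "n \<epsilon> om \<Longrightarrow> ord n \<and> sub n om"
proof (rule om_induct[where P = "\<lambda>n. ord n \<and> sub n om"])
  show "df UNIV (\<lambda>s. ord (s 0) \<and> sub (s 0) om)" by (intro dfi)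
qed (auto simp: ord_suc sub_def)

lemma ord_om [simp]: "ord om"
  using om_elt by (auto simp: ord_def trans_set_def)

lemma mem_om_om: "n \<epsilon> om \<Longrightarrow> m \<epsilon> n \<Longrightarrow> m \<epsilon> om"
  using ord_trans[OF ord_om] by blast

text \<open>One clause covers zero, successors and limits; it makes sense for every set
  \<open>x\<close> and gives the level at the rank of \<open>x\<close>.\<close>

definition vst :: "'u \<Rightarrow> 'u" where
  "vst x = trec (\<lambda>x h. un (repl x (\<lambda>y. pw (app h y)))) x"

lemma dft_vst [dfi]: "dft C a \<Longrightarrow> dft C (\<lambda>s. vst (a s))"
  unfolding vst_def by (intro dfi)

lemma mem_vst: "z \<epsilon> vst x \<longleftrightarrow> (\<exists>y. y \<epsilon> x \<and> sub z (vst y))"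
proof -
  let ?G = "\<lambda>x h. un (repl x (\<lambda>y. pw (app h y)))"
  have G: "dft UNIV (\<lambda>s. ?G (s (Suc 0)) (s 0))" by (intro dfi)
  let ?h = "lam (tc x) (trec ?G)"
  have "z \<epsilon> vst x \<longleftrightarrow> z \<epsilon> ?G x ?h" unfolding vst_def by (subst trec[OF G]) (rule refl)
  also have "\<dots> \<longleftrightarrow> (\<exists>y. y \<epsilon> x \<and> sub z (app ?h y))"
  proof -
    have "dft UNIV (\<lambda>s. pw (app ?h (s 0)))" by (intro dfi dfp)
    from mem_repl[OF this] show ?thesis by auto
  qed
  also have "\<dots> \<longleftrightarrow> (\<exists>y. y \<epsilon> x \<and> sub z (vst y))"
    using app_lam_trec[OF G mem_tc] unfolding vst_def by metis
  finally show ?thesis .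
qed

lemma sub_trans: "sub x y \<Longrightarrow> sub y z \<Longrightarrow> sub x z"
  by (simp add: sub_def)

lemma vst_mono: "sub x y \<Longrightarrow> sub (vst x) (vst y)"
proof (rule subI)
  fix z assume xy: "sub x y" and "z \<epsilon> vst x"
  then obtain w where "w \<epsilon> x" "sub z (vst w)" unfolding mem_vst[of z x] by (elim exE conjE)
  then show "z \<epsilon> vst y" unfolding mem_vst[of z y] using subD[OF xy] by blast
qed

lemma sub_vst: "sub x (vst x)"
proof (rule eps_induct[where P = "\<lambda>x. sub x (vst x)"])
  show "df UNIV (\<lambda>s. sub (s 0) (vst (s 0)))" by (intro dfi)
  fix x assume "\<And>y. y \<epsilon> x \<Longrightarrow> sub y (vst y)"
  then show "sub x (vst x)" unfolding sub_def[of x] mem_vst by blast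
qed

lemma trans_vst: "trans_set (vst x)"
proof (rule eps_induct[where P = "\<lambda>x. trans_set (vst x)"])
  show "df UNIV (\<lambda>s. trans_set (vst (s 0)))" by (intro dfi)
  fix x assume IH: "\<And>y. y \<epsilon> x \<Longrightarrow> trans_set (vst y)"
  show "trans_set (vst x)" unfolding trans_set_def
  proof (intro allI impI subI)
    fix z w assume "z \<epsilon> vst x" "w \<epsilon> z"
    then obtain y where y: "y \<epsilon> x" "w \<epsilon> vst y" by (auto simp: mem_vst[of z x] dest: subD)
    then have "sub w (vst y)" using IH[OF y(1)] by (simp add: trans_set_def)
    with y(1) show "w \<epsilon> vst x" unfolding mem_vst[of w x] by blast
  qed
qed

lemma ord_vst_mono: "ord b \<Longrightarrow> a \<epsilon> b \<Longrightarrow> sub (vst a) (vst b)"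
  by (rule vst_mono) (auto simp: ord_def trans_set_def)

lemma ex_vst: "\<exists>a. ord a \<and> x \<epsilon> vst a"
proof (rule eps_induct[where P = "\<lambda>x. \<exists>a. ord a \<and> x \<epsilon> vst a"])
  show "df UNIV (\<lambda>s. \<exists>a. ord a \<and> s 0 \<epsilon> vst a)" by (intro dfi)
  fix x assume IH: "\<And>y. y \<epsilon> x \<Longrightarrow> \<exists>a. ord a \<and> y \<epsilon> vst a"
  have "\<exists>g. ord g \<and> (\<forall>y. y \<epsilon> x \<longrightarrow> (\<exists>d. d \<epsilon> g \<and> ord d \<and> y \<epsilon> vst d))"
    by (rule bounding[OF _ IH]) (intro dfi)
  then obtain g where g: "ord g" "\<And>y. y \<epsilon> x \<Longrightarrow> \<exists>d. d \<epsilon> g \<and> ord d \<and> y \<epsilon> vst d" by blast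
  have "sub x (vst g)"
  proof (rule subI)
    fix y assume "y \<epsilon> x"
    from g(2)[OF this] obtain d where "d \<epsilon> g" "y \<epsilon> vst d" by blast
    then show "y \<epsilon> vst g" using ord_vst_mono[OF g(1)] subD by blast
  qed
  then have "x \<epsilon> vst (suc g)" unfolding mem_vst[of x] by (intro exI[of _ g]) simp
  with g(1) ord_suc show "\<exists>a. ord a \<and> x \<epsilon> vst a" by blast
qed

lemma ord_mem_vst: "ord a \<Longrightarrow> ord b \<Longrightarrow> a \<epsilon> vst b \<longleftrightarrow> a \<epsilon> b"
proof
  assume ab: "ord a" "ord b"
  have "\<forall>a. ord b \<and> ord a \<and> a \<epsilon> vst b \<longrightarrow> a \<epsilon> b"
  proof (rule eps_induct[where P = "\<lambda>b. \<forall>a. ord b \<and> ord a \<and> a \<epsilon> vst b \<longrightarrow> a \<epsilon> b"])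
    show "df UNIV (\<lambda>s. \<forall>a. ord (s 0) \<and> ord a \<and> a \<epsilon> vst (s 0) \<longrightarrow> a \<epsilon> s 0)" by (intro dfi)
    fix b assume IH: "\<And>c. c \<epsilon> b \<Longrightarrow> \<forall>a. ord c \<and> ord a \<and> a \<epsilon> vst c \<longrightarrow> a \<epsilon> c"
    show "\<forall>a. ord b \<and> ord a \<and> a \<epsilon> vst b \<longrightarrow> a \<epsilon> b"
    proof (intro allI impI, elim conjE)
      fix a assume o: "ord b" "ord a" and "a \<epsilon> vst b"
      then obtain c where c: "c \<epsilon> b" "sub a (vst c)" by (auto simp: mem_vst[of a b])
      have oc: "ord c" using ord_mem[OF o(1) c(1)] .
      have "sub a c"
      proof (rule subI)
        fix d assume "d \<epsilon> a"
        then show "d \<epsilon> c" using IH[OF c(1)] oc ord_mem[OF o(2)] subD[OF c(2)] by blast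
      qed
      then show "a \<epsilon> b" using ord_sub[OF o(2) oc] c(1) ord_trans[OF o(1)] by blast
    qed
  qed
  with ab show "a \<epsilon> vst b \<Longrightarrow> a \<epsilon> b" by blast
next
  assume "a \<epsilon> b"
  then show "a \<epsilon> vst b" unfolding mem_vst[of a b] using sub_vst by blast
qed

text \<open>No witness is chosen: for each element of \<open>a\<close> a level containing some
  witness is bounded by a common ordinal, and that level serves as \<open>b\<close>.\<close>

lemma collection:
  assumes Q: "df UNIV (\<lambda>s. Q (s 0) (s (Suc 0)))"
  shows "\<exists>b. \<forall>x. x \<epsilon> a \<longrightarrow> (\<exists>y. Q x y) \<longrightarrow> (\<exists>y. y \<epsilon> b \<and> Q x y)"
proof -
  let ?P = "\<lambda>x g. (\<exists>y. Q x y) \<longrightarrow> (\<exists>y. y \<epsilon> vst g \<and> Q x y)"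
  have P: "df UNIV (\<lambda>s. ?P (s 0) (s (Suc 0)))" by (intro dfi df2[OF Q])
  have "\<exists>g. ord g \<and> ?P x g" for x
    using ex_vst ord_emp by blast
  from bounding[where Q = ?P, OF P this] obtain g where
    g: "ord g" "\<And>x. x \<epsilon> a \<Longrightarrow> \<exists>d. d \<epsilon> g \<and> ord d \<and> ?P x d" by blast
  have "\<exists>y. y \<epsilon> vst g \<and> Q x y" if "x \<epsilon> a" "\<exists>y. Q x y" for x
  proof -
    from g(2)[OF that(1)] that(2) obtain d y where "d \<epsilon> g" "y \<epsilon> vst d" "Q x y" by blast
    then show ?thesis using ord_vst_mono[OF g(1)] subD by blast
  qed
  then show ?thesis by blast
qed

definition lim :: "'u \<Rightarrow> bool" where
  "lim a \<longleftrightarrow> ord a \<and> a \<noteq> emp \<and> (\<forall>b. b \<epsilon> a \<longrightarrow> suc b \<epsilon> a)"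

lemma df_lim [dfi]: "dft C a \<Longrightarrow> df C (\<lambda>s. lim (a s))"
  by (rule df1[of C lim]) (unfold lim_def, intro dfi)

lemma lim_ord: "lim a \<Longrightarrow> ord a" by (simp add: lim_def)

lemma mem_vst_lim: "lim a \<Longrightarrow> z \<epsilon> vst a \<Longrightarrow> \<exists>d. d \<epsilon> a \<and> z \<epsilon> vst d"
proof -
  assume a: "lim a" and "z \<epsilon> vst a"
  then obtain y where y: "y \<epsilon> a" "sub z (vst y)" by (auto simp: mem_vst[of z a])
  then have "z \<epsilon> vst (suc y)" unfolding mem_vst[of z "suc y"] by (intro exI[of _ y]) simp
  with y(1) a show ?thesis by (auto simp: lim_def)
qed

lemma vst_lim_common:
  assumes a: "lim a" and "\<And>n. s n \<epsilon> vst a"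
  shows "\<exists>d. d \<epsilon> a \<and> (\<forall>i<(m::nat). s i \<epsilon> vst d)"
proof (induction m)
  case 0
  show ?case using a by (auto simp: lim_def nonemp_iff)
next
  case (Suc m)
  then obtain d where d: "d \<epsilon> a" "\<forall>i<m. s i \<epsilon> vst d" by blast
  from mem_vst_lim[OF a assms(2)[of m]] obtain e where e: "e \<epsilon> a" "s m \<epsilon> vst e" by blast
  have od: "ord d" "ord e" using ord_mem[OF lim_ord[OF a]] d(1) e(1) by blast+
  from ord_linear[OF od] show ?case
  proof (elim disjE)
    assume "d \<epsilon> e"
    then have "sub (vst d) (vst e)" by (rule ord_vst_mono[OF od(2)])
    with d e show ?thesis by (intro exI[of _ e]) (auto simp: less_Suc_eq dest: subD)
  next
    assume "d = e"
    with d e show ?thesis by (intro exI[of _ e]) (auto simp: less_Suc_eq)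
  next
    assume "e \<epsilon> d"
    then have "sub (vst e) (vst d)" by (rule ord_vst_mono[OF od(1)])
    with d e show ?thesis by (intro exI[of _ d]) (auto simp: less_Suc_eq dest: subD)
  qed
qed

subsection \<open>Reflection\<close>

lemma df_dsat_UNIV: "(\<And>n. dft C (\<lambda>s. t s n)) \<Longrightarrow> df C (\<lambda>s. dsat UNIV (\<epsilon>) R (t s) \<phi>)"
  using df_dsat[of C "\<lambda>s x. True" "\<lambda>s. R" t \<phi>] by (simp add: dfi)

text \<open>Assignments are functions of the metatheory, so the model cannot quantify over those
  with values in a set. A formula depends on finitely many slots, and \<open>blk\<close> quantifies
  over that many elements one after the other.\<close>

primrec blk :: "nat \<Rightarrow> 'u \<Rightarrow> ((nat \<Rightarrow> 'u) \<Rightarrow> bool) \<Rightarrow> (nat \<Rightarrow> 'u) \<Rightarrow> bool" where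
  "blk 0 a P s \<longleftrightarrow> P s"
| "blk (Suc j) a P s \<longleftrightarrow> (\<forall>c. c \<epsilon> a \<longrightarrow> blk j a P (scons c s))"

lemma blkD: "blk j a P s \<Longrightarrow> (\<And>i. i < j \<Longrightarrow> t i \<epsilon> a) \<Longrightarrow> (\<And>i. t (i + j) = s i) \<Longrightarrow> P t"
proof (induction j arbitrary: s)
  case 0
  then have "t = s" by auto
  with 0 show ?case by simp
next
  case (Suc j)
  have "t (i + j) = scons (t j) s i" for i
    using Suc.prems(3)[of "i - 1"] by (cases i) auto
  moreover have "blk j a P (scons (t j) s)" using Suc.prems(1,2) by simp
  ultimately show ?case using Suc.IH[of "scons (t j) s"] Suc.prems(2) by simp
qed

lemma blk_mono: "blk j a P s \<Longrightarrow> (\<And>t. P t \<Longrightarrow> Q t) \<Longrightarrow> blk j a Q s"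
  by (induction j arbitrary: s) auto

text \<open>Tarski--Vaught: failures of \<open>\<forall>x. \<phi>\<close> with parameters in \<open>V\<^sub>b\<close> have witnesses in \<open>V\<^sub>g\<close>.\<close>

definition tvp :: "dfm \<Rightarrow> 'u \<Rightarrow> (nat \<Rightarrow> 'u) \<Rightarrow> bool" where
  "tvp \<phi> g t \<longleftrightarrow> (\<exists>x. \<not> dsat UNIV (\<epsilon>) R (scons x t) \<phi>) \<longrightarrow>
    (\<exists>x. x \<epsilon> vst g \<and> \<not> dsat UNIV (\<epsilon>) R (scons x t) \<phi>)"

lemma df_tvp:
  assumes "dft C g" "\<And>n. dft C (\<lambda>s. t s n)"
  shows "df C (\<lambda>s. tvp \<phi> (g s) (t s))"
proof -
  have *: "dft C (\<lambda>s. scons (s 0) (t (\<lambda>n. s (Suc n))) n)" for n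
    by (cases n) (auto intro: dfi dft_ren assms)
  show ?thesis unfolding tvp_def by (intro dfi df_dsat_UNIV * dft_ren[OF assms(1)])
qed

lemma df_blk_tvp:
  assumes "dft C a" "dft C g" "\<And>n. dft C (\<lambda>s. t s n)"
  shows "df C (\<lambda>s. blk j (a s) (tvp \<phi> (g s)) (t s))"
  using assms
proof (induction j arbitrary: a g t)
  case (Suc j)
  have *: "dft C (\<lambda>s. scons (s 0) (t (\<lambda>n. s (Suc n))) n)" for n
    by (cases n) (auto intro: dfi dft_ren Suc.prems)
  show ?case unfolding blk.simps
    by (intro dfi Suc.IH[OF _ _ *] dft_ren[OF Suc.prems(1)] dft_ren[OF Suc.prems(2)])
qed (simp add: df_tvp)

lemma tvp_mono: "tvp \<phi> g t \<Longrightarrow> sub (vst g) (vst h) \<Longrightarrow> tvp \<phi> h t"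
  unfolding tvp_def using subD by blast

lemma blk_tvp_ex: "\<exists>g. ord g \<and> blk j a (tvp \<phi> g) s"
proof (induction j arbitrary: s)
  case 0
  have "\<exists>g. ord g \<and> tvp \<phi> g s" unfolding tvp_def using ex_vst ord_emp by blast
  then show ?case by simp
next
  case (Suc j)
  let ?Q = "\<lambda>c g. blk j a (tvp \<phi> g) (scons c s)"
  have "dft UNIV (\<lambda>t. scons (t 0) s n)" for n by (cases n) (auto intro: dfi dfp)
  then have Q: "df UNIV (\<lambda>t. ?Q (t 0) (t (Suc 0)))" by (intro df_blk_tvp dfi dfp)
  from bounding[where Q = ?Q, OF Q Suc] obtain g where
    g: "ord g" "\<And>c. c \<epsilon> a \<Longrightarrow> \<exists>d. d \<epsilon> g \<and> ord d \<and> ?Q c d" by blast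
  have "?Q c g" if "c \<epsilon> a" for c
  proof -
    from g(2)[OF that] obtain d where "d \<epsilon> g" "?Q c d" by blast
    then show ?thesis using tvp_mono[OF _ ord_vst_mono[OF g(1)]] by (blast intro: blk_mono)
  qed
  with g(1) show ?case by auto
qed

definition supp :: "dfm \<Rightarrow> nat" where
  "supp \<phi> = (SOME m. \<forall>A E R (s :: nat \<Rightarrow> 'u) t. (\<forall>i<m. s i = t i) \<longrightarrow> dsat A E R s \<phi> = dsat A E R t \<phi>)"

lemma dsat_supp:
  "(\<And>i. i < supp \<phi> \<Longrightarrow> s i = t i) \<Longrightarrow> dsat A E' R' (s :: nat \<Rightarrow> 'u) \<phi> = dsat A E' R' t \<phi>"
  using someI_ex[OF dsat_finite_support[of \<phi>, where 'a = 'u]] unfolding supp_def by blast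

definition tv :: "dfm \<Rightarrow> 'u \<Rightarrow> 'u \<Rightarrow> bool" where
  "tv \<phi> b g \<longleftrightarrow> blk (supp \<phi>) (vst b) (tvp \<phi> g) (\<lambda>_. emp)"

lemma df_tv [dfi]: "dft C b \<Longrightarrow> dft C g \<Longrightarrow> df C (\<lambda>s. tv \<phi> (b s) (g s))"
  unfolding tv_def by (intro df_blk_tvp dfi)

lemma tvD: "tv \<phi> b g \<Longrightarrow> (\<And>i. i < supp \<phi> \<Longrightarrow> s i \<epsilon> vst b) \<Longrightarrow> tvp \<phi> g s"
proof -
  assume tv: "tv \<phi> b g" and s: "\<And>i. i < supp \<phi> \<Longrightarrow> s i \<epsilon> vst b"
  let ?t = "\<lambda>i. if i < supp \<phi> then s i else emp"
  have "tvp \<phi> g ?t" by (rule blkD[OF tv[unfolded tv_def]]) (use s in auto)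
  moreover have "dsat UNIV (\<epsilon>) R (scons x ?t) \<phi> = dsat UNIV (\<epsilon>) R (scons x s) \<phi>" for x
    by (rule dsat_supp) (auto simp: scons_def split: nat.split)
  ultimately show ?thesis by (simp add: tvp_def)
qed

lemma tv_ex: "finite F \<Longrightarrow> ord b \<Longrightarrow> \<exists>g. ord g \<and> b \<epsilon> g \<and> (\<forall>\<phi>\<in>F. tv \<phi> b g)"
proof (induction F rule: finite_induct)
  case empty
  then show ?case by (intro exI[of _ "suc b"]) (simp add: ord_suc)
next
  case (insert \<phi> F)
  then obtain g where g: "ord g" "b \<epsilon> g" "\<forall>\<phi>\<in>F. tv \<phi> b g" by blast
  obtain h where h: "ord h" "tv \<phi> b h" unfolding tv_def using blk_tvp_ex by blast
  have mono: "tv \<psi> b e" if "tv \<psi> b d" "d \<epsilon> e \<or> d = e" "ord e" for \<psi> d e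
    using that tvp_mono[OF _ ord_vst_mono[OF that(3)]] unfolding tv_def by (blast intro: blk_mono)
  from ord_linear[OF g(1) h(1)] show ?case
  proof (elim disjE)
    assume "g \<epsilon> h"
    then show ?thesis using g h mono ord_trans[OF h(1) g(2)] by (intro exI[of _ h]) blast
  next
    assume "g = h"
    then show ?thesis using g h by (intro exI[of _ h]) blast
  next
    assume "h \<epsilon> g"
    then show ?thesis using g h mono by (intro exI[of _ g]) blast
  qed
qed

primrec bodies :: "dfm \<Rightarrow> dfm set" where
  "bodies DFalse = {}"
| "bodies (DMem i j) = {}"
| "bodies (DEq i j) = {}"
| "bodies (DRel i j k) = {}"
| "bodies (DImp \<phi> \<psi>) = bodies \<phi> \<union> bodies \<psi>"
| "bodies (DAll \<phi>) = insert \<phi> (bodies \<phi>)"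

lemma finite_bodies [simp]: "finite (bodies \<phi>)"
  by (induction \<phi>) auto

text \<open>It suffices that each failing universal subformula with parameters in the level has a
  counterexample there. The function \<open>h\<close> finds a level with the counterexamples for
  parameters from \<open>vst b\<close>, and at the supremum of its iterates any finite list of
  parameters already occurs at one stage.\<close>

theorem reflection:
  assumes "finite F" "ord b"
  shows "\<exists>l. lim l \<and> b \<epsilon> l \<and> (\<forall>\<phi>\<in>F. \<forall>s. (\<forall>n. s n \<epsilon> vst l) \<longrightarrow>
    dsat {x. x \<epsilon> vst l} (\<epsilon>) R s \<phi> = dsat UNIV (\<epsilon>) R s \<phi>)"
proof -
  define B where "B = (\<Union>\<phi>\<in>F. bodies \<phi>)"
  have finB: "finite B" using assms(1) by (simp add: B_def)
  define P where "P b g \<longleftrightarrow> b \<epsilon> g \<and> (\<forall>\<phi>\<in>B. tv \<phi> b g)" for b g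
  have dfP: "df C (\<lambda>s. P (a s) (c s))" if "dft C a" "dft C c" for a c C
    unfolding P_def by (intro dfi df_finite_all finB that)
  define h where "h b = lst (P b)" for b
  have dfh: "dft C (\<lambda>s. h (a s))" if "dft C a" for a C
    unfolding h_def by (intro dfi dfP dft_ren[OF that])
  have h: "ord (h b)" "b \<epsilon> h b" "\<And>\<phi>. \<phi> \<in> B \<Longrightarrow> tv \<phi> b (h b)" if "ord b" for b
  proof -
    from tv_ex[OF finB that] obtain g where g: "ord g" "P b g" by (auto simp: P_def)
    have "df UNIV (\<lambda>s. P b (s 0))" by (intro dfP dfi dfp)
    from lst(1,2)[OF this g] have "ord (h b)" "P b (h b)" by (simp_all add: h_def)
    then show "ord (h b)" "b \<epsilon> h b" "\<And>\<phi>. \<phi> \<in> B \<Longrightarrow> tv \<phi> b (h b)" by (auto simp: P_def)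
  qed
  \<comment> \<open>The iteration runs over the natural numbers of the model, so that the stages
    form a set and their supremum exists.\<close>
  let ?L = "wrec (\<lambda>i z. h z) b"
  have g: "dft UNIV (\<lambda>s. h (s 0))" by (intro dfh dfi)
  have L0: "?L emp = b" by (rule wrec_emp[OF g])
  have LS: "?L (suc n) = h (?L n)" if "n \<epsilon> om" for n by (rule wrec_suc[OF g that])
  have dfL: "dft UNIV (\<lambda>s. ?L (s 0))" by (intro dfi dfp dfh)
  have oL: "ord (?L n)" if "n \<epsilon> om" for n
    by (rule om_induct[where P = "\<lambda>n. ord (?L n)", OF _ that])
      (intro dfi dfL, simp_all add: L0 LS assms(2) h(1))
  define l where "l = un (repl om ?L)"
  have l: "z \<epsilon> l \<longleftrightarrow> (\<exists>n. n \<epsilon> om \<and> z \<epsilon> ?L n)" for z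
    unfolding l_def using mem_repl[OF dfL, of _ om] by auto
  have ol: "ord l" unfolding l_def by (rule ord_un) (use oL mem_repl[OF dfL, of _ om] in auto)
  have Ll: "?L n \<epsilon> l" if "n \<epsilon> om" for n
    unfolding l using h(2)[OF oL[OF that]] LS[OF that] suc_om[OF that] by metis
  have lim: "lim l" unfolding lim_def
  proof (intro conjI allI impI)
    show "l \<noteq> emp" using Ll[OF emp_om] by (rule mem_nonemp)
    fix c assume "c \<epsilon> l"
    then obtain n where n: "n \<epsilon> om" "c \<epsilon> ?L n" unfolding l by blast
    then have "suc c \<epsilon> suc (?L n)" using ord_mem_suc oL[OF n(1)] ord_mem by blast
    then have "suc c \<epsilon> ?L (suc n)"
      using LS[OF n(1)] h(1,2)[OF oL[OF n(1)]] ord_trans[of "h (?L n)" "suc c" "?L n"] by auto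
    then show "suc c \<epsilon> l" unfolding l using suc_om[OF n(1)] by blast
  qed (rule ol)
  have tvl: "tvp \<phi> l s" if "\<phi> \<in> B" "\<And>n. s n \<epsilon> vst l" for \<phi> s
  proof -
    have "\<exists>d. d \<epsilon> l \<and> (\<forall>i<supp \<phi>. s i \<epsilon> vst d)" by (rule vst_lim_common[OF lim]) (rule that(2))
    then obtain d where d: "d \<epsilon> l" "\<forall>i<supp \<phi>. s i \<epsilon> vst d" by (elim exE conjE)
    from d(1) obtain n where n: "n \<epsilon> om" "d \<epsilon> ?L n" unfolding l by blast
    have "s i \<epsilon> vst (?L n)" if "i < supp \<phi>" for i
      using d(2) that subD[OF ord_vst_mono[OF oL[OF n(1)] n(2)]] by blast
    with h(3)[OF oL[OF n(1)] \<open>\<phi> \<in> B\<close>] have "tvp \<phi> (h (?L n)) s" by (rule tvD)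
    moreover have "sub (vst (h (?L n))) (vst l)"
      using ord_vst_mono[OF ol Ll[OF suc_om[OF n(1)]]] LS[OF n(1)] by simp
    ultimately show ?thesis by (rule tvp_mono)
  qed
  have "dsat {x. x \<epsilon> vst l} (\<epsilon>) R s \<phi> = dsat UNIV (\<epsilon>) R s \<phi>"
    if "bodies \<phi> \<subseteq> B" "\<And>n. s n \<epsilon> vst l" for \<phi> s
    using that
  proof (induction \<phi> arbitrary: s)
    case (DAll \<phi>)
    have *: "dsat {x. x \<epsilon> vst l} (\<epsilon>) R (scons x s) \<phi> = dsat UNIV (\<epsilon>) R (scons x s) \<phi>" if "x \<epsilon> vst l" for x
    proof (rule DAll.IH)
      show "scons x s n \<epsilon> vst l" for n using that DAll.prems(2) by (cases n) auto
    qed (use DAll.prems in auto)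
    have "\<phi> \<in> B" using DAll.prems(1) by simp
    from tvl[of \<phi> s, OF this DAll.prems(2)] * show ?case by (auto simp: tvp_def)
  qed auto
  moreover have "bodies \<phi> \<subseteq> B" if "\<phi> \<in> F" for \<phi> using that by (auto simp: B_def)
  moreover have "b \<epsilon> l" using Ll[OF emp_om] L0 by simp
  ultimately show ?thesis using lim by blast
qed

end

section \<open>Semantics of the axioms\<close>

text \<open>Quantifiers written with HOL binders bind \<open>n\<close>, \<open>n + 1\<close> and so
  on, above all variables mentioned from outside; these therefore keep their values.\<close>

lemma upd_old: "x < n \<Longrightarrow> (s(n := a)) x = s x" for x n :: nat
  by simp

lemma sat_fb:
  "sat A E s ((x \<^bold>\<in> y) n) \<longleftrightarrow> E (s x) (s y)"
  "sat A E s ((x \<^bold>= y) n) \<longleftrightarrow> s x = s y"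
  "sat A E s (\<^bold>\<bottom> n) \<longleftrightarrow> False"
  "sat A E s ((\<phi> \<^bold>\<longrightarrow> \<psi>) n) \<longleftrightarrow> (sat A E s (\<phi> n) \<longrightarrow> sat A E s (\<psi> n))"
  "sat A E s ((\<^bold>\<not> \<phi>) n) \<longleftrightarrow> \<not> sat A E s (\<phi> n)"
  "sat A E s ((\<phi> \<^bold>\<and> \<psi>) n) \<longleftrightarrow> sat A E s (\<phi> n) \<and> sat A E s (\<psi> n)"
  "sat A E s ((\<phi> \<^bold>\<or> \<psi>) n) \<longleftrightarrow> sat A E s (\<phi> n) \<or> sat A E s (\<psi> n)"
  "sat A E s ((\<phi> \<^bold>\<longleftrightarrow> \<psi>) n) \<longleftrightarrow> (sat A E s (\<phi> n) \<longleftrightarrow> sat A E s (\<psi> n))"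
  "sat A E s (bAll \<Phi> n) \<longleftrightarrow> (\<forall>a\<in>A. sat A E (s(n := a)) (\<Phi> n (Suc n)))"
  "sat A E s (bEx \<Phi> n) \<longleftrightarrow> (\<exists>a\<in>A. sat A E (s(n := a)) (\<Phi> n (Suc n)))"
  "sat A E s (all_var v \<phi> n) \<longleftrightarrow> (\<forall>a\<in>A. sat A E (s(v := a)) (\<phi> n))"
  "sat A E s (ex_var v \<phi> n) \<longleftrightarrow> (\<exists>a\<in>A. sat A E (s(v := a)) (\<phi> n))"
  "sat A E s (fixed \<chi> n) \<longleftrightarrow> sat A E s \<chi>"
  by (auto simp: bMem_def bEq_def bFalse_def bImp_def bNot_def bAnd_def bOr_def bIff_def bAll_def
      bEx_def all_var_def ex_var_def fixed_def)

lemmas sat_simps = sat_fb upd_old fun_upd_same less_SucI lessI sentence_def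

lemma valid_closure: "valid A E (universal_closure \<phi>) = valid A E \<phi>"
  by (simp add: universal_closure_def valid_fold_Forall)

lemma vars_less_fresh: "v \<in> vars \<phi> \<Longrightarrow> v < fresh \<phi>"
  unfolding fresh_def by (simp add: less_Suc_eq_le)

lemma valid_separation:
  "valid A E (separation \<phi>) \<longleftrightarrow> (\<forall>s a. range s \<subseteq> A \<longrightarrow> a \<in> A \<longrightarrow>
    (\<exists>b\<in>A. \<forall>x\<in>A. E x b \<longleftrightarrow> E x a \<and> sat A E (s(0 := x)) \<phi>))"
proof -
  let ?f = "fresh \<phi>"
  have f: "0 < ?f" by (simp add: fresh_def)
  have cong: "sat A E (s(?f := a, Suc ?f := b, 0 := x)) \<phi> = sat A E (s(0 := x)) \<phi>" for s a b x
    by (rule sat_cong) (use vars_less_fresh fv_subset_vars in fastforce)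
  have *: "(s(?f := a, Suc ?f := b, 0 := x)) 0 = x" "(s(?f := a, Suc ?f := b, 0 := x)) ?f = a"
    "(s(?f := a, Suc ?f := b, 0 := x)) (Suc ?f) = b" for s :: "nat \<Rightarrow> 'a" and a b x
    using f by simp_all
  show ?thesis
    unfolding separation_def valid_closure unfolding valid_def by (simp only: sat_fb cong *) blast
qed

lemma valid_replacement:
  "valid A E (replacement \<phi>) \<longleftrightarrow> (\<forall>s a. range s \<subseteq> A \<longrightarrow> a \<in> A \<longrightarrow>
    (\<forall>x\<in>A. E x a \<longrightarrow> (\<exists>c\<in>A. \<forall>y\<in>A. sat A E (s(0 := x, 1 := y)) \<phi> \<longleftrightarrow> y = c)) \<longrightarrow>
    (\<exists>b\<in>A. \<forall>y\<in>A. E y b \<longleftrightarrow> (\<exists>x\<in>A. E x a \<and> sat A E (s(0 := x, 1 := y)) \<phi>)))"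
proof -
  let ?f = "Suc (fresh \<phi>)"
  have f: "1 < ?f" by (simp add: fresh_def)
  have lt: "v < ?f" if "v \<in> fv \<phi>" for v
    using vars_less_fresh[of v \<phi>] fv_subset_vars[of \<phi>] that by auto
  have cong1: "sat A E (s(?f := a, 0 := x, Suc ?f := c, 1 := y)) \<phi> = sat A E (s(0 := x, 1 := y)) \<phi>" for s a c x y
    by (rule sat_cong) (use lt in fastforce)
  have cong2: "sat A E (s(?f := a, Suc ?f := b, 1 := y, 0 := x)) \<phi> = sat A E (s(0 := x, 1 := y)) \<phi>" for s a b x y
    by (rule sat_cong) (use lt in fastforce)
  have *: "(s(?f := a, 0 := x)) 0 = x" "(s(?f := a, 0 := x)) ?f = a"
    "(s(?f := a, 0 := x, Suc ?f := c, 1 := y)) 1 = y" "(s(?f := a, 0 := x, Suc ?f := c, 1 := y)) (Suc ?f) = c"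
    "(s(?f := a, Suc ?f := b, 1 := y)) 1 = y" "(s(?f := a, Suc ?f := b, 1 := y)) (Suc ?f) = b"
    "(s(?f := a, Suc ?f := b, 1 := y, 0 := x)) 0 = x" "(s(?f := a, Suc ?f := b, 1 := y, 0 := x)) ?f = a"
    for s :: "nat \<Rightarrow> 'a" and a b c x y
    using f by simp_all
  show ?thesis
    unfolding replacement_def valid_closure unfolding valid_def by (simp only: sat_fb cong1 cong2 *) blast
qed

section \<open>Meaning of the single axioms\<close>

lemma sat_is_subset: "x < n \<Longrightarrow> y < n \<Longrightarrow>
    sat A E s (is_subset x y n) \<longleftrightarrow> (\<forall>z\<in>A. E z (s x) \<longrightarrow> E z (s y))"
  by (simp add: is_subset_def sat_simps del: fun_upd_apply)

lemma sat_is_empty: "x < n \<Longrightarrow> sat A E s (is_empty x n) \<longleftrightarrow> (\<forall>z\<in>A. \<not> E z (s x))"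
  by (simp add: is_empty_def sat_simps del: fun_upd_apply)

lemma sat_is_succ: "x < n \<Longrightarrow> y < n \<Longrightarrow>
    sat A E s (is_succ x y n) \<longleftrightarrow> (\<forall>z\<in>A. E z (s y) \<longleftrightarrow> E z (s x) \<or> z = s x)"
  by (simp add: is_succ_def sat_simps del: fun_upd_apply)

lemma sat_is_upair: "x < n \<Longrightarrow> y < n \<Longrightarrow> u < n \<Longrightarrow>
    sat A E s (is_upair x y u n) \<longleftrightarrow> (\<forall>z\<in>A. E z (s u) \<longleftrightarrow> z = s x \<or> z = s y)"
  by (simp add: is_upair_def sat_simps del: fun_upd_apply)

lemma sat_extensionality: "sat A E s extensionality \<longleftrightarrow>
    (\<forall>x\<in>A. \<forall>y\<in>A. (\<forall>z\<in>A. E z x \<longleftrightarrow> E z y) \<longrightarrow> x = y)"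
  by (simp add: extensionality_def sat_simps del: fun_upd_apply)

lemma sat_foundation: "sat A E s foundation \<longleftrightarrow>
    (\<forall>x\<in>A. (\<exists>y\<in>A. E y x) \<longrightarrow> (\<exists>y\<in>A. E y x \<and> \<not> (\<exists>z\<in>A. E z x \<and> E z y)))"
  by (simp add: foundation_def sat_simps del: fun_upd_apply)

lemma sat_pairing: "sat A E s pairing \<longleftrightarrow> (\<forall>x\<in>A. \<forall>y\<in>A. \<exists>u\<in>A. \<forall>z\<in>A. E z u \<longleftrightarrow> z = x \<or> z = y)"
  by (simp add: pairing_def sat_simps sat_is_upair del: fun_upd_apply)

lemma sat_union: "sat A E s union \<longleftrightarrow> (\<forall>x\<in>A. \<exists>u\<in>A. \<forall>z\<in>A. E z u \<longleftrightarrow> (\<exists>y\<in>A. E y x \<and> E z y))"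
  by (simp add: union_def sat_simps del: fun_upd_apply)

lemma sat_power_set: "sat A E s power_set \<longleftrightarrow>
    (\<forall>x\<in>A. \<exists>u\<in>A. \<forall>z\<in>A. E z u \<longleftrightarrow> (\<forall>w\<in>A. E w z \<longrightarrow> E w x))"
  by (simp add: power_set_def sat_simps sat_is_subset del: fun_upd_apply)

lemma sat_infinity: "sat A E s infinity \<longleftrightarrow> (\<exists>x\<in>A. (\<exists>e\<in>A. (\<forall>z\<in>A. \<not> E z e) \<and> E e x) \<and>
    (\<forall>y\<in>A. E y x \<longrightarrow> (\<exists>t\<in>A. (\<forall>z\<in>A. E z t \<longleftrightarrow> E z y \<or> z = y) \<and> E t x)))"
  by (simp add: infinity_def sat_simps sat_is_empty sat_is_succ del: fun_upd_apply)

lemmas sat_axioms = sat_extensionality sat_foundation sat_pairing sat_union sat_power_set sat_infinity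

text \<open>Bound variables become the odd numbers from 3 on; \<open>\<rho>\<close> names the free ones.\<close>

primrec dfm_fm :: "(nat \<Rightarrow> nat) \<Rightarrow> nat \<Rightarrow> dfm \<Rightarrow> fm" where
  "dfm_fm \<rho> d DFalse = Falsum"
| "dfm_fm \<rho> d (DMem i j) = Mem (\<rho> i) (\<rho> j)"
| "dfm_fm \<rho> d (DEq i j) = Eq (\<rho> i) (\<rho> j)"
| "dfm_fm \<rho> d (DRel i j k) = Falsum"
| "dfm_fm \<rho> d (DImp \<phi> \<psi>) = Imp (dfm_fm \<rho> d \<phi>) (dfm_fm \<rho> d \<psi>)"
| "dfm_fm \<rho> d (DAll \<phi>) = Forall (2 * d + 3) (dfm_fm (scons (2 * d + 3) \<rho>) (Suc d) \<phi>)"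

text \<open>The relation symbol is translated by \<open>Falsum\<close>, so the comparison is with
  the empty relation. The assumption keeps the free variables away from the numbers that are still
  to be bound.\<close>

lemma sat_dfm_fm:
  assumes "\<And>i e. d \<le> e \<Longrightarrow> \<rho> i \<noteq> 2 * e + 3"
  shows "sat A E s (dfm_fm \<rho> d \<phi>) = dsat A E (\<lambda>_ _ _. False) (\<lambda>i. s (\<rho> i)) \<phi>"
  using assms
proof (induction \<phi> arbitrary: \<rho> d s)
  case (DAll \<phi>)
  let ?v = "2 * d + 3"
  have "sat A E (s(?v := a)) (dfm_fm (scons ?v \<rho>) (Suc d) \<phi>) =
      dsat A E (\<lambda>_ _ _. False) (\<lambda>i. (s(?v := a)) (scons ?v \<rho> i)) \<phi>" for a
  proof (rule DAll.IH)
    show "scons ?v \<rho> i \<noteq> 2 * e + 3" if "Suc d \<le> e" for i e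
      using DAll.prems[of e "i - 1"] that by (cases i) auto
  qed
  moreover have "(\<lambda>i. (s(?v := a)) (scons ?v \<rho> i)) = scons a (\<lambda>i. s (\<rho> i))" for a
  proof
    show "(s(?v := a)) (scons ?v \<rho> i) = scons a (\<lambda>i. s (\<rho> i)) i" for i
      using DAll.prems[of d "i - 1"] by (cases i) auto
  qed
  ultimately show ?case by (simp del: fun_upd_apply)
qed simp_all

text \<open>The schemas of \<open>ZF\<close> speak of \<epsilon> alone, which is why the extra
  relation is empty. A definition with parameters becomes a formula together with an assignment that
  supplies the parameters.\<close>

theorem zf_if_valid:
  assumes "\<And>\<phi>. \<phi> \<in> ZF \<Longrightarrow> valid UNIV E \<phi>"
  shows "zf E (\<lambda>_ _ _. False)"
proof -
  have ax: "sat UNIV E s \<phi>" if "\<phi> \<in> ZF" for s \<phi>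
    using assms[OF that] by (simp add: valid_def)
  have mem: "extensionality \<in> ZF" "foundation \<in> ZF" "pairing \<in> ZF" "union \<in> ZF" "power_set \<in> ZF" "infinity \<in> ZF"
    "separation \<phi> \<in> ZF" "replacement \<phi> \<in> ZF" for \<phi>
    by (simp_all add: ZF_def)
  \<comment> \<open>In \<open>mix\<close> the first two variables sit at slots 0 and 2; they become
    the distinguished variables 0 and 1 of the schemas. All other slots get even numbers, away from
    the odd bound variables.\<close>
  define \<rho> :: "nat \<Rightarrow> nat" where "\<rho> i = (if i = 0 then 0 else if i = 2 then 1 else 2 * i)" for i
  have \<rho>: "\<rho> i \<noteq> 2 * e + 3" for i e unfolding \<rho>_def by presburger
  have \<rho>_inj: "\<rho> i = \<rho> j \<longleftrightarrow> i = j" for i j unfolding \<rho>_def by presburger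
  have pull: "\<exists>\<psi> t. \<forall>x y. P (scons x (scons y (\<lambda>_. c))) = sat UNIV E (t(0 := x, 1 := y)) \<psi>"
    if P: "Def E (\<lambda>_ _ _. False) UNIV P" for P c
  proof -
    from Def_imp_dsat_params[OF P UNIV_I] obtain \<phi> e where
      \<phi>: "\<And>s. P s = dsat UNIV E (\<lambda>_ _ _. False) (mix s e) \<phi>" by blast
    let ?m = "mix (scons c (scons c (\<lambda>_. c))) e"
    define t where "t v = ?m (inv \<rho> v)" for v
    have inv: "inv \<rho> (\<rho> i) = i" for i by (rule inv_f_f) (use \<rho>_inj in \<open>auto simp: inj_def\<close>)
    have "(\<lambda>i. (t(0 := x, 1 := y)) (\<rho> i)) = mix (scons x (scons y (\<lambda>_. c))) e" for x y
    proof
      fix i :: nat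
      consider "i = 0" | "i = 2" | "i \<noteq> 0" "i \<noteq> 2" by blast
      then show "(t(0 := x, 1 := y)) (\<rho> i) = mix (scons x (scons y (\<lambda>_. c))) e i"
      proof cases
        case 3
        then have "\<rho> i \<noteq> 0" "\<rho> i \<noteq> 1" unfolding \<rho>_def by presburger+
        then have "(t(0 := x, 1 := y)) (\<rho> i) = ?m i" by (simp add: t_def inv)
        also have "\<dots> = mix (scons x (scons y (\<lambda>_. c))) e i"
          using 3 by (auto simp: mix_def scons_def split: nat.split elim!: evenE)
        finally show ?thesis .
      qed (simp_all add: \<rho>_def mix_def)
    qed
    then have "sat UNIV E (t(0 := x, 1 := y)) (dfm_fm \<rho> 0 \<phi>) = P (scons x (scons y (\<lambda>_. c)))" for x y
      by (simp add: sat_dfm_fm[OF \<rho>] \<phi> del: fun_upd_apply)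
    then show ?thesis by blast
  qed
  show ?thesis
  proof
    show "\<exists>b. \<forall>x. E x b \<longleftrightarrow> E x a \<and> P x" if P: "Def E (\<lambda>_ _ _. False) UNIV (\<lambda>s. P (s 0))" for P a
    proof -
      from pull[OF P, of a] obtain \<psi> t where t: "\<And>x y. P x = sat UNIV E (t(0 := x, 1 := y)) \<psi>" by auto
      have eq: "P x = sat UNIV E ((t(1 := a))(0 := x)) \<psi>" for x
        using t[of x a] by (simp add: fun_upd_twist del: fun_upd_apply)
      from assms[OF mem(7)[of \<psi>], unfolded valid_separation, THEN spec[of _ "t(1 := a)"], THEN spec[of _ a]]
      show ?thesis unfolding eq by simp
    qed
    show "\<exists>b. \<forall>y. E y b \<longleftrightarrow> (\<exists>x. E x a \<and> Q x y)"
      if Q: "Def E (\<lambda>_ _ _. False) UNIV (\<lambda>s. Q (s 0) (s (Suc 0)))" and ex: "\<And>x. E x a \<Longrightarrow> \<exists>!y. Q x y" for Q a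
    proof -
      from pull[OF Q, of a] obtain \<psi> t where t: "\<And>x y. Q x y = sat UNIV E (t(0 := x, 1 := y)) \<psi>" by auto
      have "\<exists>c. \<forall>y. sat UNIV E (t(0 := x, 1 := y)) \<psi> \<longleftrightarrow> y = c" if "E x a" for x
        using ex[OF that] unfolding t by blast
      then have "\<forall>x\<in>UNIV. E x a \<longrightarrow> (\<exists>c\<in>UNIV. \<forall>y\<in>UNIV. sat UNIV E (t(0 := x, 1 := y)) \<psi> \<longleftrightarrow> y = c)"
        by (simp del: fun_upd_apply)
      with assms[OF mem(8)[of \<psi>], unfolded valid_replacement, THEN spec[of _ t], THEN spec[of _ a]]
      show ?thesis unfolding t by (simp del: fun_upd_apply)
    qed
    show "x = y" if "\<And>z. E z x \<longleftrightarrow> E z y" for x y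
      using ax[OF mem(1), unfolded sat_axioms] that by simp
    show "\<exists>y. E y x \<and> (\<forall>z. E z x \<longrightarrow> \<not> E z y)" if "E y x" for x y
      using ax[OF mem(2), unfolded sat_axioms, THEN bspec[OF _ UNIV_I[of x]]] that by auto
    show "\<exists>u. \<forall>z. E z u \<longleftrightarrow> z = x \<or> z = y" for x y
      using ax[OF mem(3), unfolded sat_axioms] by simp
    show "\<exists>u. \<forall>z. E z u \<longleftrightarrow> (\<exists>y. E y x \<and> E z y)" for x
      using ax[OF mem(4), unfolded sat_axioms] by simp
    show "\<exists>u. \<forall>z. E z u \<longleftrightarrow> (\<forall>w. E w z \<longrightarrow> E w x)" for x
      using ax[OF mem(5), unfolded sat_axioms] by simp
    show "\<exists>x. (\<exists>e. (\<forall>z. \<not> E z e) \<and> E e x) \<and> (\<forall>y. E y x \<longrightarrow> (\<exists>s. (\<forall>z. E z s \<longleftrightarrow> E z y \<or> z = y) \<and> E s x))"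
      using ax[OF mem(6), unfolded sat_axioms] by simp
  qed
qed

text \<open>By pairing and union, every finite set of elements is covered by a single element. With
  a finite domain that element would contain itself, against foundation applied to its
  singleton.\<close>

lemma infinite_model:
  assumes "valid A E foundation" "valid A E pairing" "valid A E union" "A \<noteq> {}"
  shows "infinite A"
proof
  assume "finite A"
  from assms(4) obtain a0 where a0: "a0 \<in> A" by blast
  then have s: "range (\<lambda>_ :: nat. a0) \<subseteq> A" by simp
  have f: "sat A E (\<lambda>_. a0) foundation" "sat A E (\<lambda>_. a0) pairing" "sat A E (\<lambda>_. a0) union"
    using assms(1-3) s unfolding valid_def by blast+
  note pa = f(2)[unfolded sat_pairing, rule_format] and un = f(3)[unfolded sat_union, rule_format]
  have "\<exists>u\<in>A. \<forall>z\<in>B. E z u" if "finite B" "B \<subseteq> A" for B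
    using that
  proof (induction B)
    case empty
    then show ?case using a0 by blast
  next
    case (insert x B)
    then obtain u where u: "u \<in> A" "\<forall>z\<in>B. E z u" by blast
    from insert.prems have x: "x \<in> A" by simp
    from pa[OF x x] obtain v where v: "v \<in> A" "E x v" using x by blast
    from pa[OF u(1) v(1)] obtain w where w: "w \<in> A" "E u w" "E v w" using u(1) v(1) by blast
    from un[OF w(1)] obtain y where y: "y \<in> A" "\<And>z. z \<in> A \<Longrightarrow> E z y \<longleftrightarrow> (\<exists>y\<in>A. E y w \<and> E z y)" by blast
    have "E z y" if "z \<in> insert x B" for z
      using that u v w y(2)[of z] insert.prems by blast
    with y(1) show ?case by blast
  qed
  from this[OF \<open>finite A\<close>] obtain u where u: "u \<in> A" "E u u" by blast
  from pa[OF u(1) u(1)] obtain v where v: "v \<in> A" "\<And>z. z \<in> A \<Longrightarrow> E z v \<longleftrightarrow> z = u" by blast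
  then have "E u v" using u(1) by blast
  then show False using f(1)[unfolded sat_foundation, rule_format, of v] u v by blast
qed

text \<open>An infinite set of numbers is in bijection with all of them, so the model can be moved
  to the whole type and quantifiers need no domain.\<close>

theorem total_model:
  assumes "consistent T" "ZF \<subseteq> T"
  shows "\<exists>E :: nat \<Rightarrow> nat \<Rightarrow> bool. \<forall>\<phi>\<in>T. valid UNIV E \<phi>"
proof -
  from completeness[OF assms(1)] obtain A :: "nat set" and E where
    A: "A \<noteq> {}" "\<And>\<phi>. \<phi> \<in> T \<Longrightarrow> valid A E \<phi>" by blast
  have "foundation \<in> T" "pairing \<in> T" "union \<in> T" using assms(2) by (auto simp: ZF_def)
  with A have "infinite A" by (intro infinite_model) auto
  then have bij: "bij_betw (enumerate A) UNIV A" by (rule bij_enumerate)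
  let ?f = "enumerate A"
  have inj: "?f x = ?f y \<longleftrightarrow> x = y" for x y
    using bij by (auto simp: bij_betw_def inj_eq)
  have ran: "range ?f = A" using bij by (simp add: bij_betw_def)
  define E' where "E' i j = E (?f i) (?f j)" for i j
  have "sat UNIV E' s \<phi> = sat A E (?f \<circ> s) \<phi>" for s \<phi>
  proof (induction \<phi> arbitrary: s)
    case (Forall v \<phi>)
    have "?f \<circ> s(v := a) = (?f \<circ> s)(v := ?f a)" for a by auto
    moreover have "(\<forall>a\<in>A. P a) \<longleftrightarrow> (\<forall>a. P (?f a))" for P
      using ball_simps(9)[of ?f UNIV P] by (simp only: ran ball_UNIV)
    ultimately show ?case using Forall by (simp del: fun_upd_apply comp_apply)
  qed (simp_all add: E'_def inj)
  moreover have "range (?f \<circ> s) \<subseteq> A" for s :: "nat \<Rightarrow> nat" using ran by auto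
  ultimately have "valid UNIV E' \<phi>" if "\<phi> \<in> T" for \<phi>
    using A(2)[OF that] unfolding valid_def by simp
  then show ?thesis by blast
qed

section \<open>Enumerating definable sets\<close>

lemma dsat_cong_rel:
  "(\<And>a b c. a \<in> A \<Longrightarrow> b \<in> A \<Longrightarrow> c \<in> A \<Longrightarrow> R a b c = R' a b c) \<Longrightarrow> (\<And>n. s n \<in> A) \<Longrightarrow>
    dsat A E R s \<phi> = dsat A E R' s \<phi>"
proof (induction \<phi> arbitrary: s)
  case (DAll \<phi>)
  have "dsat A E R (scons a s) \<phi> = dsat A E R' (scons a s) \<phi>" if "a \<in> A" for a
  proof (rule DAll.IH)
    show "scons a s n \<in> A" for n using that DAll.prems(2) by (cases n) auto
  qed (use DAll.prems(1) in auto)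
  then show ?case by simp
qed auto

context zf
begin

lemma dft_funpow [dfi]: "dft C a \<Longrightarrow> dft C (\<lambda>s. (suc ^^ i) (a s))"
  by (induction i) (auto intro: dfi)

lemma not_lim_suc: "\<not> lim (suc a)"
  unfolding lim_def using not_mem_self[of "suc a"] by (metis mem_suc)

text \<open>A successor is never a limit, so an ordinal \<open>l + i\<close> with \<open>l\<close> a
  limit and \<open>i\<close> an external number can be taken apart again; it carries the number of a
  formula along with a level.\<close>

lemma funpow_suc_lim_inject: "lim l \<Longrightarrow> lim l' \<Longrightarrow> (suc ^^ i) l = (suc ^^ j) l' \<Longrightarrow> i = j \<and> l = l'"
proof (induction i arbitrary: j)
  case 0
  then show ?case using not_lim_suc by (cases j) auto
next
  case (Suc i)
  then show ?case using not_lim_suc by (cases j) auto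
qed

lemma mem_funpow_suc: "x \<epsilon> a \<Longrightarrow> x \<epsilon> (suc ^^ i) a"
  by (induction i) auto

lemma ord_funpow: "ord a \<Longrightarrow> ord ((suc ^^ i) a)"
  by (induction i) auto

text \<open>The function \<open>h\<close> supplies the enumeration at smaller ordinals, which
  interprets the relation symbol; variable 0 is the element \<open>y\<close>, and all others stand
  for the parameter \<open>x\<close>. As the list is finite and external, the choice among its
  formulas is a finite disjunction.\<close>

definition stage :: "dfm list \<Rightarrow> 'u \<Rightarrow> 'u \<Rightarrow> 'u" where
  "stage F a h = sep (cart (vst a) (vst a)) (\<lambda>p. \<exists>x y. p = prd x y \<and> (\<exists>i\<in>{..<length F}. \<exists>l. lim l \<and>
     a = (suc ^^ i) l \<and> x \<epsilon> vst l \<and> y \<epsilon> vst l \<and>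
     dsat {z. z \<epsilon> vst l} (\<epsilon>) (\<lambda>b u v. ord b \<and> prd u v \<epsilon> app h b) (scons y (\<lambda>_. x)) (F ! i)))"

lemma df_stage_body:
  assumes l: "dft C l" and x: "dft C x" and y: "dft C y" and h: "dft C h"
  shows "df C (\<lambda>s. dsat {z. z \<epsilon> vst (l s)} (\<epsilon>) (\<lambda>b u v. ord b \<and> prd u v \<epsilon> app (h s) b)
    (scons (y s) (\<lambda>_. x s)) \<phi>)"
proof (rule df_dsat)
  show "df C (\<lambda>s. s 0 \<epsilon> vst (l (\<lambda>n. s (Suc n))))" by (intro dfi dft_ren[OF l])
  show "df C (\<lambda>s. ord (s 0) \<and> prd (s (Suc 0)) (s (Suc (Suc 0))) \<epsilon> app (h (\<lambda>n. s (Suc (Suc (Suc n))))) (s 0))"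
    by (intro dfi dft_ren[OF h])
  show "dft C (\<lambda>s. scons (y s) (\<lambda>_. x s) n)" for n by (cases n) (simp_all add: x y)
qed

lemma dft_stage [dfi]:
  assumes a: "dft C a" and h: "dft C h"
  shows "dft C (\<lambda>s. stage F (a s) (h s))"
  unfolding stage_def
  by (intro dfi df_finite_ex finite_lessThan df_stage_body dft_ren[OF a] dft_ren[OF h])

lemma mem_stage: "prd x y \<epsilon> stage F a h \<longleftrightarrow> x \<epsilon> vst a \<and> y \<epsilon> vst a \<and> (\<exists>i\<in>{..<length F}. \<exists>l. lim l \<and>
     a = (suc ^^ i) l \<and> x \<epsilon> vst l \<and> y \<epsilon> vst l \<and>
     dsat {z. z \<epsilon> vst l} (\<epsilon>) (\<lambda>b u v. ord b \<and> prd u v \<epsilon> app h b) (scons y (\<lambda>_. x)) (F ! i))"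
proof -
  have "df UNIV (\<lambda>s. \<exists>x y. s 0 = prd x y \<and> (\<exists>i\<in>{..<length F}. \<exists>l. lim l \<and>
     a = (suc ^^ i) l \<and> x \<epsilon> vst l \<and> y \<epsilon> vst l \<and>
     dsat {z. z \<epsilon> vst l} (\<epsilon>) (\<lambda>b u v. ord b \<and> prd u v \<epsilon> app h b) (scons y (\<lambda>_. x)) (F ! i)))"
    by (intro dfi dfp df_finite_ex finite_lessThan df_stage_body)
  from mem_sep[OF this, of "prd x y" "cart (vst a) (vst a)"] show ?thesis unfolding stage_def by auto
qed

text \<open>\<open>enum F a x\<close> holds of the elements of the set indexed by the ordinal \<open>a\<close> and the parameter \<open>x\<close>:
  at \<open>a = l + i\<close> with \<open>l\<close> a limit, this is the set defined from \<open>x\<close> by the \<open>i\<close>-th formula of \<open>F\<close> over \<open>V\<^sub>l\<close>,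
  where the formula may refer to the enumeration below \<open>l\<close>.\<close>

definition enum :: "dfm list \<Rightarrow> 'u \<Rightarrow> 'u \<Rightarrow> 'u \<Rightarrow> bool" where
  "enum F a x y \<longleftrightarrow> ord a \<and> prd x y \<epsilon> trec (stage F) a"

lemma df_enum: "dft C a \<Longrightarrow> dft C b \<Longrightarrow> dft C c \<Longrightarrow> df C (\<lambda>s. enum F (a s) (b s) (c s))"
  unfolding enum_def by (intro dfi)

text \<open>Over the level at \<open>l\<close> the relation symbol is evaluated only at elements of
  that level, and the ordinals among them are those below \<open>l\<close>, which the recursion has
  already treated. So the finished enumeration may be put in its place.\<close>

lemma enum_step:
  assumes l: "lim l" and i: "i < length F" and x: "x \<epsilon> vst l"
  shows "enum F ((suc ^^ i) l) x y \<longleftrightarrow> y \<epsilon> vst l \<and>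
    dsat {z. z \<epsilon> vst l} (\<epsilon>) (enum F) (scons y (\<lambda>_. x)) (F ! i)"
proof -
  have G: "dft UNIV (\<lambda>s. stage F (s (Suc 0)) (s 0))" by (intro dfi)
  let ?a = "(suc ^^ i) l"
  let ?h = "lam (tc ?a) (trec (stage F))"
  have oa: "ord ?a" using lim_ord[OF l] by (rule ord_funpow)
  have la: "sub (vst l) (vst ?a)" by (rule vst_mono) (simp add: sub_def mem_funpow_suc)
  have R: "(ord b \<and> prd u v \<epsilon> app ?h b) = enum F b u v" if "b \<epsilon> vst l" for b u v
  proof (cases "ord b")
    case True
    with that have "b \<epsilon> l" using ord_mem_vst[OF True lim_ord[OF l]] by simp
    then have "b \<epsilon> tc ?a" by (intro mem_tc mem_funpow_suc)
    then show ?thesis using app_lam_trec[OF G] True by (simp add: enum_def)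
  qed (simp add: enum_def)
  have "enum F ?a x y \<longleftrightarrow> prd x y \<epsilon> stage F ?a ?h"
    unfolding enum_def using oa by (subst trec[OF G]) simp
  also have "\<dots> \<longleftrightarrow> y \<epsilon> vst l \<and>
     dsat {z. z \<epsilon> vst l} (\<epsilon>) (\<lambda>b u v. ord b \<and> prd u v \<epsilon> app ?h b) (scons y (\<lambda>_. x)) (F ! i)"
  proof -
    define D where "D l i \<longleftrightarrow> dsat {z. z \<epsilon> vst l} (\<epsilon>) (\<lambda>b u v. ord b \<and> prd u v \<epsilon> app ?h b)
      (scons y (\<lambda>_. x)) (F ! i)" for l i
    have ms: "prd x y \<epsilon> stage F ?a ?h \<longleftrightarrow> x \<epsilon> vst ?a \<and> y \<epsilon> vst ?a \<and> (\<exists>j\<in>{..<length F}. \<exists>k. lim k \<and>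
        ?a = (suc ^^ j) k \<and> x \<epsilon> vst k \<and> y \<epsilon> vst k \<and> D k j)"
      unfolding mem_stage D_def by (rule refl)
    have "prd x y \<epsilon> stage F ?a ?h \<longleftrightarrow> y \<epsilon> vst l \<and> D l i"
    proof
    assume "prd x y \<epsilon> stage F ?a ?h"
    then obtain i' l' where *: "lim l'" "?a = (suc ^^ i') l'" "y \<epsilon> vst l'" "D l' i'"
      unfolding ms by (elim conjE bexE exE)
    from funpow_suc_lim_inject[OF l *(1,2)] have "i = i'" "l = l'" by simp_all
    with *(3,4) show "y \<epsilon> vst l \<and> D l i" by simp
  next
    assume "y \<epsilon> vst l \<and> D l i"
    with x l i subD[OF la] show "prd x y \<epsilon> stage F ?a ?h"
      unfolding ms by (intro conjI bexI[of _ i] exI[of _ l]) simp_all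
    qed
    then show ?thesis by (simp only: D_def)
  qed
  also have "\<dots> \<longleftrightarrow> y \<epsilon> vst l \<and> dsat {z. z \<epsilon> vst l} (\<epsilon>) (enum F) (scons y (\<lambda>_. x)) (F ! i)"
  proof (intro conj_cong refl dsat_cong_rel)
    fix n assume "y \<epsilon> vst l"
    with x show "scons y (\<lambda>_. x) n \<in> {z. z \<epsilon> vst l}" by (cases n) auto
  qed (use R in auto)
  finally show ?thesis .
qed

text \<open>Being defined by recursion from a finite list, \<open>enum F\<close> is definable in the
  given structure, and the schemas for it reduce to the old ones.\<close>

lemma zf_enum: "zf (\<epsilon>) (enum F)"
proof -
  have *: "Def (\<epsilon>) R UNIV P" if "Def (\<epsilon>) (enum F) UNIV P" for P
    by (rule Def_interpret[OF that]) (intro df_enum dfi)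
  show ?thesis
  proof (rule zf.intro)
    show "\<exists>b. \<forall>x. x \<epsilon> b \<longleftrightarrow> x \<epsilon> a \<and> P x" if "Def (\<epsilon>) (enum F) UNIV (\<lambda>s. P (s 0))" for P a
      by (rule separate[OF *[OF that]])
    show "\<exists>b. \<forall>y. y \<epsilon> b \<longleftrightarrow> (\<exists>x. x \<epsilon> a \<and> Q x y)"
      if "Def (\<epsilon>) (enum F) UNIV (\<lambda>s. Q (s 0) (s (Suc 0)))" "\<And>x. x \<epsilon> a \<Longrightarrow> \<exists>!y. Q x y" for Q a
      by (rule replace[OF *[OF that(1)] that(2)])
  qed (fact extensional founded pairs unions powers infinite)+
qed

end

context zf
begin

definition captures :: "dfm \<Rightarrow> bool" where
  "captures \<phi> \<longleftrightarrow> (\<forall>x z. (\<forall>y. y \<epsilon> z \<longleftrightarrow> dsat UNIV (\<epsilon>) R (scons y (\<lambda>_. x)) \<phi>) \<longrightarrow>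
    (\<exists>a. ord a \<and> (\<forall>y. y \<epsilon> z \<longleftrightarrow> R a x y)))"

text \<open>Reflection in the structure with \<open>enum F\<close> gives a limit \<open>l\<close>,
  with \<open>x\<close> and \<open>z\<close> in its level, at which the formula is absolute; the set
  is then enumerated at \<open>l + i\<close>. That the formula mentions the enumeration causes no
  circle, as the enumeration is already a fixed relation.\<close>

lemma captures_enum:
  assumes "i < length F"
  shows "zf.captures (\<epsilon>) (enum F) (F ! i)"
proof -
  interpret e: zf "(\<epsilon>)" "enum F" by (rule zf_enum)
  show ?thesis unfolding e.captures_def
  proof (intro allI impI)
    fix x z assume z: "\<forall>y. y \<epsilon> z \<longleftrightarrow> dsat UNIV (\<epsilon>) (enum F) (scons y (\<lambda>_. x)) (F ! i)"
    obtain b where b: "ord b" "upr x z \<epsilon> vst b" using ex_vst by blast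
    from e.reflection[of "{F ! i}" b] b(1) obtain l where l: "lim l" "b \<epsilon> l"
      "\<And>s. (\<forall>n. s n \<epsilon> vst l) \<Longrightarrow> dsat {x. x \<epsilon> vst l} (\<epsilon>) (enum F) s (F ! i) = dsat UNIV (\<epsilon>) (enum F) s (F ! i)"
      by auto
    have "upr x z \<epsilon> vst l" using subD[OF ord_vst_mono[OF lim_ord[OF l(1)] l(2)] b(2)] .
    then have xz: "x \<epsilon> vst l" "z \<epsilon> vst l" using trans_setD[OF trans_vst] by auto
    have "y \<epsilon> z \<longleftrightarrow> enum F ((suc ^^ i) l) x y" for y
    proof -
      have "dsat {x. x \<epsilon> vst l} (\<epsilon>) (enum F) (scons y (\<lambda>_. x)) (F ! i) =
          dsat UNIV (\<epsilon>) (enum F) (scons y (\<lambda>_. x)) (F ! i)" if "y \<epsilon> vst l"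
        by (rule l(3)) (use that xz(1) in \<open>simp add: scons_def split: nat.split\<close>)
      then show ?thesis
        using z trans_setD[OF trans_vst xz(2)] enum_step[OF l(1) assms xz(1), of y] by blast
    qed
    then show "\<exists>a. ord a \<and> (\<forall>y. y \<epsilon> z \<longleftrightarrow> enum F a x y)"
      using ord_funpow[OF lim_ord[OF l(1)]] by blast
  qed
qed

end

section \<open>An ultraproduct\<close>

definition nonprincipal_ultrafilter :: "nat set set \<Rightarrow> bool" where
  "nonprincipal_ultrafilter M \<longleftrightarrow> {} \<notin> M \<and> (\<forall>X. finite X \<longrightarrow> - X \<in> M) \<and> (\<forall>X\<in>M. \<forall>Y\<in>M. X \<inter> Y \<in> M) \<and>
    (\<forall>X\<in>M. \<forall>Y. X \<subseteq> Y \<longrightarrow> Y \<in> M) \<and> (\<forall>X. X \<in> M \<or> - X \<in> M)"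

lemma nonprincipal_ultrafilter_exists: "\<exists>M. nonprincipal_ultrafilter M"
proof -
  define A where "A = {M :: nat set set. {} \<notin> M \<and> (\<forall>X. finite X \<longrightarrow> - X \<in> M) \<and>
    (\<forall>X\<in>M. \<forall>Y\<in>M. X \<inter> Y \<in> M) \<and> (\<forall>X\<in>M. \<forall>Y. X \<subseteq> Y \<longrightarrow> Y \<in> M)}"
  have "{X. finite (- X)} \<in> A"
    unfolding A_def by (auto intro: finite_subset[of "- Y" "- X" for X Y])
  then have ne: "A \<noteq> {}" by blast
  have "\<exists>M\<in>A. \<forall>X\<in>A. M \<subseteq> X \<longrightarrow> X = M"
  proof (rule subset_Zorn_nonempty[OF ne])
    fix C assume C: "C \<noteq> {}" "subset.chain A C"
    have CA: "M \<in> A" if "M \<in> C" for M using C(2) that by (auto simp: subset.chain_def)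
    have comp: "M \<subseteq> N \<or> N \<subseteq> M" if "M \<in> C" "N \<in> C" for M N
      using C(2) that by (auto simp: subset.chain_def)
    show "\<Union>C \<in> A" unfolding A_def
    proof (intro CollectI conjI allI impI ballI)
      show "{} \<notin> \<Union>C" using CA by (auto simp: A_def)
      show "- X \<in> \<Union>C" if "finite X" for X using C(1) CA that by (auto simp: A_def)
      show "X \<inter> Y \<in> \<Union>C" if XY: "X \<in> \<Union>C" "Y \<in> \<Union>C" for X Y
      proof -
        from XY obtain M N where MN: "M \<in> C" "X \<in> M" "N \<in> C" "Y \<in> N" by blast
        from comp[OF MN(1,3)] show ?thesis
        proof
          assume "M \<subseteq> N"
          then have "X \<inter> Y \<in> N" using MN CA[OF MN(3)] by (auto simp: A_def)
          then show ?thesis using MN(3) by blast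
        next
          assume "N \<subseteq> M"
          then have "X \<inter> Y \<in> M" using MN CA[OF MN(1)] by (auto simp: A_def)
          then show ?thesis using MN(1) by blast
        qed
      qed
      show "Y \<in> \<Union>C" if "X \<in> \<Union>C" "X \<subseteq> Y" for X Y using that CA unfolding A_def by blast
    qed
  qed
  then obtain M where M: "M \<in> A" "\<And>N. N \<in> A \<Longrightarrow> M \<subseteq> N \<Longrightarrow> N = M" by blast
  have dich: "X \<in> M \<or> - X \<in> M" for X
  proof (rule ccontr)
    assume n: "\<not> (X \<in> M \<or> - X \<in> M)"
    \<comment> \<open>The filter generated by \<open>M\<close> and \<open>X\<close>; it is proper
      because otherwise \<open>- X\<close> would already belong to \<open>M\<close>.\<close>
    define N where "N = {Z. \<exists>Y\<in>M. Y \<inter> X \<subseteq> Z}"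
    have "N \<in> A" unfolding A_def
    proof (intro CollectI conjI allI impI ballI)
      show "{} \<notin> N"
      proof
        assume "{} \<in> N"
        then obtain Y where "Y \<in> M" "Y \<subseteq> - X" by (auto simp: N_def)
        then have "- X \<in> M" using M(1) by (auto simp: A_def)
        with n show False by blast
      qed
      show "- Z \<in> N" if "finite Z" for Z using that M(1) by (auto simp: N_def A_def)
      show "Y \<inter> Z \<in> N" if "Y \<in> N" "Z \<in> N" for Y Z
      proof -
        from that obtain U W where "U \<in> M" "W \<in> M" "U \<inter> X \<subseteq> Y" "W \<inter> X \<subseteq> Z" by (auto simp: N_def)
        moreover from this have "U \<inter> W \<in> M" using M(1) by (simp add: A_def)
        moreover have "U \<inter> W \<inter> X \<subseteq> Y \<inter> Z" using calculation by blast
        ultimately show ?thesis unfolding N_def mem_Collect_eq by (intro bexI[of _ "U \<inter> W"])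
      qed
      show "Z \<in> N" if "Y \<in> N" "Y \<subseteq> Z" for Y Z using that unfolding N_def by blast
    qed
    moreover have "M \<subseteq> N" by (auto simp: N_def)
    ultimately have "N = M" by (rule M(2))
    moreover have "UNIV \<in> M" using M(1) by (auto simp: A_def dest: spec[of _ "{}"])
    then have "X \<in> N" by (auto simp: N_def)
    ultimately show False using n by simp
  qed
  note M1 = M(1)[unfolded A_def mem_Collect_eq]
  show ?thesis unfolding nonprincipal_ultrafilter_def
    using M1 dich by (intro exI[of _ M] conjI allI) (elim conjE, assumption | elim conjE, erule spec | assumption)+
qed

definition uf :: "nat set set" where
  "uf = (SOME M. nonprincipal_ultrafilter M)"

lemma uf: "nonprincipal_ultrafilter uf"
  unfolding uf_def by (rule someI_ex[OF nonprincipal_ultrafilter_exists])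

lemma uf_simps:
  "{} \<notin> uf" "finite X \<Longrightarrow> - X \<in> uf" "X \<in> uf \<Longrightarrow> Y \<in> uf \<Longrightarrow> X \<inter> Y \<in> uf"
  "X \<in> uf \<Longrightarrow> X \<subseteq> Y \<Longrightarrow> Y \<in> uf" "X \<in> uf \<or> - X \<in> uf"
  using uf unfolding nonprincipal_ultrafilter_def by blast+

definition ae :: "(nat \<Rightarrow> bool) \<Rightarrow> bool" where
  "ae P \<longleftrightarrow> {k. P k} \<in> uf"

lemma ae_mono: "ae P \<Longrightarrow> (\<And>k. P k \<Longrightarrow> Q k) \<Longrightarrow> ae Q"
  unfolding ae_def by (erule uf_simps(4)) blast

lemma ae_conj: "ae (\<lambda>k. P k \<and> Q k) \<longleftrightarrow> ae P \<and> ae Q"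
  using uf_simps(3)[of "{k. P k}" "{k. Q k}"] ae_mono[of "\<lambda>k. P k \<and> Q k"]
  by (auto simp: ae_def Collect_conj_eq)

lemma ae_not: "ae (\<lambda>k. \<not> P k) \<longleftrightarrow> \<not> ae P"
proof
  show "ae (\<lambda>k. \<not> P k) \<Longrightarrow> \<not> ae P"
    using uf_simps(1) uf_simps(3)[of "{k. P k}" "{k. \<not> P k}"] by (auto simp: ae_def Collect_conj_eq[symmetric])
  show "\<not> ae P \<Longrightarrow> ae (\<lambda>k. \<not> P k)"
    using uf_simps(5)[of "{k. P k}"] by (simp add: ae_def Collect_neg_eq)
qed

lemma ae_imp: "ae (\<lambda>k. P k \<longrightarrow> Q k) \<longleftrightarrow> (ae P \<longrightarrow> ae Q)"
  using ae_not[of "\<lambda>k. P k \<and> \<not> Q k"] by (simp add: ae_conj ae_not)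

lemma ae_False: "\<not> ae (\<lambda>k. False)" and ae_True: "ae (\<lambda>k. True)"
  using uf_simps(1) uf_simps(2)[of "{}"] by (simp_all add: ae_def)

lemma ae_mp: "ae P \<Longrightarrow> ae Q \<Longrightarrow> (\<And>k. P k \<Longrightarrow> Q k \<Longrightarrow> S k) \<Longrightarrow> ae S"
  using ae_conj[of P Q] ae_mono[of "\<lambda>k. P k \<and> Q k" S] by blast

lemma ae_cong: "ae S \<Longrightarrow> (\<And>k. S k \<Longrightarrow> P k = Q k) \<Longrightarrow> ae P = ae Q"
  using ae_mp[of S P Q] ae_mp[of S Q P] by blast

lemma ae_ge: "ae (\<lambda>k. m \<le> k)"
  using uf_simps(2)[of "{..<m}"] by (simp add: ae_def Compl_eq not_less)

definition uf_eq :: "(nat \<Rightarrow> 'a) \<Rightarrow> (nat \<Rightarrow> 'a) \<Rightarrow> bool" where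
  "uf_eq f g \<longleftrightarrow> ae (\<lambda>k. f k = g k)"

lemma equivp_uf_eq: "equivp (uf_eq :: (nat \<Rightarrow> 'a) \<Rightarrow> _)"
proof (rule equivpI)
  show "reflp (uf_eq :: (nat \<Rightarrow> 'a) \<Rightarrow> _)" by (auto intro: reflpI simp: uf_eq_def ae_True)
  show "symp (uf_eq :: (nat \<Rightarrow> 'a) \<Rightarrow> _)" by (auto intro: sympI simp: uf_eq_def eq_commute)
  show "transp (uf_eq :: (nat \<Rightarrow> 'a) \<Rightarrow> _)"
  proof (rule transpI)
    show "uf_eq f h" if "uf_eq f g" "uf_eq g h" for f g h :: "nat \<Rightarrow> 'a"
      using that unfolding uf_eq_def by (rule ae_mp) simp
  qed
qed

quotient_type 'a ultra = "nat \<Rightarrow> 'a" / uf_eq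
  by (rule equivp_uf_eq)

lemma rep_abs_ultra: "ae (\<lambda>k. rep_ultra (abs_ultra f) k = f k)"
  using rep_abs_rsp[OF Quotient3_ultra, of f f] Quotient3_rep_abs[OF Quotient3_ultra, of f]
  by (simp add: uf_eq_def ae_True)

lemma ultra_eq_iff: "x = y \<longleftrightarrow> ae (\<lambda>k. rep_ultra x k = rep_ultra y k)"
  using Quotient3_rel_rep[OF Quotient3_ultra, of x y] by (simp add: uf_eq_def)

definition urel :: "('a \<Rightarrow> 'a \<Rightarrow> bool) \<Rightarrow> 'a ultra \<Rightarrow> 'a ultra \<Rightarrow> bool" where
  "urel E x y \<longleftrightarrow> ae (\<lambda>k. E (rep_ultra x k) (rep_ultra y k))"

definition urel3 :: "(nat \<Rightarrow> 'a \<Rightarrow> 'a \<Rightarrow> 'a \<Rightarrow> bool) \<Rightarrow> 'a ultra \<Rightarrow> 'a ultra \<Rightarrow> 'a ultra \<Rightarrow> bool" where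
  "urel3 R x y z \<longleftrightarrow> ae (\<lambda>k. R k (rep_ultra x k) (rep_ultra y k) (rep_ultra z k))"

text \<open>A function that picks a counterexample in every coordinate having one represents a
  counterexample in the ultrapower. The assumption says that \<open>P\<close> inspects its function
  at the given coordinate only.\<close>

lemma ae_all_ultra:
  assumes "\<And>f g k. f k = g k \<Longrightarrow> P f k = P g k"
  shows "(\<forall>x :: 'a ultra. ae (P (rep_ultra x))) \<longleftrightarrow> ae (\<lambda>k. \<forall>a. P (\<lambda>_. a) k)"
proof
  assume all: "\<forall>x. ae (P (rep_ultra x))"
  define f where "f k = (SOME a. \<not> P (\<lambda>_. a) k)" for k
  have *: "(\<forall>a. P (\<lambda>_. a) k) = P f k" for k
  proof
    assume "P f k"
    then have "P (\<lambda>_. f k) k" using assms[of f k "\<lambda>_. f k"] by simp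
    then show "\<forall>a. P (\<lambda>_. a) k" using someI[of "\<lambda>a. \<not> P (\<lambda>_. a) k"] unfolding f_def by blast
  qed (use assms[of f _ "\<lambda>_. f k" for k] in auto)
  have "ae (P (rep_ultra (abs_ultra f)))" using all by blast
  then have "ae (P f)" by (rule ae_mp[OF _ rep_abs_ultra[of f]]) (use assms in blast)
  then show "ae (\<lambda>k. \<forall>a. P (\<lambda>_. a) k)" by (simp add: *)
next
  assume "ae (\<lambda>k. \<forall>a. P (\<lambda>_. a) k)"
  then have "ae (P (rep_ultra x))" for x
  proof (rule ae_mono)
    fix k assume "\<forall>a. P (\<lambda>_. a) k"
    then show "P (rep_ultra x) k" using assms[of "rep_ultra x" k "\<lambda>_. rep_ultra x k"] by simp
  qed
  then show "\<forall>x. ae (P (rep_ultra x))" by blast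
qed

text \<open>Los's theorem. Membership is the same in all factors; only the extra relation varies
  with the coordinate.\<close>

lemma dsat_ultra:
  "dsat UNIV (urel E) (urel3 R) s \<phi> \<longleftrightarrow> ae (\<lambda>k. dsat UNIV E (R k) (\<lambda>n. rep_ultra (s n) k) \<phi>)"
proof (induction \<phi> arbitrary: s)
  case (DAll \<phi>)
  have *: "(\<lambda>n. rep_ultra (scons x s n) k) = scons (rep_ultra x k) (\<lambda>n. rep_ultra (s n) k)" for x k
    by (auto simp: scons_def fun_eq_iff split: nat.split)
  show ?case
    by (simp add: DAll * ae_all_ultra[of "\<lambda>f k. dsat UNIV E (R k) (scons (f k) (\<lambda>n. rep_ultra (s n) k)) \<phi>"])
qed (simp_all add: ae_False urel_def urel3_def ultra_eq_iff ae_imp)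

lemma sat_ultra: "sat UNIV (urel E) s \<phi> \<longleftrightarrow> ae (\<lambda>k. sat UNIV E (\<lambda>n. rep_ultra (s n) k) \<phi>)"
proof (induction \<phi> arbitrary: s)
  case (Forall v \<phi>)
  have *: "(\<lambda>n. rep_ultra ((s(v := x)) n) k) = (\<lambda>n. rep_ultra (s n) k)(v := rep_ultra x k)" for x k
    by auto
  show ?case
    by (simp add: Forall * ae_all_ultra[of "\<lambda>f k. sat UNIV E ((\<lambda>n. rep_ultra (s n) k)(v := f k)) \<phi>"]
        del: fun_upd_apply)
qed (simp_all add: ae_False urel_def ultra_eq_iff ae_imp)

lemma valid_ultra: "valid UNIV E \<phi> \<Longrightarrow> valid UNIV (urel E) \<phi>"
  by (simp add: valid_def sat_ultra ae_True)

text \<open>Factor \<open>k\<close> carries the enumeration for the first \<open>k\<close> formulas.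
  Any fixed formula is on the list in all but finitely many factors, so the ultrapower captures
  every formula at once, although no single factor is known to.\<close>

theorem ultra_model:
  fixes E :: "'a \<Rightarrow> 'a \<Rightarrow> bool"
  assumes val: "\<And>\<phi>. \<phi> \<in> ZF \<Longrightarrow> valid UNIV E \<phi>"
  shows "\<exists>R. zf (urel E) R \<and> (\<forall>\<phi>. zf.captures (urel E) R \<phi>)"
proof -
  interpret z: zf E "\<lambda>_ _ _. False" by (rule zf_if_valid[OF val])
  interpret u: zf "urel E" "\<lambda>_ _ _. False" by (rule zf_if_valid[OF valid_ultra[OF val]])
  define F where "F k = map (from_nat :: nat \<Rightarrow> dfm) [0..<k]" for k
  define Rk where "Rk k = z.enum (F k)" for k
  have zk: "zf E (Rk k)" for k unfolding Rk_def by (rule z.zf_enum)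
  have cap: "zf.captures E (Rk k) \<phi>" if "Suc (to_nat \<phi>) \<le> k" for \<phi> k
    using z.captures_enum[of "to_nat \<phi>" "F k"] that by (simp add: Rk_def F_def)
  let ?E = "urel E" and ?R = "urel3 Rk"
  have repmix: "(\<lambda>n. rep_ultra (mix s e n) k) = mix (\<lambda>n. rep_ultra (s n) k) (\<lambda>n. rep_ultra (e n) k)"
    for s e :: "nat \<Rightarrow> 'a ultra" and k by (simp add: mix_def fun_eq_iff)
  have repsc: "(\<lambda>n. rep_ultra (scons x s n) k) = scons (rep_ultra x k) (\<lambda>n. rep_ultra (s n) k)"
    for s and x :: "'a ultra" and k
    by (auto simp: scons_def fun_eq_iff split: nat.split)
  have Uz: "zf ?E ?R"
  proof (rule zf.intro)
    have sep: "\<exists>b. \<forall>x. ?E x b \<longleftrightarrow> ?E x a \<and> P x" if P: "Def ?E ?R UNIV (\<lambda>s. P (s 0))" for P a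
    proof -
      from Def_imp_dsat_params[OF P UNIV_I] obtain \<phi> e where
        \<phi>: "\<And>s. P (s 0) = dsat UNIV ?E ?R (mix s e) \<phi>" by blast
      let ?d = "\<lambda>k x. dsat UNIV E (Rk k) (mix (\<lambda>n. x) (\<lambda>n. rep_ultra (e n) k)) \<phi>"
      have "\<exists>b. \<forall>x. E x b \<longleftrightarrow> E x (rep_ultra a k) \<and> ?d k x" for k
      proof -
        interpret k: zf E "Rk k" by (rule zk)
        have "k.df UNIV (\<lambda>s. ?d k (s 0))"
        proof (rule k.df_dsat_UNIV)
          show "k.dft UNIV (\<lambda>s. mix (\<lambda>n. s 0) (\<lambda>n. rep_ultra (e n) k) n)" for n
            by (cases "even n") (auto simp: mix_def intro: dfi k.dfp)
        qed
        then show ?thesis by (rule k.separate)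
      qed
      then obtain b where b: "\<And>k x. E x (b k) \<longleftrightarrow> E x (rep_ultra a k) \<and> ?d k x" by metis
      have "?E x (abs_ultra b) \<longleftrightarrow> ?E x a \<and> P x" for x
      proof -
        have "?E x (abs_ultra b) \<longleftrightarrow> ae (\<lambda>k. E (rep_ultra x k) (b k))"
          unfolding urel_def by (rule ae_cong[OF rep_abs_ultra[of b]]) simp
        also have "\<dots> \<longleftrightarrow> ?E x a \<and> ae (\<lambda>k. ?d k (rep_ultra x k))"
          by (simp add: b ae_conj urel_def)
        also have "ae (\<lambda>k. ?d k (rep_ultra x k)) \<longleftrightarrow> P x"
          using \<phi>[of "\<lambda>_. x"] by (simp add: dsat_ultra repmix)
        finally show ?thesis .
      qed
      then show ?thesis by blast
    qed
    show "\<exists>b. \<forall>x. ?E x b \<longleftrightarrow> ?E x a \<and> P x" if P: "Def ?E ?R UNIV (\<lambda>s. P (s 0))" for P a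
      by (rule sep[OF P])
    show "\<exists>b. \<forall>y. ?E y b \<longleftrightarrow> (\<exists>x. ?E x a \<and> Q x y)"
      if Q: "Def ?E ?R UNIV (\<lambda>s. Q (s 0) (s (Suc 0)))" and ex: "\<And>x. ?E x a \<Longrightarrow> \<exists>!y. Q x y" for Q a
    proof -
      from Def_imp_dsat_params[OF Q UNIV_I] obtain \<phi> e where
        \<phi>: "\<And>s. Q (s 0) (s (Suc 0)) = dsat UNIV ?E ?R (mix s e) \<phi>" by blast
      let ?d = "\<lambda>k x y. dsat UNIV E (Rk k) (mix (scons x (\<lambda>n. y)) (\<lambda>n. rep_ultra (e n) k)) \<phi>"
      \<comment> \<open>Uniqueness of the values is known in the ultrapower but not in each factor.
        Collection holds in every factor regardless, and separation in the ultrapower then cuts the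
        bound down.\<close>
      have "\<exists>b. \<forall>x. E x (rep_ultra a k) \<longrightarrow> (\<exists>y. ?d k x y) \<longrightarrow> (\<exists>y. E y b \<and> ?d k x y)" for k
      proof -
        interpret k: zf E "Rk k" by (rule zk)
        have "k.df UNIV (\<lambda>s. ?d k (s 0) (s (Suc 0)))"
        proof (rule k.df_dsat_UNIV)
          show "k.dft UNIV (\<lambda>s. mix (scons (s 0) (\<lambda>n. s (Suc 0))) (\<lambda>n. rep_ultra (e n) k) n)" for n
            by (cases "even n"; cases "n div 2") (auto simp: mix_def intro: dfi k.dfp)
        qed
        then show ?thesis by (rule k.collection)
      qed
      then obtain b where
        b: "\<And>k x. E x (rep_ultra a k) \<Longrightarrow> \<exists>y. ?d k x y \<Longrightarrow> \<exists>y. E y (b k) \<and> ?d k x y" by metis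
      have Qd: "Q x y \<longleftrightarrow> ae (\<lambda>k. ?d k (rep_ultra x k) (rep_ultra y k))" for x y
        using \<phi>[of "scons x (\<lambda>_. y)"] by (simp add: dsat_ultra repmix repsc)
      have bound: "\<exists>y. ?E y (abs_ultra b) \<and> Q x y" if "?E x a" for x
      proof -
        from ex[OF that] obtain y where y: "Q x y" by blast
        define f where "f k = (SOME y. E y (b k) \<and> ?d k (rep_ultra x k) y)" for k
        have "ae (\<lambda>k. E (f k) (b k) \<and> ?d k (rep_ultra x k) (f k))"
        proof (rule ae_mp[OF that[unfolded urel_def] y[unfolded Qd]])
          fix k assume "E (rep_ultra x k) (rep_ultra a k)" "?d k (rep_ultra x k) (rep_ultra y k)"
          with b have "\<exists>y. E y (b k) \<and> ?d k (rep_ultra x k) y" by blast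
          then show "E (f k) (b k) \<and> ?d k (rep_ultra x k) (f k)" unfolding f_def by (rule someI_ex)
        qed
        then have 1: "ae (\<lambda>k. E (rep_ultra (abs_ultra f) k) (b k) \<and> ?d k (rep_ultra x k) (rep_ultra (abs_ultra f) k))"
          by (rule ae_mp[OF _ rep_abs_ultra[of f]]) simp
        then have "?E (abs_ultra f) (abs_ultra b)" unfolding urel_def
          by (rule ae_mp[OF _ rep_abs_ultra[of b]]) simp
        moreover have "Q x (abs_ultra f)" unfolding Qd using 1 by (rule ae_mono) simp
        ultimately show ?thesis by blast
      qed
      interpret r: rel_struct ?E ?R .
      have "r.df UNIV (\<lambda>s. \<exists>x. ?E x a \<and> Q x (s 0))"
        by (intro dfi r.dfp r.df2[OF Q])
      from sep[OF this, of "abs_ultra b"] obtain c where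
        c: "\<And>y. ?E y c \<longleftrightarrow> ?E y (abs_ultra b) \<and> (\<exists>x. ?E x a \<and> Q x y)" by blast
      have "?E y c \<longleftrightarrow> (\<exists>x. ?E x a \<and> Q x y)" for y
        unfolding c using bound ex by blast
      then show ?thesis by blast
    qed
  qed (fact u.extensional u.founded u.pairs u.unions u.powers u.infinite)+
  interpret U: zf ?E ?R by (rule Uz)
  \<comment> \<open>Being an ordinal is split into two formulas, transitivity and transitivity of
    the elements, so that it transfers between the ultrapower and its factors.\<close>
  define tf where "tf = DAll (DImp (DMem 0 1) (DAll (DImp (DMem 0 1) (DMem 0 2))))"
  define ef where "ef = DAll (DImp (DMem 0 1) (DAll (DImp (DMem 0 1) (DAll (DImp (DMem 0 1) (DMem 0 2))))))"
  have ord_dsat: "zf.ord E' a \<longleftrightarrow> dsat UNIV E' R' (\<lambda>_. a) tf \<and> dsat UNIV E' R' (\<lambda>_. a) ef"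
    if "zf E' R'" for E' :: "'b \<Rightarrow> 'b \<Rightarrow> bool" and R' a
  proof -
    interpret z': zf E' R' by (rule that)
    show ?thesis
      by (simp add: z'.ord_def z'.trans_set_def z'.sub_def tf_def ef_def numeral_2_eq_2)
  qed
  have ord_ultra: "U.ord a \<longleftrightarrow> ae (\<lambda>k. z.ord (rep_ultra a k))" for a
  proof -
    have "z.ord (rep_ultra a k) \<longleftrightarrow> dsat UNIV E (Rk k) (\<lambda>_. rep_ultra a k) tf \<and>
        dsat UNIV E (Rk k) (\<lambda>_. rep_ultra a k) ef" for k
      by (rule ord_dsat[OF zk])
    then show ?thesis by (simp add: ord_dsat[OF Uz] dsat_ultra ae_conj)
  qed
  have "U.captures \<phi>" for \<phi>
    unfolding U.captures_def
  proof (intro allI impI)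
    fix x z assume z: "\<forall>y. ?E y z \<longleftrightarrow> dsat UNIV ?E ?R (scons y (\<lambda>_. x)) \<phi>"
    let ?d = "\<lambda>k y. dsat UNIV E (Rk k) (scons y (\<lambda>_. rep_ultra x k)) \<phi>"
    have "\<forall>y. ae (\<lambda>k. E (rep_ultra y k) (rep_ultra z k) \<longleftrightarrow> ?d k (rep_ultra y k))"
      using z unfolding urel_def dsat_ultra repsc iff_conv_conj_imp ae_conj ae_imp by blast
    then have 1: "ae (\<lambda>k. \<forall>y. E y (rep_ultra z k) \<longleftrightarrow> ?d k y)"
      using ae_all_ultra[of "\<lambda>f k. E (f k) (rep_ultra z k) \<longleftrightarrow> ?d k (f k)"] by simp
    define a where "a k = (SOME a. z.ord a \<and> (\<forall>y. E y (rep_ultra z k) \<longleftrightarrow> Rk k a (rep_ultra x k) y))" for k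
    have "ae (\<lambda>k. z.ord (a k) \<and> (\<forall>y. E y (rep_ultra z k) \<longleftrightarrow> Rk k (a k) (rep_ultra x k) y))"
    proof (rule ae_mp[OF 1 ae_ge[of "Suc (to_nat \<phi>)"]])
      fix k assume "\<forall>y. E y (rep_ultra z k) \<longleftrightarrow> ?d k y" "Suc (to_nat \<phi>) \<le> k"
      then have "\<exists>a. z.ord a \<and> (\<forall>y. E y (rep_ultra z k) \<longleftrightarrow> Rk k a (rep_ultra x k) y)"
        using cap unfolding zf.captures_def[OF zk] by blast
      then show "z.ord (a k) \<and> (\<forall>y. E y (rep_ultra z k) \<longleftrightarrow> Rk k (a k) (rep_ultra x k) y)"
        unfolding a_def by (rule someI_ex)
    qed
    then have 2: "ae (\<lambda>k. z.ord (rep_ultra (abs_ultra a) k) \<and>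
        (\<forall>y. E y (rep_ultra z k) \<longleftrightarrow> Rk k (rep_ultra (abs_ultra a) k) (rep_ultra x k) y))"
      by (rule ae_mp[OF _ rep_abs_ultra[of a]]) simp
    then have "U.ord (abs_ultra a)" by (simp add: ord_ultra ae_conj)
    moreover have "?E y z \<longleftrightarrow> ?R (abs_ultra a) x y" for y
    proof -
      have "ae (\<lambda>k. E (rep_ultra y k) (rep_ultra z k) \<longleftrightarrow>
          Rk k (rep_ultra (abs_ultra a) k) (rep_ultra x k) (rep_ultra y k))"
        using 2 by (rule ae_mono) blast
      then show ?thesis unfolding urel_def urel3_def iff_conv_conj_imp ae_conj ae_imp by blast
    qed
    ultimately show "\<exists>a. U.ord a \<and> (\<forall>y. ?E y z \<longleftrightarrow> ?R a x y)" by blast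
  qed
  with Uz show ?thesis by blast
qed

section \<open>Sequences, strategies and games inside a model\<close>

context zf
begin

definition fn :: "'u \<Rightarrow> 'u \<Rightarrow> 'u \<Rightarrow> bool" where
  "fn f a b \<longleftrightarrow> (\<forall>p. p \<epsilon> f \<longrightarrow> (\<exists>x y. x \<epsilon> a \<and> y \<epsilon> b \<and> p = prd x y)) \<and>
    (\<forall>x. x \<epsilon> a \<longrightarrow> (\<exists>y. \<forall>z. prd x z \<epsilon> f \<longleftrightarrow> z = y))"

definition funs :: "'u \<Rightarrow> 'u \<Rightarrow> 'u" where "funs a b = setof (\<lambda>f. fn f a b)"
definition rst :: "'u \<Rightarrow> 'u \<Rightarrow> 'u" where "rst f n = sep f (\<lambda>p. \<exists>x y. x \<epsilon> n \<and> p = prd x y)"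
definition dom :: "'u \<Rightarrow> 'u" where "dom f = setof (\<lambda>x. \<exists>y. prd x y \<epsilon> f)"
definition seqs :: "'u \<Rightarrow> 'u" where "seqs X = funs om X"
definition fseqs :: "'u \<Rightarrow> 'u" where "fseqs X = setof (\<lambda>f. \<exists>n. n \<epsilon> om \<and> fn f n X)"
definition strats :: "'u \<Rightarrow> 'u" where "strats X = funs (fseqs X) X"
definition reals :: 'u where "reals = seqs om"

lemma df_fn [dfi]: "dft C f \<Longrightarrow> dft C a \<Longrightarrow> dft C b \<Longrightarrow> df C (\<lambda>s. fn (f s) (a s) (b s))"
  by (rule df3[of C fn]) (unfold fn_def, intro dfi)

lemma dft_funs [dfi]: "dft C a \<Longrightarrow> dft C b \<Longrightarrow> dft C (\<lambda>s. funs (a s) (b s))"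
  by (rule dft2[of C funs]) (unfold funs_def, intro dfi)

lemma dft_rst [dfi]: "dft C a \<Longrightarrow> dft C b \<Longrightarrow> dft C (\<lambda>s. rst (a s) (b s))"
  by (rule dft2[of C rst]) (unfold rst_def, intro dfi)

lemma dft_dom [dfi]: "dft C a \<Longrightarrow> dft C (\<lambda>s. dom (a s))"
  by (rule dft1[of C dom]) (unfold dom_def, intro dfi)

lemma dft_seqs [dfi]: "dft C a \<Longrightarrow> dft C (\<lambda>s. seqs (a s))"
  unfolding seqs_def by (intro dfi)

lemma dft_fseqs [dfi]: "dft C a \<Longrightarrow> dft C (\<lambda>s. fseqs (a s))"
  by (rule dft1[of C fseqs]) (unfold fseqs_def, intro dfi)

lemma dft_reals [dfi]: "dft C (\<lambda>s. reals)"
  unfolding reals_def by (intro dfi)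

lemma fn_sub_cart: "fn f a b \<Longrightarrow> sub f (cart a b)"
  by (auto simp: fn_def sub_def)

lemma mem_funs [simp]: "f \<epsilon> funs a b \<longleftrightarrow> fn f a b"
  unfolding funs_def
proof (rule mem_setof, rule isset_sub)
  show "df UNIV (\<lambda>s. fn (s 0) a b)" by (intro dfi dfp)
  show "f \<epsilon> pw (cart a b)" if "fn f a b" for f using fn_sub_cart[OF that] by simp
qed

lemma mem_seqs [simp]: "f \<epsilon> seqs X \<longleftrightarrow> fn f om X" by (simp add: seqs_def)
lemma mem_reals [simp]: "f \<epsilon> reals \<longleftrightarrow> fn f om om" by (simp add: reals_def)
lemma mem_strats [simp]: "f \<epsilon> strats X \<longleftrightarrow> fn f (fseqs X) X" by (simp add: strats_def)

lemma fn_app: "fn f a b \<Longrightarrow> x \<epsilon> a \<Longrightarrow> app f x \<epsilon> b"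
  and fn_pair: "fn f a b \<Longrightarrow> prd x y \<epsilon> f \<longleftrightarrow> x \<epsilon> a \<and> y = app f x"
proof -
  assume f: "fn f a b"
  have app: "prd x z \<epsilon> f \<longleftrightarrow> z = app f x" if "x \<epsilon> a" for x z
  proof -
    from f that obtain y where y: "\<forall>z. prd x z \<epsilon> f \<longleftrightarrow> z = y" unfolding fn_def by blast
    then have "app f x = y" by (intro app_eq) simp_all
    with y show ?thesis by simp
  qed
  have dom: "x \<epsilon> a \<and> y \<epsilon> b" if "prd x y \<epsilon> f" for x y
    using f that unfolding fn_def by fastforce
  show "x \<epsilon> a \<Longrightarrow> app f x \<epsilon> b" using app[of x "app f x"] dom by blast
  show "prd x y \<epsilon> f \<longleftrightarrow> x \<epsilon> a \<and> y = app f x" using app dom by blast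
qed

lemma fn_elt: "fn f a b \<Longrightarrow> p \<epsilon> f \<longleftrightarrow> (\<exists>x. x \<epsilon> a \<and> p = prd x (app f x))"
proof
  assume f: "fn f a b" and p: "p \<epsilon> f"
  then obtain x y where "p = prd x y" unfolding fn_def by blast
  with p fn_pair[OF f] show "\<exists>x. x \<epsilon> a \<and> p = prd x (app f x)" by auto
next
  assume f: "fn f a b" and "\<exists>x. x \<epsilon> a \<and> p = prd x (app f x)"
  then show "p \<epsilon> f" by (auto simp: fn_pair[OF f])
qed

lemma fn_ext: "fn f a b \<Longrightarrow> fn g a c \<Longrightarrow> (\<And>x. x \<epsilon> a \<Longrightarrow> app f x = app g x) \<Longrightarrow> f = g"
  by (rule extensional) (auto simp: fn_elt)

lemma fn_lam: "dft UNIV (\<lambda>s. F (s 0)) \<Longrightarrow> (\<And>x. x \<epsilon> a \<Longrightarrow> F x \<epsilon> b) \<Longrightarrow> fn (lam a F) a b"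
  unfolding fn_def by (auto simp: mem_lam prd_mem_lam)

lemma lam_cong: "(\<And>x. x \<epsilon> a \<Longrightarrow> F x = H x) \<Longrightarrow> lam a F = lam a H"
proof -
  assume *: "\<And>x. x \<epsilon> a \<Longrightarrow> F x = H x"
  have "(\<exists>x. x \<epsilon> a \<and> y = prd x (F x)) \<longleftrightarrow> (\<exists>x. x \<epsilon> a \<and> y = prd x (H x))" for y
  proof
    assume "\<exists>x. x \<epsilon> a \<and> y = prd x (F x)"
    then obtain x where "x \<epsilon> a" "y = prd x (F x)" by (elim exE conjE)
    with *[OF this(1)] show "\<exists>x. x \<epsilon> a \<and> y = prd x (H x)" by (intro exI[of _ x] conjI) simp_all
  next
    assume "\<exists>x. x \<epsilon> a \<and> y = prd x (H x)"
    then obtain x where "x \<epsilon> a" "y = prd x (H x)" by (elim exE conjE)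
    with *[OF this(1)] show "\<exists>x. x \<epsilon> a \<and> y = prd x (F x)" by (intro exI[of _ x] conjI) simp_all
  qed
  then show ?thesis unfolding lam_def repl_def by simp
qed

lemma mem_rst: "p \<epsilon> rst f n \<longleftrightarrow> p \<epsilon> f \<and> (\<exists>x y. x \<epsilon> n \<and> p = prd x y)"
  unfolding rst_def by (rule mem_sep) (intro dfi dfp)

lemma rst_eq_lam: "fn f a b \<Longrightarrow> sub n a \<Longrightarrow> rst f n = lam n (app f)"
proof (rule extensional)
  fix p assume f: "fn f a b" and n: "sub n a"
  have "dft UNIV (\<lambda>s. app f (s 0))" by (intro dfi dfp)
  from mem_lam[OF this] show "p \<epsilon> rst f n \<longleftrightarrow> p \<epsilon> lam n (app f)"
    using subD[OF n] by (auto simp: mem_rst fn_elt[OF f])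
qed

lemma fn_rst: "fn f a b \<Longrightarrow> sub n a \<Longrightarrow> fn (rst f n) n b"
proof -
  assume f: "fn f a b" and n: "sub n a"
  have "dft UNIV (\<lambda>s. app f (s 0))" by (intro dfi dfp)
  then show ?thesis unfolding rst_eq_lam[OF f n] by (rule fn_lam) (rule fn_app[OF f subD[OF n]])
qed

lemma app_rst: "fn f a b \<Longrightarrow> sub n a \<Longrightarrow> x \<epsilon> n \<Longrightarrow> app (rst f n) x = app f x"
proof -
  assume f: "fn f a b" and n: "sub n a" and x: "x \<epsilon> n"
  have "dft UNIV (\<lambda>s. app f (s 0))" by (intro dfi dfp)
  from app_lam[OF this x] show ?thesis by (simp add: rst_eq_lam[OF f n])
qed

lemma dom_fn: "fn f a b \<Longrightarrow> dom f = a"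
  unfolding dom_def by (rule setof_eq) (auto simp: fn_pair)

lemma mem_fseqs: "f \<epsilon> fseqs X \<longleftrightarrow> (\<exists>n. n \<epsilon> om \<and> fn f n X)"
  unfolding fseqs_def
proof (rule mem_setof, rule isset_sub)
  show "df UNIV (\<lambda>s. \<exists>n. n \<epsilon> om \<and> fn (s 0) n X)" by (intro dfi dfp)
  show "f \<epsilon> pw (cart om X)" if "\<exists>n. n \<epsilon> om \<and> fn f n X" for f
  proof -
    from that obtain n where n: "n \<epsilon> om" "fn f n X" by blast
    then show ?thesis using fn_sub_cart[OF n(2)] mem_om_om[OF n(1)] by (fastforce simp: sub_def)
  qed
qed

lemma fn_emp: "fn emp emp X" by (simp add: fn_def)

lemma emp_fseqs [simp]: "emp \<epsilon> fseqs X"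
  unfolding mem_fseqs using fn_emp emp_om by blast

lemma om_sub: "n \<epsilon> om \<Longrightarrow> sub n om"
  using om_elt by blast

lemma rst_fseqs: "fn x om X \<Longrightarrow> n \<epsilon> om \<Longrightarrow> rst x n \<epsilon> fseqs X"
  unfolding mem_fseqs using fn_rst[OF _ om_sub] by blast

subsection \<open>Parity and pairing\<close>

definition dbl :: "'u \<Rightarrow> 'u" where "dbl n = wrec (\<lambda>i z. suc (suc z)) emp n"
definition evs :: 'u where "evs = repl om dbl"
definition ods :: 'u where "ods = repl om (\<lambda>n. suc (dbl n))"
definition half :: "'u \<Rightarrow> 'u" where "half n = iota (\<lambda>m. m \<epsilon> om \<and> (n = dbl m \<or> n = suc (dbl m)))"

lemma dft_dbl [dfi]: "dft C a \<Longrightarrow> dft C (\<lambda>s. dbl (a s))"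
  unfolding dbl_def by (intro dfi)

lemma dft_evs [dfi]: "dft C (\<lambda>s. evs)" and dft_ods [dfi]: "dft C (\<lambda>s. ods)"
  unfolding evs_def ods_def by (intro dfi)+

lemma dft_half [dfi]: "dft C a \<Longrightarrow> dft C (\<lambda>s. half (a s))"
  by (rule dft1[of C half]) (unfold half_def, intro dfi)

lemma dbl_emp [simp]: "dbl emp = emp"
  unfolding dbl_def by (rule wrec_emp) (intro dfi)

lemma dbl_suc [simp]: "n \<epsilon> om \<Longrightarrow> dbl (suc n) = suc (suc (dbl n))"
  unfolding dbl_def by (rule wrec_suc) (intro dfi)

lemma dbl_om [simp]: "n \<epsilon> om \<Longrightarrow> dbl n \<epsilon> om"
  by (rule om_induct[where P = "\<lambda>n. dbl n \<epsilon> om"]) (intro dfi, simp_all)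

lemma mem_evs: "n \<epsilon> evs \<longleftrightarrow> (\<exists>m. m \<epsilon> om \<and> n = dbl m)"
  unfolding evs_def by (rule mem_repl) (intro dfi)

lemma mem_ods: "n \<epsilon> ods \<longleftrightarrow> (\<exists>m. m \<epsilon> om \<and> n = suc (dbl m))"
  unfolding ods_def by (rule mem_repl) (intro dfi)

lemma parity_cases: "n \<epsilon> om \<Longrightarrow> \<exists>m. m \<epsilon> om \<and> (n = dbl m \<or> n = suc (dbl m))"
proof (rule om_induct[where P = "\<lambda>n. \<exists>m. m \<epsilon> om \<and> (n = dbl m \<or> n = suc (dbl m))"])
  show "df UNIV (\<lambda>s. \<exists>m. m \<epsilon> om \<and> (s 0 = dbl m \<or> s 0 = suc (dbl m)))" by (intro dfi)
  show "\<exists>m. m \<epsilon> om \<and> (emp = dbl m \<or> emp = suc (dbl m))" by (rule exI[of _ emp]) simp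
  fix n assume "\<exists>m. m \<epsilon> om \<and> (n = dbl m \<or> n = suc (dbl m))"
  then obtain m where m: "m \<epsilon> om" "n = dbl m \<or> n = suc (dbl m)" by blast
  from m(2) show "\<exists>m. m \<epsilon> om \<and> (suc n = dbl m \<or> suc n = suc (dbl m))"
  proof
    assume "n = dbl m"
    with m(1) show ?thesis by blast
  next
    assume "n = suc (dbl m)"
    with m(1) show ?thesis by (intro exI[of _ "suc m"]) simp
  qed
qed

lemma dbl_neq_odd: "m \<epsilon> om \<Longrightarrow> k \<epsilon> om \<Longrightarrow> dbl m \<noteq> suc (dbl k)"
proof -
  have "m \<epsilon> om \<Longrightarrow> \<forall>k. k \<epsilon> om \<longrightarrow> dbl m \<noteq> suc (dbl k)"
  proof (rule om_induct[where P = "\<lambda>m. \<forall>k. k \<epsilon> om \<longrightarrow> dbl m \<noteq> suc (dbl k)"])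
    show "df UNIV (\<lambda>s. \<forall>k. k \<epsilon> om \<longrightarrow> dbl (s 0) \<noteq> suc (dbl k))" by (intro dfi)
    fix m assume m: "m \<epsilon> om" and IH: "\<forall>k. k \<epsilon> om \<longrightarrow> dbl m \<noteq> suc (dbl k)"
    show "\<forall>k. k \<epsilon> om \<longrightarrow> dbl (suc m) \<noteq> suc (dbl k)"
    proof (intro allI impI)
      fix k assume "k \<epsilon> om"
      from om_cases[OF this] m IH show "dbl (suc m) \<noteq> suc (dbl k)" by auto
    qed
  qed simp_all
  then show "m \<epsilon> om \<Longrightarrow> k \<epsilon> om \<Longrightarrow> ?thesis" by blast
qed

lemma dbl_inject: "m \<epsilon> om \<Longrightarrow> k \<epsilon> om \<Longrightarrow> dbl m = dbl k \<longleftrightarrow> m = k"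
proof -
  have "m \<epsilon> om \<Longrightarrow> \<forall>k. k \<epsilon> om \<longrightarrow> dbl m = dbl k \<longrightarrow> m = k"
  proof (rule om_induct[where P = "\<lambda>m. \<forall>k. k \<epsilon> om \<longrightarrow> dbl m = dbl k \<longrightarrow> m = k"])
    show "df UNIV (\<lambda>s. \<forall>k. k \<epsilon> om \<longrightarrow> dbl (s 0) = dbl k \<longrightarrow> s 0 = k)" by (intro dfi)
    show "\<forall>k. k \<epsilon> om \<longrightarrow> dbl emp = dbl k \<longrightarrow> emp = k"
    proof (intro allI impI)
      fix k assume "k \<epsilon> om" "dbl emp = dbl k"
      with om_cases[of k] show "emp = k" by auto
    qed
    fix m assume m: "m \<epsilon> om" and IH: "\<forall>k. k \<epsilon> om \<longrightarrow> dbl m = dbl k \<longrightarrow> m = k"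
    show "\<forall>k. k \<epsilon> om \<longrightarrow> dbl (suc m) = dbl k \<longrightarrow> suc m = k"
    proof (intro allI impI)
      fix k assume "k \<epsilon> om" "dbl (suc m) = dbl k"
      have "k \<noteq> emp" using \<open>dbl (suc m) = dbl k\<close> m by auto
      with om_cases[OF \<open>k \<epsilon> om\<close>] obtain j where j: "j \<epsilon> om" "k = suc j" by (elim disjE exE conjE) simp_all
      with m \<open>dbl (suc m) = dbl k\<close> have "dbl m = dbl j" by simp
      with IH j(1) have "m = j" by blast
      with j(2) show "suc m = k" by simp
    qed
  qed
  then show "m \<epsilon> om \<Longrightarrow> k \<epsilon> om \<Longrightarrow> ?thesis" by blast
qed

lemma half_dbl [simp]: "m \<epsilon> om \<Longrightarrow> half (dbl m) = m" "m \<epsilon> om \<Longrightarrow> half (suc (dbl m)) = m"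
proof -
  assume m: "m \<epsilon> om"
  show "half (dbl m) = m" unfolding half_def
    by (rule iota_eq) (use m dbl_neq_odd[OF m] dbl_inject[OF m] in auto)
next
  assume m: "m \<epsilon> om"
  show "half (suc (dbl m)) = m" unfolding half_def
  proof (rule iota_eq)
    fix y assume "y \<epsilon> om \<and> (suc (dbl m) = dbl y \<or> suc (dbl m) = suc (dbl y))"
    then show "y = m" using m dbl_neq_odd[of y m] dbl_inject[OF m, of y] by auto
  qed (use m in simp)
qed

lemma half_om: "n \<epsilon> om \<Longrightarrow> half n \<epsilon> om"
  using parity_cases[of n] by auto

lemma dbl_evs [simp]: "m \<epsilon> om \<Longrightarrow> dbl m \<epsilon> evs" "m \<epsilon> om \<Longrightarrow> \<not> suc (dbl m) \<epsilon> evs"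
  "m \<epsilon> om \<Longrightarrow> \<not> dbl m \<epsilon> ods" "m \<epsilon> om \<Longrightarrow> suc (dbl m) \<epsilon> ods"
  using dbl_neq_odd dbl_neq_odd[THEN not_sym] unfolding mem_evs mem_ods by blast+

lemma evs_om: "n \<epsilon> evs \<Longrightarrow> n \<epsilon> om" and ods_om: "n \<epsilon> ods \<Longrightarrow> n \<epsilon> om"
  by (auto simp: mem_evs mem_ods)

lemma ods_iff: "n \<epsilon> om \<Longrightarrow> n \<epsilon> ods \<longleftrightarrow> \<not> n \<epsilon> evs"
  using parity_cases[of n] by auto

lemma suc_evs: "n \<epsilon> om \<Longrightarrow> suc n \<epsilon> evs \<longleftrightarrow> \<not> n \<epsilon> evs"
proof -
  assume n: "n \<epsilon> om"
  from parity_cases[OF n] obtain m where m: "m \<epsilon> om" "n = dbl m \<or> n = suc (dbl m)" by (elim exE conjE)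
  have "suc (suc (dbl m)) \<epsilon> evs" using dbl_evs(1)[OF suc_om[OF m(1)]] m(1) by simp
  with m show ?thesis by auto
qed

lemma emp_evs [simp]: "emp \<epsilon> evs" "\<not> emp \<epsilon> ods" "\<not> suc emp \<epsilon> evs" "suc emp \<epsilon> ods"
  using dbl_evs[of emp] by simp_all

text \<open>Interleaving. As player I moves at even and player II at odd stages, \<open>lft\<close>
  and \<open>rgt\<close> of a play are the moves of the two players.\<close>

definition join :: "'u \<Rightarrow> 'u \<Rightarrow> 'u" where
  "join x y = lam om (\<lambda>n. if n \<epsilon> evs then app x (half n) else app y (half n))"
definition lft :: "'u \<Rightarrow> 'u" where "lft z = lam om (\<lambda>n. app z (dbl n))"
definition rgt :: "'u \<Rightarrow> 'u" where "rgt z = lam om (\<lambda>n. app z (suc (dbl n)))"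

lemma dft_join [dfi]: "dft C a \<Longrightarrow> dft C b \<Longrightarrow> dft C (\<lambda>s. join (a s) (b s))"
  by (rule dft2[of C join]) (unfold join_def, intro dfi)

lemma dft_lft [dfi]: "dft C a \<Longrightarrow> dft C (\<lambda>s. lft (a s))"
  by (rule dft1[of C lft]) (unfold lft_def, intro dfi)

lemma dft_rgt [dfi]: "dft C a \<Longrightarrow> dft C (\<lambda>s. rgt (a s))"
  by (rule dft1[of C rgt]) (unfold rgt_def, intro dfi)

lemma fn_join: "fn x om X \<Longrightarrow> fn y om X \<Longrightarrow> fn (join x y) om X"
  unfolding join_def by (rule fn_lam) (intro dfi dfp, simp add: fn_app half_om)

lemma fn_lft: "fn z om X \<Longrightarrow> fn (lft z) om X" and fn_rgt: "fn z om X \<Longrightarrow> fn (rgt z) om X"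
  unfolding lft_def rgt_def by (rule fn_lam; (intro dfi dfp)?; simp add: fn_app)+

lemma app_join: "m \<epsilon> om \<Longrightarrow> app (join x y) (dbl m) = app x m"
  "m \<epsilon> om \<Longrightarrow> app (join x y) (suc (dbl m)) = app y m"
proof -
  have d: "dft UNIV (\<lambda>s. if s 0 \<epsilon> evs then app x (half (s 0)) else app y (half (s 0)))" by (intro dfi dfp)
  show "m \<epsilon> om \<Longrightarrow> app (join x y) (dbl m) = app x m"
    "m \<epsilon> om \<Longrightarrow> app (join x y) (suc (dbl m)) = app y m"
    unfolding join_def by (simp_all add: app_lam[OF d])
qed

lemma app_lft: "m \<epsilon> om \<Longrightarrow> app (lft z) m = app z (dbl m)"
  unfolding lft_def by (rule app_lam) (intro dfi dfp)

lemma app_rgt: "m \<epsilon> om \<Longrightarrow> app (rgt z) m = app z (suc (dbl m))"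
  unfolding rgt_def by (rule app_lam) (intro dfi dfp)

lemma lft_join [simp]: "fn x om X \<Longrightarrow> fn y om X \<Longrightarrow> lft (join x y) = x"
  by (rule fn_ext[OF fn_lft[OF fn_join]]) (auto simp: app_lft app_join)

lemma rgt_join [simp]: "fn x om X \<Longrightarrow> fn y om X \<Longrightarrow> rgt (join x y) = y"
  by (rule fn_ext[OF fn_rgt[OF fn_join]]) (auto simp: app_rgt app_join)

text \<open>The number 2^m (2n + 1), obtained by doubling an odd number \<open>m\<close> times;
  injectivity only needs the facts on parity.\<close>

definition opair :: "'u \<Rightarrow> 'u \<Rightarrow> 'u" where
  "opair m n = wrec (\<lambda>i z. dbl z) (suc (dbl n)) m"

lemma dft_opair [dfi]: "dft C a \<Longrightarrow> dft C b \<Longrightarrow> dft C (\<lambda>s. opair (a s) (b s))"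
  unfolding opair_def by (intro dfi)

lemma opair_emp: "opair emp n = suc (dbl n)"
  unfolding opair_def by (rule wrec_emp) (intro dfi)

lemma opair_suc: "m \<epsilon> om \<Longrightarrow> opair (suc m) n = dbl (opair m n)"
  unfolding opair_def by (rule wrec_suc) (intro dfi)

lemma opair_om [simp]: "m \<epsilon> om \<Longrightarrow> n \<epsilon> om \<Longrightarrow> opair m n \<epsilon> om"
  by (rule om_induct[where P = "\<lambda>m. opair m n \<epsilon> om"]) (intro dfi dfp, simp_all add: opair_emp opair_suc)

lemma opair_inject: "m \<epsilon> om \<Longrightarrow> m' \<epsilon> om \<Longrightarrow> n \<epsilon> om \<Longrightarrow> n' \<epsilon> om \<Longrightarrow> opair m n = opair m' n' \<Longrightarrow> m = m' \<and> n = n'"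
proof -
  assume n: "n \<epsilon> om" "n' \<epsilon> om"
  have "m \<epsilon> om \<Longrightarrow> \<forall>k. k \<epsilon> om \<longrightarrow> opair m n = opair k n' \<longrightarrow> m = k \<and> n = n'"
  proof (rule om_induct[where P = "\<lambda>m. \<forall>k. k \<epsilon> om \<longrightarrow> opair m n = opair k n' \<longrightarrow> m = k \<and> n = n'"])
    show "df UNIV (\<lambda>s. \<forall>k. k \<epsilon> om \<longrightarrow> opair (s 0) n = opair k n' \<longrightarrow> s 0 = k \<and> n = n')" by (intro dfi dfp)
    show "\<forall>k. k \<epsilon> om \<longrightarrow> opair emp n = opair k n' \<longrightarrow> emp = k \<and> n = n'"
    proof (intro allI impI)
      fix k assume k: "k \<epsilon> om" and e: "opair emp n = opair k n'"
      from om_cases[OF k] show "emp = k \<and> n = n'"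
      proof
        assume "k = emp"
        with e n show ?thesis by (simp add: opair_emp dbl_inject)
      next
        assume "\<exists>j. j \<epsilon> om \<and> k = suc j"
        then obtain j where "j \<epsilon> om" "k = suc j" by blast
        with e n dbl_neq_odd[of "opair j n'" n] show ?thesis by (simp add: opair_emp opair_suc)
      qed
    qed
    fix m assume m: "m \<epsilon> om" and IH: "\<forall>k. k \<epsilon> om \<longrightarrow> opair m n = opair k n' \<longrightarrow> m = k \<and> n = n'"
    show "\<forall>k. k \<epsilon> om \<longrightarrow> opair (suc m) n = opair k n' \<longrightarrow> suc m = k \<and> n = n'"
    proof (intro allI impI)
      fix k assume k: "k \<epsilon> om" and e: "opair (suc m) n = opair k n'"
      from om_cases[OF k] show "suc m = k \<and> n = n'"
      proof
        assume "k = emp"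
        with e n m dbl_neq_odd[of "opair m n" n'] show ?thesis by (simp add: opair_emp opair_suc)
      next
        assume "\<exists>j. j \<epsilon> om \<and> k = suc j"
        then obtain j where "j \<epsilon> om" "k = suc j" by blast
        with e n m have "opair m n = opair j n'" by (simp add: opair_suc dbl_inject)
        with IH \<open>j \<epsilon> om\<close> have "m = j \<and> n = n'" by blast
        with \<open>k = suc j\<close> show ?thesis by simp
      qed
    qed
  qed
  then show "m \<epsilon> om \<Longrightarrow> m' \<epsilon> om \<Longrightarrow> opair m n = opair m' n' \<Longrightarrow> ?thesis" by blast
qed

text \<open>Folds the pairing along the first \<open>n\<close> entries. In \<open>code\<close> the
  length is paired in, which reduces injectivity to sequences of a common length.\<close>

definition codek :: "'u \<Rightarrow> 'u \<Rightarrow> 'u" where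
  "codek u n = wrec (\<lambda>i z. opair z (app u i)) emp n"
definition code :: "'u \<Rightarrow> 'u" where "code u = opair (dom u) (codek u (dom u))"
definition dec :: "'u \<Rightarrow> 'u" where "dec r = lam (fseqs om) (\<lambda>u. app r (code u))"

lemma dft_codek [dfi]: "dft C a \<Longrightarrow> dft C b \<Longrightarrow> dft C (\<lambda>s. codek (a s) (b s))"
  by (rule dft2[of C codek]) (unfold codek_def, intro dfi)

lemma dft_code [dfi]: "dft C a \<Longrightarrow> dft C (\<lambda>s. code (a s))"
  unfolding code_def by (intro dfi)

lemma dft_dec [dfi]: "dft C a \<Longrightarrow> dft C (\<lambda>s. dec (a s))"
  by (rule dft1[of C dec]) (unfold dec_def, intro dfi)

lemma codek_emp: "codek u emp = emp"
  unfolding codek_def by (rule wrec_emp) (intro dfi dfp)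

lemma codek_suc: "n \<epsilon> om \<Longrightarrow> codek u (suc n) = opair (codek u n) (app u n)"
  unfolding codek_def by (rule wrec_suc) (intro dfi dfp)

lemma codek_om: "n \<epsilon> om \<Longrightarrow> (\<And>i. i \<epsilon> n \<Longrightarrow> app u i \<epsilon> om) \<Longrightarrow> codek u n \<epsilon> om"
proof -
  have "n \<epsilon> om \<Longrightarrow> (\<forall>i. i \<epsilon> n \<longrightarrow> app u i \<epsilon> om) \<longrightarrow> codek u n \<epsilon> om"
    by (rule om_induct[where P = "\<lambda>n. (\<forall>i. i \<epsilon> n \<longrightarrow> app u i \<epsilon> om) \<longrightarrow> codek u n \<epsilon> om"])
      (intro dfi dfp, simp_all add: codek_emp codek_suc)
  then show "n \<epsilon> om \<Longrightarrow> (\<And>i. i \<epsilon> n \<Longrightarrow> app u i \<epsilon> om) \<Longrightarrow> ?thesis" by blast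
qed

lemma codek_inject: "n \<epsilon> om \<Longrightarrow> (\<And>i. i \<epsilon> n \<Longrightarrow> app u i \<epsilon> om \<and> app v i \<epsilon> om) \<Longrightarrow> codek u n = codek v n \<Longrightarrow>
    i \<epsilon> n \<Longrightarrow> app u i = app v i"
proof -
  let ?P = "\<lambda>n. (\<forall>i. i \<epsilon> n \<longrightarrow> app u i \<epsilon> om \<and> app v i \<epsilon> om) \<longrightarrow> codek u n = codek v n \<longrightarrow>
    (\<forall>i. i \<epsilon> n \<longrightarrow> app u i = app v i)"
  have "n \<epsilon> om \<Longrightarrow> ?P n"
  proof (rule om_induct[where P = ?P])
    show "df UNIV (\<lambda>s. ?P (s 0))" by (intro dfi dfp)
    fix n assume n: "n \<epsilon> om" and IH: "?P n"
    show "?P (suc n)"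
    proof (intro impI)
      assume v: "\<forall>i. i \<epsilon> suc n \<longrightarrow> app u i \<epsilon> om \<and> app v i \<epsilon> om" and "codek u (suc n) = codek v (suc n)"
      then have e: "opair (codek u n) (app u n) = opair (codek v n) (app v n)" by (simp add: codek_suc n)
      have "codek u n \<epsilon> om" "codek v n \<epsilon> om" using v n by (auto intro: codek_om)
      from opair_inject[OF this _ _ e] v have "codek u n = codek v n" "app u n = app v n" by simp_all
      with IH v show "\<forall>i. i \<epsilon> suc n \<longrightarrow> app u i = app v i" by auto
    qed
  qed simp_all
  then show "n \<epsilon> om \<Longrightarrow> (\<And>i. i \<epsilon> n \<Longrightarrow> app u i \<epsilon> om \<and> app v i \<epsilon> om) \<Longrightarrow> codek u n = codek v n \<Longrightarrow>
    i \<epsilon> n \<Longrightarrow> ?thesis" by blast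
qed

lemma code_om: "u \<epsilon> fseqs om \<Longrightarrow> code u \<epsilon> om"
  by (auto simp: mem_fseqs code_def dom_fn intro!: opair_om codek_om fn_app)

lemma code_inject: "u \<epsilon> fseqs om \<Longrightarrow> v \<epsilon> fseqs om \<Longrightarrow> code u = code v \<Longrightarrow> u = v"
proof -
  assume "u \<epsilon> fseqs om" "v \<epsilon> fseqs om" and e: "code u = code v"
  then obtain m n where u: "m \<epsilon> om" "fn u m om" and v: "n \<epsilon> om" "fn v n om" by (auto simp: mem_fseqs)
  have "codek u m \<epsilon> om" "codek v n \<epsilon> om" using u v by (auto intro!: codek_om fn_app)
  moreover have "opair m (codek u m) = opair n (codek v n)"
    using e by (simp add: code_def dom_fn[OF u(2)] dom_fn[OF v(2)])
  ultimately have "m = n \<and> codek u m = codek v n" using opair_inject u(1) v(1) by blast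
  then have * : "m = n" "codek u m = codek v m" by auto
  show "u = v"
  proof (rule fn_ext[OF u(2)])
    show "fn v m om" using v(2) * by simp
    show "app u i = app v i" if "i \<epsilon> m" for i
      by (rule codek_inject[of m]) (use u v * that in \<open>auto intro: fn_app\<close>)
  qed
qed

lemma fn_dec: "fn r om om \<Longrightarrow> fn (dec r) (fseqs om) om"
  unfolding dec_def by (rule fn_lam) (intro dfi dfp, simp add: fn_app code_om)

text \<open>A strategy for an integer game is a function on positions, which are coded by numbers,
  so it can be stored in a real. In this way strategies are definable from reals.\<close>

lemma dec_surj: "fn s (fseqs om) om \<Longrightarrow> \<exists>r. fn r om om \<and> dec r = s"
proof -
  assume s: "fn s (fseqs om) om"
  let ?f = "\<lambda>m. app s (iota (\<lambda>u. u \<epsilon> fseqs om \<and> code u = m))"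
  have df: "dft UNIV (\<lambda>s'. ?f (s' 0))" by (intro dfi dfp)
  have inv: "iota (\<lambda>v. v \<epsilon> fseqs om \<and> code v = code u) = u" if "u \<epsilon> fseqs om" for u
    by (rule iota_eq) (use that code_inject in blast)+
  have "fn (lam om ?f) om om"
  proof (rule fn_lam[OF df])
    fix m assume "m \<epsilon> om"
    show "?f m \<epsilon> om"
    proof (cases "\<exists>u. u \<epsilon> fseqs om \<and> code u = m")
      case True
      then show ?thesis using inv fn_app[OF s] by auto
    next
      case False
      then have "\<not> (\<exists>!u. u \<epsilon> fseqs om \<and> code u = m)" by blast
      \<comment> \<open>A number that codes no position is sent to the value at \<open>emp\<close>:
        the default of \<open>iota\<close> happens to be the empty position.\<close>
      then have "iota (\<lambda>u. u \<epsilon> fseqs om \<and> code u = m) = emp" unfolding iota_def by (rule if_not_P)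
      then show ?thesis using fn_app[OF s emp_fseqs] by simp
    qed
  qed
  moreover have "dec (lam om ?f) = s"
  proof (rule fn_ext[OF fn_dec s])
    show "fn (lam om ?f) om om" by fact
    fix u assume u: "u \<epsilon> fseqs om"
    have "dft UNIV (\<lambda>s'. app (lam om ?f) (code (s' 0)))" by (intro dfi dfp)
    from app_lam[OF this u] have "app (dec (lam om ?f)) u = app (lam om ?f) (code u)"
      by (simp add: dec_def)
    also have "\<dots> = app s u" using app_lam[OF df code_om[OF u]] inv[OF u] by simp
    finally show "app (dec (lam om ?f)) u = app s u" .
  qed
  ultimately show ?thesis by blast
qed

subsection \<open>Plays\<close>

text \<open>The set \<open>K\<close> holds the stages at which \<open>s\<close> moves; at the others
  the move is the entry of \<open>b\<close> at the same stage. The position is built up as a set of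
  pairs because \<open>s\<close> takes positions as arguments.\<close>

definition gplay :: "'u \<Rightarrow> 'u \<Rightarrow> 'u \<Rightarrow> 'u \<Rightarrow> 'u" where
  "gplay K s b n = wrec (\<lambda>i g. cup g (upr (prd i (if i \<epsilon> K then app s g else app b i))
     (prd i (if i \<epsilon> K then app s g else app b i)))) emp n"

definition play :: "'u \<Rightarrow> 'u \<Rightarrow> 'u \<Rightarrow> 'u" where
  "play K s b = lam om (\<lambda>i. if i \<epsilon> K then app s (gplay K s b i) else app b i)"

definition obeys :: "'u \<Rightarrow> 'u \<Rightarrow> 'u \<Rightarrow> bool" where
  "obeys K s x \<longleftrightarrow> (\<forall>n. n \<epsilon> K \<longrightarrow> app x n = app s (rst x n))"

lemma dft_gplay:
  assumes "dft C K" "dft C st" "dft C b" "dft C n"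
  shows "dft C (\<lambda>s. gplay (K s) (st s) (b s) (n s))"
  unfolding gplay_def
  by (intro dfi dft_ren[OF assms(1)] dft_ren[OF assms(2)] dft_ren[OF assms(3)] assms(4))

lemma dft_play [dfi]: "dft C K \<Longrightarrow> dft C st \<Longrightarrow> dft C b \<Longrightarrow> dft C (\<lambda>s. play (K s) (st s) (b s))"
  by (rule dft3[of C play]) (unfold play_def, intro dfi dft_gplay)

lemma df_obeys [dfi]: "dft C K \<Longrightarrow> dft C st \<Longrightarrow> dft C b \<Longrightarrow> df C (\<lambda>s. obeys (K s) (st s) (b s))"
  by (rule df3[of C obeys]) (unfold obeys_def, intro dfi)

lemma gplay_emp: "gplay K s b emp = emp"
  unfolding gplay_def by (rule wrec_emp) (intro dfi dfp)

lemma gplay_suc: "n \<epsilon> om \<Longrightarrow> gplay K s b (suc n) =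
    cup (gplay K s b n) (upr (prd n (if n \<epsilon> K then app s (gplay K s b n) else app b n))
      (prd n (if n \<epsilon> K then app s (gplay K s b n) else app b n)))"
  unfolding gplay_def by (rule wrec_suc) (intro dfi dfp)

lemma gplay_lam: "n \<epsilon> om \<Longrightarrow>
    gplay K s b n = lam n (\<lambda>i. if i \<epsilon> K then app s (gplay K s b i) else app b i)"
proof -
  let ?v = "\<lambda>i. if i \<epsilon> K then app s (gplay K s b i) else app b i"
  have v: "dft UNIV (\<lambda>t. ?v (t 0))" by (intro dfi dfp dft_gplay)
  show "n \<epsilon> om \<Longrightarrow> gplay K s b n = lam n ?v"
  proof (rule om_induct[where P = "\<lambda>n. gplay K s b n = lam n ?v"])
    show "df UNIV (\<lambda>t. gplay K s b (t 0) = lam (t 0) ?v)" by (intro dfi dfp dft_gplay)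
    show "gplay K s b emp = lam emp ?v" by (rule extensional) (simp add: gplay_emp mem_lam[OF v])
    fix n assume n: "n \<epsilon> om" and IH: "gplay K s b n = lam n ?v"
    show "gplay K s b (suc n) = lam (suc n) ?v"
    proof (rule extensional)
      fix p
      have "p \<epsilon> gplay K s b (suc n) \<longleftrightarrow> p \<epsilon> gplay K s b n \<or> p = prd n (?v n)"
        unfolding gplay_suc[OF n] by simp
      also have "p \<epsilon> gplay K s b n \<longleftrightarrow> p \<epsilon> lam n ?v" by (simp only: IH)
      also have "p \<epsilon> lam n ?v \<or> p = prd n (?v n) \<longleftrightarrow> p \<epsilon> lam (suc n) ?v"
        unfolding mem_lam[OF v] mem_suc by blast
      finally show "p \<epsilon> gplay K s b (suc n) \<longleftrightarrow> p \<epsilon> lam (suc n) ?v" .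
    qed
  qed
qed

lemma play:
  assumes s: "fn s (fseqs X) X" and b: "fn b om X"
  shows "fn (play K s b) om X"
    and "n \<epsilon> om \<Longrightarrow> rst (play K s b) n = gplay K s b n"
    and "n \<epsilon> om \<Longrightarrow> \<not> n \<epsilon> K \<Longrightarrow> app (play K s b) n = app b n"
    and "n \<epsilon> om \<Longrightarrow> n \<epsilon> K \<Longrightarrow> app (play K s b) n = app s (gplay K s b n)"
proof -
  let ?v = "\<lambda>i. if i \<epsilon> K then app s (gplay K s b i) else app b i"
  have v: "dft UNIV (\<lambda>t. ?v (t 0))" by (intro dfi dfp dft_gplay)
  have g: "fn (gplay K s b n) n X" if "n \<epsilon> om" for n
  proof (rule om_induct[where P = "\<lambda>n. fn (gplay K s b n) n X", OF _ that])
    show "df UNIV (\<lambda>t. fn (gplay K s b (t 0)) (t 0) X)" by (intro dfi dfp dft_gplay)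
    show "fn (gplay K s b emp) emp X" by (simp add: gplay_emp fn_emp)
    fix n assume n: "n \<epsilon> om" and IH: "fn (gplay K s b n) n X"
    have vn: "?v n \<epsilon> X"
      using fn_app[OF s, of "gplay K s b n"] fn_app[OF b n] IH n by (auto simp: mem_fseqs)
    have vi: "?v i \<epsilon> X" if "i \<epsilon> n" for i
    proof -
      have "app (gplay K s b n) i = ?v i" unfolding gplay_lam[OF n] by (rule app_lam[OF v that])
      then show ?thesis using fn_app[OF IH that] by simp
    qed
    show "fn (gplay K s b (suc n)) (suc n) X"
      unfolding gplay_lam[OF suc_om[OF n]] by (rule fn_lam[OF v]) (use vn vi in \<open>simp only: mem_suc, elim disjE, simp_all only:\<close>)
  qed
  have vX: "?v n \<epsilon> X" if "n \<epsilon> om" for n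
    using fn_app[OF s, of "gplay K s b n"] fn_app[OF b that] g[OF that] that by (auto simp: mem_fseqs)
  show p: "fn (play K s b) om X" unfolding play_def by (rule fn_lam[OF v vX])
  have app: "app (play K s b) n = ?v n" if "n \<epsilon> om" for n
    unfolding play_def by (rule app_lam[OF v that])
  show "rst (play K s b) n = gplay K s b n" if "n \<epsilon> om"
    unfolding rst_eq_lam[OF p om_sub[OF that]] gplay_lam[OF that]
    by (rule lam_cong) (use app mem_om_om[OF that] in blast)
  show "n \<epsilon> om \<Longrightarrow> \<not> n \<epsilon> K \<Longrightarrow> app (play K s b) n = app b n" using app by simp
  show "n \<epsilon> om \<Longrightarrow> n \<epsilon> K \<Longrightarrow> app (play K s b) n = app s (gplay K s b n)" using app by simp
qed

lemma play_obeys: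
  assumes "fn s (fseqs X) X" "fn b om X" "sub K om"
  shows "obeys K s (play K s b)"
  unfolding obeys_def using play(2,4)[OF assms(1,2)] subD[OF assms(3)] by simp

lemma gplay_cong: "n \<epsilon> om \<Longrightarrow> (\<And>i. i \<epsilon> n \<Longrightarrow> app b i = app b' i) \<Longrightarrow> gplay K s b n = gplay K s b' n"
proof -
  let ?P = "\<lambda>n. (\<forall>i. i \<epsilon> n \<longrightarrow> app b i = app b' i) \<longrightarrow> gplay K s b n = gplay K s b' n"
  have "n \<epsilon> om \<Longrightarrow> ?P n"
    by (rule om_induct[where P = ?P]) (intro dfi dfp dft_gplay, simp_all add: gplay_emp gplay_suc)
  then show "n \<epsilon> om \<Longrightarrow> (\<And>i. i \<epsilon> n \<Longrightarrow> app b i = app b' i) \<Longrightarrow> ?thesis" by blast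
qed

lemma sub_evs: "sub evs om" and sub_ods: "sub ods om"
  using evs_om ods_om by (auto simp: sub_def)

end

subsection \<open>Determinacy\<close>

context zf
begin

definition detd :: "'u \<Rightarrow> 'u \<Rightarrow> bool" where
  "detd X A \<longleftrightarrow>
    (\<exists>s. s \<epsilon> strats X \<and> (\<forall>x. x \<epsilon> seqs X \<and> obeys evs s x \<longrightarrow> x \<epsilon> A)) \<or>
    (\<exists>s. s \<epsilon> strats X \<and> (\<forall>x. x \<epsilon> seqs X \<and> obeys ods s x \<longrightarrow> \<not> x \<epsilon> A))"

definition adx :: "'u \<Rightarrow> bool" where
  "adx X \<longleftrightarrow> (\<forall>A. sub A (seqs X) \<longrightarrow> detd X A)"

definition cns :: "'u \<Rightarrow> 'u" where "cns c = lam om (\<lambda>_. c)"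

lemma dft_cns [dfi]: "dft C a \<Longrightarrow> dft C (\<lambda>s. cns (a s))"
  by (rule dft1[of C cns]) (unfold cns_def, intro dfi)

lemma fn_cns: "c \<epsilon> X \<Longrightarrow> fn (cns c) om X"
  unfolding cns_def by (rule fn_lam) (intro dfp)

lemma app_cns [simp]: "n \<epsilon> om \<Longrightarrow> app (cns c) n = c"
  unfolding cns_def by (rule app_lam) (intro dfp)

text \<open>Only the first two moves count: player I proposes \<open>x\<close> and player II has to
  answer with some \<open>y\<close> related to it. A winning strategy of player I would be beaten by
  a correct answer to its first move; one of player II computes the uniformizing function.\<close>

theorem uniformization:
  assumes ad: "adx X" and tot: "\<And>x. x \<epsilon> X \<Longrightarrow> \<exists>y. y \<epsilon> X \<and> prd x y \<epsilon> r"
  shows "\<exists>f. fn f X X \<and> (\<forall>x. x \<epsilon> X \<longrightarrow> prd x (app f x) \<epsilon> r)"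
proof -
  let ?A = "sep (seqs X) (\<lambda>z. \<not> prd (app z emp) (app z (suc emp)) \<epsilon> r)"
  have A: "z \<epsilon> ?A \<longleftrightarrow> z \<epsilon> seqs X \<and> \<not> prd (app z emp) (app z (suc emp)) \<epsilon> r" for z
    by (rule mem_sep) (intro dfi dfp)
  have "detd X ?A" using ad A unfolding adx_def sub_def by blast
  then show ?thesis unfolding detd_def
  proof (elim disjE exE conjE)
    fix s assume s: "s \<epsilon> strats X" and win: "\<forall>x. x \<epsilon> seqs X \<and> obeys evs s x \<longrightarrow> x \<epsilon> ?A"
    have s': "fn s (fseqs X) X" using s by simp
    have x: "app s emp \<epsilon> X" by (rule fn_app[OF s']) simp
    from tot[OF x] obtain y where y: "y \<epsilon> X" "prd (app s emp) y \<epsilon> r" by blast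
    let ?z = "play evs s (cns y)"
    note p = play[OF s' fn_cns[OF y(1)], where K = evs]
    have "app ?z emp = app s emp" using p(4)[of emp] by (simp add: gplay_emp)
    moreover have "app ?z (suc emp) = y" using p(3)[of "suc emp"] by simp
    moreover have "?z \<epsilon> ?A" using win p(1) play_obeys[OF s' fn_cns[OF y(1)] sub_evs] by simp
    ultimately show ?thesis using y(2) A by simp
  next
    fix s assume s: "s \<epsilon> strats X" and win: "\<forall>x. x \<epsilon> seqs X \<and> obeys ods s x \<longrightarrow> \<not> x \<epsilon> ?A"
    have s': "fn s (fseqs X) X" using s by simp
    let ?f = "\<lambda>x. app (play ods s (cns x)) (suc emp)"
    have df: "dft UNIV (\<lambda>t. ?f (t 0))" by (intro dfi dfp)
    have "fn (lam X ?f) X X"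
      by (rule fn_lam[OF df]) (rule fn_app[OF play(1)[OF s' fn_cns]], simp_all)
    moreover have "prd x (app (lam X ?f) x) \<epsilon> r" if x: "x \<epsilon> X" for x
    proof -
      let ?z = "play ods s (cns x)"
      note p = play[OF s' fn_cns[OF x], where K = ods]
      have "\<not> ?z \<epsilon> ?A" using win p(1) play_obeys[OF s' fn_cns[OF x] sub_ods] by simp
      moreover have "app ?z emp = x" using p(3)[of emp] by simp
      ultimately show ?thesis using A p(1) by (simp add: app_lam[OF df x])
    qed
    ultimately show ?thesis by blast
  qed
qed

definition heads :: "'u \<Rightarrow> 'u" where "heads z = lam om (\<lambda>n. app (app z n) emp)"

lemma dft_heads [dfi]: "dft C a \<Longrightarrow> dft C (\<lambda>s. heads (a s))"
  by (rule dft1[of C heads]) (unfold heads_def, intro dfi)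

lemma app_heads: "n \<epsilon> om \<Longrightarrow> app (heads z) n = app (app z n) emp"
  unfolding heads_def by (rule app_lam) (intro dfi dfp)

lemma fn_heads: "fn z om reals \<Longrightarrow> fn (heads z) om om"
  unfolding heads_def
proof (rule fn_lam)
  show "dft UNIV (\<lambda>s. app (app z (s 0)) emp)" by (intro dfi dfp)
  fix n assume "fn z om reals" "n \<epsilon> om"
  then have "fn (app z n) om om" using fn_app[of z om reals n] by simp
  then show "app (app z n) emp \<epsilon> om" by (rule fn_app) simp
qed

text \<open>A strategy for real moves yields one for integer moves: integers are played as constant
  sequences and only the first digits of the answers are kept.\<close>

lemma strategy_transfer:
  assumes s': "fn s' (fseqs reals) reals" and K: "sub K om"
  shows "\<exists>s. fn s (fseqs om) om \<and>
    (\<forall>x. fn x om om \<and> obeys K s x \<longrightarrow> (\<exists>z. fn z om reals \<and> obeys K s' z \<and> heads z = x))"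
proof -
  \<comment> \<open>Up to the length of the position \<open>u\<close>, its digits are played as
    constant sequences; beyond it any filler will do, since by \<open>gplay_cong\<close> the answer
    at \<open>dom u\<close> depends on earlier moves only.\<close>
  let ?b = "\<lambda>u. lam om (\<lambda>i. if i \<epsilon> dom u then cns (app u i) else cns emp)"
  let ?s = "\<lambda>u. app (app (play K s' (?b u)) (dom u)) emp"
  have df: "dft UNIV (\<lambda>t. ?s (t 0))" by (intro dfi dfp)
  have dfb: "dft UNIV (\<lambda>t. if t 0 \<epsilon> dom u then cns (app u (t 0)) else cns emp)" for u by (intro dfi dfp)
  have cR: "cns c \<epsilon> reals" if "c \<epsilon> om" for c using fn_cns[OF that] by simp
  have fb: "fn (?b u) om reals" if "u \<epsilon> fseqs om" for u
  proof -
    from that obtain n where n: "n \<epsilon> om" "fn u n om" by (auto simp: mem_fseqs)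
    show ?thesis
    proof (rule fn_lam[OF dfb])
      fix i assume "i \<epsilon> om"
      show "(if i \<epsilon> dom u then cns (app u i) else cns emp) \<epsilon> reals"
        using cR[OF emp_om] cR[OF fn_app[OF n(2), of i]] dom_fn[OF n(2)] by (simp del: mem_reals)
    qed
  qed
  have "fn (lam (fseqs om) ?s) (fseqs om) om"
  proof (rule fn_lam[OF df])
    fix u assume u: "u \<epsilon> fseqs om"
    then have "dom u \<epsilon> om" by (auto simp: mem_fseqs dom_fn)
    from fn_app[OF play(1)[OF s' fb[OF u], where K = K] this]
    have "fn (app (play K s' (?b u)) (dom u)) om om" by simp
    then show "?s u \<epsilon> om" by (rule fn_app) simp
  qed
  moreover have "\<exists>z. fn z om reals \<and> obeys K s' z \<and> heads z = x"
    if x: "fn x om om" and ob: "obeys K (lam (fseqs om) ?s) x" for x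
  proof -
    let ?c = "lam om (\<lambda>i. cns (app x i))"
    let ?z = "play K s' ?c"
    have dfc: "dft UNIV (\<lambda>t. cns (app x (t 0)))" by (intro dfi dfp)
    have c: "fn ?c om reals" by (rule fn_lam[OF dfc]) (rule cR[OF fn_app[OF x]])
    note p = play[OF s' c, where K = K]
    have "app (heads ?z) n = app x n" if n: "n \<epsilon> om" for n
    proof (cases "n \<epsilon> K")
      case False
      have "app ?c n = cns (app x n)" by (rule app_lam[OF dfc n])
      with False n p(3)[OF n False] show ?thesis by (simp add: app_heads)
    next
      case True
      let ?u = "rst x n"
      have u: "?u \<epsilon> fseqs om" by (rule rst_fseqs[OF x n])
      have du: "dom ?u = n" by (rule dom_fn[OF fn_rst[OF x om_sub[OF n]]])
      have "app (?b ?u) i = app ?c i" if i: "i \<epsilon> n" for i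
        using app_lam[OF dfb mem_om_om[OF n i], of ?u] app_lam[OF dfc mem_om_om[OF n i]] i du
          app_rst[OF x om_sub[OF n] i] by simp
      then have g: "gplay K s' (?b ?u) n = gplay K s' ?c n" by (rule gplay_cong[OF n])
      have "app x n = app (lam (fseqs om) ?s) ?u" using ob True by (simp add: obeys_def)
      also have "\<dots> = ?s ?u" by (rule app_lam[OF df u])
      also have "\<dots> = app (app ?z n) emp"
        using play(4)[OF s' fb[OF u] n True] p(4)[OF n True] g by (simp add: du)
      finally show ?thesis by (simp add: app_heads n)
    qed
    then have "heads ?z = x" by (intro fn_ext[OF fn_heads[OF p(1)] x])
    with p(1) play_obeys[OF s' c K] show ?thesis by blast
  qed
  ultimately show ?thesis by blast
qed

text \<open>An integer game is viewed as a game with real moves in which only the first digit of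
  each move counts; a winning strategy of either player is brought back by
  \<open>strategy_transfer\<close>.\<close>

theorem adx_om: "adx reals \<Longrightarrow> adx om"
  unfolding adx_def[of om]
proof (intro allI impI)
  fix A assume ad: "adx reals" and "sub A (seqs om)"
  let ?A = "sep (seqs reals) (\<lambda>z. heads z \<epsilon> A)"
  have A: "z \<epsilon> ?A \<longleftrightarrow> z \<epsilon> seqs reals \<and> heads z \<epsilon> A" for z
    by (rule mem_sep) (intro dfi dfp)
  have "detd reals ?A" using ad A unfolding adx_def sub_def by blast
  then show "detd om A" unfolding detd_def[of reals]
  proof (elim disjE exE conjE)
    fix s assume s: "s \<epsilon> strats reals" and win: "\<forall>x. x \<epsilon> seqs reals \<and> obeys evs s x \<longrightarrow> x \<epsilon> ?A"
    from strategy_transfer[OF s[unfolded mem_strats] sub_evs] obtain t where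
      t: "fn t (fseqs om) om" "\<And>x. fn x om om \<Longrightarrow> obeys evs t x \<Longrightarrow> \<exists>z. fn z om reals \<and> obeys evs s z \<and> heads z = x"
      by blast
    have "x \<epsilon> A" if "fn x om om" "obeys evs t x" for x
      using t(2)[OF that] win A by auto
    with t(1) show ?thesis unfolding detd_def by auto
  next
    fix s assume s: "s \<epsilon> strats reals" and win: "\<forall>x. x \<epsilon> seqs reals \<and> obeys ods s x \<longrightarrow> \<not> x \<epsilon> ?A"
    from strategy_transfer[OF s[unfolded mem_strats] sub_ods] obtain t where
      t: "fn t (fseqs om) om" "\<And>x. fn x om om \<Longrightarrow> obeys ods t x \<Longrightarrow> \<exists>z. fn z om reals \<and> obeys ods s z \<and> heads z = x"
      by blast
    have "\<not> x \<epsilon> A" if x: "fn x om om" "obeys ods t x" for x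
    proof -
      from t(2)[OF x] obtain z where z: "fn z om reals" "obeys ods s z" "heads z = x" by blast
      then have "\<not> z \<epsilon> ?A" using win by simp
      with A[of z] z show ?thesis by simp
    qed
    with t(1) show ?thesis unfolding detd_def by auto
  qed
qed

text \<open>Bernstein's construction: a well-ordering of the reals lets one pick, for every strategy of
  either player, a play obeying it, all these plays being distinct.\<close>

theorem reals_not_wellorderable:
  assumes ad: "adx om" and k0: "ord k0" "\<forall>x. x \<epsilon> reals \<longrightarrow> (\<exists>a. a \<epsilon> k0 \<and> app e0 a = x)"
  shows False
proof -
  define Sur where "Sur k \<longleftrightarrow> (\<exists>e. \<forall>x. x \<epsilon> reals \<longrightarrow> (\<exists>a. a \<epsilon> k \<and> app e a = x))" for k
  have dfS: "df UNIV (\<lambda>s. Sur (s 0))" unfolding Sur_def by (intro dfi)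
  have "Sur k0" using k0(2) by (auto simp: Sur_def)
  note l = lst[of Sur, OF dfS k0(1) this]
  \<comment> \<open>The least length of an enumeration of the reals. That no ordinal below
    \<open>k\<close> enumerates them leaves enough plays to choose from at each stage.\<close>
  define k where "k = lst Sur"
  have k: "ord k" "\<And>c. c \<epsilon> k \<Longrightarrow> \<not> Sur c" using l by (simp_all add: k_def)
  from l(2) obtain e where e: "\<And>x. x \<epsilon> reals \<Longrightarrow> \<exists>a. a \<epsilon> k \<and> app e a = x"
    unfolding k_def[symmetric] Sur_def by blast
  \<comment> \<open>A real \<open>w\<close> codes a player by the first digit of its left half, and
    a strategy by its right half.\<close>
  define K where "K w = (if app (lft w) emp = emp then evs else ods)" for w
  have dfK: "dft C (\<lambda>s. K (w s))" if "dft C w" for C w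
    unfolding K_def by (intro dfi that)
  define ok where "ok w c \<longleftrightarrow> c \<epsilon> reals \<and> obeys (K w) (dec (rgt w)) c" for w c
  have dfok: "df C (\<lambda>s. ok (w s) (c s))" if "dft C w" "dft C c" for C w c
    unfolding ok_def by (intro dfi dfK that)
  \<comment> \<open>The play chosen at stage \<open>a\<close>: the first in the enumeration
    \<open>e\<close> that obeys the strategy coded by \<open>app e a\<close> and differs from all
    plays chosen before.\<close>
  define T where "T = trec (\<lambda>a h. app e (lst (\<lambda>i. ok (app e a) (app e i) \<and> (\<forall>b. b \<epsilon> a \<longrightarrow> app h b \<noteq> app e i))))"
  have G: "dft UNIV (\<lambda>s. app e (lst (\<lambda>i. ok (app e (s (Suc 0))) (app e i) \<and>
      (\<forall>b. b \<epsilon> s (Suc 0) \<longrightarrow> app (s 0) b \<noteq> app e i))))" by (intro dfi dfp dfok)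
  have dfT: "dft C (\<lambda>s. T (a s))" if "dft UNIV a" "C = UNIV" for C a
    unfolding T_def that(2) by (intro dfi dfp dfok that(1))
  have Teq: "T a = app e (lst (\<lambda>i. ok (app e a) (app e i) \<and> (\<forall>b. b \<epsilon> a \<longrightarrow> T b \<noteq> app e i)))" for a
  proof -
    have "app (lam (tc a) T) b = T b" if "b \<epsilon> a" for b
      using app_lam_trec[OF G mem_tc[OF that]] by (simp add: T_def)
    then have "(\<lambda>i. ok (app e a) (app e i) \<and> (\<forall>b. b \<epsilon> a \<longrightarrow> app (lam (tc a) T) b \<noteq> app e i)) =
        (\<lambda>i. ok (app e a) (app e i) \<and> (\<forall>b. b \<epsilon> a \<longrightarrow> T b \<noteq> app e i))" by auto
    then show ?thesis using trec[OF G, of a] by (simp add: T_def)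
  qed
  have ex: "\<exists>c. ok (app e a) c \<and> (\<forall>b. b \<epsilon> a \<longrightarrow> T b \<noteq> c)" if a: "a \<epsilon> k" "app e a \<epsilon> reals" for a
  proof (rule ccontr)
    assume n: "\<not> (\<exists>c. ok (app e a) c \<and> (\<forall>b. b \<epsilon> a \<longrightarrow> T b \<noteq> c))"
    let ?w = "app e a"
    have w: "fn ?w om om" using a(2) by simp
    have st: "fn (dec (rgt ?w)) (fseqs om) om" by (rule fn_dec[OF fn_rgt[OF w]])
    \<comment> \<open>Reads off the moves of the opponent of the coded strategy. Every real is the
      sequence of opponent's moves in some play against it, so if the earlier plays exhausted all of
      these, the ordinal \<open>a\<close> below \<open>k\<close> would already enumerate the
      reals.\<close>
    define opp where "opp c = (if app (lft ?w) emp = emp then rgt c else lft c)" for c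
    have dfo: "dft UNIV (\<lambda>s. opp (T (s 0)))" unfolding opp_def by (intro dfi dfp dfT refl)
    have "\<exists>b. b \<epsilon> a \<and> app (lam a (\<lambda>b. opp (T b))) b = y" if y: "y \<epsilon> reals" for y
    proof -
      have fy: "fn y om om" using y by simp
      have j: "fn (join y y) om om" by (rule fn_join[OF fy fy])
      let ?c = "play (K ?w) (dec (rgt ?w)) (join y y)"
      note p = play[OF st j, where K = "K ?w"]
      have "sub (K ?w) om" using sub_evs sub_ods by (simp add: K_def)
      then have "ok ?w ?c" using p(1) play_obeys[OF st j] by (simp add: ok_def)
      with n obtain b where b: "b \<epsilon> a" "T b = ?c" by blast
      have "opp ?c = y"
      proof (cases "app (lft ?w) emp = emp")
        case True
        have K: "K ?w = evs" using True by (simp add: K_def)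
        have "rgt ?c = y"
          by (rule fn_ext[OF fn_rgt[OF p(1)] fy]) (simp add: app_rgt p(3)[unfolded K] K app_join)
        with True show ?thesis by (simp add: opp_def)
      next
        case False
        have K: "K ?w = ods" using False by (simp add: K_def)
        have "lft ?c = y"
          by (rule fn_ext[OF fn_lft[OF p(1)] fy]) (simp add: app_lft p(3)[unfolded K] K app_join)
        with False show ?thesis by (simp add: opp_def)
      qed
      with b show ?thesis using app_lam[OF dfo b(1)] by auto
    qed
    then have "Sur a" unfolding Sur_def by blast
    with k(2)[OF a(1)] show False by blast
  qed
  have T: "ok (app e a) (T a) \<and> (\<forall>b. b \<epsilon> a \<longrightarrow> T b \<noteq> T a)" if a: "a \<epsilon> k" "app e a \<epsilon> reals" for a
  proof -
    let ?P = "\<lambda>i. ok (app e a) (app e i) \<and> (\<forall>b. b \<epsilon> a \<longrightarrow> T b \<noteq> app e i)"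
    from ex[OF a] obtain c where c: "ok (app e a) c" "\<forall>b. b \<epsilon> a \<longrightarrow> T b \<noteq> c" by blast
    then have "c \<epsilon> reals" by (simp add: ok_def)
    from e[OF this] obtain i where i: "i \<epsilon> k" "app e i = c" by blast
    have "df UNIV (\<lambda>s. ?P (s 0))" by (intro dfi dfp dfok dfT refl)
    from lst(2)[of ?P i, OF this ord_mem[OF k(1) i(1)]] c i(2) have "?P (lst ?P)" by simp
    then show ?thesis unfolding Teq[of a, symmetric] .
  qed
  \<comment> \<open>The plays chosen against player II go into the payoff set; those chosen against
    player I stay out of it because all chosen plays are distinct.\<close>
  let ?A = "sep reals (\<lambda>c. \<exists>a. a \<epsilon> k \<and> app e a \<epsilon> reals \<and> app (lft (app e a)) emp \<noteq> emp \<and> c = T a)"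
  have A: "c \<epsilon> ?A \<longleftrightarrow> c \<epsilon> reals \<and> (\<exists>a. a \<epsilon> k \<and> app e a \<epsilon> reals \<and> app (lft (app e a)) emp \<noteq> emp \<and> c = T a)" for c
    by (rule mem_sep) (intro dfi dfp dfT refl)
  have "sub ?A (seqs om)" using A by (simp add: sub_def)
  with ad have "detd om ?A" by (simp add: adx_def)
  then show False unfolding detd_def
  proof (elim disjE exE conjE)
    fix s assume s: "s \<epsilon> strats om" and win: "\<forall>x. x \<epsilon> seqs om \<and> obeys evs s x \<longrightarrow> x \<epsilon> ?A"
    from dec_surj[OF s[unfolded mem_strats]] obtain r where r: "fn r om om" "dec r = s" by blast
    have c0: "fn (cns emp) om om" by (rule fn_cns) simp
    from e[of "join (cns emp) r"] fn_join[OF c0 r(1)] obtain a where a: "a \<epsilon> k" "app e a = join (cns emp) r"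
      by auto
    have w: "app e a \<epsilon> reals" using a(2) fn_join[OF c0 r(1)] by simp
    have o0: "app (lft (app e a)) emp = emp" using c0 r by (simp add: a(2))
    from T[OF a(1) w] have "T a \<epsilon> seqs om" "obeys evs s (T a)"
      using o0 r c0 by (simp_all add: ok_def K_def a(2))
    with win A obtain b where b: "b \<epsilon> k" "app e b \<epsilon> reals" "app (lft (app e b)) emp \<noteq> emp" "T a = T b" by blast
    from ord_linear[OF ord_mem[OF k(1) a(1)] ord_mem[OF k(1) b(1)]] show False
      using T[OF a(1) w] T[OF b(1,2)] b(3,4) o0 by metis
  next
    fix s assume s: "s \<epsilon> strats om" and win: "\<forall>x. x \<epsilon> seqs om \<and> obeys ods s x \<longrightarrow> \<not> x \<epsilon> ?A"
    from dec_surj[OF s[unfolded mem_strats]] obtain r where r: "fn r om om" "dec r = s" by blast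
    have c0: "fn (cns (suc emp)) om om" by (rule fn_cns) simp
    from e[of "join (cns (suc emp)) r"] fn_join[OF c0 r(1)] obtain a where
      a: "a \<epsilon> k" "app e a = join (cns (suc emp)) r" by auto
    have w: "app e a \<epsilon> reals" using a(2) fn_join[OF c0 r(1)] by simp
    have o0: "app (lft (app e a)) emp \<noteq> emp" using c0 r by (simp add: a(2))
    from T[OF a(1) w] have "T a \<epsilon> seqs om" "obeys ods s (T a)"
      using o0 r c0 by (simp_all add: ok_def K_def a(2))
    with win A[of "T a"] a(1) w o0 show False by auto
  qed
qed

text \<open>In the Wadge game player I plays a candidate for \<open>B\<close> and player II one for
  \<open>A\<close>, and player II wins if the two memberships agree. A strategy of II reduces
  \<open>B\<close> to \<open>A\<close>, one of I reduces \<open>A\<close> to the complement of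
  \<open>B\<close>. Of the two halves of \<open>join x x\<close> the strategy overrides its
  own.\<close>

theorem wadge:
  assumes ad: "adx om"
  shows "(\<exists>s. s \<epsilon> strats om \<and> (\<forall>x. x \<epsilon> reals \<longrightarrow> (x \<epsilon> B \<longleftrightarrow> rgt (play ods s (join x x)) \<epsilon> A))) \<or>
    (\<exists>s. s \<epsilon> strats om \<and> (\<forall>y. y \<epsilon> reals \<longrightarrow> (y \<epsilon> A \<longleftrightarrow> \<not> lft (play evs s (join y y)) \<epsilon> B)))"
proof -
  let ?W = "sep reals (\<lambda>z. \<not> (lft z \<epsilon> B \<longleftrightarrow> rgt z \<epsilon> A))"
  have W: "z \<epsilon> ?W \<longleftrightarrow> z \<epsilon> reals \<and> \<not> (lft z \<epsilon> B \<longleftrightarrow> rgt z \<epsilon> A)" for z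
    by (rule mem_sep) (intro dfi dfp)
  have "sub ?W (seqs om)" using W by (simp add: sub_def)
  with ad have "detd om ?W" by (simp add: adx_def)
  then show ?thesis unfolding detd_def
  proof (elim disjE exE conjE)
    fix s assume s: "s \<epsilon> strats om" and win: "\<forall>x. x \<epsilon> seqs om \<and> obeys evs s x \<longrightarrow> x \<epsilon> ?W"
    have s': "fn s (fseqs om) om" using s by simp
    have "y \<epsilon> A \<longleftrightarrow> \<not> lft (play evs s (join y y)) \<epsilon> B" if "y \<epsilon> reals" for y
    proof -
      have y: "fn y om om" using that by simp
      note j = fn_join[OF y y]
      note p = play[OF s' j, where K = evs]
      have "rgt (play evs s (join y y)) = y"
        by (rule fn_ext[OF fn_rgt[OF p(1)] y]) (simp add: app_rgt p(3) app_join)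
      moreover have "play evs s (join y y) \<epsilon> ?W" using win p(1) play_obeys[OF s' j sub_evs] by simp
      ultimately show ?thesis using W by auto
    qed
    with s show ?thesis by blast
  next
    fix s assume s: "s \<epsilon> strats om" and win: "\<forall>x. x \<epsilon> seqs om \<and> obeys ods s x \<longrightarrow> \<not> x \<epsilon> ?W"
    have s': "fn s (fseqs om) om" using s by simp
    have "x \<epsilon> B \<longleftrightarrow> rgt (play ods s (join x x)) \<epsilon> A" if "x \<epsilon> reals" for x
    proof -
      have x: "fn x om om" using that by simp
      note j = fn_join[OF x x]
      note p = play[OF s' j, where K = ods]
      have "lft (play ods s (join x x)) = x"
        by (rule fn_ext[OF fn_lft[OF p(1)] x]) (simp add: app_lft p(3) app_join)
      moreover have "\<not> play ods s (join x x) \<epsilon> ?W" using win p(1) play_obeys[OF s' j sub_ods] by simp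
      ultimately show ?thesis using W p(1) by auto
    qed
    with s show ?thesis by blast
  qed
qed

end

section \<open>Ordinal and real definability\<close>

lemma Def_mono: "Def E R C P \<Longrightarrow> C \<subseteq> D \<Longrightarrow> Def E R D P"
  by (induction rule: Def.induct) (auto intro: Def.intros)

text \<open>The outcome of the ultraproduct, taken as an axiom from here on: it holds for each
  formula, including those that mention \<open>R\<close>.\<close>

locale odzf = zf E R for E :: "'u \<Rightarrow> 'u \<Rightarrow> bool" (infix \<open>\<epsilon>\<close> 50) and R :: "'u \<Rightarrow> 'u \<Rightarrow> 'u \<Rightarrow> bool" +
  assumes captures: "captures \<phi>"
begin

lemma df_mono: "df {} P \<Longrightarrow> df UNIV P"
  by (rule Def_mono) simp_all

definition oset :: "'u \<Rightarrow> 'u \<Rightarrow> 'u" where "oset a x = setof (R a x)"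

lemma dft_oset [dfi]: "dft C a \<Longrightarrow> dft C b \<Longrightarrow> dft C (\<lambda>s. oset (a s) (b s))"
  by (rule dft2[of C oset]) (unfold oset_def, intro dfi)

definition OD :: "'u \<Rightarrow> bool" where
  "OD z \<longleftrightarrow> (\<exists>a x. ord a \<and> x \<epsilon> reals \<and> z = oset a x)"

lemma df_OD [dfi]: "dft C a \<Longrightarrow> df C (\<lambda>s. OD (a s))"
  by (rule df1[of C OD]) (unfold OD_def, intro dfi)

lemma capture:
  assumes P: "df {} (\<lambda>s. P (s 0) (s (Suc 0)))" and z: "\<And>y. y \<epsilon> z \<longleftrightarrow> P y x"
  shows "\<exists>a. ord a \<and> z = oset a x"
proof -
  from Def_imp_dsat[OF P] obtain \<phi> where \<phi>: "\<And>s. P (s 0) (s (Suc 0)) = dsat UNIV (\<epsilon>) R s \<phi>" by blast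
  have "P y x = dsat UNIV (\<epsilon>) R (scons y (\<lambda>_. x)) \<phi>" for y
    using \<phi>[of "scons y (\<lambda>_. x)"] by simp
  then have "\<forall>y. y \<epsilon> z \<longleftrightarrow> dsat UNIV (\<epsilon>) R (scons y (\<lambda>_. x)) \<phi>" using z by simp
  with captures[of \<phi>] obtain a where a: "ord a" "\<forall>y. y \<epsilon> z \<longleftrightarrow> R a x y"
    unfolding captures_def by blast
  then have "oset a x = z" unfolding oset_def by (intro setof_eq) blast
  with a(1) show ?thesis by blast
qed

lemma OD_real_param:
  assumes "df {} (\<lambda>s. P (s 0) (s (Suc 0)))" "\<And>y. y \<epsilon> z \<longleftrightarrow> P y x" "x \<epsilon> reals"
  shows "OD z"
  using capture[of P, OF assms(1,2)] assms(3) unfolding OD_def by blast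

text \<open>An ordinal parameter is eliminated by passing to the least one giving a counterexample, which is
  definable without parameters.\<close>

lemma OD_ord_param:
  assumes P: "df {} (\<lambda>s. P (s 0) (s (Suc 0)) (s (Suc (Suc 0))))" and z: "\<And>y. y \<epsilon> z \<longleftrightarrow> P y x g"
    and x: "x \<epsilon> reals" and g: "ord g"
  shows "OD z"
proof (rule ccontr)
  assume n: "\<not> OD z"
  define Bad where "Bad g \<longleftrightarrow> (\<exists>x z. x \<epsilon> reals \<and> (\<forall>y. y \<epsilon> z \<longleftrightarrow> P y x g) \<and> \<not> OD z)" for g
  have dB: "df {} (\<lambda>s. Bad (s 0))" unfolding Bad_def by (intro dfi df3[of "{}" P, OF P])
  have "Bad g" unfolding Bad_def using n x z by blast
  from lst(2)[of Bad, OF df_mono[OF dB] g this] obtain x0 z0 where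
    0: "x0 \<epsilon> reals" "\<forall>y. y \<epsilon> z0 \<longleftrightarrow> P y x0 (lst Bad)" "\<not> OD z0" unfolding Bad_def by blast
  have "dft {} (\<lambda>s. lst Bad)" using dft_lst[of "{}" "\<lambda>_. Bad", OF dB] .
  then have "df {} (\<lambda>s. P (s 0) (s (Suc 0)) (lst Bad))" by (rule df3[of "{}" P, OF P dft_var dft_var])
  from OD_real_param[of "\<lambda>y x. P y x (lst Bad)", OF this _ 0(1), of z0] 0(2,3) show False by blast
qed

text \<open>The ordinal \<open>g\<close> is minimized with \<open>h\<close> quantified away; the
  minimum is definable without parameters, so that one ordinal parameter remains.\<close>

lemma OD_two_ord_params:
  assumes P: "df {} (\<lambda>s. P (s 0) (s (Suc 0)) (s (Suc (Suc 0))) (s (Suc (Suc (Suc 0)))))"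
    and z: "\<And>y. y \<epsilon> z \<longleftrightarrow> P y x g h" and x: "x \<epsilon> reals" and g: "ord g" and h: "ord h"
  shows "OD z"
proof (rule ccontr)
  assume n: "\<not> OD z"
  define Bad where "Bad g \<longleftrightarrow> (\<exists>h x z. ord h \<and> x \<epsilon> reals \<and> (\<forall>y. y \<epsilon> z \<longleftrightarrow> P y x g h) \<and> \<not> OD z)" for g
  have ren: "df {} (\<lambda>s. P (s i) (s j) (s k) (s l))" for i j k l
    using Def_rename[OF P, of "case_nat i (case_nat j (case_nat k (\<lambda>_. l)))"] by simp
  have dB: "df {} (\<lambda>s. Bad (s 0))" unfolding Bad_def by (intro dfi ren)
  have "Bad g" unfolding Bad_def using n x z h by blast
  from lst(2)[of Bad, OF df_mono[OF dB] g this] obtain h0 x0 z0 where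
    0: "ord h0" "x0 \<epsilon> reals" "\<forall>y. y \<epsilon> z0 \<longleftrightarrow> P y x0 (lst Bad) h0" "\<not> OD z0" unfolding Bad_def by blast
  have "dft {} (\<lambda>s. lst Bad)" using dft_lst[of "{}" "\<lambda>_. Bad", OF dB] .
  with ren[of "Suc 0" "Suc (Suc 0)" 0 "Suc (Suc (Suc 0))"]
  have "df {} (\<lambda>s. P (s 0) (s (Suc 0)) (lst Bad) (s (Suc (Suc 0))))"
    by (rule df_subst[of "{}" "\<lambda>s u. P (s 0) (s (Suc 0)) u (s (Suc (Suc 0)))"])
  from OD_ord_param[of "\<lambda>y x h. P y x (lst Bad) h", OF this _ 0(2,1), of z0] 0(3,4) show False by blast
qed

lemma cns_real: "cns emp \<epsilon> reals" using fn_cns[OF emp_om] by simp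

lemma OD_ord: "ord a \<Longrightarrow> OD a"
  by (rule OD_ord_param[of "\<lambda>y x g. y \<epsilon> g", OF _ _ cns_real]) (intro dfi, simp_all)

lemma OD_real: "x \<epsilon> reals \<Longrightarrow> OD x"
  by (rule OD_real_param[of "\<lambda>y x. y \<epsilon> x"]) (intro dfi, simp_all)

text \<open>The two real parameters are joined into one, which leaves two ordinals to be
  eliminated.\<close>

lemma OD_prd: "OD c \<Longrightarrow> OD d \<Longrightarrow> OD (prd c d)"
proof -
  assume "OD c" "OD d"
  then obtain a x b y where *: "ord a" "x \<epsilon> reals" "c = oset a x" "ord b" "y \<epsilon> reals" "d = oset b y"
    unfolding OD_def by blast
  have xy: "fn x om om" "fn y om om" using * by simp_all
  have j: "join x y \<epsilon> reals" using fn_join[OF xy] by simp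
  show "OD (prd c d)"
  proof (rule OD_two_ord_params[of "\<lambda>u w g h. u \<epsilon> prd (oset g (lft w)) (oset h (rgt w))", OF _ _ j *(1,4)])
    show "df {} (\<lambda>s. s 0 \<epsilon> prd (oset (s (Suc (Suc 0))) (lft (s (Suc 0)))) (oset (s (Suc (Suc (Suc 0)))) (rgt (s (Suc 0)))))"
      by (intro dfi)
  qed (simp add: * lft_join[OF xy] rgt_join[OF xy])
qed

primrec tuple :: "nat \<Rightarrow> (nat \<Rightarrow> 'u) \<Rightarrow> 'u" where
  "tuple 0 e = emp"
| "tuple (Suc m) e = prd (e m) (tuple m e)"

lemma OD_tuple: "(\<And>i. OD (e i)) \<Longrightarrow> OD (tuple m e)"
  by (induction m) (auto intro: OD_prd OD_ord)

lemma funpow_psnd_tuple: "i < m \<Longrightarrow> pfst ((psnd ^^ (m - Suc i)) (tuple m e)) = e i"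
proof (induction m)
  case (Suc m)
  show ?case
  proof (cases "i = m")
    case False
    with Suc.prems have "i < m" "Suc m - Suc i = Suc (m - Suc i)" by simp_all
    with Suc.IH show ?thesis by (simp add: funpow_swap1)
  qed simp
qed simp

lemma dft_funpow_psnd: "dft C a \<Longrightarrow> dft C (\<lambda>s. (psnd ^^ i) (a s))"
  by (induction i) (auto intro: dfi)

text \<open>The finitely many parameters of a definition form a tuple, itself given by one ordinal
  and one real, from which they are recovered by projections. Since \<open>P\<close> may involve
  \<open>R\<close>, notions such as \<open>OD\<close> can be used in definitions again; this is what
  \<open>captures\<close> was demanded for.\<close>

theorem OD_closed:
  assumes P: "df (Collect OD) (\<lambda>s. P (s 0))" and z: "\<And>y. y \<epsilon> z \<longleftrightarrow> P y"
  shows "OD z"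
proof -
  have "emp \<in> Collect OD" using OD_ord by simp
  from Def_imp_dsat_params[OF P this] obtain \<phi> e where
    e: "range e \<subseteq> Collect OD" and \<phi>: "\<And>s. P (s 0) = dsat UNIV (\<epsilon>) R (mix s e) \<phi>" by blast
  define m where "m = supp \<phi>"
  define pr where "pr i c = pfst ((psnd ^^ (m - Suc i)) c)" for i c
  define c where "c = tuple m e"
  have "OD c" unfolding c_def by (rule OD_tuple) (use e in auto)
  then obtain a x where ax: "ord a" "x \<epsilon> reals" "c = oset a x" unfolding OD_def by blast
  have pr: "pr i c = e i" if "i < m" for i
    unfolding pr_def c_def by (rule funpow_psnd_tuple[OF that])
  have Py: "P y \<longleftrightarrow> dsat UNIV (\<epsilon>) R (mix (\<lambda>_. y) (\<lambda>i. pr i (oset a x))) \<phi>" for y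
  proof -
    have "P y \<longleftrightarrow> dsat UNIV (\<epsilon>) R (mix (\<lambda>_. y) e) \<phi>" by (rule \<phi>)
    also have "\<dots> \<longleftrightarrow> dsat UNIV (\<epsilon>) R (mix (\<lambda>_. y) (\<lambda>i. pr i c)) \<phi>"
    proof (rule dsat_supp)
      fix i assume "i < supp \<phi>"
      then have "i div 2 < m" by (simp add: m_def)
      then show "mix (\<lambda>_. y) e i = mix (\<lambda>_. y) (\<lambda>i. pr i c) i" by (simp add: mix_def pr)
    qed
    finally show ?thesis by (simp add: ax(3))
  qed
  show ?thesis
  proof (rule OD_ord_param[of "\<lambda>y x g. dsat UNIV (\<epsilon>) R (mix (\<lambda>_. y) (\<lambda>i. pr i (oset g x))) \<phi>", OF _ _ ax(2,1)])
    show "df {} (\<lambda>s. dsat UNIV (\<epsilon>) R (mix (\<lambda>_. s 0) (\<lambda>i. pr i (oset (s (Suc (Suc 0))) (s (Suc 0))))) \<phi>)"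
    proof (rule df_dsat_UNIV)
      fix n
      show "dft {} (\<lambda>s. mix (\<lambda>_. s 0) (\<lambda>i. pr i (oset (s (Suc (Suc 0))) (s (Suc 0)))) n)"
        by (cases "even n") (simp_all add: mix_def pr_def, (intro dfi dft_funpow_psnd)+)
    qed
  qed (simp add: z Py)
qed

lemma dfo: "OD c \<Longrightarrow> dft (Collect OD) (\<lambda>s. c)"
  by (rule dft_par) simp

lemma OD_term: "dft (Collect OD) (\<lambda>s. t) \<Longrightarrow> OD t"
  by (rule OD_closed[of "\<lambda>y. y \<epsilon> t"]) (intro dfi, simp_all)

section \<open>The inner model of hereditarily definable sets\<close>

definition hod :: "'u \<Rightarrow> bool" where
  "hod x \<longleftrightarrow> OD x \<and> (\<forall>y. y \<epsilon> tc x \<longrightarrow> OD y)"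

lemma df_hod [dfi]: "dft C a \<Longrightarrow> df C (\<lambda>s. hod (a s))"
  by (rule df1[of C hod]) (unfold hod_def, intro dfi)

lemma hod_OD: "hod x \<Longrightarrow> OD x" by (simp add: hod_def)

lemma hod_mem: "hod x \<Longrightarrow> y \<epsilon> x \<Longrightarrow> hod y"
  unfolding hod_def using mem_tc tc_trans by blast

lemma hodI: "OD x \<Longrightarrow> (\<And>y. y \<epsilon> x \<Longrightarrow> hod y) \<Longrightarrow> hod x"
  unfolding hod_def using tc_iff[of _ x] by blast

lemma hod_ord: "ord a \<Longrightarrow> hod a"
proof -
  have "ord a \<longrightarrow> hod a"
  proof (rule eps_induct[where P = "\<lambda>a. ord a \<longrightarrow> hod a"])
    show "df UNIV (\<lambda>s. ord (s 0) \<longrightarrow> hod (s 0))" by (intro dfi)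
    fix x assume "\<And>y. y \<epsilon> x \<Longrightarrow> ord y \<longrightarrow> hod y"
    then show "ord x \<longrightarrow> hod x" using hodI[OF OD_ord] ord_mem by blast
  qed
  then show "ord a \<Longrightarrow> hod a" by blast
qed

lemma hod_upr: "hod a \<Longrightarrow> hod b \<Longrightarrow> hod (upr a b)"
  by (rule hodI[OF OD_term]) (intro dfi dfo hod_OD, assumption+, auto)

lemma hod_prd: "hod a \<Longrightarrow> hod b \<Longrightarrow> hod (prd a b)"
  unfolding prd_def by (intro hod_upr)

lemma hod_om: "hod om" by (rule hod_ord) simp

lemma hod_fn: "OD f \<Longrightarrow> fn f a b \<Longrightarrow> (\<And>x. x \<epsilon> a \<Longrightarrow> hod x) \<Longrightarrow> (\<And>y. y \<epsilon> b \<Longrightarrow> hod y) \<Longrightarrow> hod f"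
proof -
  assume o: "OD f" and f: "fn f a b" and a: "\<And>x. x \<epsilon> a \<Longrightarrow> hod x" and b: "\<And>y. y \<epsilon> b \<Longrightarrow> hod y"
  show "hod f" using o
  proof (rule hodI)
    fix p assume "p \<epsilon> f"
    then obtain x where "x \<epsilon> a" "p = prd x (app f x)" unfolding fn_elt[OF f] by (elim exE conjE)
    then show "hod p" using hod_prd[OF a b[OF fn_app[OF f]]] by simp
  qed
qed

lemma hod_real: "x \<epsilon> reals \<Longrightarrow> hod x"
  by (rule hod_fn[OF OD_real, of x om om]) (auto intro: hod_mem[OF hod_om])

lemma hod_reals: "hod reals"
  by (rule hodI[OF OD_term]) (intro dfi, rule hod_real)

lemma OD_strat: "fn s (fseqs om) om \<Longrightarrow> OD s"
proof -
  assume "fn s (fseqs om) om"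
  from dec_surj[OF this] obtain r where r: "fn r om om" "dec r = s" by blast
  have "OD (dec r)" by (rule OD_term) (intro dfi dfo OD_real, simp add: r(1))
  with r(2) show ?thesis by simp
qed

text \<open>Padding with zeros gives a real from which, with the length as an ordinal parameter, the
  finite sequence is definable.\<close>

lemma fseq_extend: "u \<epsilon> fseqs om \<Longrightarrow> \<exists>x n. x \<epsilon> reals \<and> n \<epsilon> om \<and> u = rst x n"
proof -
  assume "u \<epsilon> fseqs om"
  then obtain n where n: "n \<epsilon> om" "fn u n om" by (auto simp: mem_fseqs)
  let ?f = "\<lambda>i. if i \<epsilon> n then app u i else emp"
  have df: "dft UNIV (\<lambda>s. ?f (s 0))" by (intro dfi dfp)
  have f: "fn (lam om ?f) om om" by (rule fn_lam[OF df]) (simp add: fn_app[OF n(2)])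
  have "u = rst (lam om ?f) n"
    by (rule fn_ext[OF n(2) fn_rst[OF f om_sub[OF n(1)]]])
      (simp add: app_rst[OF f om_sub[OF n(1)]] app_lam[OF df mem_om_om[OF n(1)]])
  with f n(1) show ?thesis by (intro exI[of _ "lam om ?f"] exI[of _ n]) simp
qed

lemma hod_fseq: "u \<epsilon> fseqs om \<Longrightarrow> hod u"
proof -
  assume u: "u \<epsilon> fseqs om"
  from fseq_extend[OF u] obtain x n where x: "x \<epsilon> reals" "n \<epsilon> om" "u = rst x n" by blast
  have "OD (rst x n)" by (rule OD_term) (intro dfi dfo OD_real x(1) hod_OD hod_mem[OF hod_om] x(2))
  then have "OD u" by (simp add: x(3))
  moreover from u obtain m where m: "m \<epsilon> om" "fn u m om" by (auto simp: mem_fseqs)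
  ultimately show ?thesis
    by (intro hod_fn[of u m om]) (auto intro: hod_mem[OF hod_om] mem_om_om[OF m(1)])
qed

lemma hod_fseqs: "hod (fseqs om)"
  by (rule hodI[OF OD_term]) (intro dfi, rule hod_fseq)

lemma hod_strat: "fn s (fseqs om) om \<Longrightarrow> hod s"
  by (rule hod_fn[OF OD_strat]) (auto intro: hod_mem[OF hod_om] hod_fseq)

text \<open>Truth of a fixed formula in the class is itself definable, so the subsets and images
  demanded by the schemas are definable from the given parameters by \<open>OD_closed\<close>. Their
  elements lie in the class by construction, hence so do they.\<close>

theorem valid_hod:
  assumes "\<phi> \<in> ZF"
  shows "valid {x. hod x} (\<epsilon>) \<phi>"
proof -
  let ?N = "{x. hod x}"
  have sat_df: "df (Collect OD) (\<lambda>s. sat ?N (\<epsilon>) (t s) \<psi>)" if "\<And>n. dft (Collect OD) (\<lambda>s. t s n)" for t \<psi>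
    by (rule df_sat) (intro dfi, rule that)
  have range: "OD (t n)" if "range t \<subseteq> ?N" for t and n :: nat using that hod_OD by auto
  consider "\<phi> = extensionality" | "\<phi> = foundation" | "\<phi> = pairing" | "\<phi> = union" | "\<phi> = power_set"
    | "\<phi> = infinity" | \<psi> where "\<phi> = separation \<psi>" | \<psi> where "\<phi> = replacement \<psi>"
    using assms by (auto simp: ZF_def)
  then show ?thesis
  proof cases
    case 1
    have "x = y" if "hod x" "hod y" "\<forall>z. hod z \<longrightarrow> (z \<epsilon> x \<longleftrightarrow> z \<epsilon> y)" for x y
      by (rule extensional) (use that hod_mem in blast)
    then show ?thesis unfolding 1 valid_def sat_extensionality by simp
  next
    case 2
    have "\<exists>y\<in>?N. y \<epsilon> x \<and> \<not> (\<exists>z\<in>?N. z \<epsilon> x \<and> z \<epsilon> y)" if x: "hod x" "y \<epsilon> x" for x y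
      using founded[OF x(2)] hod_mem[OF x(1)] by blast
    then show ?thesis unfolding 2 valid_def sat_foundation by blast
  next
    case 3
    have "\<exists>u. hod u \<and> (\<forall>z. hod z \<longrightarrow> (z \<epsilon> u \<longleftrightarrow> z = x \<or> z = y))" if "hod x" "hod y" for x y
      using hod_upr[OF that] by (intro exI[of _ "upr x y"]) simp
    then show ?thesis unfolding 3 valid_def sat_pairing by simp
  next
    case 4
    have "\<exists>u. hod u \<and> (\<forall>z. hod z \<longrightarrow> (z \<epsilon> u \<longleftrightarrow> (\<exists>y. hod y \<and> y \<epsilon> x \<and> z \<epsilon> y)))" if x: "hod x" for x
    proof -
      have "hod (un x)"
      proof (rule hodI[OF OD_term])
        show "dft (Collect OD) (\<lambda>s. un x)" by (intro dfi dfo hod_OD x)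
        show "hod y" if "y \<epsilon> un x" for y using that hod_mem hod_mem[OF x] by auto
      qed
      then show ?thesis using hod_mem[OF x] by (intro exI[of _ "un x"]) auto
    qed
    then show ?thesis unfolding 4 valid_def sat_union by simp
  next
    case 5
    have "\<exists>u. hod u \<and> (\<forall>z. hod z \<longrightarrow> (z \<epsilon> u \<longleftrightarrow> (\<forall>w. hod w \<longrightarrow> w \<epsilon> z \<longrightarrow> w \<epsilon> x)))" if x: "hod x" for x
    proof -
      have m: "z \<epsilon> sep (pw x) hod \<longleftrightarrow> z \<epsilon> pw x \<and> hod z" for z by (rule mem_sep) (intro dfi)
      have "hod (sep (pw x) hod)"
      proof (rule hodI[OF OD_term])
        show "dft (Collect OD) (\<lambda>s. sep (pw x) hod)" by (intro dfi dfo hod_OD x)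
      qed (simp add: m)
      moreover have "sub z x \<longleftrightarrow> (\<forall>w. hod w \<longrightarrow> w \<epsilon> z \<longrightarrow> w \<epsilon> x)" if "hod z" for z
        using hod_mem[OF that] unfolding sub_def by blast
      ultimately show ?thesis by (intro exI[of _ "sep (pw x) hod"]) (simp add: m)
    qed
    then show ?thesis unfolding 5 valid_def sat_power_set by simp
  next
    case 6
    have "sat ?N (\<epsilon>) s infinity" for s
      unfolding sat_infinity
    proof (rule bexI[of _ om], intro conjI ballI impI)
      show "\<exists>e\<in>?N. (\<forall>z\<in>?N. \<not> z \<epsilon> e) \<and> e \<epsilon> om"
        using hod_ord[OF ord_emp] by (intro bexI[of _ emp]) auto
      show "\<exists>t\<in>?N. (\<forall>z\<in>?N. z \<epsilon> t \<longleftrightarrow> z \<epsilon> y \<or> z = y) \<and> t \<epsilon> om" if "y \<epsilon> om" for y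
        using hod_mem[OF hod_om suc_om[OF that]] that by (intro bexI[of _ "suc y"]) auto
    qed (simp add: hod_om)
    then show ?thesis by (simp add: 6 valid_def)
  next
    case (7 \<psi>)
    show ?thesis unfolding 7 valid_separation
    proof (intro allI impI)
      fix t :: "nat \<Rightarrow> 'u" and a assume t: "range t \<subseteq> ?N" and a: "a \<in> ?N"
      let ?P = "\<lambda>x. sat ?N (\<epsilon>) (t(0 := x)) \<psi>"
      have P: "df (Collect OD) (\<lambda>s. ?P (s 0))"
      proof (rule sat_df)
        show "dft (Collect OD) (\<lambda>s. (t(0 := s 0)) n)" for n
          by (cases n) (auto intro: dfi dfo range[OF t])
      qed
      have m: "x \<epsilon> sep a ?P \<longleftrightarrow> x \<epsilon> a \<and> ?P x" for x
        by (rule mem_sep) (rule Def_mono[OF P], simp)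
      have "OD (sep a ?P)"
      proof (rule OD_closed)
        show "df (Collect OD) (\<lambda>s. s 0 \<epsilon> a \<and> ?P (s 0))" using a by (intro dfi dfo hod_OD P) simp
      qed (rule m)
      then have "hod (sep a ?P)" by (rule hodI) (use a hod_mem m in auto)
      then show "\<exists>b\<in>?N. \<forall>x\<in>?N. x \<epsilon> b \<longleftrightarrow> x \<epsilon> a \<and> ?P x"
        using m by (intro bexI[of _ "sep a ?P"]) (simp_all del: fun_upd_apply)
    qed
  next
    case (8 \<psi>)
    show ?thesis unfolding 8 valid_replacement
    proof (intro allI impI)
      fix t :: "nat \<Rightarrow> 'u" and a assume t: "range t \<subseteq> ?N" and a: "a \<in> ?N"
        and func: "\<forall>x\<in>?N. x \<epsilon> a \<longrightarrow> (\<exists>c\<in>?N. \<forall>y\<in>?N. sat ?N (\<epsilon>) (t(0 := x, 1 := y)) \<psi> \<longleftrightarrow> y = c)"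
      let ?Q = "\<lambda>x y. hod y \<and> sat ?N (\<epsilon>) (t(0 := x, 1 := y)) \<psi>"
      have Q: "df (Collect OD) (\<lambda>s. ?Q (s 0) (s (Suc 0)))"
      proof (intro dfi sat_df)
        show "dft (Collect OD) (\<lambda>s. (t(0 := s 0, 1 := s (Suc 0))) n)" for n
          by (cases "n = 0"; cases "n = 1") (auto intro: dfi dfo range[OF t])
      qed
      have "\<exists>b. \<forall>y. y \<epsilon> b \<longleftrightarrow> (\<exists>x. x \<epsilon> a \<and> ?Q x y)"
      proof (rule replace[where Q = ?Q])
        show "df UNIV (\<lambda>s. ?Q (s 0) (s (Suc 0)))" by (rule Def_mono[OF Q]) simp
        fix x assume x: "x \<epsilon> a"
        with a hod_mem have "x \<in> ?N" by blast
        from func[rule_format, OF this x] show "\<exists>!y. ?Q x y" by (simp del: fun_upd_apply) blast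
      qed
      then obtain b where b: "\<And>y. y \<epsilon> b \<longleftrightarrow> (\<exists>x. x \<epsilon> a \<and> ?Q x y)" by blast
      have "OD b"
      proof (rule OD_closed)
        show "df (Collect OD) (\<lambda>s. \<exists>x. x \<epsilon> a \<and> ?Q x (s 0))"
          using a by (intro df_ex df_and[OF df_mem] dft_var dfo hod_OD df2[of _ ?Q, OF Q]) simp
      qed (rule b)
      then have "hod b" by (rule hodI) (use b in blast)
      then show "\<exists>b\<in>?N. \<forall>y\<in>?N. y \<epsilon> b \<longleftrightarrow> (\<exists>x\<in>?N. x \<epsilon> a \<and> sat ?N (\<epsilon>) (t(0 := x, 1 := y)) \<psi>)"
      proof (intro bexI[of _ b] ballI)
        fix y assume "y \<in> ?N"
        then show "y \<epsilon> b \<longleftrightarrow> (\<exists>x\<in>?N. x \<epsilon> a \<and> sat ?N (\<epsilon>) (t(0 := x, 1 := y)) \<psi>)"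
          unfolding b using a hod_mem by blast
      qed simp
    qed
  qed
qed

text \<open>The relation says that \<open>y\<close> is not definable from \<open>x\<close> and an
  ordinal. It is total, as otherwise an ordinal would enumerate the reals. A function uniformizing
  it cannot be definable from a real \<open>z\<close>, since its value at \<open>z\<close> would be
  definable from \<open>z\<close> as well.\<close>

theorem ex_not_OD:
  assumes ad: "adx reals"
  shows "\<exists>A. sub A reals \<and> \<not> OD A"
proof -
  let ?r = "sep (cart reals reals) (\<lambda>p. \<not> (\<exists>a. ord a \<and> psnd p = oset a (pfst p)))"
  have r: "p \<epsilon> ?r \<longleftrightarrow> p \<epsilon> cart reals reals \<and> \<not> (\<exists>a. ord a \<and> psnd p = oset a (pfst p))" for p
    by (rule mem_sep) (intro dfi)
  have "\<exists>y. y \<epsilon> reals \<and> prd x y \<epsilon> ?r" if x: "x \<epsilon> reals" for x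
  proof (rule ccontr)
    assume "\<not> ?thesis"
    then have all: "\<exists>a. ord a \<and> y = oset a x" if "y \<epsilon> reals" for y
      using that x r[of "prd x y"] by auto
    have "\<exists>g. ord g \<and> (\<forall>y. y \<epsilon> reals \<longrightarrow> (\<exists>d. d \<epsilon> g \<and> ord d \<and> y = oset d x))"
      by (rule bounding[OF _ all]) (intro dfi dfp)
    then obtain g where g: "ord g" "\<And>y. y \<epsilon> reals \<Longrightarrow> \<exists>d. d \<epsilon> g \<and> ord d \<and> y = oset d x" by blast
    have df: "dft UNIV (\<lambda>s. oset (s 0) x)" by (intro dfi dfp)
    have "\<exists>a. a \<epsilon> g \<and> app (lam g (\<lambda>a. oset a x)) a = y" if y: "y \<epsilon> reals" for y
    proof -
      from g(2)[OF y] obtain d where "d \<epsilon> g" "y = oset d x" by blast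
      with app_lam[OF df \<open>d \<epsilon> g\<close>] show ?thesis by (intro exI[of _ d]) simp
    qed
    then show False using reals_not_wellorderable[OF adx_om[OF ad] g(1)] by blast
  qed
  from uniformization[OF ad this] obtain f where
    f: "fn f reals reals" "\<forall>x. x \<epsilon> reals \<longrightarrow> prd x (app f x) \<epsilon> ?r" by blast
  define Unif where "Unif f \<longleftrightarrow> fn f reals reals \<and> (\<forall>x. x \<epsilon> reals \<longrightarrow> prd x (app f x) \<epsilon> ?r)" for f
  have dU: "df C (\<lambda>s. Unif (t s))" if "dft C t" for C t
    unfolding Unif_def by (intro dfi dft_ren[OF that])
  have nf: "\<not> OD f"
  proof
    assume "OD f"
    then obtain a z where az: "ord a" "z \<epsilon> reals" "f = oset a z" unfolding OD_def by blast
    let ?P = "\<lambda>a. Unif (oset a z)"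
    have "?P a" using f az by (simp add: Unif_def)
    moreover have "df UNIV (\<lambda>s. ?P (s 0))" by (intro dU dfi dfp)
    \<comment> \<open>The ordinal is replaced by the least one that yields a uniformizing function,
      so that the value at \<open>z\<close> becomes definable from \<open>z\<close> alone, as
      \<open>capture\<close> requires.\<close>
    ultimately have u: "?P (lst ?P)" using lst(2)[of ?P a] az(1) by blast
    have "\<exists>b. ord b \<and> app (oset (lst ?P) z) z = oset b z"
      by (rule capture[where P = "\<lambda>y z. y \<epsilon> app (oset (lst (\<lambda>a. Unif (oset a z))) z) z"]) (intro dfi dU, rule refl)
    moreover have "prd z (app (oset (lst ?P) z) z) \<epsilon> ?r" using u az(2) unfolding Unif_def by blast
    ultimately show False using r by auto
  qed
  \<comment> \<open>The graph of \<open>f\<close> is folded into a set of reals by joining argument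
    and value.\<close>
  let ?A = "repl f (\<lambda>p. join (pfst p) (psnd p))"
  have "dft UNIV (\<lambda>s. join (pfst (s 0)) (psnd (s 0)))" by (intro dfi)
  from mem_repl[OF this] have A: "w \<epsilon> ?A \<longleftrightarrow> (\<exists>x. x \<epsilon> reals \<and> w = join x (app f x))" for w
    by (auto simp: fn_elt[OF f(1)])
  have fx: "fn (app f x) om om" if "fn x om om" for x using fn_app[OF f(1), of x] that by simp
  have "sub ?A reals" using A fx by (auto simp: sub_def intro: fn_join)
  moreover have "\<not> OD ?A"
  proof
    assume o: "OD ?A"
    have "OD f"
    proof (rule OD_closed)
      show "df (Collect OD) (\<lambda>s. \<exists>x y. x \<epsilon> reals \<and> y \<epsilon> reals \<and> s 0 = prd x y \<and> join x y \<epsilon> ?A)"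
        by (intro dfi dfo o)
      fix p show "p \<epsilon> f \<longleftrightarrow> (\<exists>x y. x \<epsilon> reals \<and> y \<epsilon> reals \<and> p = prd x y \<and> join x y \<epsilon> ?A)"
      proof
        assume "p \<epsilon> f"
        then obtain x where "x \<epsilon> reals" "p = prd x (app f x)" by (auto simp: fn_elt[OF f(1)])
        then show "\<exists>x y. x \<epsilon> reals \<and> y \<epsilon> reals \<and> p = prd x y \<and> join x y \<epsilon> ?A"
          using A fx by (intro exI[of _ x] exI[of _ "app f x"]) auto
      next
        assume "\<exists>x y. x \<epsilon> reals \<and> y \<epsilon> reals \<and> p = prd x y \<and> join x y \<epsilon> ?A"
        then obtain x y z where *: "fn x om om" "fn y om om" "p = prd x y" "fn z om om" "join x y = join z (app f z)"
          using A by auto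
        have "x = lft (join z (app f z))" "y = rgt (join z (app f z))"
          unfolding *(5)[symmetric] using *(1,2) by simp_all
        then have "x = z" "y = app f z" using *(4) fx[OF *(4)] by simp_all
        with * show "p \<epsilon> f" by (simp add: fn_pair[OF f(1)])
      qed
    qed
    with nf show False ..
  qed
  ultimately show ?thesis by blast
qed

end

section \<open>Absoluteness for transitive classes\<close>

definition rng :: "'a set \<Rightarrow> (nat \<Rightarrow> 'a) \<Rightarrow> bool" where
  "rng W s \<longleftrightarrow> (\<forall>v. s v \<in> W)"

lemma rng_simps [simp]: "rng W s \<Longrightarrow> s v \<in> W" "rng W s \<Longrightarrow> a \<in> W \<Longrightarrow> rng W (s(n := a))"
  by (simp_all add: rng_def)

text \<open>The recursion clause of \<open>is_check\<close>, isolated so that it can be evaluated in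
  a class on its own.\<close>

definition check_step :: "nat \<Rightarrow> nat \<Rightarrow> nat \<Rightarrow> nat \<Rightarrow> fb" where
  "check_step P f y c = (\<^bold>\<forall>z. z \<^bold>\<in> c \<^bold>\<longleftrightarrow>
    (\<^bold>\<exists>u v p. u \<^bold>\<in> y \<^bold>\<and> related f u v \<^bold>\<and> p \<^bold>\<in> P \<^bold>\<and> is_pair v p z))"

lemma is_check_eq: "is_check P x t = (\<^bold>\<exists>T C f. is_transitive T \<^bold>\<and> x \<^bold>\<in> T \<^bold>\<and> is_function f T C \<^bold>\<and>
    (\<^bold>\<forall>y c. related f y c \<^bold>\<longrightarrow> check_step P f y c) \<^bold>\<and> related f x t)"
  by (simp only: is_check_def check_step_def)

locale twc = zf E R for E :: "'u \<Rightarrow> 'u \<Rightarrow> bool" (infix \<open>\<epsilon>\<close> 50) and R :: "'u \<Rightarrow> 'u \<Rightarrow> 'u \<Rightarrow> bool" +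
  fixes W :: "'u set"
  assumes trW: "x \<in> W \<Longrightarrow> y \<epsilon> x \<Longrightarrow> y \<in> W"
begin

abbreviation stW :: "(nat \<Rightarrow> 'u) \<Rightarrow> fm \<Rightarrow> bool" where "stW \<equiv> sat W (\<epsilon>)"

lemma prdW: "f \<in> W \<Longrightarrow> prd x y \<epsilon> f \<Longrightarrow> x \<in> W \<and> y \<in> W \<and> prd x y \<in> W"
proof -
  assume "f \<in> W" "prd x y \<epsilon> f"
  then have p: "prd x y \<in> W" by (rule trW)
  have "upr x y \<epsilon> prd x y" by (simp add: prd_def)
  with p have "upr x y \<in> W" by (rule trW)
  with p show ?thesis using trW[of "upr x y"] by simp
qed

text \<open>Members of the class have all their elements in it, so a description by quantifiers over
  the class already determines such a set.\<close>

lemma setW: "a \<in> W \<Longrightarrow> (\<And>z. z \<epsilon> c \<longleftrightarrow> P z) \<Longrightarrow> (\<And>z. P z \<Longrightarrow> z \<in> W) \<Longrightarrow> (\<forall>z\<in>W. z \<epsilon> a \<longleftrightarrow> P z) \<longleftrightarrow> a = c"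
  using trW by (blast intro: extensional)

lemmas ws = sat_simps rng_simps
declare fun_upd_apply [simp del]

section \<open>Bounded formulas keep their meaning in a transitive class\<close>

lemma W_subset: "rng W s \<Longrightarrow> x < n \<Longrightarrow> y < n \<Longrightarrow> stW s (is_subset x y n) \<longleftrightarrow> sub (s x) (s y)"
  unfolding sat_is_subset sub_def using trW rng_simps by blast

lemma W_empty: "rng W s \<Longrightarrow> x < n \<Longrightarrow> stW s (is_empty x n) \<longleftrightarrow> s x = emp"
  unfolding sat_is_empty emp_unique[symmetric] using trW rng_simps by blast

lemma W_succ: "rng W s \<Longrightarrow> x < n \<Longrightarrow> y < n \<Longrightarrow> stW s (is_succ x y n) \<longleftrightarrow> s y = suc (s x)"
  unfolding sat_is_succ by (rule setW) (auto intro: trW[of "s x"])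

lemma W_upair: "rng W s \<Longrightarrow> x < n \<Longrightarrow> y < n \<Longrightarrow> u < n \<Longrightarrow> stW s (is_upair x y u n) \<longleftrightarrow> s u = upr (s x) (s y)"
  unfolding sat_is_upair by (rule setW) auto

lemma W_diff: "rng W s \<Longrightarrow> x < n \<Longrightarrow> y < n \<Longrightarrow> d < n \<Longrightarrow>
    stW s (is_diff x y d n) \<longleftrightarrow> (\<forall>z. z \<epsilon> s d \<longleftrightarrow> z \<epsilon> s x \<and> \<not> z \<epsilon> s y)"
proof -
  assume *: "rng W s" "x < n" "y < n" "d < n"
  have "stW s (is_diff x y d n) \<longleftrightarrow> (\<forall>z\<in>W. z \<epsilon> s d \<longleftrightarrow> z \<epsilon> s x \<and> \<not> z \<epsilon> s y)"
    using * by (simp add: is_diff_def ws)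
  then show ?thesis using trW rng_simps(1)[OF *(1)] by blast
qed

lemma W_pair: "rng W s \<Longrightarrow> x < n \<Longrightarrow> y < n \<Longrightarrow> p < n \<Longrightarrow> stW s (is_pair x y p n) \<longleftrightarrow> s p = prd (s x) (s y)"
proof -
  assume *: "rng W s" "x < n" "y < n" "p < n"
  have "stW s (is_pair x y p n) \<longleftrightarrow>
      (\<exists>u\<in>W. \<exists>v\<in>W. u = upr (s x) (s x) \<and> v = upr (s x) (s y) \<and> s p = upr u v)"
    using * by (simp add: is_pair_def ws W_upair cong: bex_cong)
  also have "\<dots> \<longleftrightarrow> s p = prd (s x) (s y)"
  proof
    assume p: "s p = prd (s x) (s y)"
    have "upr (s x) (s x) \<epsilon> s p" "upr (s x) (s y) \<epsilon> s p" by (simp_all add: p prd_def)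
    then have "upr (s x) (s x) \<in> W" "upr (s x) (s y) \<in> W" using trW[of "s p"] *(1) by simp_all
    then show "\<exists>u\<in>W. \<exists>v\<in>W. u = upr (s x) (s x) \<and> v = upr (s x) (s y) \<and> s p = upr u v"
      using p by (simp add: prd_def)
  qed (auto simp: prd_def)
  finally show ?thesis .
qed

lemma W_related: "rng W s \<Longrightarrow> f < n \<Longrightarrow> x < n \<Longrightarrow> y < n \<Longrightarrow> stW s (related f x y n) \<longleftrightarrow> prd (s x) (s y) \<epsilon> s f"
proof -
  assume *: "rng W s" "f < n" "x < n" "y < n"
  have "stW s (related f x y n) \<longleftrightarrow> (\<exists>p\<in>W. p = prd (s x) (s y) \<and> p \<epsilon> s f)"
    using * by (simp add: related_def ws W_pair cong: bex_cong)
  then show ?thesis using trW[of "s f"] *(1) by auto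
qed

lemma W_function: "rng W s \<Longrightarrow> f < n \<Longrightarrow> X < n \<Longrightarrow> Y < n \<Longrightarrow> stW s (is_function f X Y n) \<longleftrightarrow> fn (s f) (s X) (s Y)"
proof -
  assume *: "rng W s" "f < n" "X < n" "Y < n"
  have "stW s (is_function f X Y n) \<longleftrightarrow>
      (\<forall>p\<in>W. p \<epsilon> s f \<longrightarrow> (\<exists>x\<in>W. \<exists>y\<in>W. x \<epsilon> s X \<and> y \<epsilon> s Y \<and> p = prd x y)) \<and>
      (\<forall>x\<in>W. x \<epsilon> s X \<longrightarrow> (\<exists>y\<in>W. \<forall>z\<in>W. prd x z \<epsilon> s f \<longleftrightarrow> z = y))"
    using * by (simp add: is_function_def ws W_pair W_related cong: bex_cong ball_cong)
  also have "\<dots> \<longleftrightarrow> fn (s f) (s X) (s Y)" (is "?l1 \<and> ?l2 \<longleftrightarrow> _")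
  proof -
    have W: "s f \<in> W" "s X \<in> W" "s Y \<in> W" using *(1) by simp_all
    have 1: "?l1 \<longleftrightarrow> (\<forall>p. p \<epsilon> s f \<longrightarrow> (\<exists>x y. x \<epsilon> s X \<and> y \<epsilon> s Y \<and> p = prd x y))"
      using trW[OF W(1)] trW[OF W(2)] trW[OF W(3)] by blast
    have 2: "(\<exists>y\<in>W. \<forall>z\<in>W. prd x z \<epsilon> s f \<longleftrightarrow> z = y) \<longleftrightarrow> (\<exists>y. \<forall>z. prd x z \<epsilon> s f \<longleftrightarrow> z = y)" for x
    proof
      assume "\<exists>y\<in>W. \<forall>z\<in>W. prd x z \<epsilon> s f \<longleftrightarrow> z = y"
      then obtain y where "y \<in> W" "\<forall>z\<in>W. prd x z \<epsilon> s f \<longleftrightarrow> z = y" by blast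
      then have "\<forall>z. prd x z \<epsilon> s f \<longleftrightarrow> z = y" using prdW[OF W(1)] by blast
      then show "\<exists>y. \<forall>z. prd x z \<epsilon> s f \<longleftrightarrow> z = y" by blast
    next
      assume "\<exists>y. \<forall>z. prd x z \<epsilon> s f \<longleftrightarrow> z = y"
      then obtain y where y: "\<forall>z. prd x z \<epsilon> s f \<longleftrightarrow> z = y" by blast
      then have "y \<in> W" using prdW[OF W(1)] by blast
      with y show "\<exists>y\<in>W. \<forall>z\<in>W. prd x z \<epsilon> s f \<longleftrightarrow> z = y" by blast
    qed
    have 3: "?l2 \<longleftrightarrow> (\<forall>x. x \<epsilon> s X \<longrightarrow> (\<exists>y. \<forall>z. prd x z \<epsilon> s f \<longleftrightarrow> z = y))"
      unfolding 2 using trW[OF W(2)] by blast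
    show ?thesis unfolding fn_def 1 3 ..
  qed
  finally show ?thesis .
qed

definition srj :: "'u \<Rightarrow> 'u \<Rightarrow> 'u \<Rightarrow> bool" where
  "srj f X Y \<longleftrightarrow> fn f X Y \<and> (\<forall>y. y \<epsilon> Y \<longrightarrow> (\<exists>x. x \<epsilon> X \<and> prd x y \<epsilon> f))"

lemma W_surjection: "rng W s \<Longrightarrow> f < n \<Longrightarrow> X < n \<Longrightarrow> Y < n \<Longrightarrow> stW s (is_surjection f X Y n) \<longleftrightarrow> srj (s f) (s X) (s Y)"
proof -
  assume *: "rng W s" "f < n" "X < n" "Y < n"
  have "stW s (is_surjection f X Y n) \<longleftrightarrow> fn (s f) (s X) (s Y) \<and>
      (\<forall>y\<in>W. y \<epsilon> s Y \<longrightarrow> (\<exists>x\<in>W. x \<epsilon> s X \<and> prd x y \<epsilon> s f))"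
    using * by (simp add: is_surjection_def ws W_function W_related cong: bex_cong ball_cong)
  then show ?thesis unfolding srj_def using trW rng_simps(1)[OF *(1)] by blast
qed

lemma W_restriction: "rng W s \<Longrightarrow> f < n \<Longrightarrow> X < n \<Longrightarrow> g < n \<Longrightarrow> stW s (is_restriction f X g n) \<longleftrightarrow> s g = rst (s f) (s X)"
proof -
  assume *: "rng W s" "f < n" "X < n" "g < n"
  have W: "s f \<in> W" "s X \<in> W" "s g \<in> W" using *(1) by simp_all
  have "stW s (is_restriction f X g n) \<longleftrightarrow>
      (\<forall>p\<in>W. p \<epsilon> s g \<longleftrightarrow> p \<epsilon> s f \<and> (\<exists>x\<in>W. \<exists>y\<in>W. x \<epsilon> s X \<and> p = prd x y))"
    using * by (simp add: is_restriction_def ws W_pair cong: bex_cong ball_cong)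
  also have "\<dots> \<longleftrightarrow> s g = rst (s f) (s X)"
    by (rule setW[OF W(3)]) (use prdW[OF W(1)] in \<open>unfold mem_rst, blast+\<close>)
  finally show ?thesis .
qed

lemma W_transitive: "rng W s \<Longrightarrow> x < n \<Longrightarrow> stW s (is_transitive x n) \<longleftrightarrow> trans_set (s x)"
proof -
  assume *: "rng W s" "x < n"
  have "stW s (is_transitive x n) \<longleftrightarrow> (\<forall>y\<in>W. y \<epsilon> s x \<longrightarrow> sub y (s x))"
    using * by (simp add: is_transitive_def ws W_subset cong: ball_cong)
  then show ?thesis unfolding trans_set_def using trW rng_simps(1)[OF *(1)] by blast
qed

lemma W_ordinal: "rng W s \<Longrightarrow> x < n \<Longrightarrow> stW s (is_ordinal x n) \<longleftrightarrow> ord (s x)"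
proof -
  assume *: "rng W s" "x < n"
  have "stW s (is_ordinal x n) \<longleftrightarrow> trans_set (s x) \<and> (\<forall>y\<in>W. y \<epsilon> s x \<longrightarrow> trans_set y)"
    using * by (simp add: is_ordinal_def ws W_transitive cong: ball_cong)
  then show ?thesis unfolding ord_def using trW rng_simps(1)[OF *(1)] by blast
qed

lemma W_pairs_of: "rng W s \<Longrightarrow> P < n \<Longrightarrow> L < n \<Longrightarrow> stW s (is_poset P L n) \<longleftrightarrow>
    (\<exists>p. p \<epsilon> s P) \<and> (\<forall>z. z \<epsilon> s L \<longrightarrow> (\<exists>p q. p \<epsilon> s P \<and> q \<epsilon> s P \<and> z = prd p q)) \<and>
    (\<forall>p. p \<epsilon> s P \<longrightarrow> prd p p \<epsilon> s L) \<and>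
    (\<forall>p q. prd p q \<epsilon> s L \<and> prd q p \<epsilon> s L \<longrightarrow> p = q) \<and>
    (\<forall>p q r. prd p q \<epsilon> s L \<and> prd q r \<epsilon> s L \<longrightarrow> prd p r \<epsilon> s L)"
proof -
  assume *: "rng W s" "P < n" "L < n"
  have W: "s P \<in> W" "s L \<in> W" using *(1) by simp_all
  have "stW s (is_poset P L n) \<longleftrightarrow>
    (\<exists>p\<in>W. p \<epsilon> s P) \<and> (\<forall>z\<in>W. z \<epsilon> s L \<longrightarrow> (\<exists>p\<in>W. \<exists>q\<in>W. p \<epsilon> s P \<and> q \<epsilon> s P \<and> z = prd p q)) \<and>
    (\<forall>p\<in>W. p \<epsilon> s P \<longrightarrow> prd p p \<epsilon> s L) \<and>
    (\<forall>p\<in>W. \<forall>q\<in>W. prd p q \<epsilon> s L \<and> prd q p \<epsilon> s L \<longrightarrow> p = q) \<and>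
    (\<forall>p\<in>W. \<forall>q\<in>W. \<forall>r\<in>W. prd p q \<epsilon> s L \<and> prd q r \<epsilon> s L \<longrightarrow> prd p r \<epsilon> s L)"
    using * by (simp add: is_poset_def ws W_pair W_related cong: bex_cong ball_cong)
  moreover have "(\<exists>p\<in>W. p \<epsilon> s P) \<longleftrightarrow> (\<exists>p. p \<epsilon> s P)" using trW[OF W(1)] by blast
  moreover have "(\<forall>z\<in>W. z \<epsilon> s L \<longrightarrow> (\<exists>p\<in>W. \<exists>q\<in>W. p \<epsilon> s P \<and> q \<epsilon> s P \<and> z = prd p q)) \<longleftrightarrow>
      (\<forall>z. z \<epsilon> s L \<longrightarrow> (\<exists>p q. p \<epsilon> s P \<and> q \<epsilon> s P \<and> z = prd p q))"
    using trW[OF W(1)] trW[OF W(2)] by blast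
  moreover have "(\<forall>p\<in>W. p \<epsilon> s P \<longrightarrow> prd p p \<epsilon> s L) \<longleftrightarrow> (\<forall>p. p \<epsilon> s P \<longrightarrow> prd p p \<epsilon> s L)"
    using trW[OF W(1)] by blast
  moreover have "(\<forall>p\<in>W. \<forall>q\<in>W. prd p q \<epsilon> s L \<and> prd q p \<epsilon> s L \<longrightarrow> p = q) \<longleftrightarrow>
      (\<forall>p q. prd p q \<epsilon> s L \<and> prd q p \<epsilon> s L \<longrightarrow> p = q)"
    using prdW[OF W(2)] by blast
  moreover have "(\<forall>p\<in>W. \<forall>q\<in>W. \<forall>r\<in>W. prd p q \<epsilon> s L \<and> prd q r \<epsilon> s L \<longrightarrow> prd p r \<epsilon> s L) \<longleftrightarrow>
      (\<forall>p q r. prd p q \<epsilon> s L \<and> prd q r \<epsilon> s L \<longrightarrow> prd p r \<epsilon> s L)"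
    using prdW[OF W(2)] by blast
  ultimately show ?thesis by simp
qed

definition name_domain :: "'u \<Rightarrow> 'u \<Rightarrow> bool" where
  "name_domain P D \<longleftrightarrow> (\<forall>a z. a \<epsilon> D \<and> z \<epsilon> a \<longrightarrow> (\<exists>s p. s \<epsilon> D \<and> p \<epsilon> P \<and> z = prd s p))"

lemma W_name_domain: "rng W s \<Longrightarrow> P < n \<Longrightarrow> D < n \<Longrightarrow> stW s (is_name_domain P D n) \<longleftrightarrow> name_domain (s P) (s D)"
proof -
  assume *: "rng W s" "P < n" "D < n"
  have W: "s P \<in> W" "s D \<in> W" using *(1) by simp_all
  have "stW s (is_name_domain P D n) \<longleftrightarrow>
      (\<forall>a\<in>W. \<forall>z\<in>W. a \<epsilon> s D \<and> z \<epsilon> a \<longrightarrow> (\<exists>t\<in>W. \<exists>p\<in>W. t \<epsilon> s D \<and> p \<epsilon> s P \<and> z = prd t p))"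
    using * by (simp add: is_name_domain_def ws W_pair cong: bex_cong ball_cong)
  then show ?thesis unfolding name_domain_def using trW[OF W(1)] trW[OF W(2)] trW by blast
qed

lemma W_name: "rng W s \<Longrightarrow> P < n \<Longrightarrow> a < n \<Longrightarrow> stW s (is_name P a n) \<longleftrightarrow> (\<exists>D\<in>W. name_domain (s P) D \<and> s a \<epsilon> D)"
  by (simp add: is_name_def ws W_name_domain cong: bex_cong)

definition atomic_forcing :: "'u \<Rightarrow> 'u \<Rightarrow> 'u \<Rightarrow> 'u \<Rightarrow> 'u \<Rightarrow> bool" where
  "atomic_forcing P L D e m \<longleftrightarrow> name_domain P D \<and>
     (\<forall>p a b. p \<epsilon> P \<and> a \<epsilon> D \<and> b \<epsilon> D \<longrightarrow>
       (prd p (prd a b) \<epsilon> e \<longleftrightarrow>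
         (\<forall>s q. (\<exists>t. prd s t \<epsilon> a \<or> prd s t \<epsilon> b) \<and> prd q p \<epsilon> L \<longrightarrow>
           (prd q (prd s a) \<epsilon> m \<longleftrightarrow> prd q (prd s b) \<epsilon> m))) \<and>
       (prd p (prd a b) \<epsilon> m \<longleftrightarrow>
         (\<forall>q. prd q p \<epsilon> L \<longrightarrow> (\<exists>r s t. prd r q \<epsilon> L \<and> prd s t \<epsilon> b \<and> prd r t \<epsilon> L \<and> prd r (prd a s) \<epsilon> e))))"

lemma W_related3: "rng W s \<Longrightarrow> r < n \<Longrightarrow> p < n \<Longrightarrow> a < n \<Longrightarrow> b < n \<Longrightarrow>
    stW s (related3 r p a b n) \<longleftrightarrow> prd (s p) (prd (s a) (s b)) \<epsilon> s r"
proof -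
  assume *: "rng W s" "r < n" "p < n" "a < n" "b < n"
  have "stW s (related3 r p a b n) \<longleftrightarrow> (\<exists>u\<in>W. u = prd (s a) (s b) \<and> prd (s p) u \<epsilon> s r)"
    using * by (simp add: related3_def ws W_pair W_related cong: bex_cong)
  then show ?thesis using prdW[of "s r" "s p"] *(1) by auto
qed

lemma W_atomic: "rng W s \<Longrightarrow> P < n \<Longrightarrow> L < n \<Longrightarrow> D < n \<Longrightarrow> e < n \<Longrightarrow> m < n \<Longrightarrow>
    stW s (is_atomic_forcing P L D e m n) \<longleftrightarrow> atomic_forcing (s P) (s L) (s D) (s e) (s m)"
proof -
  assume *: "rng W s" "P < n" "L < n" "D < n" "e < n" "m < n"
  have W: "s P \<in> W" "s L \<in> W" "s D \<in> W" using *(1) by simp_all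
  have 1: "stW s (is_atomic_forcing P L D e m n) \<longleftrightarrow> name_domain (s P) (s D) \<and>
     (\<forall>p\<in>W. \<forall>a\<in>W. \<forall>b\<in>W. p \<epsilon> s P \<and> a \<epsilon> s D \<and> b \<epsilon> s D \<longrightarrow>
       (prd p (prd a b) \<epsilon> s e \<longleftrightarrow>
         (\<forall>c\<in>W. \<forall>q\<in>W. (\<exists>t\<in>W. prd c t \<epsilon> a \<or> prd c t \<epsilon> b) \<and> prd q p \<epsilon> s L \<longrightarrow>
           (prd q (prd c a) \<epsilon> s m \<longleftrightarrow> prd q (prd c b) \<epsilon> s m))) \<and>
       (prd p (prd a b) \<epsilon> s m \<longleftrightarrow>
         (\<forall>q\<in>W. prd q p \<epsilon> s L \<longrightarrow> (\<exists>r\<in>W. \<exists>c\<in>W. \<exists>t\<in>W. prd r q \<epsilon> s L \<and> prd c t \<epsilon> b \<and> prd r t \<epsilon> s L \<and> prd r (prd a c) \<epsilon> s e))))"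
    using * by (simp add: is_atomic_forcing_def ws W_name_domain W_related W_related3 cong: bex_cong ball_cong)
  have 2: "(\<forall>c\<in>W. \<forall>q\<in>W. (\<exists>t\<in>W. prd c t \<epsilon> a \<or> prd c t \<epsilon> b) \<and> prd q p \<epsilon> s L \<longrightarrow> Q c q) \<longleftrightarrow>
      (\<forall>c q. (\<exists>t. prd c t \<epsilon> a \<or> prd c t \<epsilon> b) \<and> prd q p \<epsilon> s L \<longrightarrow> Q c q)"
    if "a \<in> W" "b \<in> W" for a b p Q
    using prdW[OF that(1)] prdW[OF that(2)] prdW[OF W(2)] by blast
  have 3: "(\<forall>q\<in>W. prd q p \<epsilon> s L \<longrightarrow> (\<exists>r\<in>W. \<exists>c\<in>W. \<exists>t\<in>W. prd r q \<epsilon> s L \<and> prd c t \<epsilon> b \<and> prd r t \<epsilon> s L \<and> Q r c)) \<longleftrightarrow>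
      (\<forall>q. prd q p \<epsilon> s L \<longrightarrow> (\<exists>r c t. prd r q \<epsilon> s L \<and> prd c t \<epsilon> b \<and> prd r t \<epsilon> s L \<and> Q r c))"
    if "b \<in> W" for b p Q
    using prdW[OF that] prdW[OF W(2)] by blast
  have 4: "(\<forall>p\<in>W. \<forall>a\<in>W. \<forall>b\<in>W. p \<epsilon> s P \<and> a \<epsilon> s D \<and> b \<epsilon> s D \<longrightarrow> Q p a b) \<longleftrightarrow>
      (\<forall>p a b. p \<epsilon> s P \<and> a \<epsilon> s D \<and> b \<epsilon> s D \<longrightarrow> Q p a b)" for Q
    using trW[OF W(1)] trW[OF W(3)] by blast
  show ?thesis unfolding 1 atomic_forcing_def 4[symmetric] by (simp only: 2 3 cong: ball_cong)
qed

lemma W_check_step: "rng W s \<Longrightarrow> P < n \<Longrightarrow> f < n \<Longrightarrow> y < n \<Longrightarrow> c < n \<Longrightarrow> stW s (check_step P f y c n) \<longleftrightarrow>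
    (\<forall>z\<in>W. z \<epsilon> s c \<longleftrightarrow> (\<exists>u\<in>W. \<exists>v\<in>W. \<exists>p\<in>W. u \<epsilon> s y \<and> prd u v \<epsilon> s f \<and> p \<epsilon> s P \<and> z = prd v p))"
  unfolding check_step_def by (simp only: ws W_related W_pair cong: bex_cong ball_cong)

text \<open>A transitive class may lack some pairs of its members, so the recursion clause only
  describes those pairs that lie in it; the conjunct \<open>z \<in> W\<close> records this.\<close>

lemma W_check: "rng W s \<Longrightarrow> P < n \<Longrightarrow> x < n \<Longrightarrow> t < n \<Longrightarrow> stW s (is_check P x t n) \<Longrightarrow>
    \<exists>T\<in>W. \<exists>C\<in>W. \<exists>f\<in>W. trans_set T \<and> s x \<epsilon> T \<and> fn f T C \<and>
      (\<forall>y c. prd y c \<epsilon> f \<longrightarrow> (\<forall>z. z \<epsilon> c \<longleftrightarrow> (\<exists>u v p. u \<epsilon> y \<and> prd u v \<epsilon> f \<and> p \<epsilon> s P \<and> z = prd v p) \<and> z \<in> W)) \<and>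
      prd (s x) (s t) \<epsilon> f"
proof -
  assume *: "rng W s" "P < n" "x < n" "t < n" and "stW s (is_check P x t n)"
  moreover have "stW s (is_check P x t n) \<longleftrightarrow> (\<exists>T\<in>W. \<exists>C\<in>W. \<exists>f\<in>W. trans_set T \<and> s x \<epsilon> T \<and> fn f T C \<and>
      (\<forall>y\<in>W. \<forall>c\<in>W. prd y c \<epsilon> f \<longrightarrow>
        (\<forall>z\<in>W. z \<epsilon> c \<longleftrightarrow> (\<exists>u\<in>W. \<exists>v\<in>W. \<exists>p\<in>W. u \<epsilon> y \<and> prd u v \<epsilon> f \<and> p \<epsilon> s P \<and> z = prd v p))) \<and>
      prd (s x) (s t) \<epsilon> f)"
    using * unfolding is_check_eq
    by (simp only: ws W_transitive W_function W_related W_check_step cong: bex_cong ball_cong)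
  moreover note \<open>stW s (is_check P x t n)\<close>
  ultimately have "\<exists>T\<in>W. \<exists>C\<in>W. \<exists>f\<in>W. trans_set T \<and> s x \<epsilon> T \<and> fn f T C \<and>
      (\<forall>y\<in>W. \<forall>c\<in>W. prd y c \<epsilon> f \<longrightarrow>
        (\<forall>z\<in>W. z \<epsilon> c \<longleftrightarrow> (\<exists>u\<in>W. \<exists>v\<in>W. \<exists>p\<in>W. u \<epsilon> y \<and> prd u v \<epsilon> f \<and> p \<epsilon> s P \<and> z = prd v p))) \<and>
      prd (s x) (s t) \<epsilon> f" by (simp only:)
  then obtain T C f where T: "T \<in> W" "C \<in> W" "f \<in> W" "trans_set T" "s x \<epsilon> T" "fn f T C" "prd (s x) (s t) \<epsilon> f"
    and F: "\<forall>y\<in>W. \<forall>c\<in>W. prd y c \<epsilon> f \<longrightarrow>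
      (\<forall>z\<in>W. z \<epsilon> c \<longleftrightarrow> (\<exists>u\<in>W. \<exists>v\<in>W. \<exists>p\<in>W. u \<epsilon> y \<and> prd u v \<epsilon> f \<and> p \<epsilon> s P \<and> z = prd v p))"
    by (elim bexE conjE)
  note f = F[rule_format]
  have sP: "s P \<in> W" using *(1) by simp
  have "z \<epsilon> c \<longleftrightarrow> (\<exists>u v p. u \<epsilon> y \<and> prd u v \<epsilon> f \<and> p \<epsilon> s P \<and> z = prd v p) \<and> z \<in> W"
    if yc: "prd y c \<epsilon> f" for y c z
  proof -
    have W: "y \<in> W" "c \<in> W" using prdW[OF T(3) yc] by simp_all
    show ?thesis
    proof (cases "z \<in> W")
      case True
      show ?thesis using f[OF W yc True] True prdW[OF T(3)] trW[OF sP] by blast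
    next
      case False
      then show ?thesis using trW[OF W(2)] by blast
    qed
  qed
  with T show ?thesis by blast
qed

end

locale twc_om = twc E R W for E :: "'u \<Rightarrow> 'u \<Rightarrow> bool" (infix \<open>\<epsilon>\<close> 50) and R :: "'u \<Rightarrow> 'u \<Rightarrow> 'u \<Rightarrow> bool" and W :: "'u set" +
  assumes omW: "om \<in> W"
begin

lemma numW: "n \<epsilon> om \<Longrightarrow> n \<in> W" by (rule trW[OF omW])

text \<open>Minimality is tested only against inductive sets of the class, but \<open>om\<close> is
  one of them, and every inductive set of the class includes it by induction.\<close>

lemma W_omega: "rng W s \<Longrightarrow> w < n \<Longrightarrow> stW s (is_omega w n) \<longleftrightarrow> s w = om"
proof -
  assume *: "rng W s" "w < n"
  define I where "I v \<longleftrightarrow> (\<forall>e\<in>W. e = emp \<longrightarrow> e \<epsilon> v) \<and> (\<forall>y\<in>W. \<forall>t\<in>W. y \<epsilon> v \<and> t = suc y \<longrightarrow> t \<epsilon> v)" for v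
  have ind: "stW t (is_inductive v k) \<longleftrightarrow> I (t v)" if "rng W t" "v < k" for t v k
    using that by (simp add: is_inductive_def I_def ws W_empty W_succ cong: ball_cong)
  have "stW s (is_omega w n) \<longleftrightarrow> I (s w) \<and> (\<forall>v\<in>W. I v \<longrightarrow> sub (s w) v)"
    using * by (simp add: is_omega_def ws ind W_subset cong: ball_cong)
  moreover have Iom: "I om" unfolding I_def by auto
  moreover have "sub om v" if "I v" for v
  proof (rule subI)
    fix k assume "k \<epsilon> om"
    then show "k \<epsilon> v"
    proof (rule om_induct[where P = "\<lambda>k. k \<epsilon> v", rotated])
      show "df UNIV (\<lambda>s. s 0 \<epsilon> v)" by (intro dfi dfp)
      show "emp \<epsilon> v" using that numW[OF emp_om] by (simp add: I_def)
      show "suc k \<epsilon> v" if "k \<epsilon> om" "k \<epsilon> v" for k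
        using that \<open>I v\<close> numW[OF that(1)] numW[OF suc_om[OF that(1)]] by (simp add: I_def)
    qed
  qed
  moreover have sub_eq: "sub a b \<Longrightarrow> sub b a \<Longrightarrow> a = b" for a b
    unfolding sub_def by (rule extensional) blast
  ultimately show ?thesis
  proof -
    assume 1: "stW s (is_omega w n) \<longleftrightarrow> I (s w) \<and> (\<forall>v\<in>W. I v \<longrightarrow> sub (s w) v)"
      and 2: "I om" and 3: "\<And>v. I v \<Longrightarrow> sub om v"
    show ?thesis unfolding 1
    proof
      assume a: "I (s w) \<and> (\<forall>v\<in>W. I v \<longrightarrow> sub (s w) v)"
      then have "sub (s w) om" using omW 2 by blast
      with 3 a show "s w = om" by (blast intro: sub_eq)
    next
      assume a: "s w = om"
      show "I (s w) \<and> (\<forall>v\<in>W. I v \<longrightarrow> sub (s w) v)" unfolding a using 2 3 by blast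
    qed
  qed
qed

lemma W_sequences: "rng W s \<Longrightarrow> X < n \<Longrightarrow> S < n \<Longrightarrow> stW s (is_sequences X S n) \<longleftrightarrow>
    (\<forall>f\<in>W. f \<epsilon> s S \<longleftrightarrow> fn f om (s X))"
  using omW by (simp add: is_sequences_def ws W_omega W_function cong: bex_cong ball_cong conj_cong)

lemma W_finite_sequences: "rng W s \<Longrightarrow> X < n \<Longrightarrow> S < n \<Longrightarrow> stW s (is_finite_sequences X S n) \<longleftrightarrow>
    (\<forall>f\<in>W. f \<epsilon> s S \<longleftrightarrow> (\<exists>n\<in>W. n \<epsilon> om \<and> fn f n (s X)))"
  using omW by (simp add: is_finite_sequences_def ws W_omega W_function cong: bex_cong ball_cong conj_cong)

end

subsection \<open>Games and the ordinal \<open>\<Theta>\<close> in a transitive class\<close>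

text \<open>What a class must contain for integer games and \<Theta> to be read off correctly:
  stages, positions, plays and all ordinals. Definability of the class allows the least upper bound
  to be formed in the surrounding model.\<close>

locale gd = twc_om E R W for E :: "'u \<Rightarrow> 'u \<Rightarrow> bool" (infix \<open>\<epsilon>\<close> 50) and R :: "'u \<Rightarrow> 'u \<Rightarrow> 'u \<Rightarrow> bool" and W :: "'u set" +
  assumes evsW: "evs \<in> W" and odsW: "ods \<in> W" and realsW: "reals \<in> W" and fseqsW: "fseqs om \<in> W"
    and ordW: "ord a \<Longrightarrow> a \<in> W" and dfW: "df UNIV (\<lambda>s. s 0 \<in> W)"
begin

declare fun_upd_apply [simp del]

text \<open>For such \<open>X\<close> all positions and plays belong to the class, so whether a
  strategy wins is absolute and only its existence depends on the class.\<close>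

definition full :: "'u \<Rightarrow> bool" where
  "full X \<longleftrightarrow> X \<in> W \<and> seqs X \<in> W \<and> fseqs X \<in> W"

lemma full_om: "full om"
  using omW realsW fseqsW by (simp add: full_def reals_def)

lemma W_evens: "rng W s \<Longrightarrow> e < n \<Longrightarrow> stW s (is_evens e n) \<longleftrightarrow> s e = evs"
proof -
  assume *: "rng W s" "e < n"
  have 1: "stW s (is_evens e n) \<longleftrightarrow> (\<exists>w\<in>W. w = om \<and> sub (s e) w \<and> (\<forall>z\<in>W. z = emp \<longrightarrow> z \<epsilon> s e) \<and>
      (\<forall>m\<in>W. \<forall>k\<in>W. m \<epsilon> w \<and> k = suc m \<longrightarrow> (k \<epsilon> s e \<longleftrightarrow> \<not> m \<epsilon> s e)))"
    using * unfolding is_evens_def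
    by (simp only: ws W_omega W_subset W_empty W_succ cong: bex_cong ball_cong)
  show ?thesis unfolding 1
  proof
    assume "\<exists>w\<in>W. w = om \<and> sub (s e) w \<and> (\<forall>z\<in>W. z = emp \<longrightarrow> z \<epsilon> s e) \<and>
      (\<forall>m\<in>W. \<forall>k\<in>W. m \<epsilon> w \<and> k = suc m \<longrightarrow> (k \<epsilon> s e \<longleftrightarrow> \<not> m \<epsilon> s e))"
    then have sub: "sub (s e) om" and 0: "emp \<epsilon> s e"
      and S: "\<And>m. m \<epsilon> om \<Longrightarrow> suc m \<epsilon> s e \<longleftrightarrow> \<not> m \<epsilon> s e"
      using numW suc_om emp_om by blast+
    have eq: "m \<epsilon> s e \<longleftrightarrow> m \<epsilon> evs" if "m \<epsilon> om" for m
    proof (rule om_induct[where P = "\<lambda>m. m \<epsilon> s e \<longleftrightarrow> m \<epsilon> evs", OF _ that])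
      show "df UNIV (\<lambda>t. t 0 \<epsilon> s e \<longleftrightarrow> t 0 \<epsilon> evs)" by (intro dfi dfp)
    qed (simp_all add: 0 S suc_evs)
    show "s e = evs"
    proof (rule extensional)
      fix z show "z \<epsilon> s e \<longleftrightarrow> z \<epsilon> evs" using eq[of z] subD[OF sub, of z] evs_om[of z] by blast
    qed
  next
    assume e: "s e = evs"
    show "\<exists>w\<in>W. w = om \<and> sub (s e) w \<and> (\<forall>z\<in>W. z = emp \<longrightarrow> z \<epsilon> s e) \<and>
      (\<forall>m\<in>W. \<forall>k\<in>W. m \<epsilon> w \<and> k = suc m \<longrightarrow> (k \<epsilon> s e \<longleftrightarrow> \<not> m \<epsilon> s e))"
      unfolding e using omW sub_evs suc_evs by (intro bexI[of _ om]) auto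
  qed
qed

definition fol :: "'u \<Rightarrow> 'u \<Rightarrow> 'u \<Rightarrow> bool" where
  "fol K st x \<longleftrightarrow> (\<forall>n\<in>W. n \<epsilon> K \<longrightarrow> (\<exists>g\<in>W. \<exists>y\<in>W. g = rst x n \<and> prd g y \<epsilon> st \<and> prd n y \<epsilon> x))"

lemma W_follows: "rng W s \<Longrightarrow> K < n \<Longrightarrow> st < n \<Longrightarrow> x < n \<Longrightarrow> stW s (follows K st x n) \<longleftrightarrow> fol (s K) (s st) (s x)"
  unfolding follows_def fol_def
  by (simp only: ws W_restriction W_related cong: bex_cong ball_cong)

lemma fol_obeys:
  assumes "full X" "fn st (fseqs X) X" "fn x om X" "sub K om"
  shows "fol K st x \<longleftrightarrow> obeys K st x"
proof -
  have "(\<exists>g\<in>W. \<exists>y\<in>W. g = rst x n \<and> prd g y \<epsilon> st \<and> prd n y \<epsilon> x) \<longleftrightarrow> app x n = app st (rst x n)"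
    if "n \<epsilon> K" for n
  proof -
    have n: "n \<epsilon> om" using subD[OF assms(4) that] .
    have g: "rst x n \<epsilon> fseqs X" by (rule rst_fseqs[OF assms(3) n])
    have gW: "rst x n \<in> W" using trW[OF _ g] assms(1) by (simp add: full_def)
    have yW: "app x n \<in> W" using trW[OF _ fn_app[OF assms(3) n]] assms(1) by (simp add: full_def)
    show ?thesis using gW yW g n by (auto simp: fn_pair[OF assms(2)] fn_pair[OF assms(3)])
  qed
  then show ?thesis unfolding fol_def obeys_def using numW subD[OF assms(4)] by blast
qed

definition detW :: "'u \<Rightarrow> 'u \<Rightarrow> bool" where
  "detW X A \<longleftrightarrow>
    (\<exists>s\<in>W. s \<epsilon> strats X \<and> (\<forall>x. x \<epsilon> seqs X \<and> obeys evs s x \<longrightarrow> x \<epsilon> A)) \<or>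
    (\<exists>s\<in>W. s \<epsilon> strats X \<and> (\<forall>x. x \<epsilon> seqs X \<and> obeys ods s x \<longrightarrow> \<not> x \<epsilon> A))"

lemma seqs_char: "full X \<Longrightarrow> M \<in> W \<Longrightarrow> (\<forall>f\<in>W. f \<epsilon> M \<longleftrightarrow> fn f om X) \<longleftrightarrow> M = seqs X"
  by (rule setW) (auto simp: full_def intro: trW[of "seqs X"])

lemma fseqs_char: "full X \<Longrightarrow> S \<in> W \<Longrightarrow> (\<forall>f\<in>W. f \<epsilon> S \<longleftrightarrow> (\<exists>n\<in>W. n \<epsilon> om \<and> fn f n X)) \<longleftrightarrow> S = fseqs X"
proof (rule setW)
  show "f \<epsilon> fseqs X \<longleftrightarrow> (\<exists>n\<in>W. n \<epsilon> om \<and> fn f n X)" for f unfolding mem_fseqs using numW by blast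
  then show "full X \<Longrightarrow> \<exists>n\<in>W. n \<epsilon> om \<and> fn f n X \<Longrightarrow> f \<in> W" for f
    using trW[of "fseqs X" f] by (simp add: full_def)
qed

lemma W_determined: "rng W s \<Longrightarrow> X < n \<Longrightarrow> A < n \<Longrightarrow> full (s X) \<Longrightarrow>
    stW s (determined X A n) \<longleftrightarrow> detW (s X) (s A)"
proof -
  assume *: "rng W s" "X < n" "A < n" and fX: "full (s X)"
  let ?X = "s X" and ?A = "s A"
  have 1: "stW s (determined X A n) \<longleftrightarrow> (\<exists>w\<in>W. \<exists>e\<in>W. \<exists>d\<in>W. \<exists>S\<in>W. \<exists>M\<in>W. w = om \<and> e = evs \<and>
      (\<forall>z. z \<epsilon> d \<longleftrightarrow> z \<epsilon> w \<and> \<not> z \<epsilon> e) \<and> (\<forall>f\<in>W. f \<epsilon> S \<longleftrightarrow> (\<exists>n\<in>W. n \<epsilon> om \<and> fn f n ?X)) \<and>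
      (\<forall>f\<in>W. f \<epsilon> M \<longleftrightarrow> fn f om ?X) \<and>
      ((\<exists>st\<in>W. fn st S ?X \<and> (\<forall>x\<in>W. x \<epsilon> M \<and> fol e st x \<longrightarrow> x \<epsilon> ?A)) \<or>
       (\<exists>st\<in>W. fn st S ?X \<and> (\<forall>x\<in>W. x \<epsilon> M \<and> fol d st x \<longrightarrow> \<not> x \<epsilon> ?A))))"
    using * unfolding determined_def
    by (simp only: ws W_omega W_evens W_diff W_finite_sequences W_sequences W_function W_follows cong: bex_cong ball_cong)
  have d: "(\<forall>z. z \<epsilon> d \<longleftrightarrow> z \<epsilon> om \<and> \<not> z \<epsilon> evs) \<longleftrightarrow> d = ods" for d
  proof
    assume "\<forall>z. z \<epsilon> d \<longleftrightarrow> z \<epsilon> om \<and> \<not> z \<epsilon> evs"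
    then show "d = ods" using ods_iff ods_om by (intro extensional) blast
  next
    assume "d = ods"
    then show "\<forall>z. z \<epsilon> d \<longleftrightarrow> z \<epsilon> om \<and> \<not> z \<epsilon> evs" using ods_iff ods_om by blast
  qed
  have side: "(\<exists>st\<in>W. fn st (fseqs ?X) ?X \<and> (\<forall>x\<in>W. x \<epsilon> seqs ?X \<and> fol K st x \<longrightarrow> Q x)) \<longleftrightarrow>
      (\<exists>st\<in>W. st \<epsilon> strats ?X \<and> (\<forall>x. x \<epsilon> seqs ?X \<and> obeys K st x \<longrightarrow> Q x))" if "sub K om" for K Q
  proof (intro bex_cong refl)
    fix st assume "st \<in> W"
    have "x \<in> W" if "x \<epsilon> seqs ?X" for x using trW[OF _ that] fX by (simp add: full_def)
    then show "(fn st (fseqs ?X) ?X \<and> (\<forall>x\<in>W. x \<epsilon> seqs ?X \<and> fol K st x \<longrightarrow> Q x)) \<longleftrightarrow>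
        (st \<epsilon> strats ?X \<and> (\<forall>x. x \<epsilon> seqs ?X \<and> obeys K st x \<longrightarrow> Q x))"
      using fol_obeys[OF fX _ _ that, of st] unfolding mem_strats mem_seqs by blast
  qed
  have "stW s (determined X A n) \<longleftrightarrow>
      (\<exists>st\<in>W. fn st (fseqs ?X) ?X \<and> (\<forall>x\<in>W. x \<epsilon> seqs ?X \<and> fol evs st x \<longrightarrow> x \<epsilon> ?A)) \<or>
      (\<exists>st\<in>W. fn st (fseqs ?X) ?X \<and> (\<forall>x\<in>W. x \<epsilon> seqs ?X \<and> fol ods st x \<longrightarrow> \<not> x \<epsilon> ?A))" (is "_ \<longleftrightarrow> ?rhs")
    unfolding 1
  proof
    assume "\<exists>w\<in>W. \<exists>e\<in>W. \<exists>d\<in>W. \<exists>S\<in>W. \<exists>M\<in>W. w = om \<and> e = evs \<and>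
      (\<forall>z. z \<epsilon> d \<longleftrightarrow> z \<epsilon> w \<and> \<not> z \<epsilon> e) \<and> (\<forall>f\<in>W. f \<epsilon> S \<longleftrightarrow> (\<exists>n\<in>W. n \<epsilon> om \<and> fn f n ?X)) \<and>
      (\<forall>f\<in>W. f \<epsilon> M \<longleftrightarrow> fn f om ?X) \<and>
      ((\<exists>st\<in>W. fn st S ?X \<and> (\<forall>x\<in>W. x \<epsilon> M \<and> fol e st x \<longrightarrow> x \<epsilon> ?A)) \<or>
       (\<exists>st\<in>W. fn st S ?X \<and> (\<forall>x\<in>W. x \<epsilon> M \<and> fol d st x \<longrightarrow> \<not> x \<epsilon> ?A)))"
    then obtain w e d S M where W: "S \<in> W" "M \<in> W" and eq: "w = om" "e = evs" "\<forall>z. z \<epsilon> d \<longleftrightarrow> z \<epsilon> w \<and> \<not> z \<epsilon> e"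
      "\<forall>f\<in>W. f \<epsilon> S \<longleftrightarrow> (\<exists>n\<in>W. n \<epsilon> om \<and> fn f n ?X)" "\<forall>f\<in>W. f \<epsilon> M \<longleftrightarrow> fn f om ?X"
      and r: "(\<exists>st\<in>W. fn st S ?X \<and> (\<forall>x\<in>W. x \<epsilon> M \<and> fol e st x \<longrightarrow> x \<epsilon> ?A)) \<or>
       (\<exists>st\<in>W. fn st S ?X \<and> (\<forall>x\<in>W. x \<epsilon> M \<and> fol d st x \<longrightarrow> \<not> x \<epsilon> ?A))"
      by (elim bexE conjE)
    have "S = fseqs ?X" "M = seqs ?X" "d = ods"
      using fseqs_char[OF fX W(1)] seqs_char[OF fX W(2)] d[of d] eq by simp_all
    with r eq(2) show ?rhs by (simp only:)
  next
    assume r: ?rhs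
    have W: "fseqs ?X \<in> W" "seqs ?X \<in> W" using fX by (simp_all add: full_def)
    have e: "\<forall>z. z \<epsilon> ods \<longleftrightarrow> z \<epsilon> om \<and> \<not> z \<epsilon> evs" by (rule d[THEN iffD2]) (rule refl)
    show "\<exists>w\<in>W. \<exists>e\<in>W. \<exists>d\<in>W. \<exists>S\<in>W. \<exists>M\<in>W. w = om \<and> e = evs \<and>
      (\<forall>z. z \<epsilon> d \<longleftrightarrow> z \<epsilon> w \<and> \<not> z \<epsilon> e) \<and> (\<forall>f\<in>W. f \<epsilon> S \<longleftrightarrow> (\<exists>n\<in>W. n \<epsilon> om \<and> fn f n ?X)) \<and>
      (\<forall>f\<in>W. f \<epsilon> M \<longleftrightarrow> fn f om ?X) \<and>
      ((\<exists>st\<in>W. fn st S ?X \<and> (\<forall>x\<in>W. x \<epsilon> M \<and> fol e st x \<longrightarrow> x \<epsilon> ?A)) \<or>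
       (\<exists>st\<in>W. fn st S ?X \<and> (\<forall>x\<in>W. x \<epsilon> M \<and> fol d st x \<longrightarrow> \<not> x \<epsilon> ?A)))"
      by (rule bexI[OF _ omW], rule bexI[OF _ evsW], rule bexI[OF _ odsW], rule bexI[OF _ W(1)], rule bexI[OF _ W(2)],
          rule conjI[OF refl conjI[OF refl conjI[OF e conjI[OF fseqs_char[OF fX W(1), THEN iffD2, OF refl]
            conjI[OF seqs_char[OF fX W(2), THEN iffD2, OF refl] r]]]]])
  qed
  then show ?thesis unfolding side[OF sub_evs] side[OF sub_ods] detW_def .
qed

lemma W_games: "rng W s \<Longrightarrow> X < n \<Longrightarrow> full (s X) \<Longrightarrow> stW s (all_games_determined X n) \<longleftrightarrow>
    (\<forall>A\<in>W. sub A (seqs (s X)) \<longrightarrow> detW (s X) A)"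
proof -
  assume *: "rng W s" "X < n" and fX: "full (s X)"
  have "stW s (all_games_determined X n) \<longleftrightarrow>
      (\<forall>M\<in>W. \<forall>A\<in>W. (\<forall>f\<in>W. f \<epsilon> M \<longleftrightarrow> fn f om (s X)) \<and> sub A M \<longrightarrow> detW (s X) A)"
    using * fX unfolding all_games_determined_def
    by (simp only: ws W_sequences W_subset W_determined cong: bex_cong ball_cong)
  also have "\<dots> \<longleftrightarrow> (\<forall>M\<in>W. \<forall>A\<in>W. M = seqs (s X) \<and> sub A M \<longrightarrow> detW (s X) A)"
    by (intro ball_cong refl) (simp only: seqs_char[OF fX])
  also have "\<dots> \<longleftrightarrow> (\<forall>A\<in>W. sub A (seqs (s X)) \<longrightarrow> detW (s X) A)"
    using fX unfolding full_def by blast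
  finally show ?thesis .
qed

lemma W_AD: "rng W s \<Longrightarrow> stW s (AD n) \<longleftrightarrow> (\<forall>A\<in>W. sub A reals \<longrightarrow> detW om A)"
proof -
  assume *: "rng W s"
  have "stW s (AD n) \<longleftrightarrow> (\<exists>w\<in>W. w = om \<and> (\<forall>A\<in>W. sub A (seqs w) \<longrightarrow> detW w A))"
    unfolding AD_def sat_fb
  proof (intro bex_cong refl conj_cong)
    fix w assume w: "w \<in> W"
    show o: "stW (s(n := w)) (is_omega n (Suc n)) \<longleftrightarrow> w = om"
      using W_omega[of "s(n := w)" n "Suc n"] * w by (simp add: ws)
    assume "w = om"
    then show "stW (s(n := w)) (all_games_determined n (Suc n)) \<longleftrightarrow> (\<forall>A\<in>W. sub A (seqs w) \<longrightarrow> detW w A)"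
      using W_games[of "s(n := w)" n "Suc n"] * w full_om by (simp add: ws)
  qed
  then show ?thesis using omW by (simp add: reals_def)
qed

lemma W_reals: "rng W s \<Longrightarrow> r < n \<Longrightarrow> stW s (is_reals r n) \<longleftrightarrow> s r = reals"
proof -
  assume *: "rng W s" "r < n"
  have "stW s (is_reals r n) \<longleftrightarrow> (\<exists>w\<in>W. w = om \<and> (\<forall>f\<in>W. f \<epsilon> s r \<longleftrightarrow> fn f om w))"
    using * unfolding is_reals_def by (simp only: ws W_omega W_sequences cong: bex_cong)
  also have "\<dots> \<longleftrightarrow> (\<forall>f\<in>W. f \<epsilon> s r \<longleftrightarrow> fn f om om)" using omW by blast
  finally show ?thesis using seqs_char[OF full_om, of "s r"] * by (simp add: reals_def)
qed

lemma W_AD_R: "rng W s \<Longrightarrow> full reals \<Longrightarrow> stW s (AD_R n) \<longleftrightarrow> (\<forall>A\<in>W. sub A (seqs reals) \<longrightarrow> detW reals A)"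
proof -
  assume *: "rng W s" and f: "full reals"
  have "stW s (AD_R n) \<longleftrightarrow> (\<exists>w\<in>W. w = reals \<and> (\<forall>A\<in>W. sub A (seqs w) \<longrightarrow> detW w A))"
    unfolding AD_R_def sat_fb
  proof (intro bex_cong refl conj_cong)
    fix w assume w: "w \<in> W"
    show o: "stW (s(n := w)) (is_reals n (Suc n)) \<longleftrightarrow> w = reals"
      using W_reals[of "s(n := w)" n "Suc n"] * w by (simp add: ws)
    assume "w = reals"
    then show "stW (s(n := w)) (all_games_determined n (Suc n)) \<longleftrightarrow> (\<forall>A\<in>W. sub A (seqs w) \<longrightarrow> detW w A)"
      using W_games[of "s(n := w)" n "Suc n"] * w f by (simp add: ws)
  qed
  then show ?thesis using realsW by simp
qed

section \<open>Images of the reals and their supremum\<close>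

definition img :: "'u \<Rightarrow> bool" where
  "img a \<longleftrightarrow> ord a \<and> (\<exists>f\<in>W. srj f reals a)"
definition ub :: "'u \<Rightarrow> bool" where
  "ub b \<longleftrightarrow> ord b \<and> (\<forall>a. img a \<longrightarrow> a \<epsilon> b \<or> a = b)"
definition isTh :: "'u \<Rightarrow> bool" where
  "isTh t \<longleftrightarrow> ub t \<and> (\<forall>b. ub b \<longrightarrow> t \<epsilon> b \<or> t = b)"

lemma W_image: "rng W s \<Longrightarrow> a < n \<Longrightarrow> stW s (is_real_image a n) \<longleftrightarrow> img (s a)"
proof -
  assume *: "rng W s" "a < n"
  have "stW s (is_real_image a n) \<longleftrightarrow> ord (s a) \<and> (\<exists>r\<in>W. \<exists>f\<in>W. r = reals \<and> srj f r (s a))"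
    using * unfolding is_real_image_def
    by (simp only: ws W_ordinal W_reals W_surjection cong: bex_cong)
  then show ?thesis using realsW unfolding img_def by blast
qed

lemma W_upper: "rng W s \<Longrightarrow> b < n \<Longrightarrow> stW s (is_upper_bound b n) \<longleftrightarrow> ub (s b)"
proof -
  assume *: "rng W s" "b < n"
  have "stW s (is_upper_bound b n) \<longleftrightarrow> ord (s b) \<and> (\<forall>a\<in>W. img a \<longrightarrow> a \<epsilon> s b \<or> a = s b)"
    using * unfolding is_upper_bound_def
    by (simp only: ws W_ordinal W_image cong: ball_cong)
  then show ?thesis using ordW unfolding ub_def img_def by blast
qed

lemma W_Theta: "rng W s \<Longrightarrow> t < n \<Longrightarrow> stW s (is_Theta t n) \<longleftrightarrow> isTh (s t)"
proof -
  assume *: "rng W s" "t < n"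
  have "stW s (is_Theta t n) \<longleftrightarrow> ub (s t) \<and> (\<forall>b\<in>W. ub b \<longrightarrow> s t \<epsilon> b \<or> s t = b)"
    using * unfolding is_Theta_def
    by (simp only: ws W_upper cong: ball_cong)
  then show ?thesis using ordW unfolding isTh_def ub_def by blast
qed

text \<open>The value of such a surjection at \<open>x\<close> is the rank of \<open>x\<close> in
  the induced prewellordering, hence is recovered by induction on the value.\<close>

lemma srj_unique:
  assumes f: "srj f reals a" "ord a" and g: "srj g reals b" "ord b"
    and eq: "\<And>x y. x \<epsilon> reals \<Longrightarrow> y \<epsilon> reals \<Longrightarrow> app f x \<epsilon> app f y \<longleftrightarrow> app g x \<epsilon> app g y"
  shows "f = g \<and> a = b"
proof -
  have ff: "fn f reals a" and gg: "fn g reals b" using f g by (simp_all add: srj_def)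
  have fs: "\<exists>x. x \<epsilon> reals \<and> app f x = y" if "y \<epsilon> a" for y
  proof -
    from f(1) that obtain x where "x \<epsilon> reals" "prd x y \<epsilon> f" unfolding srj_def by (elim conjE allE impE exE)
    then show ?thesis using fn_pair[OF ff, of x y] by (intro exI[of _ x]) simp
  qed
  have gs: "\<exists>x. x \<epsilon> reals \<and> app g x = y" if "y \<epsilon> b" for y
  proof -
    from g(1) that obtain x where "x \<epsilon> reals" "prd x y \<epsilon> g" unfolding srj_def by (elim conjE allE impE exE)
    then show ?thesis using fn_pair[OF gg, of x y] by (intro exI[of _ x]) simp
  qed
  have "\<forall>x. x \<epsilon> reals \<and> app f x = v \<longrightarrow> app g x = v" for v
  proof (rule eps_induct[where P = "\<lambda>v. \<forall>x. x \<epsilon> reals \<and> app f x = v \<longrightarrow> app g x = v"])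
    show "df UNIV (\<lambda>s. \<forall>x. x \<epsilon> reals \<and> app f x = s 0 \<longrightarrow> app g x = s 0)" by (intro dfi dfp)
    fix v assume IH: "\<And>w. w \<epsilon> v \<Longrightarrow> \<forall>x. x \<epsilon> reals \<and> app f x = w \<longrightarrow> app g x = w"
    show "\<forall>x. x \<epsilon> reals \<and> app f x = v \<longrightarrow> app g x = v"
    proof (intro allI impI, elim conjE)
      fix x assume x: "x \<epsilon> reals" and v: "app f x = v"
      show "app g x = v"
      proof (rule extensional)
        fix w show "w \<epsilon> app g x \<longleftrightarrow> w \<epsilon> v"
        proof
          assume w: "w \<epsilon> app g x"
          then have "w \<epsilon> b" using ord_trans[OF g(2) _ fn_app[OF gg x]] by blast
          from gs[OF this] obtain y where y: "y \<epsilon> reals" "app g y = w" by blast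
          with w eq[OF y(1) x] have "app f y \<epsilon> v" by (simp add: v)
          with IH[OF this] y show "w \<epsilon> v" by simp
        next
          assume w: "w \<epsilon> v"
          then have "w \<epsilon> a" using ord_trans[OF f(2) _ fn_app[OF ff x]] v by blast
          from fs[OF this] obtain y where y: "y \<epsilon> reals" "app f y = w" by blast
          with w have "app f y \<epsilon> app f x" by (simp add: v)
          with eq[OF y(1) x] have "app g y \<epsilon> app g x" by simp
          with IH[OF w] y show "w \<epsilon> app g x" by simp
        qed
      qed
    qed
  qed
  then have app: "app f x = app g x" if "x \<epsilon> reals" for x using that by simp
  have "f = g" by (rule fn_ext[OF ff gg]) (rule app)
  moreover have "a = b"
  proof (rule extensional)
    fix y
    have "y \<epsilon> b" if y: "y \<epsilon> a"
    proof -
      from fs[OF y] obtain x where "x \<epsilon> reals" "app f x = y" by blast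
      with fn_app[OF gg, of x] app[of x] show ?thesis by simp
    qed
    moreover have "y \<epsilon> a" if y: "y \<epsilon> b"
    proof -
      from gs[OF y] obtain x where "x \<epsilon> reals" "app g x = y" by blast
      with fn_app[OF ff, of x] app[of x] show ?thesis by simp
    qed
    ultimately show "y \<epsilon> a \<longleftrightarrow> y \<epsilon> b" by blast
  qed
  ultimately show ?thesis by blast
qed

lemma df_srj [dfi]: "dft C f \<Longrightarrow> dft C a \<Longrightarrow> dft C b \<Longrightarrow> df C (\<lambda>s. srj (f s) (a s) (b s))"
  by (rule df3[of C srj]) (unfold srj_def, intro dfi)

lemma df_W: "dft UNIV a \<Longrightarrow> df UNIV (\<lambda>s. a s \<in> W)"
  by (rule df1[of UNIV "\<lambda>x. x \<in> W", OF dfW])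

lemma df_img: "dft UNIV a \<Longrightarrow> df UNIV (\<lambda>s. img (a s))"
  by (rule df1[of UNIV img]) (unfold img_def Bex_def, intro dfi dfp df_W)

lemma df_ub: "dft UNIV a \<Longrightarrow> df UNIV (\<lambda>s. ub (a s))"
  by (rule df1[of UNIV ub]) (unfold ub_def, intro dfi df_img)

text \<open>By \<open>srj_unique\<close> each image of the reals is determined by a set of pairs of
  reals. Bounding over the power set of \<open>cart reals reals\<close> thus gives an upper bound,
  and the least one is taken.\<close>

theorem Theta_exists: "\<exists>t. isTh t"
proof -
  define Q where "Q c g \<longleftrightarrow> (\<forall>a f. ord a \<and> srj f reals a \<and>
    c = sep (cart reals reals) (\<lambda>p. app f (pfst p) \<epsilon> app f (psnd p)) \<longrightarrow> a \<epsilon> g)" for c g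
  have dQ: "df UNIV (\<lambda>s. Q (s 0) (s (Suc 0)))" unfolding Q_def by (intro dfi)
  have m: "p \<epsilon> sep (cart reals reals) (\<lambda>p. app f (pfst p) \<epsilon> app f (psnd p)) \<longleftrightarrow>
      p \<epsilon> cart reals reals \<and> app f (pfst p) \<epsilon> app f (psnd p)" for p f
    by (rule mem_sep) (intro dfi dfp)
  let ?c = "\<lambda>f. sep (cart reals reals) (\<lambda>p. app f (pfst p) \<epsilon> app f (psnd p))"
  have eq: "a = b" if "ord a" "srj f reals a" "ord b" "srj g reals b" "?c f = ?c g" for a b f g
  proof -
    have "app f x \<epsilon> app f y \<longleftrightarrow> app g x \<epsilon> app g y" if "x \<epsilon> reals" "y \<epsilon> reals" for x y
      using m[of "prd x y" f] m[of "prd x y" g] that \<open>?c f = ?c g\<close> by simp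
    with srj_unique that(1-4) show ?thesis by blast
  qed
  have "\<exists>g. ord g \<and> Q c g" for c
  proof (cases "\<exists>a f. ord a \<and> srj f reals a \<and> c = ?c f")
    case True
    then obtain a f where af: "ord a" "srj f reals a" "c = ?c f" by blast
    have "Q c (suc a)" unfolding Q_def
    proof (intro allI impI, elim conjE)
      fix b g assume "ord b" "srj g reals b" "c = ?c g"
      with eq[OF af(1,2)] af(3) have "a = b" by simp
      then show "b \<epsilon> suc a" by simp
    qed
    with af(1) show ?thesis using ord_suc by blast
  next
    case False
    then have "Q c emp" unfolding Q_def by blast
    then show ?thesis using ord_emp by blast
  qed
  from bounding[where Q = Q and a = "pw (cart reals reals)", OF dQ this] obtain h where
    h: "ord h" "\<And>c. c \<epsilon> pw (cart reals reals) \<Longrightarrow> \<exists>d. d \<epsilon> h \<and> ord d \<and> Q c d" by blast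
  have "ub h" unfolding ub_def
  proof (intro conjI allI impI)
    fix a assume "img a"
    then obtain f where f: "ord a" "srj f reals a" by (auto simp: img_def)
    have "?c f \<epsilon> pw (cart reals reals)" using m by (simp add: sub_def del: mem_cart)
    from h(2)[OF this] obtain d where d: "d \<epsilon> h" "Q (?c f) d" by blast
    then have "a \<epsilon> d" using f unfolding Q_def by blast
    with d(1) ord_trans[OF h(1)] show "a \<epsilon> h \<or> a = h" by blast
  qed (rule h(1))
  have dub: "df UNIV (\<lambda>s. ub (s 0))" by (intro df_ub dfi)
  note l = lst[of ub, OF dub h(1) \<open>ub h\<close>]
  have "lst ub \<epsilon> b \<or> lst ub = b" if "ub b" for b
    using ord_linear[OF l(1), of b] l(3)[of b] that unfolding ub_def by blast
  with l(2) show ?thesis unfolding isTh_def by blast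
qed

text \<open>Otherwise \<open>a\<close> itself would be an upper bound below the least one.\<close>

lemma Theta_mem: "isTh t \<Longrightarrow> a \<epsilon> t \<Longrightarrow> \<exists>b. img b \<and> a \<epsilon> b"
proof (rule ccontr)
  assume t: "isTh t" and a: "a \<epsilon> t" and n: "\<not> (\<exists>b. img b \<and> a \<epsilon> b)"
  have ot: "ord t" using t by (simp add: isTh_def ub_def)
  have oa: "ord a" by (rule ord_mem[OF ot a])
  have "ub a" unfolding ub_def using oa n ord_linear[OF oa] img_def by blast
  then have "t \<epsilon> a \<or> t = a" using t unfolding isTh_def by blast
  then show False using a mem_asym[OF a] not_mem_self by blast
qed

end

context odzf
begin

lemma hod_pow: "hod x \<Longrightarrow> OD y \<Longrightarrow> sub y x \<Longrightarrow> hod y"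
  by (rule hodI) (auto simp: sub_def intro: hod_mem)

lemma hod_evs: "hod evs" and hod_ods: "hod ods"
  by (rule hod_pow[OF hod_om OD_term]; (intro dfi)?; simp add: sub_evs sub_ods)+

lemma gd_hod: "gd (\<epsilon>) R {x. hod x}"
proof unfold_locales
  show "df UNIV (\<lambda>s. s 0 \<in> {x. hod x})" by (simp, intro dfi)
qed (use hod_mem hod_om hod_evs hod_ods hod_reals hod_fseqs hod_ord in auto)

end

subsection \<open>All reals code the ordinals below \<open>\<Theta>\<close> of the inner model\<close>

sublocale odzf \<subseteq> H: gd E R "{x. hod x}"
  by (rule gd_hod)

context odzf
begin

text \<open>A set of reals that is not ordinal definable from a real lies above all those that are in the
  Wadge hierarchy, so that the latter are indexed by reals: uniformly, without any choice.\<close>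

lemma wadge_OD:
  assumes ad: "adx om" and A: "\<not> OD A" "sub A reals" and C: "OD C"
  shows "\<exists>s. s \<epsilon> strats om \<and> (\<forall>x. x \<epsilon> reals \<longrightarrow> (x \<epsilon> C \<longleftrightarrow> rgt (play ods s (join x x)) \<epsilon> A))"
proof (rule ccontr)
  assume n: "\<not> ?thesis"
  with wadge[OF ad, of C A] obtain s where s: "s \<epsilon> strats om"
    and A': "\<forall>y. y \<epsilon> reals \<longrightarrow> (y \<epsilon> A \<longleftrightarrow> \<not> lft (play evs s (join y y)) \<epsilon> C)" by blast
  have "OD s" using s by (intro OD_strat) simp
  have "OD A"
  proof (rule OD_closed)
    show "df (Collect OD) (\<lambda>t. t 0 \<epsilon> reals \<and> \<not> lft (play evs s (join (t 0) (t 0))) \<epsilon> C)"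
      by (intro dfi dfo C \<open>OD s\<close>)
    show "y \<epsilon> A \<longleftrightarrow> y \<epsilon> reals \<and> \<not> lft (play evs s (join y y)) \<epsilon> C" for y
      using A' subD[OF A(2), of y] by blast
  qed
  with A show False by blast
qed

text \<open>Shows that \<Theta> of the inner model is not zero, which provides \<open>emp\<close> as
  a default value for a surjection onto it.\<close>

lemma one_img: "H.img (suc emp)"
proof -
  let ?f = "lam reals (\<lambda>_. emp)"
  have f: "fn ?f reals (suc emp)" by (rule fn_lam) (intro dfi, simp)
  have "OD ?f" by (rule OD_term) (intro dfi)
  then have "hod ?f" using f by (rule hod_fn) (auto intro: hod_real hod_ord simp del: mem_reals)
  moreover have "H.srj ?f reals (suc emp)"
    unfolding H.srj_def using f cns_real fn_pair[OF f] app_lam[of "\<lambda>_. emp", OF dft_emp cns_real] by auto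
  ultimately show ?thesis unfolding H.img_def by (auto simp: ord_suc)
qed

lemma emp_Theta: "H.isTh t \<Longrightarrow> emp \<epsilon> t"
proof -
  assume "H.isTh t"
  then have "ord t" "suc emp \<epsilon> t \<or> suc emp = t" using one_img unfolding H.isTh_def H.ub_def by blast+
  then show ?thesis using ord_trans[of t emp "suc emp"] by auto
qed

text \<open>A real is split into the code of a strategy and an argument. The strategy pulls
  \<open>A\<close> back to a set of reals; if this set codes the prewellordering of a surjection in
  the inner model, that surjection is unique and is applied to the argument. By
  \<open>wadge_OD\<close> every surjection in the inner model is reached.\<close>

theorem surjection_onto_Theta:
  assumes ad: "adx reals" and t: "H.isTh t"
  shows "\<exists>B. H.srj B reals t"
proof -
  obtain A where A: "sub A reals" "\<not> OD A" using ex_not_OD[OF ad] by blast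
  define Q where "Q s z \<longleftrightarrow> rgt (play ods s (join z z)) \<epsilon> A" for s z
  define ok where "ok s g \<longleftrightarrow> hod g \<and> (\<exists>b. ord b \<and> H.srj g reals b) \<and>
    (\<forall>x y. x \<epsilon> reals \<and> y \<epsilon> reals \<longrightarrow> (app g x \<epsilon> app g y \<longleftrightarrow> Q s (join x y)))" for s g
  have ok_eq: "g = h" if "ok s g" "ok s h" for s g h
  proof -
    from that obtain a b where *: "ord a" "H.srj g reals a" "ord b" "H.srj h reals b"
      unfolding ok_def by blast
    have "app g x \<epsilon> app g y \<longleftrightarrow> app h x \<epsilon> app h y" if "x \<epsilon> reals" "y \<epsilon> reals" for x y
      using \<open>ok s g\<close> \<open>ok s h\<close> that unfolding ok_def by blast
    with H.srj_unique[OF *(2,1,4,3)] show ?thesis by blast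
  qed
  define v where "v w = app (iota (ok (dec (lft w)))) (rgt w)" for w
  have dv: "dft UNIV (\<lambda>s. v (s 0))" unfolding v_def ok_def Q_def by (intro dfi dfp)
  \<comment> \<open>Values outside of \<open>t\<close> are replaced by \<open>emp\<close>; they
    arise from strategies that code no surjection, or one onto an ordinal that is too long for the
    argument at hand.\<close>
  define B where "B = lam reals (\<lambda>w. if v w \<epsilon> t then v w else emp)"
  have dB: "dft UNIV (\<lambda>s. if v (s 0) \<epsilon> t then v (s 0) else emp)" by (intro dfi dfp dv)
  have B: "fn B reals t" unfolding B_def by (rule fn_lam[OF dB]) (simp add: emp_Theta[OF t])
  have "\<exists>w. w \<epsilon> reals \<and> prd w a \<epsilon> B" if a: "a \<epsilon> t" for a
  proof -
    from H.Theta_mem[OF t a] obtain b f where b: "ord b" "a \<epsilon> b" "hod f" "H.srj f reals b"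
      unfolding H.img_def by blast
    have ff: "fn f reals b" using b(4) by (simp add: H.srj_def)
    from b(2,4) obtain x where x: "x \<epsilon> reals" "prd x a \<epsilon> f" unfolding H.srj_def by blast
    have ax: "app f x = a" using x fn_pair[OF ff] by simp
    let ?C = "sep reals (\<lambda>z. app f (lft z) \<epsilon> app f (rgt z))"
    have C: "z \<epsilon> ?C \<longleftrightarrow> z \<epsilon> reals \<and> app f (lft z) \<epsilon> app f (rgt z)" for z
      by (rule mem_sep) (intro dfi dfp)
    have "OD ?C" by (rule OD_term) (intro dfi dfo hod_OD b(3))
    from wadge_OD[OF adx_om[OF ad] A(2,1) this] obtain s where s: "s \<epsilon> strats om"
      and sC: "\<And>z. z \<epsilon> reals \<Longrightarrow> z \<epsilon> ?C \<longleftrightarrow> Q s z" unfolding Q_def by blast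
    have "app f x \<epsilon> app f y \<longleftrightarrow> Q s (join x y)" if "x \<epsilon> reals" "y \<epsilon> reals" for x y
    proof -
      have "join x y \<epsilon> reals" using that by (simp add: fn_join)
      from sC[OF this] C[of "join x y"] \<open>join x y \<epsilon> reals\<close> that show ?thesis by simp
    qed
    with b have ok: "ok s f" unfolding ok_def by blast
    from s have "fn s (fseqs om) om" by simp
    from dec_surj[OF this] obtain r where r: "fn r om om" "dec r = s" by blast
    have w: "join r x \<epsilon> reals" using r(1) x(1) by (simp add: fn_join)
    have "v (join r x) = a"
      using r x(1) ax iota_eq[of "ok s" f, OF ok ok_eq[OF _ ok]] by (simp add: v_def)
    with a have "app B (join r x) = a" unfolding B_def app_lam[OF dB w] by simp
    with w fn_pair[OF B] show ?thesis by blast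
  qed
  with B show ?thesis unfolding H.srj_def by blast
qed

end

section \<open>Forcing with ordinal definable sets of surjections\<close>

context odzf
begin

text \<open>An image of length \<open>t\<close> would only bound \<Theta> of the extension from
  below by \<open>t\<close>; one more point makes the inequality strict. The value \<open>t\<close>
  is taken at the reals whose left half is constantly zero.\<close>

lemma surjection_onto_suc_Theta:
  assumes ad: "adx reals" and t: "H.isTh t"
  shows "\<exists>B. H.srj B reals (suc t)"
proof -
  from surjection_onto_Theta[OF ad t] obtain B where B: "H.srj B reals t" by blast
  then have fB: "fn B reals t" by (simp add: H.srj_def)
  let ?F = "\<lambda>w. if lft w = cns emp then t else app B (rgt w)"
  have d: "dft UNIV (\<lambda>s. ?F (s 0))" by (intro dfi dfp)
  have rgt: "rgt w \<epsilon> reals" if "w \<epsilon> reals" for w using that by (simp add: fn_rgt)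
  have f: "fn (lam reals ?F) reals (suc t)"
    by (rule fn_lam[OF d]) (use fn_app[OF fB rgt] in auto)
  have one: "cns (suc emp) \<epsilon> reals" using fn_cns[of "suc emp" om] by simp
  have ne: "cns (suc emp) \<noteq> cns emp"
  proof
    assume "cns (suc emp) = cns emp"
    then have "app (cns (suc emp)) emp = app (cns emp) emp" by simp
    then have "suc emp = emp" by (simp add: app_cns)
    then have "emp \<epsilon> emp" by (metis mem_suc)
    then show False by simp
  qed
  have "\<exists>w. w \<epsilon> reals \<and> prd w a \<epsilon> lam reals ?F" if "a \<epsilon> suc t" for a
  proof (cases "a = t")
    case True
    have "join (cns emp) (cns emp) \<epsilon> reals" "lft (join (cns emp) (cns emp)) = cns emp"
      using cns_real by (simp_all add: fn_join)
    then show ?thesis using True by (intro exI[of _ "join (cns emp) (cns emp)"]) (simp add: prd_mem_lam[OF d])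
  next
    case False
    with that have "a \<epsilon> t" by simp
    with B obtain x where "x \<epsilon> reals" "prd x a \<epsilon> B" unfolding H.srj_def by blast
    then have x: "x \<epsilon> reals" "app B x = a" using fn_pair[OF fB, of x a] by simp_all
    have "join (cns (suc emp)) x \<epsilon> reals" "lft (join (cns (suc emp)) x) = cns (suc emp)"
      "rgt (join (cns (suc emp)) x) = x"
      using one x(1) by (simp_all add: fn_join)
    then show ?thesis using x ne by (intro exI[of _ "join (cns (suc emp)) x"]) (simp add: prd_mem_lam[OF d])
  qed
  with f show ?thesis unfolding H.srj_def by blast
qed

text \<open>A payoff set of the class is determined in the full model, and the winning strategy,
  being coded by a real, belongs to every class that includes the inner model.\<close>

lemma AD_inner:
  assumes "gd (\<epsilon>) R W" and W: "\<And>x. hod x \<Longrightarrow> x \<in> W" and ad: "adx om" and s: "rng W s"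
  shows "sat W (\<epsilon>) s (AD n)"
proof -
  interpret W: gd E R W by fact
  have "W.detW om A" if "sub A reals" for A
  proof -
    have "detd om A" using ad that by (simp add: adx_def reals_def)
    moreover have "s \<epsilon> strats om \<Longrightarrow> s \<in> W" for s using hod_strat W by simp
    ultimately show ?thesis unfolding detd_def W.detW_def by blast
  qed
  then show ?thesis using W.W_AD[OF s] by blast
qed

end

text \<open>The ordinal \<open>k\<close> makes the codes of conditions sets rather than proper
  classes: every definable set of surjections has an index below \<open>k\<close>.\<close>

locale frc = odzf E R for E :: "'u \<Rightarrow> 'u \<Rightarrow> bool" (infix \<open>\<epsilon>\<close> 50) and R :: "'u \<Rightarrow> 'u \<Rightarrow> 'u \<Rightarrow> bool" +
  fixes t k :: 'u
  assumes ad: "adx reals" and Th: "H.isTh t" and ordk: "ord k"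
    and k: "OD z \<Longrightarrow> sub z (setof (\<lambda>B. H.srj B reals (suc t))) \<Longrightarrow> \<exists>a x. a \<epsilon> k \<and> x \<epsilon> reals \<and> z = oset a x"
begin

section \<open>The poset of coded definable sets\<close>

definition Y :: 'u where "Y = setof (\<lambda>B. H.srj B reals (suc t))"

lemma ordt: "ord t" using Th unfolding H.isTh_def H.ub_def by blast

lemma mem_Y: "B \<epsilon> Y \<longleftrightarrow> H.srj B reals (suc t)"
  unfolding Y_def
proof (intro mem_setof isset_sub)
  show "df UNIV (\<lambda>s. H.srj (s 0) reals (suc t))" by (intro dfi dfp)
  show "B \<epsilon> pw (cart reals (suc t))" if "H.srj B reals (suc t)" for B
  proof -
    from that have "\<forall>p. p \<epsilon> B \<longrightarrow> (\<exists>x y. x \<epsilon> reals \<and> y \<epsilon> suc t \<and> p = prd x y)"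
      unfolding H.srj_def fn_def by (elim conjE)
    then show ?thesis unfolding mem_pw sub_def mem_cart .
  qed
qed

lemma OD_Y: "OD Y"
  unfolding Y_def by (rule OD_term) (intro dfi dfo OD_ord ordt)

lemma ex_Y: "\<exists>B. B \<epsilon> Y"
  unfolding mem_Y by (rule surjection_onto_suc_Theta[OF ad Th])

definition cond :: "'u \<Rightarrow> bool" where "cond z \<longleftrightarrow> OD z \<and> sub z Y \<and> (\<exists>B. B \<epsilon> z)"

text \<open>A condition \<open>z\<close> is a set of arbitrary surjections and as such is not in the inner model; its code
  \<open>cd z\<close>, the set of all pairs indexing \<open>z\<close>, is.\<close>

definition cd :: "'u \<Rightarrow> 'u" where "cd z = sep (cart k reals) (\<lambda>p. oset (pfst p) (psnd p) = z)"
text \<open>A code lists indices of one and the same set, so the union of all sets indexed by it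
  returns that set.\<close>

definition dc :: "'u \<Rightarrow> 'u" where "dc p = un (repl p (\<lambda>q. oset (pfst q) (psnd q)))"
definition PP :: 'u where "PP = repl (sep (pw Y) cond) cd"
definition LL :: 'u where "LL = sep (cart PP PP) (\<lambda>p. sub (dc (pfst p)) (dc (psnd p)))"

lemma dft_dc [dfi]: "dft C a \<Longrightarrow> dft C (\<lambda>s. dc (a s))"
  by (rule dft1[of C dc]) (unfold dc_def, intro dfi)

lemma df_cond: "dft (Collect OD) a \<Longrightarrow> df (Collect OD) (\<lambda>s. cond (a s))"
  by (rule df1[of _ cond]) (unfold cond_def, intro dfi dfo OD_Y)

lemma dft_cd: "dft (Collect OD) a \<Longrightarrow> dft (Collect OD) (\<lambda>s. cd (a s))"
  by (rule dft1[of _ cd]) (unfold cd_def, intro dfi dfo OD_ord ordk)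

lemma mem_cd: "p \<epsilon> cd z \<longleftrightarrow> (\<exists>a x. a \<epsilon> k \<and> x \<epsilon> reals \<and> p = prd a x \<and> oset a x = z)"
proof -
  have "p \<epsilon> cd z \<longleftrightarrow> p \<epsilon> cart k reals \<and> oset (pfst p) (psnd p) = z"
    unfolding cd_def by (rule mem_sep) (intro dfi dfp)
  then show ?thesis by (auto simp del: mem_reals)
qed

lemma dc_cd: "cond z \<Longrightarrow> dc (cd z) = z"
proof -
  assume z: "cond z"
  then obtain a x where ax: "a \<epsilon> k" "x \<epsilon> reals" "z = oset a x"
    using k[of z] unfolding cond_def Y_def by blast
  have m: "q \<epsilon> repl (cd z) (\<lambda>q. oset (pfst q) (psnd q)) \<longleftrightarrow> q = z" for q
  proof -
    have "q \<epsilon> repl (cd z) (\<lambda>q. oset (pfst q) (psnd q)) \<longleftrightarrow> (\<exists>p. p \<epsilon> cd z \<and> q = oset (pfst p) (psnd p))"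
      by (rule mem_repl) (intro dfi)
    also have "\<dots> \<longleftrightarrow> q = z"
    proof
      assume "\<exists>p. p \<epsilon> cd z \<and> q = oset (pfst p) (psnd p)"
      then show "q = z" unfolding mem_cd by (elim exE conjE) simp
    next
      assume "q = z"
      moreover have "prd a x \<epsilon> cd z" unfolding mem_cd using ax by blast
      ultimately show "\<exists>p. p \<epsilon> cd z \<and> q = oset (pfst p) (psnd p)"
        using ax(3) by (intro exI[of _ "prd a x"]) simp
    qed
    finally show ?thesis .
  qed
  show ?thesis unfolding dc_def by (rule extensional) (simp only: mem_un m, blast)
qed

lemma mem_PP: "p \<epsilon> PP \<longleftrightarrow> (\<exists>z. cond z \<and> p = cd z)"
proof -
  have d: "dft UNIV (\<lambda>s. cd (s 0))" unfolding cd_def by (intro dfi dfp)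
  have c: "z \<epsilon> sep (pw Y) cond \<longleftrightarrow> z \<epsilon> pw Y \<and> cond z" for z
    by (rule mem_sep) (unfold cond_def, intro dfi dfp)
  show ?thesis unfolding PP_def mem_repl[OF d] c by (auto simp: cond_def)
qed

lemma PP_cond: "p \<epsilon> PP \<Longrightarrow> cond (dc p)" and PP_cd: "p \<epsilon> PP \<Longrightarrow> cd (dc p) = p"
  unfolding mem_PP using dc_cd by auto

lemma PP_sub: "p \<epsilon> PP \<Longrightarrow> B \<epsilon> dc p \<Longrightarrow> B \<epsilon> Y"
  using PP_cond[of p] subD[of "dc p" Y B] unfolding cond_def by blast

lemma hod_cd: "OD z \<Longrightarrow> hod (cd z)"
proof (rule hodI)
  show "OD z \<Longrightarrow> OD (cd z)" by (rule OD_term) (intro dft_cd dfo)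
  show "hod p" if "p \<epsilon> cd z" for p
    using that hod_mem[OF hod_ord[OF ordk]] hod_real unfolding mem_cd by (blast intro: hod_prd)
qed

lemma hod_PP: "hod PP"
proof (rule hodI)
  show "OD PP" unfolding PP_def by (rule OD_term) (intro dfi dfo OD_Y df_cond dft_cd)
  show "hod p" if "p \<epsilon> PP" for p using that hod_cd unfolding mem_PP cond_def by blast
qed

lemmas OD_PP = hod_OD[OF hod_PP]

lemma mem_LL: "prd p q \<epsilon> LL \<longleftrightarrow> p \<epsilon> PP \<and> q \<epsilon> PP \<and> sub (dc p) (dc q)"
proof -
  have "prd p q \<epsilon> LL \<longleftrightarrow> prd p q \<epsilon> cart PP PP \<and> sub (dc (pfst (prd p q))) (dc (psnd (prd p q)))"
    unfolding LL_def by (rule mem_sep) (intro dfi)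
  then show ?thesis by simp
qed

lemma LL_prd: "z \<epsilon> LL \<Longrightarrow> \<exists>p q. p \<epsilon> PP \<and> q \<epsilon> PP \<and> z = prd p q"
proof -
  have "z \<epsilon> LL \<longleftrightarrow> z \<epsilon> cart PP PP \<and> sub (dc (pfst z)) (dc (psnd z))"
    unfolding LL_def by (rule mem_sep) (intro dfi)
  then show "z \<epsilon> LL \<Longrightarrow> \<exists>p q. p \<epsilon> PP \<and> q \<epsilon> PP \<and> z = prd p q" by simp
qed

lemma hod_LL: "hod LL"
proof (rule hodI)
  show "OD LL" unfolding LL_def by (rule OD_term) (intro dfi dfo OD_PP)
  show "hod z" if "z \<epsilon> LL" for z using LL_prd[OF that] hod_mem[OF hod_PP] by (auto intro: hod_prd)
qed

lemma poset: "(\<exists>p. p \<epsilon> PP) \<and> (\<forall>z. z \<epsilon> LL \<longrightarrow> (\<exists>p q. p \<epsilon> PP \<and> q \<epsilon> PP \<and> z = prd p q)) \<and>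
    (\<forall>p. p \<epsilon> PP \<longrightarrow> prd p p \<epsilon> LL) \<and>
    (\<forall>p q. prd p q \<epsilon> LL \<and> prd q p \<epsilon> LL \<longrightarrow> p = q) \<and>
    (\<forall>p q r. prd p q \<epsilon> LL \<and> prd q r \<epsilon> LL \<longrightarrow> prd p r \<epsilon> LL)"
proof (intro conjI allI impI)
  have "cond Y" using OD_Y ex_Y by (simp add: cond_def)
  then show "\<exists>p. p \<epsilon> PP" unfolding mem_PP by blast
  show "prd p p \<epsilon> LL" if "p \<epsilon> PP" for p using that by (simp add: mem_LL)
  show "p = q" if "prd p q \<epsilon> LL \<and> prd q p \<epsilon> LL" for p q
  proof -
    from that have pq: "p \<epsilon> PP" "q \<epsilon> PP" "sub (dc p) (dc q)" "sub (dc q) (dc p)" unfolding mem_LL by blast+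
    from pq(3,4) have "dc p = dc q" unfolding sub_def by (intro extensional) blast
    then have "cd (dc p) = cd (dc q)" by (rule arg_cong)
    then show ?thesis unfolding PP_cd[OF pq(1)] PP_cd[OF pq(2)] .
  qed
  show "prd p r \<epsilon> LL" if "prd p q \<epsilon> LL \<and> prd q r \<epsilon> LL" for p q r
    using that unfolding mem_LL by (elim conjE) (intro conjI, assumption+, rule sub_trans)
qed (rule LL_prd)

text \<open>Closure of \<open>OD\<close> under definitions makes the set of all \<open>B\<close> in
  \<open>p\<close> with property \<open>Q\<close> a condition. This replaces density and genericity:
  a definable property of a single \<open>B\<close> in \<open>p\<close> holds throughout some
  stronger condition that contains \<open>B\<close>.\<close>

lemma cond_sep:
  assumes p: "p \<epsilon> PP" and B: "B \<epsilon> dc p" "Q B" and Q: "df (Collect OD) (\<lambda>s. Q (s 0))"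
  shows "\<exists>q. prd q p \<epsilon> LL \<and> (\<forall>B. B \<epsilon> dc q \<longleftrightarrow> B \<epsilon> dc p \<and> Q B)"
proof -
  have m: "x \<epsilon> sep (dc p) Q \<longleftrightarrow> x \<epsilon> dc p \<and> Q x" for x
    by (rule mem_sep) (rule Def_mono[OF Q], simp)
  have "OD (sep (dc p) Q)"
    by (rule OD_term) (intro dfi dfo hod_OD hod_mem[OF hod_PP p] Q)
  then have c: "cond (sep (dc p) Q)" using PP_sub[OF p] m B unfolding cond_def sub_def by blast
  show ?thesis
  proof (intro exI conjI allI)
    show "prd (cd (sep (dc p) Q)) p \<epsilon> LL"
      unfolding mem_LL mem_PP[of "cd _"] dc_cd[OF c] using p c m by (auto simp: sub_def)
    show "B \<epsilon> dc (cd (sep (dc p) Q)) \<longleftrightarrow> B \<epsilon> dc p \<and> Q B" for B unfolding dc_cd[OF c] by (rule m)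
  qed
qed

text \<open>The usual evaluation of names, with the set of all conditions containing
  \<open>B\<close> in the role of the generic filter.\<close>

definition val :: "'u \<Rightarrow> 'u \<Rightarrow> 'u" where
  "val B = trec (\<lambda>x h. repl (sep x (\<lambda>q. \<exists>s p. q = prd s p \<and> p \<epsilon> PP \<and> B \<epsilon> dc p)) (\<lambda>q. app h (pfst q)))"

lemma dft_val: "dft (Collect OD) a \<Longrightarrow> dft (Collect OD) b \<Longrightarrow> dft (Collect OD) (\<lambda>s. val (a s) (b s))"
  by (rule dft2[of _ val]) (unfold val_def, intro dfi dfo OD_PP)

lemma dft_val_UNIV: "dft UNIV a \<Longrightarrow> dft UNIV b \<Longrightarrow> dft UNIV (\<lambda>s. val (a s) (b s))"
  by (rule dft2[of _ val]) (unfold val_def, intro dfi dfp)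

lemma tc_fst: "prd s p \<epsilon> x \<Longrightarrow> s \<epsilon> tc x"
proof -
  assume x: "prd s p \<epsilon> x"
  have "s \<epsilon> upr s s" "upr s s \<epsilon> prd s p" by (simp_all add: prd_def)
  then have "s \<epsilon> tc (prd s p)" using mem_tc tc_trans by blast
  with x show ?thesis using mem_tc tc_trans by blast
qed

lemma mem_val: "v \<epsilon> val B a \<longleftrightarrow> (\<exists>s p. prd s p \<epsilon> a \<and> p \<epsilon> PP \<and> B \<epsilon> dc p \<and> v = val B s)"
proof -
  let ?S = "\<lambda>x. sep x (\<lambda>q. \<exists>s p. q = prd s p \<and> p \<epsilon> PP \<and> B \<epsilon> dc p)"
  let ?G = "\<lambda>x h. repl (?S x) (\<lambda>q. app h (pfst q))"
  have G: "dft UNIV (\<lambda>s. ?G (s (Suc 0)) (s 0))" by (intro dfi dfp)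
  have m: "q \<epsilon> ?S a \<longleftrightarrow> q \<epsilon> a \<and> (\<exists>s p. q = prd s p \<and> p \<epsilon> PP \<and> B \<epsilon> dc p)" for q
    by (rule mem_sep) (intro dfi dfp)
  let ?h = "lam (tc a) (trec ?G)"
  have r: "v \<epsilon> repl (?S a) (\<lambda>q. app ?h (pfst q)) \<longleftrightarrow> (\<exists>q. q \<epsilon> ?S a \<and> v = app ?h (pfst q))"
    by (rule mem_repl) (intro dfi dfp)
  have "val B a = repl (?S a) (\<lambda>q. app ?h (pfst q))" unfolding val_def by (rule trec[OF G])
  then have "v \<epsilon> val B a \<longleftrightarrow> (\<exists>q. q \<epsilon> ?S a \<and> v = app ?h (pfst q))" by (simp only: r)
  also have "\<dots> \<longleftrightarrow> (\<exists>s p. prd s p \<epsilon> a \<and> p \<epsilon> PP \<and> B \<epsilon> dc p \<and> v = app ?h s)"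
  proof
    assume "\<exists>q. q \<epsilon> ?S a \<and> v = app ?h (pfst q)"
    then obtain q where q: "q \<epsilon> ?S a" "v = app ?h (pfst q)" by blast
    from q(1) obtain s p where "q \<epsilon> a" "q = prd s p" "p \<epsilon> PP" "B \<epsilon> dc p" unfolding m by blast
    with q(2) show "\<exists>s p. prd s p \<epsilon> a \<and> p \<epsilon> PP \<and> B \<epsilon> dc p \<and> v = app ?h s"
      by (intro exI[of _ s] exI[of _ p]) simp
  next
    assume "\<exists>s p. prd s p \<epsilon> a \<and> p \<epsilon> PP \<and> B \<epsilon> dc p \<and> v = app ?h s"
    then obtain s p where "prd s p \<epsilon> a" "p \<epsilon> PP" "B \<epsilon> dc p" "v = app ?h s" by blast
    then show "\<exists>q. q \<epsilon> ?S a \<and> v = app ?h (pfst q)"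
      unfolding m by (intro exI[of _ "prd s p"]) simp
  qed
  also have "\<dots> \<longleftrightarrow> (\<exists>s p. prd s p \<epsilon> a \<and> p \<epsilon> PP \<and> B \<epsilon> dc p \<and> v = val B s)"
  proof (intro ex_cong1 conj_cong refl)
    fix s p assume "prd s p \<epsilon> a"
    from app_lam_trec[OF G tc_fst[OF this]] show "v = app ?h s \<longleftrightarrow> v = val B s" unfolding val_def by simp
  qed
  finally show ?thesis .
qed

definition chk :: "'u \<Rightarrow> 'u" where
  "chk = trec (\<lambda>x h. repl (cart x PP) (\<lambda>q. prd (app h (pfst q)) (psnd q)))"

lemma dft_chk: "dft (Collect OD) a \<Longrightarrow> dft (Collect OD) (\<lambda>s. chk (a s))"
  by (rule dft1[of _ chk]) (unfold chk_def, intro dfi dfo OD_PP)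

lemma dft_chk_UNIV: "dft UNIV a \<Longrightarrow> dft UNIV (\<lambda>s. chk (a s))"
  by (rule dft1[of _ chk]) (unfold chk_def, intro dfi dfp)

lemma mem_chk: "z \<epsilon> chk x \<longleftrightarrow> (\<exists>u p. u \<epsilon> x \<and> p \<epsilon> PP \<and> z = prd (chk u) p)"
proof -
  let ?G = "\<lambda>x h. repl (cart x PP) (\<lambda>q. prd (app h (pfst q)) (psnd q))"
  have G: "dft UNIV (\<lambda>s. ?G (s (Suc 0)) (s 0))" by (intro dfi dfp)
  let ?h = "lam (tc x) (trec ?G)"
  have r: "z \<epsilon> repl (cart x PP) (\<lambda>q. prd (app ?h (pfst q)) (psnd q)) \<longleftrightarrow>
      (\<exists>q. q \<epsilon> cart x PP \<and> z = prd (app ?h (pfst q)) (psnd q))"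
    by (rule mem_repl) (intro dfi dfp)
  have "chk x = repl (cart x PP) (\<lambda>q. prd (app ?h (pfst q)) (psnd q))" unfolding chk_def by (rule trec[OF G])
  then have "z \<epsilon> chk x \<longleftrightarrow> (\<exists>q. q \<epsilon> cart x PP \<and> z = prd (app ?h (pfst q)) (psnd q))" by (simp only: r)
  also have "\<dots> \<longleftrightarrow> (\<exists>u p. u \<epsilon> x \<and> p \<epsilon> PP \<and> z = prd (app ?h u) p)"
  proof
    assume "\<exists>q. q \<epsilon> cart x PP \<and> z = prd (app ?h (pfst q)) (psnd q)"
    then obtain q where q: "q \<epsilon> cart x PP" "z = prd (app ?h (pfst q)) (psnd q)" by blast
    from q(1) obtain u p where "q = prd u p" "u \<epsilon> x" "p \<epsilon> PP" unfolding mem_cart by blast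
    with q(2) show "\<exists>u p. u \<epsilon> x \<and> p \<epsilon> PP \<and> z = prd (app ?h u) p"
      by (intro exI[of _ u] exI[of _ p]) simp
  next
    assume "\<exists>u p. u \<epsilon> x \<and> p \<epsilon> PP \<and> z = prd (app ?h u) p"
    then obtain u p where "u \<epsilon> x" "p \<epsilon> PP" "z = prd (app ?h u) p" by blast
    then show "\<exists>q. q \<epsilon> cart x PP \<and> z = prd (app ?h (pfst q)) (psnd q)"
      by (intro exI[of _ "prd u p"]) simp
  qed
  also have "\<dots> \<longleftrightarrow> (\<exists>u p. u \<epsilon> x \<and> p \<epsilon> PP \<and> z = prd (chk u) p)"
  proof (intro ex_cong1 conj_cong refl)
    fix u p assume "u \<epsilon> x"
    from app_lam_trec[OF G mem_tc[OF this]] show "z = prd (app ?h u) p \<longleftrightarrow> z = prd (chk u) p"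
      unfolding chk_def by simp
  qed
  finally show ?thesis .
qed

lemma hod_chk: "hod x \<Longrightarrow> hod (chk x)"
proof -
  have "hod x \<longrightarrow> hod (chk x)"
  proof (rule eps_induct[where P = "\<lambda>x. hod x \<longrightarrow> hod (chk x)"])
    show "df UNIV (\<lambda>s. hod (s 0) \<longrightarrow> hod (chk (s 0)))" by (intro dfi dft_chk_UNIV)
    fix x assume IH: "\<And>y. y \<epsilon> x \<Longrightarrow> hod y \<longrightarrow> hod (chk y)"
    show "hod x \<longrightarrow> hod (chk x)"
    proof
      assume x: "hod x"
      show "hod (chk x)"
      proof (rule hodI)
        show "OD (chk x)" by (rule OD_term) (intro dft_chk dfo hod_OD x)
        show "hod z" if "z \<epsilon> chk x" for z
          using that IH hod_mem[OF x] hod_mem[OF hod_PP] unfolding mem_chk by (auto intro: hod_prd)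
      qed
    qed
  qed
  then show "hod x \<Longrightarrow> hod (chk x)" by simp
qed

definition nm :: "'u \<Rightarrow> bool" where
  "nm a \<longleftrightarrow> (\<exists>D. hod D \<and> H.name_domain PP D \<and> a \<epsilon> D)"

lemma df_nm: "dft (Collect OD) a \<Longrightarrow> df (Collect OD) (\<lambda>s. nm (a s))"
  by (rule df1[of _ nm]) (unfold nm_def H.name_domain_def, intro dfi dfo OD_PP)

lemma df_nm_UNIV: "dft UNIV a \<Longrightarrow> df UNIV (\<lambda>s. nm (a s))"
  by (rule df1[of _ nm]) (unfold nm_def H.name_domain_def, intro dfi dfp)

lemma nm_hod: "nm a \<Longrightarrow> hod a"
  unfolding nm_def using hod_mem by blast

lemma nm_sub: "nm a \<Longrightarrow> prd s p \<epsilon> a \<Longrightarrow> nm s"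
  unfolding nm_def H.name_domain_def by (metis prd_inject)

text \<open>A name domain for \<open>a\<close> is obtained by adding the check names of all members
  in the inner model of \<open>vst X\<close>, a transitive set that includes \<open>X\<close>; this
  closes it under subnames.\<close>

lemma nmI:
  assumes a: "OD a" and X: "hod X" and z: "\<And>z. z \<epsilon> a \<Longrightarrow> \<exists>u p. u \<epsilon> X \<and> p \<epsilon> PP \<and> z = prd (chk u) p"
  shows "nm a"
proof -
  let ?T = "sep (vst X) hod"
  have T: "u \<epsilon> ?T \<longleftrightarrow> u \<epsilon> vst X \<and> hod u" for u by (rule mem_sep) (intro dfi)
  have r: "c \<epsilon> repl ?T chk \<longleftrightarrow> (\<exists>u. u \<epsilon> ?T \<and> c = chk u)" for c by (rule mem_repl) (intro dft_chk_UNIV dfi)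
  let ?D = "cup (upr a a) (repl ?T chk)"
  have D: "c \<epsilon> ?D \<longleftrightarrow> c = a \<or> (\<exists>u. u \<epsilon> vst X \<and> hod u \<and> c = chk u)" for c
    unfolding mem_cup mem_upr r T by blast
  have XT: "u \<epsilon> vst X \<and> hod u" if "u \<epsilon> X" for u using hod_mem[OF X that] subD[OF sub_vst that] by simp
  have "hod ?D"
  proof (rule hodI)
    show "OD ?D" by (rule OD_term) (intro dfi dfo a hod_OD[OF X] dft_chk)
    have "hod a" by (rule hodI[OF a]) (use z XT hod_chk hod_mem[OF hod_PP] in \<open>blast intro: hod_prd\<close>)
    then show "hod c" if "c \<epsilon> ?D" for c using that hod_chk unfolding D by blast
  qed
  moreover have "H.name_domain PP ?D"
    unfolding H.name_domain_def
  proof (intro allI impI, elim conjE)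
    fix c z' assume c: "c \<epsilon> ?D" and z': "z' \<epsilon> c"
    have "\<exists>u p. u \<epsilon> vst X \<and> hod u \<and> p \<epsilon> PP \<and> z' = prd (chk u) p"
    proof (cases "c = a")
      case True
      with z z' XT show ?thesis by blast
    next
      case False
      with c obtain y where y: "y \<epsilon> vst X" "hod y" "c = chk y" unfolding D by blast
      from z' have "z' \<epsilon> chk y" by (simp only: y(3))
      then obtain u p where "u \<epsilon> y" "p \<epsilon> PP" "z' = prd (chk u) p" unfolding mem_chk by blast
      moreover have "u \<epsilon> vst X" using trans_setD[OF trans_vst y(1) \<open>u \<epsilon> y\<close>] .
      ultimately show ?thesis using hod_mem[OF y(2)] by blast
    qed
    then show "\<exists>s p. s \<epsilon> ?D \<and> p \<epsilon> PP \<and> z' = prd s p" unfolding D by blast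
  qed
  moreover have "a \<epsilon> ?D" unfolding D by blast
  ultimately show ?thesis unfolding nm_def by blast
qed

lemma nm_chk: "hod x \<Longrightarrow> nm (chk x)"
  by (rule nmI[of _ x]) (simp_all add: hod_OD hod_chk mem_chk)

text \<open>The weakest condition, coded by \<open>cd Y\<close>, contains every \<open>B\<close> in
  \<open>Y\<close>, so no element of \<open>x\<close> is lost in the evaluation.\<close>

lemma val_chk: "B \<epsilon> Y \<Longrightarrow> val B (chk x) = x"
proof -
  assume B: "B \<epsilon> Y"
  have "cond Y" using OD_Y ex_Y by (simp add: cond_def)
  then have Yp: "cd Y \<epsilon> PP" "B \<epsilon> dc (cd Y)" using B by (auto simp: mem_PP dc_cd)
  show ?thesis
  proof (rule eps_induct[where P = "\<lambda>x. val B (chk x) = x"])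
    show "df UNIV (\<lambda>s. val B (chk (s 0)) = s 0)" by (intro dfi dfp dft_val_UNIV dft_chk_UNIV)
    fix x assume IH: "\<And>y. y \<epsilon> x \<Longrightarrow> val B (chk y) = y"
    show "val B (chk x) = x"
    proof (rule extensional)
      fix v
      have "v \<epsilon> val B (chk x) \<longleftrightarrow> (\<exists>u p. u \<epsilon> x \<and> p \<epsilon> PP \<and> B \<epsilon> dc p \<and> v = val B (chk u))"
        unfolding mem_val mem_chk by auto
      also have "\<dots> \<longleftrightarrow> (\<exists>u p. u \<epsilon> x \<and> p \<epsilon> PP \<and> B \<epsilon> dc p \<and> v = u)"
        by (intro ex_cong1 conj_cong refl) (simp add: IH)
      also have "\<dots> \<longleftrightarrow> v \<epsilon> x" using Yp by blast
      finally show "v \<epsilon> val B (chk x) \<longleftrightarrow> v \<epsilon> x" .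
    qed
  qed
qed

definition ext :: "'u \<Rightarrow> 'u set" where "ext B = {v. \<exists>a. nm a \<and> v = val B a}"

lemma hod_ext: "B \<epsilon> Y \<Longrightarrow> hod x \<Longrightarrow> x \<in> ext B"
  unfolding ext_def using val_chk[of B x] nm_chk[of x] by (simp, metis)

lemma gd_ext: "B \<epsilon> Y \<Longrightarrow> gd (\<epsilon>) R (ext B)"
proof unfold_locales
  assume B: "B \<epsilon> Y"
  show "y \<in> ext B" if "x \<in> ext B" "y \<epsilon> x" for x y
  proof -
    from that obtain a where a: "nm a" "y \<epsilon> val B a" unfolding ext_def by blast
    from a(2) obtain s p where s: "prd s p \<epsilon> a" "y = val B s" unfolding mem_val by blast
    with nm_sub[OF a(1) s(1)] show ?thesis unfolding ext_def by blast
  qed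
  show "df UNIV (\<lambda>s. s 0 \<in> ext B)" unfolding ext_def mem_Collect_eq by (intro dfi dfp df_nm_UNIV dft_val_UNIV)
qed (auto intro!: hod_ext intro: hod_om hod_evs hod_ods hod_reals hod_fseqs hod_ord)

text \<open>The name pairs the check name of \<open>x\<close> with those conditions all of whose
  surjections contain \<open>x\<close>. If \<open>x\<close> belongs to \<open>B\<close>, the
  surjections in \<open>Y\<close> containing \<open>x\<close> form such a condition with
  \<open>B\<close> in it, because \<open>x\<close>, a pair of a real and an ordinal, is
  definable.\<close>

lemma generic_ext: "B \<epsilon> Y \<Longrightarrow> B \<in> ext B"
proof -
  assume B: "B \<epsilon> Y"
  let ?X = "cart reals (suc t)"
  have X: "hod ?X"
  proof (rule hodI)
    show "OD ?X" by (rule OD_term) (intro dfi dfo OD_ord ordt)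
    show "hod z" if "z \<epsilon> ?X" for z
      using that hod_real hod_mem[OF hod_ord[OF ord_suc[OF ordt]]] unfolding mem_cart by (blast intro: hod_prd)
  qed
  let ?Q = "\<lambda>z. \<exists>x p. z = prd (chk x) p \<and> x \<epsilon> ?X \<and> p \<epsilon> PP \<and> (\<forall>C. C \<epsilon> dc p \<longrightarrow> x \<epsilon> C)"
  let ?g = "sep (chk ?X) ?Q"
  have g: "z \<epsilon> ?g \<longleftrightarrow> z \<epsilon> chk ?X \<and> ?Q z" for z
    by (rule mem_sep) (intro dfi dfp dft_chk_UNIV)
  have "OD ?g" by (rule OD_term) (intro dfi dfo OD_PP hod_OD[OF X] dft_chk OD_ord ordt)
  then have n: "nm ?g" by (rule nmI[OF _ X]) (unfold g, blast)
  have "val B ?g = B"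
  proof (rule extensional)
    fix v
    have "v \<epsilon> val B ?g \<longleftrightarrow> (\<exists>x p. x \<epsilon> ?X \<and> p \<epsilon> PP \<and> (\<forall>C. C \<epsilon> dc p \<longrightarrow> x \<epsilon> C) \<and> B \<epsilon> dc p \<and> v = x)"
    proof
      assume "v \<epsilon> val B ?g"
      then obtain s p where s: "prd s p \<epsilon> ?g" "p \<epsilon> PP" "B \<epsilon> dc p" "v = val B s" unfolding mem_val by blast
      from s(1)[unfolded g prd_inject] obtain x p' where x: "s = chk x" "p = p'" "x \<epsilon> ?X" "\<forall>C. C \<epsilon> dc p' \<longrightarrow> x \<epsilon> C"
        by (elim conjE exE)
      have "v = x" using s(4) x(1) val_chk[OF B, of x] by simp
      with s x show "\<exists>x p. x \<epsilon> ?X \<and> p \<epsilon> PP \<and> (\<forall>C. C \<epsilon> dc p \<longrightarrow> x \<epsilon> C) \<and> B \<epsilon> dc p \<and> v = x"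
        by (intro exI[of _ x] exI[of _ p]) (simp only: simp_thms)
    next
      assume "\<exists>x p. x \<epsilon> ?X \<and> p \<epsilon> PP \<and> (\<forall>C. C \<epsilon> dc p \<longrightarrow> x \<epsilon> C) \<and> B \<epsilon> dc p \<and> v = x"
      then obtain p where p: "v \<epsilon> ?X" "p \<epsilon> PP" "\<forall>C. C \<epsilon> dc p \<longrightarrow> v \<epsilon> C" "B \<epsilon> dc p" by blast
      have "prd (chk v) p \<epsilon> chk ?X" unfolding mem_chk[of _ ?X] using p(1,2) by (intro exI[of _ v] exI[of _ p] conjI refl)
      then have "prd (chk v) p \<epsilon> ?g" unfolding g using p by (intro conjI exI[of _ v] exI[of _ p] refl)
      then show "v \<epsilon> val B ?g" unfolding mem_val using p val_chk[OF B, of v]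
        by (intro exI[of _ "chk v"] exI[of _ p] conjI) (simp_all only:)
    qed
    also have "\<dots> \<longleftrightarrow> v \<epsilon> B"
    proof
      assume v: "v \<epsilon> B"
      then have vX: "v \<epsilon> ?X" using B unfolding mem_Y H.srj_def fn_def mem_cart by blast
      have "cond Y" using OD_Y ex_Y by (simp add: cond_def)
      then have Yp: "cd Y \<epsilon> PP" "dc (cd Y) = Y" by (auto simp: mem_PP dc_cd)
      have "\<exists>q. prd q (cd Y) \<epsilon> LL \<and> (\<forall>C. C \<epsilon> dc q \<longleftrightarrow> C \<epsilon> dc (cd Y) \<and> v \<epsilon> C)"
        by (rule cond_sep[where Q = "\<lambda>C. v \<epsilon> C", OF Yp(1) _ v])
          (use Yp B in simp, intro dfi dfo hod_OD hod_mem[OF X vX])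
      then obtain q where "prd q (cd Y) \<epsilon> LL" "\<forall>C. C \<epsilon> dc q \<longleftrightarrow> C \<epsilon> dc (cd Y) \<and> v \<epsilon> C" by blast
      then have "q \<epsilon> PP" "B \<epsilon> dc q" "\<forall>C. C \<epsilon> dc q \<longrightarrow> v \<epsilon> C"
        using Yp B v by (simp_all add: mem_LL)
      with vX show "\<exists>x p. x \<epsilon> ?X \<and> p \<epsilon> PP \<and> (\<forall>C. C \<epsilon> dc p \<longrightarrow> x \<epsilon> C) \<and> B \<epsilon> dc p \<and> v = x" by blast
    qed blast
    finally show "v \<epsilon> val B ?g \<longleftrightarrow> v \<epsilon> B" .
  qed
  from n this[symmetric] show ?thesis unfolding ext_def mem_Collect_eq by (intro exI conjI)
qed

end

subsection \<open>The forcing theorem\<close>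

context frc
begin

text \<open>Semantic forcing. That it solves the recursion for atomic forcing, and is its only
  solution on a name domain, is what has to be proved.\<close>

definition fE :: "'u \<Rightarrow> 'u \<Rightarrow> 'u \<Rightarrow> bool" where
  "fE p a b \<longleftrightarrow> (\<forall>B. B \<epsilon> dc p \<longrightarrow> val B a = val B b)"
definition fM :: "'u \<Rightarrow> 'u \<Rightarrow> 'u \<Rightarrow> bool" where
  "fM p a b \<longleftrightarrow> (\<forall>B. B \<epsilon> dc p \<longrightarrow> val B a \<epsilon> val B b)"

lemma hod_fst: "hod a \<Longrightarrow> prd s p \<epsilon> a \<Longrightarrow> hod s"
  using H.prdW[of a s p] by simp

lemma hod_snd: "hod a \<Longrightarrow> prd s p \<epsilon> a \<Longrightarrow> hod p"
  using H.prdW[of a s p] by simp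

lemma LL_sub: "prd q p \<epsilon> LL \<Longrightarrow> B \<epsilon> dc q \<Longrightarrow> B \<epsilon> dc p"
  unfolding mem_LL by (elim conjE) (rule subD)

text \<open>If the subname \<open>s\<close> is evaluated into \<open>a\<close> at \<open>B\<close>,
  then the condition of all \<open>C\<close> in \<open>p\<close> where this happens forces
  \<open>s\<close> into \<open>a\<close>, hence by assumption into \<open>b\<close>; and
  \<open>B\<close> belongs to it.\<close>

lemma fE_sub:
  assumes a: "hod a" and p: "p \<epsilon> PP"
    and h: "\<And>s q t. prd s t \<epsilon> a \<Longrightarrow> prd q p \<epsilon> LL \<Longrightarrow> fM q s a \<Longrightarrow> fM q s b"
    and B: "B \<epsilon> dc p" and v: "v \<epsilon> val B a"
  shows "v \<epsilon> val B b"
proof -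
  from v obtain s u where s: "prd s u \<epsilon> a" "v = val B s" unfolding mem_val by blast
  have "\<exists>q. prd q p \<epsilon> LL \<and> (\<forall>C. C \<epsilon> dc q \<longleftrightarrow> C \<epsilon> dc p \<and> val C s \<epsilon> val C a)"
  proof (rule cond_sep[where Q = "\<lambda>C. val C s \<epsilon> val C a", OF p B])
    show "val B s \<epsilon> val B a" using v s(2) by simp
    show "df (Collect OD) (\<lambda>u. val (u 0) s \<epsilon> val (u 0) a)"
      by (intro dfi dft_val dfo hod_OD a hod_fst[OF a s(1)])
  qed
  then obtain q where q: "prd q p \<epsilon> LL" "\<And>C. C \<epsilon> dc q \<longleftrightarrow> C \<epsilon> dc p \<and> val C s \<epsilon> val C a" by blast
  have "fM q s a" unfolding fM_def using q(2) by blast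
  from h[OF s(1) q(1) this] have "fM q s b" .
  moreover have "B \<epsilon> dc q" unfolding q(2) using B v s(2) by simp
  ultimately show ?thesis unfolding fM_def s(2) by blast
qed

lemma fE_iff:
  assumes a: "hod a" and b: "hod b" and p: "p \<epsilon> PP"
  shows "fE p a b \<longleftrightarrow> (\<forall>s q. (\<exists>t. prd s t \<epsilon> a \<or> prd s t \<epsilon> b) \<and> prd q p \<epsilon> LL \<longrightarrow> (fM q s a \<longleftrightarrow> fM q s b))"
proof
  assume e: "fE p a b"
  have "fM q s a \<longleftrightarrow> fM q s b" if "prd q p \<epsilon> LL" for q s
    using e LL_sub[OF that] unfolding fE_def fM_def by simp
  then show "\<forall>s q. (\<exists>t. prd s t \<epsilon> a \<or> prd s t \<epsilon> b) \<and> prd q p \<epsilon> LL \<longrightarrow> (fM q s a \<longleftrightarrow> fM q s b)" by blast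
next
  assume h: "\<forall>s q. (\<exists>t. prd s t \<epsilon> a \<or> prd s t \<epsilon> b) \<and> prd q p \<epsilon> LL \<longrightarrow> (fM q s a \<longleftrightarrow> fM q s b)"
  show "fE p a b" unfolding fE_def
  proof (intro allI impI, rule extensional)
    fix B v assume B: "B \<epsilon> dc p"
    have "v \<epsilon> val B b" if "v \<epsilon> val B a"
      by (rule fE_sub[OF a p _ B that]) (use h in blast)
    moreover have "v \<epsilon> val B a" if "v \<epsilon> val B b"
      by (rule fE_sub[OF b p _ B that]) (use h in blast)
    ultimately show "v \<epsilon> val B a \<longleftrightarrow> v \<epsilon> val B b" by blast
  qed
qed

text \<open>Forwards, a single \<open>B\<close> in \<open>q\<close> shows which pair in
  \<open>b\<close> is responsible, and \<open>cond_sep\<close> cuts \<open>q\<close> down to where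
  this persists. Backwards, the failures in \<open>p\<close> would form a condition, below which the
  density clause yields a success.\<close>

lemma fM_iff:
  assumes a: "hod a" and b: "hod b" and p: "p \<epsilon> PP"
  shows "fM p a b \<longleftrightarrow> (\<forall>q. prd q p \<epsilon> LL \<longrightarrow>
    (\<exists>r s t. prd r q \<epsilon> LL \<and> prd s t \<epsilon> b \<and> prd r t \<epsilon> LL \<and> fE r a s))" (is "_ \<longleftrightarrow> ?rhs")
proof
  assume m: "fM p a b"
  show ?rhs
  proof (intro allI impI)
    fix q assume q: "prd q p \<epsilon> LL"
    then have qP: "q \<epsilon> PP" by (simp add: mem_LL)
    then obtain B where B: "B \<epsilon> dc q" using PP_cond[of q] unfolding cond_def by blast
    with LL_sub[OF q] m have "val B a \<epsilon> val B b" unfolding fM_def by blast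
    then obtain s u where s: "prd s u \<epsilon> b" "u \<epsilon> PP" "B \<epsilon> dc u" "val B a = val B s" unfolding mem_val[of _ B b] by blast
    have "\<exists>r. prd r q \<epsilon> LL \<and> (\<forall>C. C \<epsilon> dc r \<longleftrightarrow> C \<epsilon> dc q \<and> (C \<epsilon> dc u \<and> val C a = val C s))"
    proof (rule cond_sep[where Q = "\<lambda>C. C \<epsilon> dc u \<and> val C a = val C s", OF qP B])
      show "B \<epsilon> dc u \<and> val B a = val B s" using s by blast
      show "df (Collect OD) (\<lambda>w. w 0 \<epsilon> dc u \<and> val (w 0) a = val (w 0) s)"
        by (intro dfi dft_val dfo hod_OD a hod_fst[OF b s(1)] hod_snd[OF b s(1)])
    qed
    then obtain r where r: "prd r q \<epsilon> LL" "\<And>C. C \<epsilon> dc r \<longleftrightarrow> C \<epsilon> dc q \<and> (C \<epsilon> dc u \<and> val C a = val C s)" by blast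
    have "prd r u \<epsilon> LL" unfolding mem_LL sub_def using r s(2) by (simp add: mem_LL)
    moreover have "fE r a s" unfolding fE_def using r(2) by blast
    ultimately show "\<exists>r s t. prd r q \<epsilon> LL \<and> prd s t \<epsilon> b \<and> prd r t \<epsilon> LL \<and> fE r a s" using r(1) s(1) by blast
  qed
next
  assume h: ?rhs
  show "fM p a b"
  proof (rule ccontr)
    assume "\<not> fM p a b"
    then obtain B where B: "B \<epsilon> dc p" "\<not> val B a \<epsilon> val B b" unfolding fM_def by blast
    have "\<exists>q. prd q p \<epsilon> LL \<and> (\<forall>C. C \<epsilon> dc q \<longleftrightarrow> C \<epsilon> dc p \<and> \<not> val C a \<epsilon> val C b)"
      by (rule cond_sep[where Q = "\<lambda>C. \<not> val C a \<epsilon> val C b", OF p B]) (intro dfi dft_val dfo hod_OD a b)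
    then obtain q where q: "prd q p \<epsilon> LL" "\<And>C. C \<epsilon> dc q \<longleftrightarrow> C \<epsilon> dc p \<and> \<not> val C a \<epsilon> val C b" by blast
    from h q(1) obtain r s u where r: "prd r q \<epsilon> LL" "prd s u \<epsilon> b" "prd r u \<epsilon> LL" "fE r a s" by blast
    from r(3) have rP: "r \<epsilon> PP" "u \<epsilon> PP" by (simp_all add: mem_LL)
    then obtain C where C: "C \<epsilon> dc r" using PP_cond[of r] unfolding cond_def by blast
    have "val C a \<epsilon> val C b" unfolding mem_val[of _ C b]
      using r(2,4) rP(2) C LL_sub[OF r(3) C] unfolding fE_def by blast
    moreover have "\<not> val C a \<epsilon> val C b" using LL_sub[OF r(1) C] q(2) by blast
    ultimately show False by blast
  qed
qed

lemma name_fst: "H.name_domain PP D \<Longrightarrow> a \<epsilon> D \<Longrightarrow> prd s u \<epsilon> a \<Longrightarrow> s \<epsilon> D"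
  unfolding H.name_domain_def by (metis prd_inject)

lemma sub_vst_fst: "sub a (vst x) \<Longrightarrow> prd s u \<epsilon> a \<Longrightarrow> \<exists>y. y \<epsilon> x \<and> sub s (vst y)"
proof -
  assume "sub a (vst x)" "prd s u \<epsilon> a"
  then have "prd s u \<epsilon> vst x" by (rule subD)
  then obtain y where y: "y \<epsilon> x" "sub (prd s u) (vst y)" unfolding mem_vst[of _ x] by blast
  have "upr s s \<epsilon> prd s u" "s \<epsilon> upr s s" by (simp_all add: prd_def)
  then have "s \<epsilon> vst y" using subD[OF y(2)] trans_setD[OF trans_vst] by blast
  then have "sub s (vst y)" using trans_vst[of y] unfolding trans_set_def by blast
  with y(1) show ?thesis by blast
qed

text \<open>The recursion leads to names of smaller rank inside the same name domain, so it has only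
  one solution there, and \<open>fE_iff\<close> and \<open>fM_iff\<close> say that semantic forcing
  is one.\<close>

lemma atomic_correct:
  assumes F: "H.atomic_forcing PP LL D e m" and D: "hod D"
  shows "p \<epsilon> PP \<Longrightarrow> a \<epsilon> D \<Longrightarrow> b \<epsilon> D \<Longrightarrow> prd p (prd a b) \<epsilon> e \<longleftrightarrow> fE p a b"
    and "p \<epsilon> PP \<Longrightarrow> a \<epsilon> D \<Longrightarrow> b \<epsilon> D \<Longrightarrow> prd p (prd a b) \<epsilon> m \<longleftrightarrow> fM p a b"
proof -
  have nd: "H.name_domain PP D" using F unfolding H.atomic_forcing_def by (elim conjE)
  note F2 = F[unfolded H.atomic_forcing_def, THEN conjunct2]
  have Fe: "prd p (prd a b) \<epsilon> e \<longleftrightarrow> (\<forall>s q. (\<exists>t. prd s t \<epsilon> a \<or> prd s t \<epsilon> b) \<and> prd q p \<epsilon> LL \<longrightarrow>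
      (prd q (prd s a) \<epsilon> m \<longleftrightarrow> prd q (prd s b) \<epsilon> m))" if "p \<epsilon> PP" "a \<epsilon> D" "b \<epsilon> D" for p a b
    by (rule F2[rule_format, THEN conjunct1]) (intro conjI that)
  have Fm: "prd p (prd a b) \<epsilon> m \<longleftrightarrow> (\<forall>q. prd q p \<epsilon> LL \<longrightarrow>
      (\<exists>r s t. prd r q \<epsilon> LL \<and> prd s t \<epsilon> b \<and> prd r t \<epsilon> LL \<and> prd r (prd a s) \<epsilon> e))"
    if "p \<epsilon> PP" "a \<epsilon> D" "b \<epsilon> D" for p a b
    by (rule F2[rule_format, THEN conjunct2]) (intro conjI that)
  have hD: "hod a" if "a \<epsilon> D" for a by (rule hod_mem[OF D that])
  have stepM: "prd p (prd a b) \<epsilon> m \<longleftrightarrow> fM p a b"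
    if p: "p \<epsilon> PP" "a \<epsilon> D" "b \<epsilon> D"
      and h: "\<And>r s u. r \<epsilon> PP \<Longrightarrow> prd s u \<epsilon> b \<Longrightarrow> prd r (prd a s) \<epsilon> e \<longleftrightarrow> fE r a s" for p a b
    unfolding Fm[OF p] fM_iff[OF hD[OF p(2)] hD[OF p(3)] p(1)]
  proof (intro all_cong1 imp_cong ex_cong1 conj_cong refl)
    fix q r s u assume "prd r q \<epsilon> LL" "prd s u \<epsilon> b"
    then show "prd r (prd a s) \<epsilon> e \<longleftrightarrow> fE r a s" by (intro h) (simp add: mem_LL)
  qed
  have stepE: "prd p (prd a b) \<epsilon> e \<longleftrightarrow> fE p a b"
    if p: "p \<epsilon> PP" "a \<epsilon> D" "b \<epsilon> D"
      and h: "\<And>q s u c. q \<epsilon> PP \<Longrightarrow> prd s u \<epsilon> a \<or> prd s u \<epsilon> b \<Longrightarrow> c = a \<or> c = b \<Longrightarrow>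
        prd q (prd s c) \<epsilon> m \<longleftrightarrow> fM q s c" for p a b
    unfolding Fe[OF p] fE_iff[OF hD[OF p(2)] hD[OF p(3)] p(1)]
  proof (intro all_cong1 imp_cong refl)
    fix s q assume "(\<exists>t. prd s t \<epsilon> a \<or> prd s t \<epsilon> b) \<and> prd q p \<epsilon> LL"
    then obtain u where u: "prd s u \<epsilon> a \<or> prd s u \<epsilon> b" and q: "q \<epsilon> PP" unfolding mem_LL by blast
    show "(prd q (prd s a) \<epsilon> m \<longleftrightarrow> prd q (prd s b) \<epsilon> m) \<longleftrightarrow> (fM q s a \<longleftrightarrow> fM q s b)"
      using h[OF q u, of a] h[OF q u, of b] by simp
  qed
  \<comment> \<open>Equality of \<open>a\<close> and \<open>b\<close> reduces to membership of
    subnames in them, and this to equality of subnames with each other. Two steps of the recursion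
    thus return to equality at smaller rank, and membership is treated without an induction of its
    own.\<close>
  have E: "ord x \<longrightarrow> (\<forall>p a b. p \<epsilon> PP \<and> a \<epsilon> D \<and> b \<epsilon> D \<and> sub a (vst x) \<and> sub b (vst x) \<longrightarrow>
      (prd p (prd a b) \<epsilon> e \<longleftrightarrow> fE p a b))" (is "?P x") for x
  proof (rule eps_induct[where P = ?P])
    show "df UNIV (\<lambda>s. ?P (s 0))" unfolding fE_def by (intro dfi dfp dft_val_UNIV)
    fix x assume IH: "\<And>y. y \<epsilon> x \<Longrightarrow> ?P y"
    show "?P x"
    proof (intro allI impI, elim conjE)
      fix p a b assume ox: "ord x" and p: "p \<epsilon> PP" "a \<epsilon> D" "b \<epsilon> D" and ab: "sub a (vst x)" "sub b (vst x)"
      have low: "\<exists>y. y \<epsilon> x \<and> sub s (vst y)" if "prd s u \<epsilon> a \<or> prd s u \<epsilon> b" for s u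
        using that sub_vst_fst[OF ab(1)] sub_vst_fst[OF ab(2)] by blast
      have lowD: "s \<epsilon> D" if "prd s u \<epsilon> a \<or> prd s u \<epsilon> b" for s u
        using that name_fst[OF nd p(2)] name_fst[OF nd p(3)] by blast
      have e: "prd r (prd s s') \<epsilon> e \<longleftrightarrow> fE r s s'"
        if s: "prd s u \<epsilon> a \<or> prd s u \<epsilon> b" and s': "prd s' u' \<epsilon> a \<or> prd s' u' \<epsilon> b" and r: "r \<epsilon> PP" for r s s' u u'
      proof -
        from low[OF s] obtain y where y: "y \<epsilon> x" "sub s (vst y)" by blast
        from low[OF s'] obtain y' where y': "y' \<epsilon> x" "sub s' (vst y')" by blast
        have oy: "ord y" "ord y'" using ord_mem[OF ox] y y' by blast+
        have "\<exists>z. z \<epsilon> x \<and> sub s (vst z) \<and> sub s' (vst z)"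
        proof -
          consider "y \<epsilon> y'" | "y = y'" | "y' \<epsilon> y" using ord_linear[OF oy] by blast
          then show ?thesis
          proof cases
            case 1 then show ?thesis using sub_trans[OF y(2) ord_vst_mono[OF oy(2)]] y' by blast
          next
            case 2 then show ?thesis using y y' by blast
          next
            case 3 then show ?thesis using sub_trans[OF y'(2) ord_vst_mono[OF oy(1)]] y by blast
          qed
        qed
        then obtain z where z: "z \<epsilon> x" "sub s (vst z)" "sub s' (vst z)" by blast
        show ?thesis
          by (rule IH[OF z(1), rule_format, OF ord_mem[OF ox z(1)]])
            (intro conjI r lowD[OF s] lowD[OF s'] z)
      qed
      show "prd p (prd a b) \<epsilon> e \<longleftrightarrow> fE p a b"
      proof (rule stepE[OF p])
        fix q s u c assume q: "q \<epsilon> PP" and s: "prd s u \<epsilon> a \<or> prd s u \<epsilon> b" and c: "c = a \<or> c = b"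
        have "c \<epsilon> D" using c p by blast
        show "prd q (prd s c) \<epsilon> m \<longleftrightarrow> fM q s c"
        proof (rule stepM[OF q lowD[OF s] \<open>c \<epsilon> D\<close>])
          fix r s' u' assume r: "r \<epsilon> PP" and "prd s' u' \<epsilon> c"
          then have s': "prd s' u' \<epsilon> a \<or> prd s' u' \<epsilon> b" using c by blast
          show "prd r (prd s s') \<epsilon> e \<longleftrightarrow> fE r s s'" by (rule e[OF s s' r])
        qed
      qed
    qed
  qed
  show 1: "prd p (prd a b) \<epsilon> e \<longleftrightarrow> fE p a b" if p: "p \<epsilon> PP" "a \<epsilon> D" "b \<epsilon> D" for p a b
  proof -
    obtain x where x: "ord x" "upr a b \<epsilon> vst x" using ex_vst by blast
    have "a \<epsilon> vst x" "b \<epsilon> vst x" using trans_setD[OF trans_vst x(2)] by simp_all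
    then have "sub a (vst x)" "sub b (vst x)" using trans_vst[of x] unfolding trans_set_def by blast+
    then show ?thesis
      by (intro E[rule_format, OF x(1)] conjI p)
  qed
  show "prd p (prd a b) \<epsilon> m \<longleftrightarrow> fM p a b" if p: "p \<epsilon> PP" "a \<epsilon> D" "b \<epsilon> D" for p a b
    by (rule stepM[OF p], rule 1) (use p name_fst[OF nd p(3)] in blast)+
qed

lemma name_domain_pair:
  assumes a: "nm a" and b: "nm b"
  shows "\<exists>D. hod D \<and> H.name_domain PP D \<and> a \<epsilon> D \<and> b \<epsilon> D"
proof -
  from a b obtain D D' where D: "hod D" "H.name_domain PP D" "a \<epsilon> D" "hod D'" "H.name_domain PP D'" "b \<epsilon> D'"
    unfolding nm_def by blast
  have "hod (cup D D')"
  proof (rule hodI)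
    show "OD (cup D D')" by (rule OD_term) (intro dfi dfo hod_OD D)
    show "hod x" if "x \<epsilon> cup D D'" for x using that hod_mem[OF D(1)] hod_mem[OF D(4)] by auto
  qed
  moreover have "H.name_domain PP (cup D D')"
    using D(2,5) unfolding H.name_domain_def mem_cup by meson
  ultimately show ?thesis using D(3,6) by (intro exI[of _ "cup D D'"]) simp
qed

text \<open>Semantic forcing, restricted to a name domain, is definable from parameters in the inner
  model and hence is a set there.\<close>

lemma atomic_exists:
  assumes D: "hod D" "H.name_domain PP D"
  shows "\<exists>e m. hod e \<and> hod m \<and> H.atomic_forcing PP LL D e m"
proof -
  let ?S = "cart PP (cart D D)"
  have S: "hod z" if "z \<epsilon> ?S" for z
    using that hod_mem[OF hod_PP] hod_mem[OF D(1)] unfolding mem_cart by (elim exE conjE) (simp add: hod_prd)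
  have set: "\<exists>e. hod e \<and> (\<forall>p a b. prd p (prd a b) \<epsilon> e \<longleftrightarrow> p \<epsilon> PP \<and> a \<epsilon> D \<and> b \<epsilon> D \<and> Q p a b)"
    if Q: "df (Collect OD) (\<lambda>s. Q (pfst (s 0)) (pfst (psnd (s 0))) (psnd (psnd (s 0))))" for Q
  proof -
    let ?Q = "\<lambda>z. Q (pfst z) (pfst (psnd z)) (psnd (psnd z))"
    have m: "z \<epsilon> sep ?S ?Q \<longleftrightarrow> z \<epsilon> ?S \<and> ?Q z" for z
      by (rule mem_sep) (rule Def_mono[OF Q], simp)
    have "hod (sep ?S ?Q)"
    proof (rule hodI)
      show "OD (sep ?S ?Q)" by (rule OD_term) (intro dfi dfo OD_PP hod_OD[OF D(1)] Q)
    qed (simp only: m S)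
    then show ?thesis by (intro exI[of _ "sep ?S ?Q"]) (simp add: m)
  qed
  have dE: "df (Collect OD) (\<lambda>s. fE (pfst (s 0)) (pfst (psnd (s 0))) (psnd (psnd (s 0))))"
    unfolding fE_def by (intro dfi dft_val)
  have dM: "df (Collect OD) (\<lambda>s. fM (pfst (s 0)) (pfst (psnd (s 0))) (psnd (psnd (s 0))))"
    unfolding fM_def by (intro dfi dft_val)
  from set[of fE, OF dE] obtain e where e: "hod e"
    "\<forall>p a b. prd p (prd a b) \<epsilon> e \<longleftrightarrow> p \<epsilon> PP \<and> a \<epsilon> D \<and> b \<epsilon> D \<and> fE p a b" by (elim exE conjE)
  from set[of fM, OF dM] obtain m where m: "hod m"
    "\<forall>p a b. prd p (prd a b) \<epsilon> m \<longleftrightarrow> p \<epsilon> PP \<and> a \<epsilon> D \<and> b \<epsilon> D \<and> fM p a b" by (elim exE conjE)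
  note em = e(1) m(1) e(2)[rule_format] m(2)[rule_format]
  have hD: "hod a" if "a \<epsilon> D" for a by (rule hod_mem[OF D(1) that])
  have "H.atomic_forcing PP LL D e m" unfolding H.atomic_forcing_def
  proof (intro conjI D(2) allI impI; elim conjE)
    fix p a b assume p: "p \<epsilon> PP" and a: "a \<epsilon> D" and b: "b \<epsilon> D"
    have fe: "prd p (prd a b) \<epsilon> e \<longleftrightarrow> fE p a b" and fm: "prd p (prd a b) \<epsilon> m \<longleftrightarrow> fM p a b"
      using em(3,4) p a b by simp_all
    show "prd p (prd a b) \<epsilon> e \<longleftrightarrow> (\<forall>s q. (\<exists>t. prd s t \<epsilon> a \<or> prd s t \<epsilon> b) \<and> prd q p \<epsilon> LL \<longrightarrow>
        (prd q (prd s a) \<epsilon> m \<longleftrightarrow> prd q (prd s b) \<epsilon> m))"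
      unfolding fe fE_iff[OF hD[OF a] hD[OF b] p]
    proof (intro all_cong1 imp_cong refl)
      fix s q assume "(\<exists>t. prd s t \<epsilon> a \<or> prd s t \<epsilon> b) \<and> prd q p \<epsilon> LL"
      then have "s \<epsilon> D" "q \<epsilon> PP" using name_fst[OF D(2) a] name_fst[OF D(2) b] unfolding mem_LL by blast+
      then show "(fM q s a \<longleftrightarrow> fM q s b) \<longleftrightarrow> (prd q (prd s a) \<epsilon> m \<longleftrightarrow> prd q (prd s b) \<epsilon> m)"
        using em(4) a b by simp
    qed
    show "prd p (prd a b) \<epsilon> m \<longleftrightarrow> (\<forall>q. prd q p \<epsilon> LL \<longrightarrow>
        (\<exists>r s t. prd r q \<epsilon> LL \<and> prd s t \<epsilon> b \<and> prd r t \<epsilon> LL \<and> prd r (prd a s) \<epsilon> e))"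
      unfolding fm fM_iff[OF hD[OF a] hD[OF b] p]
    proof (intro all_cong1 imp_cong ex_cong1 conj_cong refl)
      fix q r s u assume "prd r q \<epsilon> LL" "prd s u \<epsilon> b"
      then have "r \<epsilon> PP" "s \<epsilon> D" using name_fst[OF D(2) b] unfolding mem_LL by blast+
      then show "fE r a s \<longleftrightarrow> prd r (prd a s) \<epsilon> e" using em(3) a by simp
    qed
  qed
  with em(1,2) show ?thesis by blast
qed

abbreviation hodset :: "'u set" where "hodset \<equiv> {x. hod x}"

text \<open>One direction uses that the solution is unique on any name domain, the other that some
  solution exists on a domain containing both names.\<close>

lemma forces_Eq: "rng hodset s \<Longrightarrow> P < n \<Longrightarrow> L < n \<Longrightarrow> p < n \<Longrightarrow> a < n \<Longrightarrow> b < n \<Longrightarrow>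
    s P = PP \<Longrightarrow> s L = LL \<Longrightarrow> s p \<epsilon> PP \<Longrightarrow> nm (s a) \<Longrightarrow> nm (s b) \<Longrightarrow>
    H.stW s (forces_Eq P L p a b n) \<longleftrightarrow> fE (s p) (s a) (s b)"
proof -
  assume *: "rng hodset s" "P < n" "L < n" "p < n" "a < n" "b < n" and PL: "s P = PP" "s L = LL" "s p \<epsilon> PP"
    and ab: "nm (s a)" "nm (s b)"
  have "H.stW s (forces_Eq P L p a b n) \<longleftrightarrow> (\<exists>D\<in>hodset. \<exists>e\<in>hodset. \<exists>m\<in>hodset.
      H.atomic_forcing (s P) (s L) D e m \<and> s a \<epsilon> D \<and> s b \<epsilon> D \<and> prd (s p) (prd (s a) (s b)) \<epsilon> e)"
    using * unfolding forces_Eq_def by (simp only: H.ws H.W_atomic H.W_related3 cong: bex_cong)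
  also have "\<dots> \<longleftrightarrow> fE (s p) (s a) (s b)" unfolding PL(1,2)
  proof
    assume "\<exists>D\<in>hodset. \<exists>e\<in>hodset. \<exists>m\<in>hodset. H.atomic_forcing PP LL D e m \<and> s a \<epsilon> D \<and> s b \<epsilon> D \<and>
      prd (s p) (prd (s a) (s b)) \<epsilon> e"
    then obtain D e m where "hod D" "H.atomic_forcing PP LL D e m" "s a \<epsilon> D" "s b \<epsilon> D"
      "prd (s p) (prd (s a) (s b)) \<epsilon> e" by blast
    with atomic_correct(1)[of D e m "s p" "s a" "s b"] PL(3) show "fE (s p) (s a) (s b)" by blast
  next
    assume e: "fE (s p) (s a) (s b)"
    from name_domain_pair[OF ab] obtain D where D: "hod D" "H.name_domain PP D" "s a \<epsilon> D" "s b \<epsilon> D" by blast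
    from atomic_exists[OF D(1,2)] obtain e m where em: "hod e" "hod m" "H.atomic_forcing PP LL D e m" by blast
    from atomic_correct(1)[OF em(3) D(1) PL(3) D(3,4)] e have "prd (s p) (prd (s a) (s b)) \<epsilon> e" by blast
    with D em show "\<exists>D\<in>hodset. \<exists>e\<in>hodset. \<exists>m\<in>hodset. H.atomic_forcing PP LL D e m \<and> s a \<epsilon> D \<and> s b \<epsilon> D \<and>
      prd (s p) (prd (s a) (s b)) \<epsilon> e" by blast
  qed
  finally show ?thesis .
qed

lemma forces_Mem: "rng hodset s \<Longrightarrow> P < n \<Longrightarrow> L < n \<Longrightarrow> p < n \<Longrightarrow> a < n \<Longrightarrow> b < n \<Longrightarrow>
    s P = PP \<Longrightarrow> s L = LL \<Longrightarrow> s p \<epsilon> PP \<Longrightarrow> nm (s a) \<Longrightarrow> nm (s b) \<Longrightarrow>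
    H.stW s (forces_Mem P L p a b n) \<longleftrightarrow> fM (s p) (s a) (s b)"
proof -
  assume *: "rng hodset s" "P < n" "L < n" "p < n" "a < n" "b < n" and PL: "s P = PP" "s L = LL" "s p \<epsilon> PP"
    and ab: "nm (s a)" "nm (s b)"
  have "H.stW s (forces_Mem P L p a b n) \<longleftrightarrow> (\<exists>D\<in>hodset. \<exists>e\<in>hodset. \<exists>m\<in>hodset.
      H.atomic_forcing (s P) (s L) D e m \<and> s a \<epsilon> D \<and> s b \<epsilon> D \<and> prd (s p) (prd (s a) (s b)) \<epsilon> m)"
    using * unfolding forces_Mem_def by (simp only: H.ws H.W_atomic H.W_related3 cong: bex_cong)
  also have "\<dots> \<longleftrightarrow> fM (s p) (s a) (s b)" unfolding PL(1,2)
  proof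
    assume "\<exists>D\<in>hodset. \<exists>e\<in>hodset. \<exists>m\<in>hodset. H.atomic_forcing PP LL D e m \<and> s a \<epsilon> D \<and> s b \<epsilon> D \<and>
      prd (s p) (prd (s a) (s b)) \<epsilon> m"
    then obtain D e m where "hod D" "H.atomic_forcing PP LL D e m" "s a \<epsilon> D" "s b \<epsilon> D"
      "prd (s p) (prd (s a) (s b)) \<epsilon> m" by blast
    with atomic_correct(2)[of D e m "s p" "s a" "s b"] PL(3) show "fM (s p) (s a) (s b)" by blast
  next
    assume e: "fM (s p) (s a) (s b)"
    from name_domain_pair[OF ab] obtain D where D: "hod D" "H.name_domain PP D" "s a \<epsilon> D" "s b \<epsilon> D" by blast
    from atomic_exists[OF D(1,2)] obtain e m where em: "hod e" "hod m" "H.atomic_forcing PP LL D e m" by blast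
    from atomic_correct(2)[OF em(3) D(1) PL(3) D(3,4)] e have "prd (s p) (prd (s a) (s b)) \<epsilon> m" by blast
    with D em show "\<exists>D\<in>hodset. \<exists>e\<in>hodset. \<exists>m\<in>hodset. H.atomic_forcing PP LL D e m \<and> s a \<epsilon> D \<and> s b \<epsilon> D \<and>
      prd (s p) (prd (s a) (s b)) \<epsilon> m" by blast
  qed
  finally show ?thesis .
qed

text \<open>The value at sets that are not names keeps all assignments inside of \<open>ext B\<close>.\<close>

definition ev :: "'u \<Rightarrow> 'u \<Rightarrow> 'u" where "ev B a = (if nm a then val B a else emp)"

text \<open>The order enters the induction at implications: the \<open>B\<close> in a condition that
  satisfy the premise form a condition if there are any. Universal quantifiers commute with the one
  over \<open>B\<close>, since the names are the same for all \<open>B\<close>. The bound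
  \<open>m\<close> keeps the variables of the formula apart from those for poset and
  condition.\<close>

theorem forcing:
  assumes "rng hodset s" "\<And>v. v \<in> vars \<phi> \<Longrightarrow> v < m" "m \<le> P" "m \<le> L" "m \<le> p" "P < n" "L < n" "p < n"
    and "s P = PP" "s L = LL" "s p \<epsilon> PP" "\<And>v. v \<in> fv \<phi> \<Longrightarrow> nm (s v)"
  shows "H.stW s (forces P L \<phi> p n) \<longleftrightarrow>
    (\<forall>B. B \<epsilon> dc (s p) \<longrightarrow> sat (ext B) (\<epsilon>) (\<lambda>v. ev B (s v)) \<phi>)"
  using assms
proof (induction \<phi> arbitrary: s p n)
  case Falsum
  then have "\<exists>B. B \<epsilon> dc (s p)" using PP_cond unfolding cond_def by blast
  then show ?case by (simp add: H.ws)
next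
  case (Mem x y)
  have xy: "x < n" "y < n" using Mem.prems(2)[of x] Mem.prems(2)[of y] Mem.prems(5,8) by simp_all
  have "H.stW s (forces P L (Mem x y) p n) \<longleftrightarrow> fM (s p) (s x) (s y)"
    unfolding forces.simps by (rule forces_Mem) (use Mem.prems xy in simp_all)
  then show ?case using Mem.prems(12)[of x] Mem.prems(12)[of y] by (simp add: fM_def ev_def)
next
  case (Eq x y)
  have xy: "x < n" "y < n" using Eq.prems(2)[of x] Eq.prems(2)[of y] Eq.prems(5,8) by simp_all
  have "H.stW s (forces P L (Eq x y) p n) \<longleftrightarrow> fE (s p) (s x) (s y)"
    unfolding forces.simps by (rule forces_Eq) (use Eq.prems xy in simp_all)
  then show ?case using Eq.prems(12)[of x] Eq.prems(12)[of y] by (simp add: fE_def ev_def)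
next
  case (Imp \<phi> \<psi>)
  let ?T = "\<lambda>\<chi> B. sat (ext B) (\<epsilon>) (\<lambda>v. ev B (s v)) \<chi>"
  have old: "(s(n := q)) v = s v" if "v < n" for q v using that by (rule upd_old)
  have cong: "sat (ext B) (\<epsilon>) (\<lambda>v. ev B ((s(n := q)) v)) \<chi> \<longleftrightarrow> ?T \<chi> B" if "vars \<chi> \<subseteq> vars (Imp \<phi> \<psi>)" for B q \<chi>
  proof (rule sat_cong)
    fix v assume "v \<in> fv \<chi>"
    then have "v < n" using that fv_subset_vars[of \<chi>] Imp.prems(2)[of v] Imp.prems(5,8) by fastforce
    from old[OF this] show "ev B ((s(n := q)) v) = ev B (s v)" by simp
  qed
  have sub: "H.stW (s(n := q)) (forces P L \<chi> n (Suc n)) \<longleftrightarrow> (\<forall>B. B \<epsilon> dc q \<longrightarrow> ?T \<chi> B)"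
    if q: "q \<epsilon> PP" and c: "\<chi> = \<phi> \<or> \<chi> = \<psi>" for q \<chi>
  proof -
    have v: "vars \<chi> \<subseteq> vars (Imp \<phi> \<psi>)" "fv \<chi> \<subseteq> fv (Imp \<phi> \<psi>)" using c by auto
    have "H.stW (s(n := q)) (forces P L \<chi> n (Suc n)) \<longleftrightarrow>
        (\<forall>B. B \<epsilon> dc ((s(n := q)) n) \<longrightarrow> sat (ext B) (\<epsilon>) (\<lambda>v. ev B ((s(n := q)) v)) \<chi>)"
    proof -
      have h: "rng hodset (s(n := q))" using Imp.prems(1) hod_mem[OF hod_PP q] by simp
      have f: "nm ((s(n := q)) v)" if "v \<in> fv \<chi>" for v
      proof -
        have "v < n" using that v(1) fv_subset_vars[of \<chi>] Imp.prems(2)[of v] Imp.prems(5,8) by fastforce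
        from old[OF this] show ?thesis using Imp.prems(12)[of v] that v(2) by auto
      qed
      have P: "(s(n := q)) P = PP" "(s(n := q)) L = LL" "(s(n := q)) n \<epsilon> PP"
        using Imp.prems(6,7,9,10) q by (simp_all add: fun_upd_apply)
      have w: "v < m" if "v \<in> vars \<chi>" for v using Imp.prems(2) that v(1) by blast
      have o: "m \<le> n" "P < Suc n" "L < Suc n" "n < Suc n" using Imp.prems(5-8) by simp_all
      show ?thesis using c
      proof
        assume c: "\<chi> = \<phi>"
        show ?thesis unfolding c
          by (rule Imp.IH(1)[OF h _ Imp.prems(3,4) o P]) (use w f c in blast)+
      next
        assume c: "\<chi> = \<psi>"
        show ?thesis unfolding c
          by (rule Imp.IH(2)[OF h _ Imp.prems(3,4) o P]) (use w f c in blast)+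
      qed
    qed
    then show ?thesis unfolding cong[OF v(1)] by (simp add: fun_upd_apply)
  qed
  have "H.stW s (forces P L (Imp \<phi> \<psi>) p n) \<longleftrightarrow> (\<forall>q\<in>hodset. prd q (s p) \<epsilon> LL \<longrightarrow>
      (\<forall>B. B \<epsilon> dc q \<longrightarrow> ?T \<phi> B) \<longrightarrow> (\<forall>B. B \<epsilon> dc q \<longrightarrow> ?T \<psi> B))"
    unfolding forces.simps sat_fb
  proof (intro ball_cong imp_cong refl)
    fix q assume q: "q \<in> hodset"
    show r: "H.stW (s(n := q)) (related L n p (Suc n)) \<longleftrightarrow> prd q (s p) \<epsilon> LL"
      using H.W_related[of "s(n := q)" L "Suc n" n p] Imp.prems(1,7,8,10) q by (simp add: fun_upd_apply)
    assume "prd q (s p) \<epsilon> LL"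
    then have q: "q \<epsilon> PP" by (simp add: mem_LL)
    show "H.stW (s(n := q)) (forces P L \<phi> n (Suc n)) \<longleftrightarrow> (\<forall>B. B \<epsilon> dc q \<longrightarrow> ?T \<phi> B)"
      and "H.stW (s(n := q)) (forces P L \<psi> n (Suc n)) \<longleftrightarrow> (\<forall>B. B \<epsilon> dc q \<longrightarrow> ?T \<psi> B)"
      by (rule sub[OF q], simp)+
  qed
  also have "\<dots> \<longleftrightarrow> (\<forall>B. B \<epsilon> dc (s p) \<longrightarrow> ?T \<phi> B \<longrightarrow> ?T \<psi> B)"
  proof
    assume h: "\<forall>q\<in>hodset. prd q (s p) \<epsilon> LL \<longrightarrow> (\<forall>B. B \<epsilon> dc q \<longrightarrow> ?T \<phi> B) \<longrightarrow> (\<forall>B. B \<epsilon> dc q \<longrightarrow> ?T \<psi> B)"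
    show "\<forall>B. B \<epsilon> dc (s p) \<longrightarrow> ?T \<phi> B \<longrightarrow> ?T \<psi> B"
    proof (intro allI impI)
      fix B assume B: "B \<epsilon> dc (s p)" "?T \<phi> B"
      have OD: "OD (s v)" for v using Imp.prems(1) hod_OD by (simp add: rng_def)
      \<comment> \<open>Truth is evaluated in \<open>ext B\<close>, a class that varies with the
        very \<open>B\<close> being collected; \<open>df_sat\<close> permits this.\<close>
      have "df (Collect OD) (\<lambda>u. ?T \<phi> (u 0))"
        unfolding ext_def
      proof (rule df_sat)
        show "df (Collect OD) (\<lambda>u. \<exists>a. nm a \<and> u 0 = val (u (Suc 0)) a)"
          by (intro dfi dft_val df_nm)
        show "dft (Collect OD) (\<lambda>u. ev (u 0) (s v))" for v
          unfolding ev_def by (intro dfi dft_val df_nm dfo OD)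
      qed
      from cond_sep[of _ _ "?T \<phi>", OF Imp.prems(11) B this] obtain q where
        q: "prd q (s p) \<epsilon> LL" "\<And>C. C \<epsilon> dc q \<longleftrightarrow> C \<epsilon> dc (s p) \<and> ?T \<phi> C" by blast
      then have "hod q" using hod_mem[OF hod_PP] by (simp add: mem_LL)
      then show "?T \<psi> B" using h q B by blast
    qed
  next
    assume "\<forall>B. B \<epsilon> dc (s p) \<longrightarrow> ?T \<phi> B \<longrightarrow> ?T \<psi> B"
    then show "\<forall>q\<in>hodset. prd q (s p) \<epsilon> LL \<longrightarrow> (\<forall>B. B \<epsilon> dc q \<longrightarrow> ?T \<phi> B) \<longrightarrow> (\<forall>B. B \<epsilon> dc q \<longrightarrow> ?T \<psi> B)"
      using LL_sub by blast
  qed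
  finally show ?case by simp
next
  case (Forall x \<phi>)
  have x: "x < m" using Forall.prems(2) by simp
  have ne: "x \<noteq> P" "x \<noteq> L" "x \<noteq> p" "x < n" using x Forall.prems(3-8) by simp_all
  have ev: "(\<lambda>v. ev B ((s(x := a)) v)) = (\<lambda>v. ev B (s v))(x := ev B a)" for B a
    by (simp add: fun_eq_iff fun_upd_apply)
  have "H.stW s (forces P L (Forall x \<phi>) p n) \<longleftrightarrow>
      (\<forall>a\<in>hodset. nm a \<longrightarrow> (\<forall>B. B \<epsilon> dc (s p) \<longrightarrow> sat (ext B) (\<epsilon>) ((\<lambda>v. ev B (s v))(x := ev B a)) \<phi>))"
    unfolding forces.simps sat_fb
  proof (intro ball_cong imp_cong refl)
    fix a assume a: "a \<in> hodset"
    have r: "rng hodset (s(x := a))" using Forall.prems(1) a by simp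
    have eq: "(s(x := a)) P = s P" "(s(x := a)) L = s L" "(s(x := a)) p = s p" "(s(x := a)) x = a" using ne by (simp_all add: fun_upd_apply)
    show "H.stW (s(x := a)) (is_name P x n) \<longleftrightarrow> nm a"
      using H.W_name[OF r Forall.prems(6) ne(4)] Forall.prems(9) unfolding eq nm_def by simp
    assume na: "nm a"
    have "H.stW (s(x := a)) (forces P L \<phi> p n) \<longleftrightarrow>
        (\<forall>B. B \<epsilon> dc ((s(x := a)) p) \<longrightarrow> sat (ext B) (\<epsilon>) (\<lambda>v. ev B ((s(x := a)) v)) \<phi>)"
    proof (rule Forall.IH[OF r _ Forall.prems(3-8)])
      show "nm ((s(x := a)) v)" if "v \<in> fv \<phi>" for v
        using na that Forall.prems(12)[of v] by (cases "v = x") (simp_all add: fun_upd_apply)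
      show "v \<in> vars \<phi> \<Longrightarrow> v < m" for v using Forall.prems(2)[of v] by simp
    qed (use eq Forall.prems(9-11) in simp_all)
    then show "H.stW (s(x := a)) (forces P L \<phi> p n) \<longleftrightarrow>
        (\<forall>B. B \<epsilon> dc (s p) \<longrightarrow> sat (ext B) (\<epsilon>) ((\<lambda>v. ev B (s v))(x := ev B a)) \<phi>)"
      unfolding eq ev .
  qed
  also have "\<dots> \<longleftrightarrow> (\<forall>B. B \<epsilon> dc (s p) \<longrightarrow> sat (ext B) (\<epsilon>) (\<lambda>v. ev B (s v)) (Forall x \<phi>))"
    unfolding sat.simps ext_def ev_def using nm_hod by (auto simp del: fun_upd_apply)
  finally show ?case .
qed

end

section \<open>The consistency result\<close>

subsection \<open>Free variables\<close>

lemma fv_fb: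
  "fv ((x \<^bold>\<in> y) n) = {x, y}"
  "fv ((x \<^bold>= y) n) = {x, y}"
  "fv (\<^bold>\<bottom> n) = {}"
  "fv ((\<phi> \<^bold>\<longrightarrow> \<psi>) n) = fv (\<phi> n) \<union> fv (\<psi> n)"
  "fv ((\<^bold>\<not> \<phi>) n) = fv (\<phi> n)"
  "fv ((\<phi> \<^bold>\<and> \<psi>) n) = fv (\<phi> n) \<union> fv (\<psi> n)"
  "fv ((\<phi> \<^bold>\<or> \<psi>) n) = fv (\<phi> n) \<union> fv (\<psi> n)"
  "fv ((\<phi> \<^bold>\<longleftrightarrow> \<psi>) n) = fv (\<phi> n) \<union> fv (\<psi> n)"
  "fv (bAll \<Phi> n) = fv (\<Phi> n (Suc n)) - {n}"
  "fv (bEx \<Phi> n) = fv (\<Phi> n (Suc n)) - {n}"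
  by (auto simp: bMem_def bEq_def bFalse_def bImp_def bNot_def bAnd_def bOr_def bIff_def bAll_def bEx_def)

named_theorems fvD

lemma [fvD]: "v \<in> fv (is_subset x y n) \<Longrightarrow> v \<in> {x, y}"
  by (auto simp: is_subset_def fv_fb)
lemma [fvD]: "v \<in> fv (is_empty x n) \<Longrightarrow> v \<in> {x}"
  by (auto simp: is_empty_def fv_fb)
lemma [fvD]: "v \<in> fv (is_diff x y d n) \<Longrightarrow> v \<in> {x, y, d}"
  by (auto simp: is_diff_def fv_fb)
lemma [fvD]: "v \<in> fv (is_succ x y n) \<Longrightarrow> v \<in> {x, y}"
  by (auto simp: is_succ_def fv_fb)
lemma [fvD]: "v \<in> fv (is_upair x y u n) \<Longrightarrow> v \<in> {x, y, u}"
  by (auto simp: is_upair_def fv_fb)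
lemma [fvD]: "v \<in> fv (is_pair x y p n) \<Longrightarrow> v \<in> {x, y, p}"
  by (auto simp: is_pair_def fv_fb dest!: fvD)
lemma [fvD]: "v \<in> fv (related f x y n) \<Longrightarrow> v \<in> {f, x, y}"
  by (auto simp: related_def fv_fb dest!: fvD)
lemma [fvD]: "v \<in> fv (is_function f x y n) \<Longrightarrow> v \<in> {f, x, y}"
  by (auto simp: is_function_def fv_fb dest!: fvD)
lemma [fvD]: "v \<in> fv (is_surjection f x y n) \<Longrightarrow> v \<in> {f, x, y}"
  by (auto simp: is_surjection_def fv_fb dest!: fvD)
lemma [fvD]: "v \<in> fv (is_restriction f x g n) \<Longrightarrow> v \<in> {f, x, g}"
  by (auto simp: is_restriction_def fv_fb dest!: fvD)
lemma [fvD]: "v \<in> fv (is_transitive x n) \<Longrightarrow> v \<in> {x}"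
  by (auto simp: is_transitive_def fv_fb dest!: fvD)
lemma [fvD]: "v \<in> fv (is_ordinal x n) \<Longrightarrow> v \<in> {x}"
  by (auto simp: is_ordinal_def fv_fb dest!: fvD)
lemma [fvD]: "v \<in> fv (is_inductive x n) \<Longrightarrow> v \<in> {x}"
  by (auto simp: is_inductive_def fv_fb dest!: fvD)
lemma [fvD]: "v \<in> fv (is_omega x n) \<Longrightarrow> v \<in> {x}"
  by (auto simp: is_omega_def fv_fb dest!: fvD)
lemma [fvD]: "v \<in> fv (is_sequences x s n) \<Longrightarrow> v \<in> {x, s}"
  by (auto simp: is_sequences_def fv_fb dest!: fvD)
lemma [fvD]: "v \<in> fv (is_finite_sequences x s n) \<Longrightarrow> v \<in> {x, s}"
  by (auto simp: is_finite_sequences_def fv_fb dest!: fvD)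
lemma [fvD]: "v \<in> fv (is_reals r n) \<Longrightarrow> v \<in> {r}"
  by (auto simp: is_reals_def fv_fb dest!: fvD)
lemma [fvD]: "v \<in> fv (is_real_image a n) \<Longrightarrow> v \<in> {a}"
  by (auto simp: is_real_image_def fv_fb dest!: fvD)
lemma [fvD]: "v \<in> fv (is_upper_bound b n) \<Longrightarrow> v \<in> {b}"
  by (auto simp: is_upper_bound_def fv_fb dest!: fvD)
lemma [fvD]: "v \<in> fv (is_Theta t n) \<Longrightarrow> v \<in> {t}"
  by (auto simp: is_Theta_def fv_fb dest!: fvD)
lemma [fvD]: "v \<in> fv (is_evens e n) \<Longrightarrow> v \<in> {e}"
  by (auto simp: is_evens_def fv_fb dest!: fvD)
lemma [fvD]: "v \<in> fv (follows k s x n) \<Longrightarrow> v \<in> {k, s, x}"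
  by (auto simp: follows_def fv_fb dest!: fvD)
lemma [fvD]: "v \<in> fv (determined x a n) \<Longrightarrow> v \<in> {x, a}"
  by (auto simp: determined_def fv_fb dest!: fvD)
lemma [fvD]: "v \<in> fv (all_games_determined x n) \<Longrightarrow> v \<in> {x}"
  by (auto simp: all_games_determined_def fv_fb dest!: fvD)
lemma [fvD]: "v \<in> fv (AD n) \<Longrightarrow> v \<in> {}"
  by (auto simp: AD_def fv_fb dest!: fvD)

text \<open>Serves to restrict the assumption of the forcing theorem that free variables denote
  names to the single variable 0.\<close>

lemma fv_above_and_AD: "v \<in> fv above_and_AD \<Longrightarrow> v = 0"
  by (auto simp: above_and_AD_def fv_fb dest!: fvD)

subsection \<open>The inner model forces its \<open>\<Theta>\<close> to increase\<close>

context frc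
begin

text \<open>The surjection \<open>B\<close> belongs to \<open>ext B\<close> and makes
  \<open>suc t\<close> an image of the reals there, so \<Theta> is at least \<open>suc t\<close>.
  Determinacy holds since the strategies of the surrounding model are already in the inner
  model.\<close>

lemma Theta_increases:
  assumes B: "B \<epsilon> Y" and s: "rng (ext B) s" "s 0 = t"
  shows "sat (ext B) (\<epsilon>) s above_and_AD"
proof -
  interpret N: gd E R "ext B" by (rule gd_ext[OF B])
  obtain u where u: "N.isTh u" using N.Theta_exists by blast
  then have ou: "ord u" and "\<And>a. N.img a \<Longrightarrow> a \<epsilon> u \<or> a = u" unfolding N.isTh_def N.ub_def by blast+
  moreover have "N.img (suc t)"
    unfolding N.img_def using ordt generic_ext[OF B] B[unfolded mem_Y] ord_suc by blast
  ultimately have "suc t \<epsilon> u \<or> suc t = u" by blast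
  then have tu: "t \<epsilon> u" using ord_trans[OF ou, of t "suc t"] by auto
  have uW: "u \<in> ext B" by (rule N.ordW[OF ou])
  have "N.stW (s(1 := u)) (is_Theta 1 2) \<longleftrightarrow> N.isTh u"
    using N.W_Theta[of "s(1 := u)" 1 2] s(1) uW by (simp add: fun_upd_apply)
  then have "N.stW s ((\<^bold>\<exists>t. is_Theta t \<^bold>\<and> 0 \<^bold>\<in> t) 1)"
    unfolding sat_fb using u uW tu s(2) by (intro bexI[of _ u] conjI) (simp_all add: fun_upd_apply numeral_2_eq_2)
  moreover have "N.stW s (AD 1)"
    by (rule AD_inner[OF gd_ext[OF B] hod_ext[OF B] adx_om[OF ad] s(1)])
  ultimately show ?thesis unfolding above_and_AD_def sat_fb by blast
qed

text \<open>The pairs demanded by the recursion clause do exist in the inner model, which is closed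
  under pairing and \<open>chk\<close>; induction then identifies the function witnessing
  \<open>is_check\<close> with \<open>chk\<close>.\<close>

lemma check_name:
  assumes s: "rng hodset s" "P < n" "x < n" "c < n" and P: "s P = PP"
    and c: "H.stW s (is_check P x c n)"
  shows "s c = chk (s x)"
proof -
  from H.W_check[OF s c] obtain T C f where "T \<in> hodset" and Tt: "trans_set T" "s x \<epsilon> T" "fn f T C"
    and F: "\<forall>y c. prd y c \<epsilon> f \<longrightarrow>
      (\<forall>z. z \<epsilon> c \<longleftrightarrow> (\<exists>u v p. u \<epsilon> y \<and> prd u v \<epsilon> f \<and> p \<epsilon> s P \<and> z = prd v p) \<and> z \<in> hodset)"
    and xc: "prd (s x) (s c) \<epsilon> f" by (elim bexE conjE)
  then have T: "hod T" by simp
  note f = F[unfolded P mem_Collect_eq, rule_format]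
  have "y \<epsilon> T \<longrightarrow> app f y = chk y" for y
  proof (rule eps_induct[where P = "\<lambda>y. y \<epsilon> T \<longrightarrow> app f y = chk y"])
    show "df UNIV (\<lambda>s. s 0 \<epsilon> T \<longrightarrow> app f (s 0) = chk (s 0))" by (intro dfi dfp dft_chk_UNIV)
    fix y assume IH: "\<And>u. u \<epsilon> y \<Longrightarrow> u \<epsilon> T \<longrightarrow> app f u = chk u"
    show "y \<epsilon> T \<longrightarrow> app f y = chk y"
    proof (intro impI extensional)
      fix z assume y: "y \<epsilon> T"
      have u: "u \<epsilon> T" "app f u = chk u" "hod u" if "u \<epsilon> y" for u
        using trans_setD[OF Tt(1) y that] IH[OF that] hod_mem[OF T] by blast+
      have "prd y (app f y) \<epsilon> f" using fn_pair[OF Tt(3)] y by blast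
      note fy = f[OF this, of z]
      show "z \<epsilon> app f y \<longleftrightarrow> z \<epsilon> chk y"
      proof
        assume "z \<epsilon> app f y"
        then obtain w v p where w: "w \<epsilon> y" "prd w v \<epsilon> f" "p \<epsilon> PP" "z = prd v p" unfolding fy by blast
        have "v = chk w" using w(2) u(2)[OF w(1)] unfolding fn_pair[OF Tt(3)] by simp
        with w show "z \<epsilon> chk y" unfolding mem_chk[of z y] by blast
      next
        assume "z \<epsilon> chk y"
        then obtain w p where w: "w \<epsilon> y" "p \<epsilon> PP" "z = prd (chk w) p" unfolding mem_chk[of z y] by blast
        have "prd w (chk w) \<epsilon> f" unfolding fn_pair[OF Tt(3)] using u[OF w(1)] by simp
        moreover have "hod z" unfolding w(3) by (intro hod_prd hod_chk u(3)[OF w(1)] hod_mem[OF hod_PP w(2)])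
        ultimately show "z \<epsilon> app f y" unfolding fy using w by blast
      qed
    qed
  qed
  then show ?thesis using xc Tt(2) unfolding fn_pair[OF Tt(3)] by simp
qed

theorem forcing_statement:
  assumes s: "rng hodset s"
  shows "H.stW s forcing_increases_Theta_preserving_AD"
proof -
  let ?P = "fresh above_and_AD"
  let ?L = "Suc ?P" let ?t = "Suc ?L" let ?n = "Suc ?t"
  let ?s = "s(?P := PP, ?L := LL, ?t := t)"
  have tW: "hod t" by (rule hod_ord[OF ordt])
  have r2: "rng hodset (s(?P := PP, ?L := LL))" using s hod_PP hod_LL by simp
  have r: "rng hodset ?s" using r2 tW by simp
  have e: "(s(?P := PP, ?L := LL)) ?P = PP" "(s(?P := PP, ?L := LL)) ?L = LL" "?s ?P = PP" "?s ?L = LL" "?s ?t = t"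
    by (simp_all add: fun_upd_apply)
  have 0: "0 < ?P" by (simp add: fresh_def)
  have lt: "?P < ?t" "?L < ?t" by simp_all
  have poset: "H.stW (s(?P := PP, ?L := LL)) (is_poset ?P ?L ?t)"
    unfolding H.W_pairs_of[OF r2 lt] e by (rule poset)
  have Theta: "H.stW ?s (is_Theta ?t ?n)" using H.W_Theta[OF r, of ?t ?n] Th unfolding e by simp
  have main: "H.stW (?s(0 := a)) (holds_in_every_extension ?P ?L above_and_AD ?n)"
    if a: "hod a" and c: "H.stW (?s(0 := a)) (is_check ?P ?t 0 ?n)" for a
  proof -
    let ?s0 = "?s(0 := a)"
    have r0: "rng hodset ?s0" using r a by simp
    have e0: "?s0 ?P = PP" "?s0 ?L = LL" "?s0 ?t = t" "?s0 0 = a" using 0 by (simp_all add: fun_upd_apply)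
    have "?s0 0 = chk (?s0 ?t)" by (rule check_name[OF r0 _ _ _ e0(1) c]) simp_all
    then have chk: "a = chk t" unfolding e0 .
    show ?thesis unfolding holds_in_every_extension_def sat_fb
    proof (intro ballI impI)
      fix p assume "p \<in> hodset" and "(?s0(?n := p)) ?n \<epsilon> (?s0(?n := p)) ?P"
      then have p: "hod p" "p \<epsilon> PP" using e0(1) by (simp_all add: fun_upd_apply)
      let ?s1 = "?s0(?n := p)"
      have r1: "rng hodset ?s1" using r0 p by simp
      have e1: "?s1 ?P = PP" "?s1 ?L = LL" "?s1 ?n = p" "?s1 0 = a" using 0 by (simp_all add: fun_upd_apply)
      have c1: "?s1 0 = chk t" using e1(4) chk by (rule trans)
      have "H.stW ?s1 (forces ?P ?L above_and_AD ?n (Suc ?n)) \<longleftrightarrow>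
          (\<forall>B. B \<epsilon> dc (?s1 ?n) \<longrightarrow> sat (ext B) (\<epsilon>) (\<lambda>v. ev B (?s1 v)) above_and_AD)"
      proof (rule forcing[where m = ?P, OF r1])
        show "?s1 ?P = PP" "?s1 ?L = LL" "?s1 ?n \<epsilon> PP" unfolding e1 using p(2) by simp_all
        show "nm (?s1 v)" if "v \<in> fv above_and_AD" for v
          unfolding fv_above_and_AD[OF that] c1 by (rule nm_chk[OF tW])
      qed (auto intro: vars_less_fresh)
      moreover have "sat (ext B) (\<epsilon>) (\<lambda>v. ev B (?s1 v)) above_and_AD" if "B \<epsilon> dc p" for B
      proof (rule Theta_increases)
        show B: "B \<epsilon> Y" by (rule PP_sub[OF p(2) that])
        have "emp \<in> ext B" by (rule hod_ext[OF B hod_ord[OF ord_emp]])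
        then show "rng (ext B) (\<lambda>v. ev B (?s1 v))" unfolding rng_def ev_def ext_def by auto
        show "ev B (?s1 0) = t" unfolding c1 ev_def using nm_chk[OF tW] val_chk[OF B] by simp
      qed
      ultimately show "H.stW ?s1 (forces ?P ?L above_and_AD ?n (Suc ?n))" unfolding e1 by blast
    qed
  qed
  show ?thesis unfolding forcing_increases_Theta_preserving_AD_def
    by (simp only: sat_fb, rule bexI[of _ PP], rule bexI[of _ LL], rule conjI[OF poset], rule bexI[of _ t],
        rule conjI[OF Theta]) (use main hod_PP hod_LL tW in auto)
qed

end

context odzf
begin

text \<open>All sets in question are subsets of one set, so their indices have a common bound
  although \<open>OD\<close> is a proper class.\<close>

lemma ex_frc:
  assumes ad: "adx reals" and t: "H.isTh t"
  shows "\<exists>k. frc (\<epsilon>) R t k"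
proof -
  let ?Y = "setof (\<lambda>B. H.srj B reals (suc t))"
  define Q where "Q z g \<longleftrightarrow> (OD z \<longrightarrow> (\<exists>x. x \<epsilon> reals \<and> z = oset g x))" for z g
  have dQ: "df UNIV (\<lambda>s. Q (s 0) (s (Suc 0)))" unfolding Q_def by (intro dfi)
  have "\<exists>g. ord g \<and> Q z g" for z
  proof (cases "OD z")
    case True
    then show ?thesis unfolding OD_def Q_def by blast
  next
    case False
    then show ?thesis unfolding Q_def using ord_emp by blast
  qed
  from bounding[where Q = Q and a = "pw ?Y", OF dQ this] obtain k where
    k: "ord k" "\<And>z. z \<epsilon> pw ?Y \<Longrightarrow> \<exists>d. d \<epsilon> k \<and> ord d \<and> Q z d" by blast
  have "frc (\<epsilon>) R t k"
  proof unfold_locales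
    show "\<exists>a x. a \<epsilon> k \<and> x \<epsilon> reals \<and> z = oset a x" if "OD z" "sub z ?Y" for z
      using k(2)[of z] that unfolding mem_pw Q_def by blast
  qed (fact ad t k(1))+
  then show ?thesis by blast
qed

lemma gd_UNIV: "gd (\<epsilon>) R UNIV"
  by unfold_locales (simp_all, intro dfi)

text \<open>The full model is itself a class of the kind treated above, so the sentence unwinds by
  the same computation as for inner models.\<close>

lemma adx_if_AD_R:
  assumes "valid UNIV (\<epsilon>) (sentence AD_R)"
  shows "adx reals"
proof -
  interpret V: gd E R UNIV by (rule gd_UNIV)
  have "V.stW (\<lambda>_. emp) (AD_R 0)" using assms by (simp add: valid_def sentence_def)
  moreover have "V.full reals" by (simp add: V.full_def)
  ultimately have "V.detW reals A" if "sub A (seqs reals)" for A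
    using V.W_AD_R[of "\<lambda>_. emp" 0] that by (simp add: rng_def)
  then show ?thesis unfolding adx_def detd_def V.detW_def by simp
qed

end

theorem theorem3p2:
  assumes "consistent (ZF \<union> {sentence AD_R})"
  shows "consistent (ZF \<union> {sentence AD, forcing_increases_Theta_preserving_AD})"
proof -
  from total_model[OF assms] obtain E :: "nat \<Rightarrow> nat \<Rightarrow> bool" where
    E: "\<forall>\<phi>\<in>ZF \<union> {sentence AD_R}. valid UNIV E \<phi>" by auto
  \<comment> \<open>It is the ultrapower, not the countable model, that carries a relation capturing
    all formulas; the sentences of the hypothesis pass to it by \<open>valid_ultra\<close>.\<close>
  from ultra_model[of E] E obtain R where R: "zf (urel E) R" "\<And>\<phi>. zf.captures (urel E) R \<phi>" by blast
  interpret odzf "urel E" R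
    using R by (simp add: odzf_def odzf_axioms_def)
  have ad: "adx reals"
    by (rule adx_if_AD_R, rule valid_ultra) (use E in simp)
  obtain t where t: "H.isTh t" using H.Theta_exists by blast
  then obtain k where "frc (urel E) R t k" using ex_frc[OF ad t] by blast
  then interpret frc "urel E" R t k .
  show ?thesis
  proof (rule consistent_if_model)
    show "{x. hod x} \<noteq> {}" using hod_om by blast
    fix \<psi> assume "\<psi> \<in> ZF \<union> {sentence AD, forcing_increases_Theta_preserving_AD}"
    then consider "\<psi> \<in> ZF" | "\<psi> = sentence AD" | "\<psi> = forcing_increases_Theta_preserving_AD" by blast
    then show "valid {x. hod x} (urel E) \<psi>"
    proof cases
      case 1
      then show ?thesis by (rule valid_hod)
    next
      case 2
      show ?thesis unfolding 2 valid_def sentence_def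
        by (intro allI impI AD_inner[OF gd_hod _ adx_om[OF ad]]) (auto simp: rng_def)
    next
      case 3
      show ?thesis unfolding 3 valid_def
        by (intro allI impI forcing_statement) (auto simp: rng_def)
    qed
  qed
qed

end
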